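(* $\mathrm{BMO}(\mathbb R^n)\subset\left(\mathcal H^1(\mathbb R^n)\right)^*$ and the constant of embedding does not depend on dimension. That is, there is a constant $C$, independent of $n$, such that $$\left|\int_{\mathbb R^n}\varphi(y)f(y)\,dy\right|\le C\,\|\varphi\|_{\mathrm{BMO}}\,\|f\|_{\mathcal H^1}$$ for all $\varphi\in\mathrm{BMO}(\mathbb R^n)$ and $f\in\mathcal H^1(\mathbb R^n)$.
   Context: Fix a dyadic lattice $D$ of cubes on $\mathbb R^n$. For $I\in D$ with side length $l(I)$ and volume $|I|$, let $I^1,\dots,I^{2^n}$ be its dyadic offspring, that is, the $2^n$ disjoint dyadic subcubes of $I$ of volume $2^{-n}|I|$; let $Q_I=I\times(0,l(I)]$, and let $TQ_I=Q_I\setminus\bigcup_{v=1}^{2^n}Q_{I^v}$ be the top half of $Q_I$. For $x\in\mathbb R^n$ let $$\Gamma^d_x=\bigcup_{I\ni x,\,I\in D}TQ_I .$$ For $f\in L^1(\mathbb R^n)$, $f(y,t)$ denotes its harmonic extension into $\mathbb R^{n+1}_+=\mathbb R^n\times(0,\infty)$, and $\nabla$ is the gradient in $(y,t)$. $\mathcal H^1(\mathbb R^n)$ is the space of all $f\in L^1(\mathbb R^n)$ with $$\|f\|_{\mathcal H^1}=\int_{\mathbb R^n}\Bigl(\int_{\Gamma^d_x}|\nabla f(y,t)|^2\,t^{1-n}\,dy\,dt\Bigr)^{1/2}dx<\infty .$$ $\mathrm{BMO}(\mathbb R^n)$ is the space of all $\varphi\in L^1(\mathbb R^n)$ for which there is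 a constant $C_0$ with $$\int_{Q_I}|\nabla\varphi(y,t)|^2\,t\,dy\,dt\le C_0^2\,|I|\qquad\text{for all }I\in D,$$ and $\|\varphi\|_{\mathrm{BMO}}$ is the best such $C_0$. A function $\varphi\in\mathrm{BMO}(\mathbb R^n)$ acts on $f\in\mathcal H^1(\mathbb R^n)$ by the pairing $\int_{\mathbb R^n}\varphi(y)f(y)\,dy$. *)

theory Defs
  imports "HOL-Analysis.Analysis"
begin

(* The constant of the theorem is uniform in the dimension n, so n has to be a term and not a
   type: R^n is the set PiE {..<n} (%_. UNIV) of functions on {..<n} (extended by undefined). *)

definition Rn :: "nat \<Rightarrow> (nat \<Rightarrow> real) measure" where
  "Rn n = (\<Pi>\<^sub>M i\<in>{..<n}. lborel)"

definition vol :: "nat \<Rightarrow> (nat \<Rightarrow> real) set \<Rightarrow> real" where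
  "vol n I = measure (Rn n) I"


section \<open>Dyadic lattices\<close>

definition cube :: "nat \<Rightarrow> (nat \<Rightarrow> real) \<Rightarrow> real \<Rightarrow> (nat \<Rightarrow> real) set" where
  "cube n a l = (\<Pi>\<^sub>E i\<in>{..<n}. {a i ..< a i + l})"

definition side :: "nat \<Rightarrow> (nat \<Rightarrow> real) set \<Rightarrow> real" where
  "side n I = (THE l. 0 < l \<and> (\<exists>a. I = cube n a l))"

(* The cubes of each generation k tile R^n, and the generations are nested. No common origin is
   prescribed: the standard lattice and all of its (generation-compatible) shifts are covered. *)
definition dyadic_lattice :: "nat \<Rightarrow> (nat \<Rightarrow> real) set set \<Rightarrow> bool" where
  "dyadic_lattice n D \<longleftrightarrow>
     (\<forall>I\<in>D. \<exists>a. \<exists>k::int. I = cube n a (2 powi k)) \<and>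
     (\<forall>k::int. \<forall>x\<in>space (Rn n). \<exists>!I. I \<in> D \<and> side n I = 2 powi k \<and> x \<in> I) \<and>
     (\<forall>I\<in>D. \<forall>J\<in>D. I \<subseteq> J \<or> J \<subseteq> I \<or> I \<inter> J = {})"

definition offspring :: "nat \<Rightarrow> (nat \<Rightarrow> real) set set \<Rightarrow> (nat \<Rightarrow> real) set \<Rightarrow> (nat \<Rightarrow> real) set set"
  where "offspring n D I = {J \<in> D. J \<subseteq> I \<and> vol n J = vol n I / 2 ^ n}"

definition carleson_box :: "nat \<Rightarrow> (nat \<Rightarrow> real) set \<Rightarrow> ((nat \<Rightarrow> real) \<times> real) set" where
  "carleson_box n I = I \<times> {0 <.. side n I}"

definition top_half ::
  "nat \<Rightarrow> (nat \<Rightarrow> real) set set \<Rightarrow> (nat \<Rightarrow> real) set \<Rightarrow> ((nat \<Rightarrow> real) \<times> real) set" where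
  "top_half n D I = carleson_box n I - (\<Union>J\<in>offspring n D I. carleson_box n J)"

definition dyadic_cone ::
  "nat \<Rightarrow> (nat \<Rightarrow> real) set set \<Rightarrow> (nat \<Rightarrow> real) \<Rightarrow> ((nat \<Rightarrow> real) \<times> real) set" where
  "dyadic_cone n D x = (\<Union>I\<in>{I \<in> D. x \<in> I}. top_half n D I)"


section \<open>The harmonic extension and its gradient\<close>

definition poisson_kernel :: "nat \<Rightarrow> real \<Rightarrow> (nat \<Rightarrow> real) \<Rightarrow> real" where
  "poisson_kernel n t x =
     Gamma ((real n + 1) / 2) / pi powr ((real n + 1) / 2) *
       (t / (t\<^sup>2 + (\<Sum>i<n. (x i)\<^sup>2)) powr ((real n + 1) / 2))"

definition harmonic_ext :: "nat \<Rightarrow> ((nat \<Rightarrow> real) \<Rightarrow> real) \<Rightarrow> (nat \<Rightarrow> real) \<Rightarrow> real \<Rightarrow> real" where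
  "harmonic_ext n f y t = (\<integral>z. poisson_kernel n t (\<lambda>i. y i - z i) * f z \<partial>Rn n)"

(* |grad f(y,t)|^2, the squares of the n partial derivatives in y and of the one in t *)
definition grad_sq :: "nat \<Rightarrow> ((nat \<Rightarrow> real) \<Rightarrow> real) \<Rightarrow> (nat \<Rightarrow> real) \<Rightarrow> real \<Rightarrow> real" where
  "grad_sq n f y t =
     (\<Sum>i<n. (deriv (\<lambda>s. harmonic_ext n f (y(i := s)) t) (y i))\<^sup>2) +
     (deriv (\<lambda>s. harmonic_ext n f y s) t)\<^sup>2"


section \<open>The Hardy space and BMO\<close>

definition ennsqrt :: "ennreal \<Rightarrow> ennreal" where
  "ennsqrt r = (if r = \<infinity> then \<infinity> else ennreal (sqrt (enn2real r)))"

definition hardy_ennnorm :: "nat \<Rightarrow> (nat \<Rightarrow> real) set set \<Rightarrow> ((nat \<Rightarrow> real) \<Rightarrow> real) \<Rightarrow> ennreal" where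
  "hardy_ennnorm n D f =
     (\<integral>\<^sup>+x. ennsqrt
        (\<integral>\<^sup>+p\<in>dyadic_cone n D x.
            ennreal (grad_sq n f (fst p) (snd p) * snd p powi (1 - int n))
          \<partial>(Rn n \<Otimes>\<^sub>M lborel))
      \<partial>Rn n)"

definition hardy_space :: "nat \<Rightarrow> (nat \<Rightarrow> real) set set \<Rightarrow> ((nat \<Rightarrow> real) \<Rightarrow> real) set" where
  "hardy_space n D = {f. integrable (Rn n) f \<and> hardy_ennnorm n D f < \<infinity>}"

definition hardy_norm :: "nat \<Rightarrow> (nat \<Rightarrow> real) set set \<Rightarrow> ((nat \<Rightarrow> real) \<Rightarrow> real) \<Rightarrow> real" where
  "hardy_norm n D f = enn2real (hardy_ennnorm n D f)"

definition bmo_bound ::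
  "nat \<Rightarrow> (nat \<Rightarrow> real) set set \<Rightarrow> ((nat \<Rightarrow> real) \<Rightarrow> real) \<Rightarrow> real \<Rightarrow> bool" where
  "bmo_bound n D \<phi> C0 \<longleftrightarrow> 0 \<le> C0 \<and>
     (\<forall>I\<in>D. (\<integral>\<^sup>+p\<in>carleson_box n I. ennreal (grad_sq n \<phi> (fst p) (snd p) * snd p)
               \<partial>(Rn n \<Otimes>\<^sub>M lborel)) \<le> ennreal (C0\<^sup>2 * vol n I))"

definition bmo_space :: "nat \<Rightarrow> (nat \<Rightarrow> real) set set \<Rightarrow> ((nat \<Rightarrow> real) \<Rightarrow> real) set" where
  "bmo_space n D = {\<phi>. integrable (Rn n) \<phi> \<and> (\<exists>C0. bmo_bound n D \<phi> C0)}"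

definition bmo_norm :: "nat \<Rightarrow> (nat \<Rightarrow> real) set set \<Rightarrow> ((nat \<Rightarrow> real) \<Rightarrow> real) \<Rightarrow> real" where
  "bmo_norm n D \<phi> = Inf {C0. bmo_bound n D \<phi> C0}"

(* Bounded linear functionals on the Hardy space. Its elements are represented by functions;
   boundedness makes a functional respect equality almost everywhere. *)
definition hardy_dual ::
  "nat \<Rightarrow> (nat \<Rightarrow> real) set set \<Rightarrow> (((nat \<Rightarrow> real) \<Rightarrow> real) \<Rightarrow> real) set" where
  "hardy_dual n D =
     {\<Lambda>. (\<forall>f\<in>hardy_space n D. \<forall>g\<in>hardy_space n D. \<forall>a b.
            \<Lambda> (\<lambda>y. a * f y + b * g y) = a * \<Lambda> f + b * \<Lambda> g) \<and>
         (\<exists>K. \<forall>f\<in>hardy_space n D. \<bar>\<Lambda> f\<bar> \<le> K * hardy_norm n D f)}"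

(* For phi in BMO and f in the Hardy space the product phi * f need not be integrable. The
   functional induced by phi is given by the pairing whenever the pairing is defined. *)
definition represents ::
  "nat \<Rightarrow> (nat \<Rightarrow> real) set set \<Rightarrow> ((nat \<Rightarrow> real) \<Rightarrow> real) \<Rightarrow> (((nat \<Rightarrow> real) \<Rightarrow> real) \<Rightarrow> real) \<Rightarrow> bool"
  where
  "represents n D \<phi> \<Lambda> \<longleftrightarrow> \<Lambda> \<in> hardy_dual n D \<and>
     (\<forall>f\<in>hardy_space n D. integrable (Rn n) (\<lambda>y. \<phi> y * f y) \<longrightarrow>
        \<Lambda> f = (\<integral>y. \<phi> y * f y \<partial>Rn n))"

end

theory Submission
  imports Defs "HOL-Probability.Distributions"
begin

text \<open>
Green's formula writes the pairing of \<open>\<phi>\<close> and \<open>f\<close> as twice the integral of the height \<open>t\<close> times the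
inner product of the gradients of the harmonic extensions \<open>u\<close> of \<open>\<phi>\<close> and \<open>v\<close> of \<open>f\<close>. Let \<open>r\<close> at a
point and a generation \<open>k\<close> be the square root of the sum, over the generations from \<open>k\<close> upwards, of the
averages of the energy of \<open>v\<close> on the top halves of the dyadic cubes around the point. Young's inequality
with weight \<open>C0 / r\<close> splits the integrand: the part with \<open>v\<close> telescopes to the square function, and, as \<open>r\<close>
is constant on dyadic cubes, summation by parts and the Carleson condition on \<open>u\<close> bound the other part. No
constant depends on the dimension.

Green's formula represents the pairing only for bounded \<open>\<phi>\<close>, so \<open>\<phi>\<close> is truncated, and truncation must
preserve the Carleson condition with some bound, which may depend on everything but the level. This is
visible for Garcia's equivalent condition that the Poisson averages of \<open>\<bar>\<phi> - u(x,t)\<bar>\<^sup>2\<close> around \<open>(x,t)\<close>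
are bounded.
\<close>

section \<open>Integration on the space of n-tuples\<close>

text \<open>The dimension stays harmless because every comparison on the way to the bound is exact
  on dyadic cubes. A top half of generation \<open>k\<close> has heights \<open>t\<close> at most
  \<open>2 powi k\<close>, so one over the volume of its cube is at most \<open>t\<close> to the
  power \<open>-n\<close>, the weight in the square function; and the weights in the Carleson
  estimate are constant on cubes, so they pass through averages with factor 1. The constant is 3:
  Green's formula contributes 2 and the duality 3/2, of which 1 comes from the telescoping part and
  1/2 from the Carleson part. The product of \<phi> and \<open>f\<close> need not be integrable, so
  the functional is defined by the Green integral, and its agreement with the pairing is a separate
  task. Truncation is not compared with \<phi> at the level of gradients; only the Carleson
  constants are under control. The limit in the level is therefore taken on a strip of heights
  bounded away from zero and infinity, and the rest is estimated, uniformly in the level, by the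
  tail of the square function of \<open>f\<close>.\<close>

type_synonym point = "nat \<Rightarrow> real"

interpretation lborel_product: product_sigma_finite "\<lambda>_::nat. lborel :: real measure"
  by standard

lemma sigma_finite_Rn: "sigma_finite_measure (Rn n)"
  unfolding Rn_def by (rule lborel_product.sigma_finite) simp

interpretation Rn: sigma_finite_measure "Rn n" for n
  by (rule sigma_finite_Rn)

interpretation Rn_line: pair_sigma_finite "Rn n" "lborel :: real measure" for n
  by standard

interpretation Rn_Rn: pair_sigma_finite "Rn n" "Rn n" for n
  by standard

abbreviation Rnt :: "nat \<Rightarrow> (point \<times> real) measure" where
  "Rnt n \<equiv> Rn n \<Otimes>\<^sub>M lborel"

lemma space_Rn: "space (Rn n) = (\<Pi>\<^sub>E i\<in>{..<n}. UNIV)"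
  by (simp add: Rn_def space_PiM)

lemma measurable_Rn_component[measurable (raw)]:
  assumes "f \<in> M \<rightarrow>\<^sub>M Rn n" "i < n"
  shows "(\<lambda>x. f x i) \<in> borel_measurable M"
proof -
  have "(\<lambda>x. x i) \<in> Rn n \<rightarrow>\<^sub>M (lborel::real measure)"
    unfolding Rn_def by (rule measurable_component_singleton) (use assms in simp)
  from measurable_compose[OF assms(1) this] show ?thesis by simp
qed

lemma measurable_into_Rn:
  assumes "\<And>i. i < n \<Longrightarrow> (\<lambda>x. f x i) \<in> borel_measurable M"
    and "\<And>x. x \<in> space M \<Longrightarrow> f x \<in> extensional {..<n}"
  shows "f \<in> M \<rightarrow>\<^sub>M Rn n"
  unfolding Rn_def
proof (rule measurable_PiM_single')
  show "\<And>i. i \<in> {..<n} \<Longrightarrow> (\<lambda>\<omega>. f \<omega> i) \<in> M \<rightarrow>\<^sub>M lborel" using assms(1) by simp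
  show "f \<in> space M \<rightarrow> (\<Pi>\<^sub>E i\<in>{..<n}. space lborel)"
    using assms(2) by (auto simp: PiE_def)
qed

text \<open>Only the slopes \<open>e = 1\<close> (translation by \<open>a\<close>) and
  \<open>e = -1\<close> (point reflection) are used. The restriction to \<open>{..<n}\<close> keeps
  the values extensional, hence inside \<open>space (Rn n)\<close>.\<close>

definition affine_map :: "nat \<Rightarrow> point \<Rightarrow> real \<Rightarrow> point \<Rightarrow> nat \<Rightarrow> real" where
  "affine_map n a e z = (\<lambda>i\<in>{..<n}. a i + e * z i)"

lemma measurable_affine_map[measurable]: "affine_map n a e \<in> Rn n \<rightarrow>\<^sub>M Rn n"
  unfolding affine_map_def by (rule measurable_into_Rn) auto

text \<open>A product measure is determined by boxes, and in each coordinate the map is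
  one-dimensional affine with Jacobian 1.\<close>

lemma distr_affine_map:
  assumes "\<bar>e\<bar> = 1"
  shows "distr (Rn n) (Rn n) (affine_map n a e) = Rn n"
proof -
  have "distr (Rn n) (Rn n) (affine_map n a e) = Pi\<^sub>M {..<n} (\<lambda>_. lborel)"
  proof (rule lborel_product.PiM_eqI)
    show "sets (distr (Rn n) (Rn n) (affine_map n a e)) = sets (Pi\<^sub>M {..<n} (\<lambda>_. lborel))"
      by (simp add: Rn_def)
    fix A :: "nat \<Rightarrow> real set"
    assume A: "\<And>i. i \<in> {..<n} \<Longrightarrow> A i \<in> sets lborel"
    then have box: "Pi\<^sub>E {..<n} A \<in> sets (Rn n)"
      unfolding Rn_def by (intro sets_PiM_I_finite) auto
    have pre: "affine_map n a e -` Pi\<^sub>E {..<n} A \<inter> space (Rn n)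
        = (\<Pi>\<^sub>E i\<in>{..<n}. (\<lambda>s. a i + e * s) -` A i)"
      by (auto simp: space_Rn affine_map_def PiE_iff restrict_def extensional_def)
    have meas: "(\<lambda>s. a i + e * s) -` A i \<in> sets lborel" if "i < n" for i
    proof -
      have "(\<lambda>s. a i + e * s) -` A i \<inter> space borel \<in> sets (borel :: real measure)"
        by (rule measurable_sets[where A=borel]) (use A that in auto)
      then show ?thesis by simp
    qed
    have one: "emeasure lborel ((\<lambda>s. a i + e * s) -` A i) = emeasure lborel (A i)" if "i < n" for i
    proof -
      have e: "e \<noteq> 0" using assms by auto
      have Ai[measurable]: "A i \<in> sets borel" using A that by auto
      have "emeasure lborel (A i) = emeasure (density (distr lborel borel (\<lambda>x. a i + e * x)) (\<lambda>_. ennreal \<bar>e\<bar>)) (A i)"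
        by (subst lborel_real_affine[OF e, of "a i"]) simp
      also have "\<dots> = emeasure lborel ((\<lambda>s. a i + e * s) -` A i)"
        using assms by (simp add: density_1 emeasure_distr)
      finally show ?thesis by simp
    qed
    show "emeasure (distr (Rn n) (Rn n) (affine_map n a e)) (Pi\<^sub>E {..<n} A)
        = (\<Prod>i\<in>{..<n}. emeasure lborel (A i))"
      using box meas one
      by (simp add: emeasure_distr pre) (subst Rn_def, subst lborel_product.emeasure_PiM, auto)
  qed simp
  then show ?thesis by (simp add: Rn_def)
qed

lemma nn_integral_affine_map:
  assumes "\<bar>e\<bar> = 1" and [measurable]: "h \<in> borel_measurable (Rn n)"
  shows "(\<integral>\<^sup>+z. h (affine_map n a e z) \<partial>Rn n) = (\<integral>\<^sup>+z. h z \<partial>Rn n)"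
proof -
  have "(\<integral>\<^sup>+z. h z \<partial>Rn n) = (\<integral>\<^sup>+z. h z \<partial>distr (Rn n) (Rn n) (affine_map n a e))"
    by (simp only: distr_affine_map[OF assms(1)])
  also have "\<dots> = (\<integral>\<^sup>+z. h (affine_map n a e z) \<partial>Rn n)"
    by (rule nn_integral_distr) auto
  finally show ?thesis by simp
qed

lemma integral_affine_map:
  fixes h :: "point \<Rightarrow> real"
  assumes "\<bar>e\<bar> = 1" and [measurable]: "h \<in> borel_measurable (Rn n)"
  shows "(\<integral>z. h (affine_map n a e z) \<partial>Rn n) = (\<integral>z. h z \<partial>Rn n)"
proof -
  have "(\<integral>z. h z \<partial>Rn n) = (\<integral>z. h z \<partial>distr (Rn n) (Rn n) (affine_map n a e))"
    by (simp only: distr_affine_map[OF assms(1)])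
  also have "\<dots> = (\<integral>z. h (affine_map n a e z) \<partial>Rn n)"
    by (rule integral_distr) auto
  finally show ?thesis by simp
qed

lemma integrable_affine_map:
  fixes h :: "point \<Rightarrow> real"
  assumes "\<bar>e\<bar> = 1" and "integrable (Rn n) h"
  shows "integrable (Rn n) (\<lambda>z. h (affine_map n a e z))"
proof -
  have "integrable (distr (Rn n) (Rn n) (affine_map n a e)) h"
    using assms by (simp add: distr_affine_map)
  then show ?thesis by (subst (asm) integrable_distr_eq) (use assms in auto)
qed

section \<open>Gaussian integrals and integrals of inverse powers\<close>

lemma gamma_subordination:
  assumes "a > 0" "\<rho> > (0::real)"
  shows "(\<integral>\<^sup>+l. ennreal (indicator {0<..} l * l powr (a - 1) * exp (- l * \<rho>)) \<partial>lborel)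
    = ennreal (Gamma a * \<rho> powr (- a))"
proof -
  have "ennreal (Gamma a) = (\<integral>\<^sup>+t. ennreal (indicator {0..} t * t powr (a - 1) / exp t) \<partial>lborel)"
    by (rule Gamma_conv_nn_integral_real) fact
  also have "\<dots> = ennreal \<bar>\<rho>\<bar> * (\<integral>\<^sup>+t. ennreal (indicator {0..} (0 + \<rho> * t) * (0 + \<rho> * t) powr (a - 1) / exp (0 + \<rho> * t)) \<partial>lborel)"
    by (rule nn_integral_real_affine) (use assms in auto)
  also have "\<dots> = ennreal \<rho> * (\<integral>\<^sup>+t. ennreal (\<rho> powr (a - 1)) * ennreal (indicator {0<..} t * t powr (a - 1) * exp (- t * \<rho>)) \<partial>lborel)"
  proof -
    have "(\<integral>\<^sup>+t. ennreal (indicator {0..} (0 + \<rho> * t) * (0 + \<rho> * t) powr (a - 1) / exp (0 + \<rho> * t)) \<partial>lborel)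
      = (\<integral>\<^sup>+t. ennreal (\<rho> powr (a - 1)) * ennreal (indicator {0<..} t * t powr (a - 1) * exp (- t * \<rho>)) \<partial>lborel)"
    proof (rule nn_integral_cong_AE)
      show "AE t in lborel. ennreal (indicator {0..} (0 + \<rho> * t) * (0 + \<rho> * t) powr (a - 1) / exp (0 + \<rho> * t))
        = ennreal (\<rho> powr (a - 1)) * ennreal (indicator {0<..} t * t powr (a - 1) * exp (- t * \<rho>))"
        using AE_lborel_singleton[of "0::real"]
      proof eventually_elim
        case (elim t)
        then show ?case using assms
          by (auto simp: indicator_def powr_mult exp_minus ennreal_mult'[symmetric] zero_le_mult_iff
              field_simps split: if_splits)
      qed
    qed
    then show ?thesis using assms by simp
  qed
  also have "\<dots> = ennreal (\<rho> powr a) * (\<integral>\<^sup>+t. ennreal (indicator {0<..} t * t powr (a - 1) * exp (- t * \<rho>)) \<partial>lborel)"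
  proof -
    have "\<rho> * \<rho> powr (a - 1) = \<rho> powr a"
      using assms by (simp add: powr_diff)
    then show ?thesis
      by (subst nn_integral_cmult) (use assms in \<open>auto simp: mult.assoc[symmetric] ennreal_mult'[symmetric]\<close>)
  qed
  finally have eq: "ennreal (Gamma a) = ennreal (\<rho> powr a) * (\<integral>\<^sup>+t. ennreal (indicator {0<..} t * t powr (a - 1) * exp (- t * \<rho>)) \<partial>lborel)" .
  have "ennreal (Gamma a * \<rho> powr (- a)) = ennreal (\<rho> powr (-a)) * ennreal (Gamma a)"
    using assms by (simp add: ennreal_mult'[symmetric] mult.commute)
  also have "\<dots> = ennreal (\<rho> powr (-a) * \<rho> powr a) * (\<integral>\<^sup>+t. ennreal (indicator {0<..} t * t powr (a - 1) * exp (- t * \<rho>)) \<partial>lborel)"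
    unfolding eq by (simp add: ennreal_mult mult.assoc)
  also have "\<rho> powr (-a) * \<rho> powr a = 1" using assms by (simp add: powr_add[symmetric])
  finally show ?thesis by simp
qed

lemma nn_integral_gaussian:
  assumes "l > (0::real)"
  shows "(\<integral>\<^sup>+x. ennreal (exp (- l * x\<^sup>2)) \<partial>lborel) = ennreal (sqrt (pi / l))"
proof -
  define \<sigma> where "\<sigma> = sqrt (1 / (2 * l))"
  have s: "\<sigma> > 0" "\<sigma>\<^sup>2 = 1 / (2 * l)" using assms by (auto simp: \<sigma>_def)
  have "ennreal (exp (- l * x\<^sup>2)) = ennreal (sqrt (pi / l)) * ennreal (normal_density 0 \<sigma> x)" for x
  proof -
    have "normal_density 0 \<sigma> x = 1 / sqrt (pi / l) * exp (- l * x\<^sup>2)"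
      unfolding normal_density_def s(2) using assms by (simp add: field_simps)
    then have "exp (- l * x\<^sup>2) = sqrt (pi / l) * normal_density 0 \<sigma> x"
      using assms by simp
    then show ?thesis using assms by (simp add: ennreal_mult'[symmetric])
  qed
  then have "(\<integral>\<^sup>+x. ennreal (exp (- l * x\<^sup>2)) \<partial>lborel) = ennreal (sqrt (pi / l)) * (\<integral>\<^sup>+x. ennreal (normal_density 0 \<sigma> x) \<partial>lborel)"
    by (simp add: nn_integral_cmult)
  also have "(\<integral>\<^sup>+x. ennreal (normal_density 0 \<sigma> x) \<partial>lborel) = ennreal 1"
    using s by (subst nn_integral_eq_integral) (auto)
  finally show ?thesis by simp
qed

lemma nn_integral_gaussian_Rn:
  assumes "l > (0::real)"
  shows "(\<integral>\<^sup>+y. ennreal (exp (- l * (\<Sum>i<n. (y i)\<^sup>2))) \<partial>Rn n) = ennreal ((pi / l) powr (real n / 2))"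
proof -
  have "(\<integral>\<^sup>+y. ennreal (exp (- l * (\<Sum>i<n. (y i)\<^sup>2))) \<partial>Rn n) = (\<integral>\<^sup>+y. (\<Prod>i\<in>{..<n}. ennreal (exp (- l * (y i)\<^sup>2))) \<partial>Rn n)"
    by (intro nn_integral_cong, subst prod_ennreal)
      (auto simp only: sum_distrib_left exp_sum finite_lessThan exp_ge_zero)
  also have "\<dots> = (\<Prod>i\<in>{..<n}. ennreal (sqrt (pi / l)))"
    unfolding Rn_def by (subst lborel_product.product_nn_integral_prod) (auto simp: nn_integral_gaussian[OF assms, simplified])
  also have "\<dots> = ennreal ((pi / l) powr (real n / 2))"
  proof -
    have "sqrt (pi / l) ^ n = ((pi / l) powr (1/2)) powr real n"
      using assms by (subst powr_realpow) (simp_all add: powr_half_sqrt)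
    then show ?thesis using assms by (simp add: ennreal_power powr_powr)
  qed
  finally show ?thesis .
qed

text \<open>Subordination: by \<open>gamma_subordination\<close> the inverse power is a
  superposition of Gaussians in \<open>y\<close>; after Tonelli's theorem the integral over
  \<open>y\<close> factors into one-dimensional Gaussians, and the remaining integral over the
  parameter is a Gamma integral again. The exponent is kept general because three values occur:
  \<open>n + 1\<close> normalises the Poisson kernel, \<open>n + 2\<close> belongs to the bound of
  its second derivatives, and \<open>n + 1/2\<close> to the kernel multiplied by a growth
  weight.\<close>

lemma nn_integral_bracket_Rn:
  assumes "q > real n" "T > 0"
  shows "(\<integral>\<^sup>+y. ennreal ((T\<^sup>2 + (\<Sum>i<n. (y i)\<^sup>2)) powr (- q / 2)) \<partial>Rn n)
    = ennreal (pi powr (real n / 2) * Gamma ((q - real n) / 2) / Gamma (q / 2) * T powr (real n - q))"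
proof -
  have q: "q > 0" using assms by linarith
  have G: "Gamma (q / 2) > 0" using q by (intro Gamma_real_pos) simp
  define N where "N = (\<lambda>y::nat\<Rightarrow>real. \<Sum>i<n. (y i)\<^sup>2)"
  have [measurable]: "N \<in> borel_measurable (Rn n)" unfolding N_def by measurable
  have N0: "N y \<ge> 0" for y by (simp add: N_def sum_nonneg)
  define F where "F = (\<lambda>(y::nat\<Rightarrow>real, l::real). ennreal (indicator {0<..} l * l powr (q / 2 - 1) * exp (- l * (T\<^sup>2 + N y))))"
  have [measurable]: "F \<in> borel_measurable (Rnt n)" unfolding F_def by measurable
  have "ennreal (Gamma (q/2)) * (\<integral>\<^sup>+y. ennreal ((T\<^sup>2 + N y) powr (- q / 2)) \<partial>Rn n)
      = (\<integral>\<^sup>+y. ennreal (Gamma (q/2) * (T\<^sup>2 + N y) powr (- (q / 2))) \<partial>Rn n)"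
    using G by (subst nn_integral_cmult[symmetric]) (auto simp: ennreal_mult' less_imp_le)
  also have "\<dots> = (\<integral>\<^sup>+y. (\<integral>\<^sup>+l. F (y, l) \<partial>lborel) \<partial>Rn n)"
    unfolding F_def prod.case
    by (intro nn_integral_cong gamma_subordination[symmetric]) (use q assms N0 in \<open>auto intro: add_pos_nonneg\<close>)
  also have "\<dots> = (\<integral>\<^sup>+l. (\<integral>\<^sup>+y. F (y, l) \<partial>Rn n) \<partial>lborel)"
    by (rule Rn_line.Fubini'[symmetric]) simp
  also have "\<dots> = (\<integral>\<^sup>+l. ennreal (pi powr (real n / 2)) * ennreal (indicator {0<..} l * l powr ((q - real n) / 2 - 1) * exp (- l * T\<^sup>2)) \<partial>lborel)"
  proof (intro nn_integral_cong)
    fix l :: real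
    show "(\<integral>\<^sup>+y. F (y, l) \<partial>Rn n) = ennreal (pi powr (real n / 2)) * ennreal (indicator {0<..} l * l powr ((q - real n) / 2 - 1) * exp (- l * T\<^sup>2))"
    proof (cases "l > 0")
      case True
      have "(\<integral>\<^sup>+y. F (y, l) \<partial>Rn n) = (\<integral>\<^sup>+y. ennreal (l powr (q / 2 - 1) * exp (- l * T\<^sup>2)) * ennreal (exp (- l * N y)) \<partial>Rn n)"
        using True by (intro nn_integral_cong) (simp add: F_def ennreal_mult'[symmetric] mult.assoc exp_add[symmetric] algebra_simps)
      also have "\<dots> = ennreal (l powr (q / 2 - 1) * exp (- l * T\<^sup>2)) * ennreal ((pi / l) powr (real n / 2))"
        using nn_integral_gaussian_Rn[OF True, of n] by (subst nn_integral_cmult) (auto simp: N_def)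
      also have "\<dots> = ennreal (pi powr (real n / 2)) * ennreal (l powr ((q - real n) / 2 - 1) * exp (- l * T\<^sup>2))"
      proof -
        have "l powr (q / 2 - 1) * (pi / l) powr (real n / 2) = pi powr (real n / 2) * (l powr (q / 2 - 1) * l powr (- (real n / 2)))"
          using True by (simp add: powr_divide powr_minus_divide)
        also have "l powr (q / 2 - 1) * l powr (- (real n / 2)) = l powr ((q - real n) / 2 - 1)"
          by (simp add: powr_add[symmetric] diff_divide_distrib algebra_simps)
        finally have "l powr (q / 2 - 1) * exp (- l * T\<^sup>2) * (pi / l) powr (real n / 2)
          = pi powr (real n / 2) * (l powr ((q - real n) / 2 - 1) * exp (- l * T\<^sup>2))"
          by (simp only: mult_ac)
        then show ?thesis by (subst (1 2) ennreal_mult'[symmetric]) auto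
      qed
      finally show ?thesis using True by simp
    qed (simp add: F_def)
  qed
  also have "\<dots> = ennreal (pi powr (real n / 2)) * ennreal (Gamma ((q - real n) / 2) * (T\<^sup>2) powr (- ((q - real n) / 2)))"
    using assms by (subst nn_integral_cmult, simp, subst gamma_subordination) auto
  also have "\<dots> = ennreal (pi powr (real n / 2) * Gamma ((q - real n) / 2) * T powr (real n - q))"
  proof -
    have "(T\<^sup>2) powr (- ((q - real n) / 2)) = T powr (real n - q)"
    proof -
      have "T\<^sup>2 = T powr 2" using assms by simp
      then show ?thesis by (simp only: powr_powr) (simp add: diff_divide_distrib)
    qed
    then show ?thesis by (simp add: ennreal_mult'[symmetric] mult.assoc)
  qed
  finally have *: "ennreal (Gamma (q/2)) * (\<integral>\<^sup>+y. ennreal ((T\<^sup>2 + N y) powr (- q / 2)) \<partial>Rn n) = ennreal (pi powr (real n / 2) * Gamma ((q - real n) / 2) * T powr (real n - q))" .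
  have "(\<integral>\<^sup>+y. ennreal ((T\<^sup>2 + N y) powr (- q / 2)) \<partial>Rn n) = ennreal (1 / Gamma (q/2)) * (ennreal (Gamma (q/2)) * (\<integral>\<^sup>+y. ennreal ((T\<^sup>2 + N y) powr (- q / 2)) \<partial>Rn n))"
    using G by (simp add: mult.assoc[symmetric] ennreal_mult'[symmetric])
  also have "\<dots> = ennreal (pi powr (real n / 2) * Gamma ((q - real n) / 2) / Gamma (q / 2) * T powr (real n - q))"
    using G unfolding * by (subst ennreal_mult'[symmetric]) (auto simp: less_imp_le)
  finally show ?thesis by (simp add: N_def)
qed

section \<open>The Poisson kernel\<close>

lemma powr_mult_powr: "a + b = c \<Longrightarrow> x powr a * x powr b = x powr c" for x :: real
  by (metis powr_add)

lemma mult_powr: "x > 0 \<Longrightarrow> 1 + b = c \<Longrightarrow> x * x powr b = x powr c" for x :: real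
  using powr_mult_powr[of 1 b c x] by simp

text \<open>A point of the half space is a function whose coordinates below \<open>n\<close> are the horizontal ones and whose coordinate
\<open>n\<close> is the height. In these coordinates \<open>pk\<close> is the Poisson kernel, \<open>pk1\<close> and \<open>pk2\<close> are its partial derivatives.\<close>

definition ssq :: "nat \<Rightarrow> point \<Rightarrow> real" where
  "ssq n X = (\<Sum>i\<le>n. (X i)\<^sup>2)"

definition pm :: "nat \<Rightarrow> real" where "pm n = (real n + 1) / 2"

definition pc :: "nat \<Rightarrow> real" where "pc n = Gamma (pm n) / pi powr pm n"

definition pk :: "nat \<Rightarrow> point \<Rightarrow> real" where
  "pk n X = pc n * X n * ssq n X powr (- pm n)"

definition pk1 :: "nat \<Rightarrow> nat \<Rightarrow> point \<Rightarrow> real" where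
  "pk1 n i X = pc n * ((if i = n then ssq n X powr (- pm n) else 0)
     - 2 * pm n * X n * X i * ssq n X powr (- pm n - 1))"

definition pk2 :: "nat \<Rightarrow> nat \<Rightarrow> nat \<Rightarrow> point \<Rightarrow> real" where
  "pk2 n i j X = pc n * (4 * pm n * (pm n + 1) * X n * X i * X j * ssq n X powr (- pm n - 2)
     - 2 * pm n * ((if i = n then X j else 0) + (if j = n then X i else 0) + (if i = j then X n else 0))
         * ssq n X powr (- pm n - 1))"

lemma pm_pos: "pm n > 0" by (simp add: pm_def)

lemma pc_pos: "pc n > 0"
  using pm_pos[of n] by (simp add: pc_def Gamma_real_pos)

lemma ssq_nonneg: "ssq n X \<ge> 0" by (simp add: ssq_def sum_nonneg)

lemma component_sq_le_ssq: "i \<le> n \<Longrightarrow> (X i)\<^sup>2 \<le> ssq n X"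
  unfolding ssq_def by (rule member_le_sum) auto

lemma component_le_sqrt_ssq: "i \<le> n \<Longrightarrow> \<bar>X i\<bar> \<le> sqrt (ssq n X)"
  using component_sq_le_ssq[of i n X] real_le_rsqrt real_sqrt_abs real_sqrt_le_mono by metis

lemma ssq_pos: "X n \<noteq> 0 \<Longrightarrow> ssq n X > 0"
  using component_sq_le_ssq[of n n X] by (smt (verit) zero_less_power2 order_refl)

lemma ssq_fun_upd:
  assumes "j \<le> n"
  shows "ssq n (X(j := s)) = (\<Sum>i\<in>{..n} - {j}. (X i)\<^sup>2) + s\<^sup>2"
  unfolding ssq_def using assms by (subst sum.remove[of _ j]) auto

lemma DERIV_ssq:
  assumes "j \<le> n"
  shows "((\<lambda>s. ssq n (X(j := s))) has_real_derivative 2 * s) (at s)"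
  unfolding ssq_fun_upd[OF assms] by (auto intro!: derivative_eq_intros)

lemma DERIV_fun_upd: "((\<lambda>s. (X(j := s)) i) has_real_derivative (if i = j then 1 else 0)) (at s)"
  for X :: "nat \<Rightarrow> real"
  by auto

lemma DERIV_ssq_powr:
  assumes "j \<le> n" "ssq n (X(j := s)) > 0"
  shows "((\<lambda>s. ssq n (X(j := s)) powr r) has_real_derivative
     2 * r * s * ssq n (X(j := s)) powr (r - 1)) (at s)"
  using DERIV_fun_powr[OF DERIV_ssq[OF assms(1), of X s] assms(2), of r]
  by (simp only: of_nat_1 mult_ac)

lemma DERIV_pk:
  assumes "j \<le> n" "ssq n (X(j := s)) > 0"
  shows "((\<lambda>s. pk n (X(j := s))) has_real_derivative pk1 n j (X(j := s))) (at s)"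
  unfolding pk_def pk1_def
  by (rule DERIV_cong[OF DERIV_mult[OF DERIV_cmult[OF DERIV_fun_upd] DERIV_ssq_powr[OF assms]]])
    (auto simp: algebra_simps)

lemma DERIV_pk1:
  assumes "j \<le> n" "ssq n (X(j := s)) > 0"
  shows "((\<lambda>s. pk1 n i (X(j := s))) has_real_derivative pk2 n i j (X(j := s))) (at s)"
proof -
  have A: "((\<lambda>s. if i = n then ssq n (X(j := s)) powr (- pm n) else 0) has_real_derivative
     (if i = n then - 2 * pm n * s * ssq n (X(j := s)) powr (- pm n - 1) else 0)) (at s)"
    using DERIV_ssq_powr[OF assms, of "- pm n"] by auto
  have B: "((\<lambda>s. 2 * pm n * (X(j := s)) n * (X(j := s)) i * ssq n (X(j := s)) powr (- pm n - 1))
     has_real_derivative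
       (2 * pm n * (if n = j then 1 else 0) * (X(j := s)) i + (if i = j then 1 else 0) * (2 * pm n * (X(j := s)) n))
          * ssq n (X(j := s)) powr (- pm n - 1)
       + 2 * (- pm n - 1) * s * ssq n (X(j := s)) powr (- pm n - 1 - 1) * (2 * pm n * (X(j := s)) n * (X(j := s)) i)) (at s)"
    by (rule DERIV_mult[OF DERIV_mult[OF DERIV_cmult[OF DERIV_fun_upd] DERIV_fun_upd] DERIV_ssq_powr[OF assms]])
  have e: "- pm n - 1 - 1 = - pm n - 2" by simp
  show ?thesis
    unfolding pk1_def pk2_def
    by (rule DERIV_cong[OF DERIV_cmult[OF DERIV_diff[OF A B]]])
      (simp add: e algebra_simps)
qed

text \<open>All terms share the factor \<open>X n * ssq n X powr (- pm n - 1)\<close>, and the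
  remaining coefficient \<open>2 * (pm n + 1) - (n + 1) - 2\<close> vanishes because the exponent
  \<open>pm n\<close> is \<open>(n + 1) / 2\<close>.\<close>

lemma pk2_laplace:
  assumes "ssq n X > 0"
  shows "(\<Sum>i\<le>n. pk2 n i i X) = 0"
proof -
  define L where "L = ssq n X powr (- pm n - 2)"
  have L1: "ssq n X powr (- pm n - 1) = ssq n X * L"
    unfolding L_def using assms by (intro mult_powr[symmetric]) auto
  have "(\<Sum>i\<le>n. pk2 n i i X) = (\<Sum>i\<le>n. pc n * (4 * pm n * (pm n + 1) * X n * L) * (X i)\<^sup>2
     - pc n * (2 * pm n * ssq n X * L) * (X n + (if i = n then 2 * X n else 0)))"
    unfolding pk2_def L1 L_def[symmetric]
    by (intro sum.cong) (auto simp: power2_eq_square algebra_simps)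
  also have "\<dots> = pc n * (4 * pm n * (pm n + 1) * X n * L) * ssq n X
     - pc n * (2 * pm n * ssq n X * L) * (real (Suc n) * X n + 2 * X n)"
    unfolding sum_subtractf sum_distrib_left[symmetric] sum.distrib ssq_def[symmetric]
    by simp
  also have "\<dots> = pc n * 2 * pm n * L * X n * ssq n X * (2 * (pm n + 1) - real (Suc n) - 2)"
    by (simp add: algebra_simps)
  also have "2 * (pm n + 1) - real (Suc n) - 2 = 0" by (simp add: pm_def field_simps)
  finally show ?thesis by simp
qed

text \<open>One constant for both orders of differentiation: \<open>1 + 2 * pm n\<close> suffices
  for the first derivatives and \<open>4 * pm n * (pm n + 1) + 6 * pm n\<close> for the
  second.\<close>

definition pC :: "nat \<Rightarrow> real" where "pC n = 1 + 6 * pm n + 4 * pm n * (pm n + 1)"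

lemma pC_ge_1: "pC n \<ge> 1"
  using pm_pos[of n] by (simp add: pC_def)

lemma abs_pk1_le:
  assumes "i \<le> n" "ssq n X > 0"
  shows "\<bar>pk1 n i X\<bar> \<le> pc n * pC n * ssq n X powr (- pm n)"
proof -
  have e: "ssq n X * ssq n X powr (- pm n - 1) = ssq n X powr (- pm n)"
    using assms by (simp add: mult_powr)
  have "\<bar>X n\<bar> * \<bar>X i\<bar> \<le> sqrt (ssq n X) * sqrt (ssq n X)"
    using assms by (intro mult_mono component_le_sqrt_ssq) (auto simp: ssq_nonneg)
  then have "\<bar>X n\<bar> * \<bar>X i\<bar> \<le> ssq n X" by (simp add: ssq_nonneg)
  then have "\<bar>X n\<bar> * \<bar>X i\<bar> * ssq n X powr (- pm n - 1) \<le> ssq n X * ssq n X powr (- pm n - 1)"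
    by (intro mult_right_mono) auto
  then have *: "2 * pm n * (\<bar>X n\<bar> * \<bar>X i\<bar> * ssq n X powr (- pm n - 1)) \<le> 2 * pm n * ssq n X powr (- pm n)"
    unfolding e using pm_pos[of n] by (intro mult_left_mono) auto
  have "\<bar>(if i = n then ssq n X powr (- pm n) else 0) - 2 * pm n * X n * X i * ssq n X powr (- pm n - 1)\<bar>
     \<le> ssq n X powr (- pm n) + 2 * pm n * (\<bar>X n\<bar> * \<bar>X i\<bar> * ssq n X powr (- pm n - 1))"
    using pm_pos[of n] by (intro order.trans[OF abs_triangle_ineq4] add_mono) (auto simp: abs_mult)
  also have "\<dots> \<le> ssq n X powr (- pm n) + 2 * pm n * ssq n X powr (- pm n)" using * by simp
  also have "\<dots> \<le> pC n * ssq n X powr (- pm n)"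
    using pm_pos[of n] unfolding pC_def distrib_right[of _ _ "ssq n X powr _"]
    by (simp add: mult_right_mono)
  finally show ?thesis
    unfolding pk1_def abs_mult using pc_pos[of n] by (simp add: mult.assoc)
qed

lemma abs_pk2_le:
  assumes "i \<le> n" "j \<le> n" "ssq n X > 0"
  shows "\<bar>pk2 n i j X\<bar> \<le> pc n * pC n * ssq n X powr (- pm n - 1/2)"
proof -
  define r where "r = sqrt (ssq n X)"
  have r: "r > 0" "r * r = ssq n X" using assms by (auto simp: r_def)
  have rp: "r = ssq n X powr (1/2)" using assms by (simp add: r_def powr_half_sqrt)
  have e1: "r * ssq n X powr (- pm n - 1) = ssq n X powr (- pm n - 1/2)"
    unfolding rp by (rule powr_mult_powr) simp
  have e2: "(r * r * r) * ssq n X powr (- pm n - 2) = ssq n X powr (- pm n - 1/2)"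
    unfolding rp by (simp only: powr_add[symmetric]) (simp add: algebra_simps)
  have c: "\<bar>X k\<bar> \<le> r" if "k \<le> n" for k using that by (simp add: r_def component_le_sqrt_ssq)
  have "\<bar>X n\<bar> * \<bar>X i\<bar> * \<bar>X j\<bar> \<le> r * r * r"
    using r assms by (intro mult_mono c) auto
  then have "\<bar>X n\<bar> * \<bar>X i\<bar> * \<bar>X j\<bar> * ssq n X powr (- pm n - 2) \<le> (r * r * r) * ssq n X powr (- pm n - 2)"
    by (intro mult_right_mono) auto
  then have b1: "4 * pm n * (pm n + 1) * (\<bar>X n\<bar> * \<bar>X i\<bar> * \<bar>X j\<bar> * ssq n X powr (- pm n - 2))
     \<le> 4 * pm n * (pm n + 1) * ssq n X powr (- pm n - 1/2)"
    unfolding e2 using pm_pos[of n] by (intro mult_left_mono) auto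
  have "\<bar>(if i = n then X j else 0) + (if j = n then X i else 0) + (if i = j then X n else 0)\<bar> \<le> 3 * r"
    using c[of i] c[of j] c[of n] assms r by (auto simp: abs_le_iff)
  then have "\<bar>(if i = n then X j else 0) + (if j = n then X i else 0) + (if i = j then X n else 0)\<bar> * ssq n X powr (- pm n - 1)
     \<le> 3 * r * ssq n X powr (- pm n - 1)"
    by (intro mult_right_mono) auto
  also have "\<dots> = 3 * ssq n X powr (- pm n - 1/2)" using e1 by (simp add: mult.assoc)
  finally have b2: "2 * pm n * (\<bar>(if i = n then X j else 0) + (if j = n then X i else 0) + (if i = j then X n else 0)\<bar> * ssq n X powr (- pm n - 1))
     \<le> 2 * pm n * (3 * ssq n X powr (- pm n - 1/2))"
    using pm_pos[of n] by (intro mult_left_mono) auto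
  have "\<bar>pk2 n i j X\<bar> = pc n * \<bar>4 * pm n * (pm n + 1) * X n * X i * X j * ssq n X powr (- pm n - 2)
     - 2 * pm n * ((if i = n then X j else 0) + (if j = n then X i else 0) + (if i = j then X n else 0))
         * ssq n X powr (- pm n - 1)\<bar>"
    unfolding pk2_def abs_mult[of "pc n"] using pc_pos[of n] by simp
  also have "\<dots> \<le> pc n * (4 * pm n * (pm n + 1) * (\<bar>X n\<bar> * \<bar>X i\<bar> * \<bar>X j\<bar> * ssq n X powr (- pm n - 2))
      + 2 * pm n * (\<bar>(if i = n then X j else 0) + (if j = n then X i else 0) + (if i = j then X n else 0)\<bar> * ssq n X powr (- pm n - 1)))"
    using pc_pos[of n] pm_pos[of n]
    by (intro mult_left_mono order.trans[OF abs_triangle_ineq4] add_mono) (auto simp: abs_mult)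
  also have "\<dots> \<le> pc n * (pC n * ssq n X powr (- pm n - 1/2))"
  proof (intro mult_left_mono order.trans[OF add_mono[OF b1 b2]])
    have "4 * pm n * (pm n + 1) * R + 2 * pm n * (3 * R) \<le> pC n * R" if "R \<ge> 0" for R
      using that unfolding pC_def by (simp add: algebra_simps)
    then show "4 * pm n * (pm n + 1) * ssq n X powr (- pm n - 1/2) + 2 * pm n * (3 * ssq n X powr (- pm n - 1/2))
        \<le> pC n * ssq n X powr (- pm n - 1/2)" by simp
  qed (use pc_pos[of n] in simp)
  finally show ?thesis by (simp add: mult.assoc)
qed

lemma pk_nonneg: "X n \<ge> 0 \<Longrightarrow> pk n X \<ge> 0"
  using pc_pos[of n] by (simp add: pk_def)

text \<open>The bound by \<open>ssq n X powr (- pm n)\<close> is the kernel itself up to the factor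
  \<open>pc n * X n\<close>. So a derivative costs one over the height, and the extension of an
  absolute value controls all derivatives of an extension.\<close>

lemma abs_pk1_le_pk:
  assumes "i \<le> n" "X n > 0"
  shows "\<bar>pk1 n i X\<bar> \<le> pC n * pk n X / X n"
  using abs_pk1_le[of i n X] assms ssq_pos[of X n] by (simp add: pk_def mult_ac)

lemma abs_pk2_le_pk:
  assumes "i \<le> n" "j \<le> n" "X n > 0"
  shows "\<bar>pk2 n i j X\<bar> \<le> pC n * pk n X / (X n)\<^sup>2"
proof -
  have s: "ssq n X > 0" using assms ssq_pos[of X n] by simp
  have "X n \<le> ssq n X powr (1/2)"
    using component_le_sqrt_ssq[of n n X] assms s by (simp add: powr_half_sqrt)
  then have "ssq n X powr (- (1/2)) \<le> 1 / X n"
    using assms s by (simp add: powr_minus_divide frac_le)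
  then have "ssq n X powr (- pm n) * ssq n X powr (- (1/2)) \<le> ssq n X powr (- pm n) * (1 / X n)"
    by (intro mult_left_mono) auto
  then have "ssq n X powr (- pm n - 1/2) \<le> ssq n X powr (- pm n) / X n"
    by (simp add: powr_mult_powr)
  then have "pc n * pC n * ssq n X powr (- pm n - 1/2) \<le> pc n * pC n * (ssq n X powr (- pm n) / X n)"
    using pc_pos[of n] pC_ge_1[of n] by (intro mult_left_mono) auto
  also have "\<dots> = pC n * pk n X / (X n)\<^sup>2"
    using assms by (simp add: pk_def power2_eq_square)
  finally show ?thesis using abs_pk2_le[OF assms(1,2) s] by simp
qed

lemma pk_le:
  assumes "X n > 0"
  shows "pk n X \<le> pc n / X n ^ n"
proof -
  have s: "ssq n X > 0" using assms ssq_pos[of X n] by simp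
  have "ssq n X powr (- pm n) \<le> ((X n)\<^sup>2) powr (- pm n)"
    using component_sq_le_ssq[of n n X] pm_pos[of n] assms by (intro powr_mono2') auto
  also have "(X n)\<^sup>2 = X n powr 2" using assms by simp
  also have "(X n powr 2) powr (- pm n) = X n powr (- real (Suc n))"
    by (simp only: powr_powr) (simp add: pm_def add_divide_distrib algebra_simps)
  also have "\<dots> = 1 / X n ^ Suc n"
    using assms by (simp only: powr_minus_divide powr_realpow)
  finally have "ssq n X powr (- pm n) \<le> 1 / X n ^ Suc n" .
  then have "pc n * X n * ssq n X powr (- pm n) \<le> pc n * X n * (1 / X n ^ Suc n)"
    using pc_pos[of n] assms by (intro mult_left_mono) auto
  then show ?thesis using assms by (simp add: pk_def)
qed

section \<open>Harmonic extensions\<close>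

text \<open>Differentiation under the integral sign: the mean value theorem bounds the difference
  quotients by \<open>B\<close>, which makes dominated convergence applicable along every null
  sequence.\<close>

lemma has_real_derivative_integral:
  fixes g g' :: "real \<Rightarrow> 'a \<Rightarrow> real"
  assumes "\<delta> > 0"
    and int: "\<And>s. \<bar>s - s0\<bar> < \<delta> \<Longrightarrow> integrable M (g s)"
    and der: "\<And>s z. \<bar>s - s0\<bar> < \<delta> \<Longrightarrow> z \<in> space M \<Longrightarrow> ((\<lambda>s. g s z) has_real_derivative g' s z) (at s)"
    and bound: "\<And>s z. \<bar>s - s0\<bar> < \<delta> \<Longrightarrow> z \<in> space M \<Longrightarrow> \<bar>g' s z\<bar> \<le> B z"
    and B: "integrable M B"
    and meas: "g' s0 \<in> borel_measurable M"
  shows "((\<lambda>s. \<integral>z. g s z \<partial>M) has_real_derivative (\<integral>z. g' s0 z \<partial>M)) (at s0)"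
  unfolding DERIV_def tendsto_at_iff_sequentially
proof (intro allI impI)
  fix X :: "nat \<Rightarrow> real"
  assume X0: "\<forall>i. X i \<in> UNIV - {0}" and X: "X \<longlonglongrightarrow> 0"
  \<comment> \<open>Dominated convergence asks for the bound at every index, so the sequence is
    shifted past the finitely many terms outside the \<delta>-neighbourhood.\<close>
  obtain N where N: "\<And>i. i \<ge> N \<Longrightarrow> \<bar>X i\<bar> < \<delta>"
    using LIMSEQ_D[OF X \<open>\<delta> > 0\<close>] by auto
  define Y where "Y i = X (i + N)" for i
  have Y: "Y i \<noteq> 0" "\<bar>Y i\<bar> < \<delta>" for i using X0 N by (auto simp: Y_def)
  have Y0: "Y \<longlonglongrightarrow> 0" unfolding Y_def by (rule LIMSEQ_ignore_initial_segment[OF X])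
  have "(\<lambda>i. \<integral>z. (g (s0 + Y i) z - g s0 z) / Y i \<partial>M) \<longlonglongrightarrow> (\<integral>z. g' s0 z \<partial>M)"
  proof (rule integral_dominated_convergence[OF meas _ B])
    show "(\<lambda>z. (g (s0 + Y i) z - g s0 z) / Y i) \<in> borel_measurable M" for i
      using int[of "s0 + Y i"] int[of s0] Y[of i] \<open>\<delta> > 0\<close> by (intro borel_measurable_divide borel_measurable_diff) auto
    show "AE z in M. (\<lambda>i. (g (s0 + Y i) z - g s0 z) / Y i) \<longlonglongrightarrow> g' s0 z"
    proof (rule AE_I2)
      fix z assume z: "z \<in> space M"
      from der[OF _ z, of s0] \<open>\<delta> > 0\<close> have "((\<lambda>h. (g (s0 + h) z - g s0 z) / h) \<longlongrightarrow> g' s0 z) (at 0)"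
        by (auto simp: DERIV_def)
      then show "(\<lambda>i. (g (s0 + Y i) z - g s0 z) / Y i) \<longlonglongrightarrow> g' s0 z"
        using Y Y0 unfolding tendsto_at_iff_sequentially by (auto simp: comp_def)
    qed
    show "AE z in M. norm ((g (s0 + Y i) z - g s0 z) / Y i) \<le> B z" for i
    proof (rule AE_I2)
      fix z assume z: "z \<in> space M"
      have "norm (g (s0 + Y i) z - g s0 z) \<le> B z * norm (s0 + Y i - s0)"
      proof (rule field_differentiable_bound[of "{s. \<bar>s - s0\<bar> < \<delta>}" "\<lambda>s. g s z" "\<lambda>s. g' s z"])
        have "{s. \<bar>s - s0\<bar> < \<delta>} = ball s0 \<delta>" by (auto simp: dist_real_def)
        then show "convex {s. \<bar>s - s0\<bar> < \<delta>}" by simp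
      qed (use der bound z Y \<open>\<delta> > 0\<close> in \<open>auto intro: has_field_derivative_at_within\<close>)
      then show "norm ((g (s0 + Y i) z - g s0 z) / Y i) \<le> B z"
        using Y[of i] by (simp add: abs_divide divide_le_eq)
    qed
  qed
  moreover have "\<And>i. (\<integral>z. (g (s0 + Y i) z - g s0 z) / Y i \<partial>M) = ((\<integral>z. g (s0 + Y i) z \<partial>M) - (\<integral>z. g s0 z \<partial>M)) / Y i"
    using int Y \<open>\<delta> > 0\<close> by simp
  ultimately have "(\<lambda>i. ((\<lambda>h. ((\<integral>z. g (s0 + h) z \<partial>M) - (\<integral>z. g s0 z \<partial>M)) / h) \<circ> X) (i + N)) \<longlonglongrightarrow> (\<integral>z. g' s0 z \<partial>M)"
    by (simp only: Y_def comp_def)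
  then show "((\<lambda>h. ((\<integral>z. g (s0 + h) z \<partial>M) - (\<integral>z. g s0 z \<partial>M)) / h) \<circ> X) \<longlonglongrightarrow> (\<integral>z. g' s0 z \<partial>M)"
    by (rule LIMSEQ_offset)
qed

lemma abs_integral_le:
  fixes f g :: "'a \<Rightarrow> real"
  assumes g: "integrable M g" and le: "\<And>x. x \<in> space M \<Longrightarrow> \<bar>f x\<bar> \<le> g x"
  shows "\<bar>\<integral>x. f x \<partial>M\<bar> \<le> (\<integral>x. g x \<partial>M)"
proof -
  have "\<bar>\<integral>x. f x \<partial>M\<bar> \<le> (\<integral>x. \<bar>f x\<bar> \<partial>M)"
    using integral_norm_bound[of M f] by simp
  also have "\<dots> \<le> (\<integral>x. g x \<partial>M)"
    using le by (intro integral_mono'[OF g]) (auto intro: order.trans[OF abs_ge_zero])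
  finally show ?thesis .
qed

text \<open>The difference of \<open>X\<close> and a base point \<open>z\<close> on the boundary.
  The height stays that of \<open>X\<close>, and the value of \<open>z\<close> at \<open>n\<close>,
  which carries no information, is not read.\<close>

definition sh :: "nat \<Rightarrow> point \<Rightarrow> point \<Rightarrow> nat \<Rightarrow> real" where
  "sh n X z = (\<lambda>i. if i < n then X i - z i else X i)"

lemma sh_n[simp]: "sh n X z n = X n" by (simp add: sh_def)

lemma sh_fun_upd: "sh n (X(j := s)) z = (sh n X z)(j := s - (if j < n then z j else 0))"
  by (auto simp: sh_def)

lemma ssq_split: "ssq n X = (X n)\<^sup>2 + (\<Sum>i<n. (X i)\<^sup>2)"
  by (simp add: ssq_def lessThan_Suc_atMost[symmetric])

lemma ssq_sh_swap: "ssq n (sh n (y(n := t)) z) = ssq n (sh n (z(n := t)) y)"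
  by (simp add: ssq_split) (simp add: sh_def power2_commute)

lemma pk_sh_swap: "pk n (sh n (y(n := t)) z) = pk n (sh n (z(n := t)) y)"
  by (simp add: pk_def ssq_sh_swap)

lemma measurable_ssq[measurable (raw)]:
  "(\<And>i. i \<le> n \<Longrightarrow> (\<lambda>x. G x i) \<in> borel_measurable M) \<Longrightarrow> (\<lambda>x. ssq n (G x)) \<in> borel_measurable M"
  unfolding ssq_def by (intro borel_measurable_sum borel_measurable_power) auto

lemma measurable_pk[measurable (raw)]:
  assumes [measurable]: "\<And>i. i \<le> n \<Longrightarrow> (\<lambda>x. G x i) \<in> borel_measurable M"
  shows "(\<lambda>x. pk n (G x)) \<in> borel_measurable M"
  unfolding pk_def using assms measurable_ssq[of n G M] by auto

lemma measurable_pk1: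
  assumes [measurable]: "\<And>i. i \<le> n \<Longrightarrow> (\<lambda>x. G x i) \<in> borel_measurable M" and [simp]: "i \<le> n"
  shows "(\<lambda>x. pk1 n i (G x)) \<in> borel_measurable M"
  unfolding pk1_def using assms measurable_ssq[of n G M] by auto

lemma measurable_pk2:
  assumes [measurable]: "\<And>i. i \<le> n \<Longrightarrow> (\<lambda>x. G x i) \<in> borel_measurable M" and [simp]: "i \<le> n" "j \<le> n"
  shows "(\<lambda>x. pk2 n i j (G x)) \<in> borel_measurable M"
  unfolding pk2_def using assms measurable_ssq[of n G M] by auto

lemma measurable_sh_component:
  assumes "\<And>i. i \<le> n \<Longrightarrow> (\<lambda>x. G x i) \<in> borel_measurable M" "H \<in> M \<rightarrow>\<^sub>M Rn n" "i \<le> n"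
  shows "(\<lambda>x. sh n (G x) (H x) i) \<in> borel_measurable M"
  using assms measurable_Rn_component[OF assms(2)] unfolding sh_def by (cases "i < n") auto

lemma measurable_half_space_component:
  assumes "Y \<in> M \<rightarrow>\<^sub>M Rn n" "T \<in> borel_measurable M" "i \<le> n"
  shows "(\<lambda>x. ((Y x)(n := T x)) i) \<in> borel_measurable M"
  using assms measurable_Rn_component[OF assms(1)] by (cases "i = n") auto

definition bq :: "nat \<Rightarrow> real \<Rightarrow> real" where
  "bq n q = pi powr (real n / 2) * Gamma ((q - real n) / 2) / Gamma (q / 2)"

lemma bq_pos: "q > real n \<Longrightarrow> bq n q > 0"
  by (auto simp: bq_def intro!: mult_pos_pos divide_pos_pos Gamma_real_pos)

lemma nn_integral_ssq_powr:
  assumes "q > real n" "X n > 0"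
  shows "(\<integral>\<^sup>+z. ennreal (ssq n (sh n X z) powr (- q / 2)) \<partial>Rn n) = ennreal (bq n q * X n powr (real n - q))"
proof -
  define h where "h z = ennreal (((X n)\<^sup>2 + (\<Sum>i<n. (z i)\<^sup>2)) powr (- q / 2))" for z
  have [measurable]: "h \<in> borel_measurable (Rn n)" unfolding h_def by measurable
  have "(\<integral>\<^sup>+z. ennreal (ssq n (sh n X z) powr (- q / 2)) \<partial>Rn n) = (\<integral>\<^sup>+z. h (affine_map n X (-1) z) \<partial>Rn n)"
    by (intro nn_integral_cong) (simp add: h_def ssq_split, simp add: affine_map_def sh_def)
  also have "\<dots> = (\<integral>\<^sup>+z. h z \<partial>Rn n)" by (rule nn_integral_affine_map) auto
  finally show ?thesis
    unfolding h_def using nn_integral_bracket_Rn[OF assms] by (simp add: bq_def)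
qed

text \<open>The constant \<open>pc n\<close> is the reciprocal of the bracket integral with exponent
  \<open>n + 1\<close>: the Gamma factors cancel up to the value of Gamma at 1/2, the square root of
  \<open>pi\<close>.\<close>

lemma nn_integral_pk:
  assumes "X n > 0"
  shows "(\<integral>\<^sup>+z. ennreal (pk n (sh n X z)) \<partial>Rn n) = 1"
proof -
  have "(\<integral>\<^sup>+z. ennreal (pk n (sh n X z)) \<partial>Rn n) = (\<integral>\<^sup>+z. ennreal (pc n * X n) * ennreal (ssq n (sh n X z) powr (- (real n + 1) / 2)) \<partial>Rn n)"
    using assms pc_pos[of n]
    by (intro nn_integral_cong) (simp add: pk_def ennreal_mult'[symmetric] pm_def minus_divide_left)
  also have "\<dots> = ennreal (pc n * X n) * ennreal (bq n (real n + 1) * X n powr (real n - (real n + 1)))"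
    using assms nn_integral_ssq_powr[of n "real n + 1" X]
    by (subst nn_integral_cmult)
      (auto simp del: powr_minus_divide intro!: measurable_ennreal powr_real_measurable measurable_ssq measurable_sh_component)
  also have "\<dots> = ennreal (pc n * X n * (bq n (real n + 1) * X n powr (-1)))"
    using assms pc_pos[of n] by (subst ennreal_mult'[symmetric]) auto
  also have "pc n * X n * (bq n (real n + 1) * X n powr (-1)) = pc n * bq n (real n + 1)"
    using assms by (simp add: powr_minus_divide)
  also have "\<dots> = pi powr (- pm n + real n / 2) * sqrt pi"
    using Gamma_real_pos[of "(real n + 1) / 2", THEN less_imp_neq, THEN not_sym]
    unfolding pc_def bq_def powr_add powr_minus_divide by (simp add: pm_def Gamma_one_half_real)
  also have "\<dots> = 1"
    unfolding powr_half_sqrt[OF pi_ge_zero, symmetric] powr_add[symmetric] by (simp add: pm_def add_divide_distrib)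
  finally show ?thesis by simp
qed

lemma measurable_pk_sh[measurable]: "(\<lambda>z. pk n (sh n X z)) \<in> borel_measurable (Rn n)"
  by (intro measurable_pk measurable_sh_component) auto

lemma measurable_pk1_sh: "i \<le> n \<Longrightarrow> (\<lambda>z. pk1 n i (sh n X z)) \<in> borel_measurable (Rn n)"
  by (intro measurable_pk1 measurable_sh_component) auto

lemma measurable_pk2_sh: "i \<le> n \<Longrightarrow> j \<le> n \<Longrightarrow> (\<lambda>z. pk2 n i j (sh n X z)) \<in> borel_measurable (Rn n)"
  by (intro measurable_pk2 measurable_sh_component) auto

lemma integrable_pk: "X n > 0 \<Longrightarrow> integrable (Rn n) (\<lambda>z. pk n (sh n X z))"
  using nn_integral_pk[of X n] by (intro integrableI_nonneg) (auto simp: pk_nonneg)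

lemma integral_pk: "X n > 0 \<Longrightarrow> (\<integral>z. pk n (sh n X z) \<partial>Rn n) = 1"
  using nn_integral_pk[of X n] by (subst integral_eq_nn_integral) (auto simp: pk_nonneg)

lemma nn_integral_pk_swap:
  assumes "t > 0"
  shows "(\<integral>\<^sup>+y. ennreal (pk n (sh n (y(n := t)) z)) \<partial>Rn n) = 1"
  unfolding pk_sh_swap[of n _ t z] by (rule nn_integral_pk) (use assms in simp)

text \<open>Green's formula is applied to extensions of integrable functions and also to the Poisson
  kernel of a fixed point, so it is proved from properties shared by both: pure derivatives up to
  order two with the Laplace equation, and one majorant \<open>a\<close> that bounds each derivative
  at the price of a power of the height, decays like the height to the power \<open>-n\<close>, and
  has uniformly bounded integrals over horizontal slices. Mixed derivatives do not occur.\<close>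

locale nice_harmonic =
  fixes n :: nat and u :: "point \<Rightarrow> real" and u1 u2 :: "nat \<Rightarrow> point \<Rightarrow> real"
    and a :: "point \<Rightarrow> real" and A :: real
  assumes n: "n \<ge> 1"
    and D1: "\<And>j X. j \<le> n \<Longrightarrow> X n > 0 \<Longrightarrow> ((\<lambda>s. u (X(j := s))) has_real_derivative u1 j X) (at (X j))"
    and D2: "\<And>j X. j \<le> n \<Longrightarrow> X n > 0 \<Longrightarrow> ((\<lambda>s. u1 j (X(j := s))) has_real_derivative u2 j X) (at (X j))"
    and laplace: "\<And>X. X n > 0 \<Longrightarrow> (\<Sum>j\<le>n. u2 j X) = 0"
    and meas0: "(\<lambda>p. u ((fst p)(n := snd p))) \<in> borel_measurable (Rnt n)"
    and meas1: "\<And>j. j \<le> n \<Longrightarrow> (\<lambda>p. u1 j ((fst p)(n := snd p))) \<in> borel_measurable (Rnt n)"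
    and meas2: "\<And>j. j \<le> n \<Longrightarrow> (\<lambda>p. u2 j ((fst p)(n := snd p))) \<in> borel_measurable (Rnt n)"
    and measa: "(\<lambda>p. a ((fst p)(n := snd p))) \<in> borel_measurable (Rnt n)"
    and bound0: "\<And>X. X n > 0 \<Longrightarrow> \<bar>u X\<bar> \<le> a X"
    and bound1: "\<And>j X. j \<le> n \<Longrightarrow> X n > 0 \<Longrightarrow> \<bar>u1 j X\<bar> \<le> a X / X n"
    and bound2: "\<And>j X. j \<le> n \<Longrightarrow> X n > 0 \<Longrightarrow> \<bar>u2 j X\<bar> \<le> a X / (X n)\<^sup>2"
    and a_le: "\<And>X. X n > 0 \<Longrightarrow> a X \<le> A / X n ^ n"
    and a_int: "\<And>t. t > 0 \<Longrightarrow> (\<integral>\<^sup>+y. ennreal (a (y(n := t))) \<partial>Rn n) \<le> ennreal A"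

definition U :: "nat \<Rightarrow> (point \<Rightarrow> real) \<Rightarrow> point \<Rightarrow> real" where
  "U n f X = (\<integral>z. pk n (sh n X z) * f z \<partial>Rn n)"

definition U1 :: "nat \<Rightarrow> (point \<Rightarrow> real) \<Rightarrow> nat \<Rightarrow> point \<Rightarrow> real" where
  "U1 n f i X = (\<integral>z. pk1 n i (sh n X z) * f z \<partial>Rn n)"

definition U2 :: "nat \<Rightarrow> (point \<Rightarrow> real) \<Rightarrow> nat \<Rightarrow> point \<Rightarrow> real" where
  "U2 n f i X = (\<integral>z. pk2 n i i (sh n X z) * f z \<partial>Rn n)"

lemma integrable_bounded_mult:
  fixes g f :: "'a \<Rightarrow> real"
  assumes "integrable M f" "g \<in> borel_measurable M" "\<And>z. z \<in> space M \<Longrightarrow> \<bar>g z\<bar> \<le> B"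
  shows "integrable M (\<lambda>z. g z * f z)"
proof (rule Bochner_Integration.integrable_bound)
  show "integrable M (\<lambda>z. B * f z)" using assms by simp
  have "\<bar>g z\<bar> * \<bar>f z\<bar> \<le> \<bar>B\<bar> * \<bar>f z\<bar>" if "z \<in> space M" for z
    using assms(3)[OF that] by (intro mult_right_mono) auto
  then show "AE z in M. norm (g z * f z) \<le> norm (B * f z)" by (intro AE_I2) (simp add: abs_mult)
qed (use assms in auto)

lemma abs_pk_le: "X n > 0 \<Longrightarrow> \<bar>pk n X\<bar> \<le> pc n / X n ^ n"
  using pk_le[of X n] pk_nonneg[of X n] by simp

lemma abs_pk1_le_height:
  assumes "i \<le> n" "X n > 0" shows "\<bar>pk1 n i X\<bar> \<le> pC n * pc n / X n ^ Suc n"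
proof -
  have "pC n * pk n X / X n \<le> pC n * (pc n / X n ^ n) / X n"
    using assms pk_le[of X n] pC_ge_1[of n] by (intro divide_right_mono mult_left_mono) auto
  then show ?thesis using abs_pk1_le_pk[of i n X] assms by (simp add: mult_ac)
qed

lemma abs_pk2_le_height:
  assumes "i \<le> n" "j \<le> n" "X n > 0" shows "\<bar>pk2 n i j X\<bar> \<le> pC n * pc n / X n ^ Suc (Suc n)"
proof -
  have "pC n * pk n X / (X n)\<^sup>2 \<le> pC n * (pc n / X n ^ n) / (X n)\<^sup>2"
    using assms pk_le[of X n] pC_ge_1[of n] by (intro divide_right_mono mult_left_mono) auto
  then show ?thesis using abs_pk2_le_pk[of i n j X] assms by (simp add: mult_ac power2_eq_square)
qed

lemma integrable_pk_mult:
  assumes "integrable (Rn n) f" "X n > 0"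
  shows "integrable (Rn n) (\<lambda>z. pk n (sh n X z) * f z)"
  using assms abs_pk_le[of "sh n X _" n] by (intro integrable_bounded_mult[where B="pc n / X n ^ n"]) auto

lemma integrable_pk1_mult:
  assumes "integrable (Rn n) f" "X n > 0" "i \<le> n"
  shows "integrable (Rn n) (\<lambda>z. pk1 n i (sh n X z) * f z)"
  using assms abs_pk1_le_height[of i n "sh n X _"]
  by (intro integrable_bounded_mult[where B="pC n * pc n / X n ^ Suc n"] measurable_pk1_sh) auto

lemma integrable_pk2_mult:
  assumes "integrable (Rn n) f" "X n > 0" "i \<le> n" "j \<le> n"
  shows "integrable (Rn n) (\<lambda>z. pk2 n i j (sh n X z) * f z)"
  using assms abs_pk2_le_height[of i n j "sh n X _"]
  by (intro integrable_bounded_mult[where B="pC n * pc n / X n ^ Suc (Suc n)"] measurable_pk2_sh) auto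

text \<open>A generic kernel \<open>k\<close> serves both the step from \<open>pk\<close> to
  \<open>pk1\<close> and that from \<open>pk1\<close> to \<open>pk2\<close>. Within half a height of
  the point the height stays at least \<open>X n / 2\<close>, which yields an integrable majorant: a
  constant times the absolute value of \<open>f\<close>.\<close>

lemma has_real_derivative_sh:
  assumes k: "\<And>X s. ssq n (X(j := s)) > 0 \<Longrightarrow> ((\<lambda>s. k (X(j := s))) has_real_derivative k1 (X(j := s))) (at s)"
    and f: "integrable (Rn n) f" and X: "X n > 0" and j: "j \<le> n"
    and ik: "\<And>X. X n > 0 \<Longrightarrow> integrable (Rn n) (\<lambda>z. k (sh n X z) * f z)"
    and ik1: "\<And>X. X n > 0 \<Longrightarrow> integrable (Rn n) (\<lambda>z. k1 (sh n X z) * f z)"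
    and b: "\<And>X. X n > 0 \<Longrightarrow> \<bar>k1 X\<bar> \<le> C / X n ^ m"
  shows "((\<lambda>s. \<integral>z. k (sh n (X(j := s)) z) * f z \<partial>Rn n) has_real_derivative (\<integral>z. k1 (sh n X z) * f z \<partial>Rn n)) (at (X j))"
proof -
  have pos: "(X(j := s)) n \<ge> X n / 2" if "\<bar>s - X j\<bar> < X n / 2" for s
    using that X by (cases "j = n") (auto simp: abs_if split: if_splits)
  have C: "C \<ge> 0"
  proof -
    have "0 \<le> C / X n ^ m" using b[of X] X by linarith
    then show ?thesis using zero_less_power[OF X, of m] by (simp only: zero_le_divide_iff) linarith
  qed
  have "((\<lambda>s. \<integral>z. k (sh n (X(j := s)) z) * f z \<partial>Rn n) has_real_derivative (\<integral>z. k1 (sh n (X(j := X j)) z) * f z \<partial>Rn n)) (at (X j))"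
  proof (rule has_real_derivative_integral[where \<delta>="X n / 2" and B="\<lambda>z. C / (X n / 2) ^ m * \<bar>f z\<bar>"
        and g'="\<lambda>s z. k1 (sh n (X(j := s)) z) * f z"])
    show "X n / 2 > 0" using X by simp
    fix s assume s: "\<bar>s - X j\<bar> < X n / 2"
    have p: "(X(j := s)) n > 0" using pos[OF s] X by linarith
    show "integrable (Rn n) (\<lambda>z. k (sh n (X(j := s)) z) * f z)" by (rule ik) fact
    fix z
    have "sh n (X(j := s)) z n \<noteq> 0" using p unfolding sh_n by simp
    then have "ssq n (sh n (X(j := s)) z) > 0" by (rule ssq_pos)
    then have "((\<lambda>s. k ((sh n X z)(j := s))) has_real_derivative k1 (sh n (X(j := s)) z)) (at (s + (- (if j < n then z j else 0))))"
      unfolding sh_fun_upd by (intro DERIV_cong[OF k]) auto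
    then have "((\<lambda>s. k ((sh n X z)(j := s + (- (if j < n then z j else 0))))) has_real_derivative k1 (sh n (X(j := s)) z)) (at s)"
      by (rule DERIV_shift[THEN iffD1])
    then have "((\<lambda>s. k (sh n (X(j := s)) z)) has_real_derivative k1 (sh n (X(j := s)) z)) (at s)"
      unfolding sh_fun_upd by simp
    then show "((\<lambda>s. k (sh n (X(j := s)) z) * f z) has_real_derivative k1 (sh n (X(j := s)) z) * f z) (at s)"
      by (rule DERIV_cmult_right)
    have "\<bar>k1 (sh n (X(j := s)) z)\<bar> \<le> C / (X(j := s)) n ^ m"
      using b[of "sh n (X(j := s)) z"] p by (simp only: sh_n)
    also have "\<dots> \<le> C / (X n / 2) ^ m"
      using pos[OF s] X C p by (intro divide_left_mono power_mono mult_pos_pos zero_less_power) auto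
    finally show "\<bar>k1 (sh n (X(j := s)) z) * f z\<bar> \<le> C / (X n / 2) ^ m * \<bar>f z\<bar>"
      unfolding abs_mult by (rule mult_right_mono) simp
  next
    show "integrable (Rn n) (\<lambda>z. C / (X n / 2) ^ m * \<bar>f z\<bar>)" using f by simp
    show "(\<lambda>z. k1 (sh n (X(j := X j)) z) * f z) \<in> borel_measurable (Rn n)"
      using ik1[of X] X by simp
  qed
  then show ?thesis by simp
qed

lemma measurable_half_space_integral:
  fixes k f :: "point \<Rightarrow> real"
  assumes "\<And>G :: (point \<times> real) \<times> point \<Rightarrow> nat \<Rightarrow> real.
      (\<And>i. i \<le> n \<Longrightarrow> (\<lambda>x. G x i) \<in> borel_measurable ((Rnt n) \<Otimes>\<^sub>M Rn n)) \<Longrightarrow>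
      (\<lambda>x. k (G x)) \<in> borel_measurable ((Rnt n) \<Otimes>\<^sub>M Rn n)"
    and f: "f \<in> borel_measurable (Rn n)"
  shows "(\<lambda>p. \<integral>z. k (sh n ((fst p)(n := snd p)) z) * f z \<partial>Rn n) \<in> borel_measurable (Rnt n)"
proof (rule Rn.borel_measurable_lebesgue_integral)
  have "(\<lambda>x. k (sh n ((fst (fst x))(n := snd (fst x))) (snd x)) * f (snd x)) \<in> borel_measurable ((Rnt n) \<Otimes>\<^sub>M Rn n)"
    using f by (intro borel_measurable_times assms(1) measurable_sh_component measurable_half_space_component) auto
  then show "(\<lambda>(p, z). k (sh n ((fst p)(n := snd p)) z) * f z) \<in> borel_measurable ((Rnt n) \<Otimes>\<^sub>M Rn n)"
    by (simp add: split_beta')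
qed

text \<open>Every kernel is at most a factor depending on the height times \<open>pk\<close>, which
  gives the first three bounds; the fourth uses the maximum of the kernel at a given height; the
  last is Tonelli's theorem, since by symmetry the kernel has mass one in its other variable
  too.\<close>

lemma U_abs_bounds:
  assumes f: "integrable (Rn n) f"
  shows "X n > 0 \<Longrightarrow> \<bar>U n f X\<bar> \<le> U n (\<lambda>z. \<bar>f z\<bar>) X"
    and "X n > 0 \<Longrightarrow> j \<le> n \<Longrightarrow> \<bar>U1 n f j X\<bar> \<le> pC n * U n (\<lambda>z. \<bar>f z\<bar>) X / X n"
    and "X n > 0 \<Longrightarrow> j \<le> n \<Longrightarrow> \<bar>U2 n f j X\<bar> \<le> pC n * U n (\<lambda>z. \<bar>f z\<bar>) X / (X n)\<^sup>2"
    and "X n > 0 \<Longrightarrow> U n (\<lambda>z. \<bar>f z\<bar>) X \<le> pc n * (\<integral>z. \<bar>f z\<bar> \<partial>Rn n) / X n ^ n"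
    and "t > 0 \<Longrightarrow> (\<integral>\<^sup>+y. ennreal (U n (\<lambda>z. \<bar>f z\<bar>) (y(n := t))) \<partial>Rn n) = ennreal (\<integral>z. \<bar>f z\<bar> \<partial>Rn n)"
proof -
  have [measurable]: "f \<in> borel_measurable (Rn n)" using f by auto
  have fa: "integrable (Rn n) (\<lambda>z. \<bar>f z\<bar>)" using f by simp
  have gen: "\<bar>\<integral>z. k (sh n X z) * f z \<partial>Rn n\<bar> \<le> C * U n (\<lambda>z. \<bar>f z\<bar>) X"
    if X: "X n > 0" and b: "\<And>Y. Y n = X n \<Longrightarrow> \<bar>k Y\<bar> \<le> C * pk n Y" for k C X
  proof -
    have "\<bar>\<integral>z. k (sh n X z) * f z \<partial>Rn n\<bar> \<le> (\<integral>z. C * (pk n (sh n X z) * \<bar>f z\<bar>) \<partial>Rn n)"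
    proof (rule abs_integral_le)
      show "integrable (Rn n) (\<lambda>z. C * (pk n (sh n X z) * \<bar>f z\<bar>))"
        using integrable_pk_mult[OF fa, of X] X by simp
      show "\<bar>k (sh n X z) * f z\<bar> \<le> C * (pk n (sh n X z) * \<bar>f z\<bar>)" for z
        using mult_right_mono[OF b[of "sh n X z"] abs_ge_zero[of "f z"]] by (simp add: abs_mult mult.assoc)
    qed
    then show ?thesis by (simp add: U_def)
  qed
  show "\<bar>U n f X\<bar> \<le> U n (\<lambda>z. \<bar>f z\<bar>) X" if "X n > 0"
    using gen[of X "pk n" 1] that by (simp add: U_def pk_nonneg)
  show "\<bar>U1 n f j X\<bar> \<le> pC n * U n (\<lambda>z. \<bar>f z\<bar>) X / X n" if "X n > 0" "j \<le> n"
  proof -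
    have "\<bar>pk1 n j Y\<bar> \<le> pC n / X n * pk n Y" if "Y n = X n" for Y
      using abs_pk1_le_pk[of j n Y] that \<open>X n > 0\<close> \<open>j \<le> n\<close> by simp
    from gen[of X, OF _ this] that show ?thesis by (simp add: U1_def)
  qed
  show "\<bar>U2 n f j X\<bar> \<le> pC n * U n (\<lambda>z. \<bar>f z\<bar>) X / (X n)\<^sup>2" if "X n > 0" "j \<le> n"
  proof -
    have "\<bar>pk2 n j j Y\<bar> \<le> pC n / (X n)\<^sup>2 * pk n Y" if "Y n = X n" for Y
      using abs_pk2_le_pk[of j n j Y] that \<open>X n > 0\<close> \<open>j \<le> n\<close> by simp
    from gen[of X, OF _ this] that show ?thesis by (simp add: U2_def)
  qed
  show "U n (\<lambda>z. \<bar>f z\<bar>) X \<le> pc n * (\<integral>z. \<bar>f z\<bar> \<partial>Rn n) / X n ^ n" if "X n > 0"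
  proof -
    have "U n (\<lambda>z. \<bar>f z\<bar>) X \<le> (\<integral>z. pc n / X n ^ n * \<bar>f z\<bar> \<partial>Rn n)"
      unfolding U_def using that fa pk_le[of "sh n X _" n]
      by (intro integral_mono integrable_pk_mult mult_right_mono) auto
    then show ?thesis by simp
  qed
  show "(\<integral>\<^sup>+y. ennreal (U n (\<lambda>z. \<bar>f z\<bar>) (y(n := t))) \<partial>Rn n) = ennreal (\<integral>z. \<bar>f z\<bar> \<partial>Rn n)" if t: "t > 0"
  proof -
    have "(\<integral>\<^sup>+y. ennreal (U n (\<lambda>z. \<bar>f z\<bar>) (y(n := t))) \<partial>Rn n) = (\<integral>\<^sup>+y. (\<integral>\<^sup>+z. ennreal (pk n (sh n (y(n := t)) z) * \<bar>f z\<bar>) \<partial>Rn n) \<partial>Rn n)"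
      unfolding U_def
      by (intro nn_integral_cong nn_integral_eq_integral[symmetric] integrable_pk_mult[OF fa] AE_I2 mult_nonneg_nonneg pk_nonneg)
        (use t in auto)
    also have "\<dots> = (\<integral>\<^sup>+z. (\<integral>\<^sup>+y. ennreal (pk n (sh n (y(n := t)) z) * \<bar>f z\<bar>) \<partial>Rn n) \<partial>Rn n)"
    proof (rule Rn_Rn.Fubini'[symmetric])
      have "(\<lambda>x. pk n (sh n ((fst x)(n := t)) (snd x)) * \<bar>f (snd x)\<bar>) \<in> borel_measurable (Rn n \<Otimes>\<^sub>M Rn n)"
        by (intro borel_measurable_times measurable_pk measurable_sh_component measurable_half_space_component) auto
      from measurable_compose[OF this measurable_ennreal]
      show "(\<lambda>(y, z). ennreal (pk n (sh n (y(n := t)) z) * \<bar>f z\<bar>)) \<in> borel_measurable (Rn n \<Otimes>\<^sub>M Rn n)"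
        by (simp add: split_beta')
    qed
    also have "\<dots> = (\<integral>\<^sup>+z. ennreal \<bar>f z\<bar> * (\<integral>\<^sup>+y. ennreal (pk n (sh n (y(n := t)) z)) \<partial>Rn n) \<partial>Rn n)"
    proof (intro nn_integral_cong)
      fix z
      show "(\<integral>\<^sup>+y. ennreal (pk n (sh n (y(n := t)) z) * \<bar>f z\<bar>) \<partial>Rn n) = ennreal \<bar>f z\<bar> * (\<integral>\<^sup>+y. ennreal (pk n (sh n (y(n := t)) z)) \<partial>Rn n)"
        unfolding pk_sh_swap[of n _ t z]
        by (subst nn_integral_cmult[symmetric]) (auto simp: ennreal_mult' mult.commute)
    qed
    also have "\<dots> = (\<integral>\<^sup>+z. ennreal \<bar>f z\<bar> \<partial>Rn n)" using t by (simp add: nn_integral_pk_swap)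
    also have "\<dots> = ennreal (\<integral>z. \<bar>f z\<bar> \<partial>Rn n)" using fa by (intro nn_integral_eq_integral) auto
    finally show ?thesis .
  qed
qed

lemma nice_harmonic_U:
  assumes "n \<ge> 1" and f: "integrable (Rn n) f"
  shows "nice_harmonic n (U n f) (U1 n f) (U2 n f) (\<lambda>X. pC n * U n (\<lambda>z. \<bar>f z\<bar>) X) (pC n * (1 + pc n) * (\<integral>z. \<bar>f z\<bar> \<partial>Rn n))"
proof
  have [measurable]: "f \<in> borel_measurable (Rn n)" using f by auto
  define I where "I = (\<integral>z. \<bar>f z\<bar> \<partial>Rn n)"
  have I: "I \<ge> 0" by (simp add: I_def)
  note B = U_abs_bounds[OF f, folded I_def]
  show "n \<ge> 1" by fact
  show "((\<lambda>s. U n f (X(j := s))) has_real_derivative U1 n f j X) (at (X j))" if "j \<le> n" "X n > 0" for j X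
    unfolding U_def U1_def
    by (rule has_real_derivative_sh[where m="Suc n" and C="pC n * pc n" and f=f and X=X and j=j and k="pk n" and ?k1.0="pk1 n j"])
      (use that f in \<open>auto intro: DERIV_pk integrable_pk_mult integrable_pk1_mult abs_pk1_le_height simp del: power_Suc fun_upd_apply\<close>)
  show "((\<lambda>s. U1 n f j (X(j := s))) has_real_derivative U2 n f j X) (at (X j))" if "j \<le> n" "X n > 0" for j X
    unfolding U1_def U2_def
    by (rule has_real_derivative_sh[where m="Suc (Suc n)" and C="pC n * pc n" and f=f and X=X and j=j and k="pk1 n j" and ?k1.0="pk2 n j j"])
      (use that f in \<open>auto intro: DERIV_pk1 integrable_pk1_mult integrable_pk2_mult abs_pk2_le_height simp del: power_Suc fun_upd_apply\<close>)
  show "(\<Sum>j\<le>n. U2 n f j X) = 0" if "X n > 0" for X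
  proof -
    have "(\<Sum>j\<le>n. U2 n f j X) = (\<integral>z. (\<Sum>j\<le>n. pk2 n j j (sh n X z) * f z) \<partial>Rn n)"
      unfolding U2_def using that f by (subst Bochner_Integration.integral_sum) (auto intro: integrable_pk2_mult)
    also have "\<dots> = (\<integral>z. 0 \<partial>Rn n)"
      using that pk2_laplace[of n "sh n X _"] ssq_pos[of "sh n X _" n]
      by (intro Bochner_Integration.integral_cong) (auto simp: sum_distrib_right[symmetric])
    finally show ?thesis by simp
  qed
  show "(\<lambda>p. U n f ((fst p)(n := snd p))) \<in> borel_measurable (Rnt n)"
    unfolding U_def by (intro measurable_half_space_integral measurable_pk) auto
  show "(\<lambda>p. U1 n f j ((fst p)(n := snd p))) \<in> borel_measurable (Rnt n)" if "j \<le> n" for j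
    unfolding U1_def using that by (intro measurable_half_space_integral measurable_pk1) auto
  show "(\<lambda>p. U2 n f j ((fst p)(n := snd p))) \<in> borel_measurable (Rnt n)" if "j \<le> n" for j
    unfolding U2_def using that by (intro measurable_half_space_integral measurable_pk2) auto
  show "(\<lambda>p. pC n * U n (\<lambda>z. \<bar>f z\<bar>) ((fst p)(n := snd p))) \<in> borel_measurable (Rnt n)"
    unfolding U_def by (intro borel_measurable_times measurable_half_space_integral measurable_pk) auto
  fix X :: "nat \<Rightarrow> real" assume X: "X n > 0"
  have Ua: "0 \<le> U n (\<lambda>z. \<bar>f z\<bar>) X" using B(1)[of X] X by linarith
  show "\<bar>U n f X\<bar> \<le> pC n * U n (\<lambda>z. \<bar>f z\<bar>) X"
    using B(1)[of X] X mult_right_mono[OF pC_ge_1[of n] Ua] by simp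
  show "\<bar>U1 n f j X\<bar> \<le> pC n * U n (\<lambda>z. \<bar>f z\<bar>) X / X n" if "j \<le> n" for j using B(2)[of X j] X that by simp
  show "\<bar>U2 n f j X\<bar> \<le> pC n * U n (\<lambda>z. \<bar>f z\<bar>) X / (X n)\<^sup>2" if "j \<le> n" for j using B(3)[of X j] X that by simp
  have "pC n * U n (\<lambda>z. \<bar>f z\<bar>) X \<le> pC n * (pc n * I / X n ^ n)"
    using B(4)[of X] X pC_ge_1[of n] by (intro mult_left_mono) auto
  also have "\<dots> \<le> pC n * ((1 + pc n) * I / X n ^ n)"
    using pC_ge_1[of n] pc_pos[of n] I X by (intro mult_left_mono divide_right_mono mult_right_mono) auto
  finally show "pC n * U n (\<lambda>z. \<bar>f z\<bar>) X \<le> pC n * (1 + pc n) * (\<integral>z. \<bar>f z\<bar> \<partial>Rn n) / X n ^ n"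
    by (simp add: I_def mult.assoc)
next
  define I where "I = (\<integral>z. \<bar>f z\<bar> \<partial>Rn n)"
  have I: "I \<ge> 0" by (simp add: I_def)
  fix t :: real assume t: "t > 0"
  have m: "(\<lambda>y. U n (\<lambda>z. \<bar>f z\<bar>) (y(n := t))) \<in> borel_measurable (Rn n)"
  proof -
    have "(\<lambda>p. U n (\<lambda>z. \<bar>f z\<bar>) ((fst p)(n := snd p))) \<in> borel_measurable (Rnt n)"
      unfolding U_def using f by (intro measurable_half_space_integral measurable_pk) auto
    from measurable_compose[OF measurable_Pair[OF measurable_ident measurable_const, of t "lborel" ] this]
    show ?thesis by (simp add: id_def)
  qed
  have "(\<integral>\<^sup>+y. ennreal (pC n * U n (\<lambda>z. \<bar>f z\<bar>) (y(n := t))) \<partial>Rn n) = ennreal (pC n) * ennreal I"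
    unfolding I_def U_abs_bounds(5)[OF f t, symmetric] using pC_ge_1[of n] m
    by (subst nn_integral_cmult[symmetric]) (auto simp: ennreal_mult')
  also have "\<dots> \<le> ennreal (pC n * (1 + pc n) * I)"
    using pC_ge_1[of n] pc_pos[of n] I by (subst ennreal_mult'[symmetric]) (auto intro!: ennreal_leI simp: algebra_simps)
  finally show "(\<integral>\<^sup>+y. ennreal (pC n * U n (\<lambda>z. \<bar>f z\<bar>) (y(n := t))) \<partial>Rn n)
      \<le> ennreal (pC n * (1 + pc n) * (\<integral>z. \<bar>f z\<bar> \<partial>Rn n))" by (simp add: I_def)
qed

section \<open>Green's formula on horizontal slices\<close>

lemma measurable_slice:
  assumes "(\<lambda>p. g ((fst p)(n := snd p))) \<in> borel_measurable (Rnt n)"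
  shows "(\<lambda>y. g (y(n := t))) \<in> borel_measurable (Rn n)"
    and "y \<in> space (Rn n) \<Longrightarrow> (\<lambda>r. g (y(n := r))) \<in> borel_measurable lborel"
proof -
  have "(\<lambda>y. (y, t)) \<in> Rn n \<rightarrow>\<^sub>M Rnt n" by simp
  from measurable_compose[OF this assms] show "(\<lambda>y. g (y(n := t))) \<in> borel_measurable (Rn n)" by simp
  assume "y \<in> space (Rn n)"
  then have "(\<lambda>r. (y, r)) \<in> lborel \<rightarrow>\<^sub>M Rnt n" by simp
  from measurable_compose[OF this assms] show "(\<lambda>r. g (y(n := r))) \<in> borel_measurable lborel" by simp
qed

text \<open>No decay at infinity is assumed. The increment of \<open>F\<close> under a unit
  translation in direction \<open>i\<close> has integral zero by translation invariance; it is also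
  the integral of the translates of \<open>F1\<close> over parameters between 0 and 1, so Fubini's
  theorem turns its integral into that of \<open>F1\<close>.\<close>

lemma integral_partial_derivative_eq_0:
  fixes F F1 :: "point \<Rightarrow> real"
  assumes i: "i < n"
    and D: "\<And>y s. y \<in> space (Rn n) \<Longrightarrow> ((\<lambda>s. F (y(i := s))) has_real_derivative F1 (y(i := s))) (at s)"
    and F: "integrable (Rn n) F" and F1: "integrable (Rn n) F1"
    and B: "\<And>y. y \<in> space (Rn n) \<Longrightarrow> \<bar>F1 y\<bar> \<le> B"
  shows "(\<integral>y. F1 y \<partial>Rn n) = 0"
proof -
  have [measurable]: "F \<in> borel_measurable (Rn n)" "F1 \<in> borel_measurable (Rn n)" using F F1 by auto
  define \<tau> where "\<tau> \<sigma> y = affine_map n (\<lambda>j. if j = i then \<sigma> else 0) 1 y" for \<sigma> y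
  have \<tau>: "\<tau> \<sigma> y = y(i := y i + \<sigma>)" if "y \<in> space (Rn n)" for \<sigma> y
    using that i by (auto simp: \<tau>_def affine_map_def space_Rn PiE_def extensional_def fun_eq_iff)
  have m: "(\<lambda>p. F1 (\<tau> (snd p) (fst p))) \<in> borel_measurable (Rnt n)"
  proof (rule measurable_compose[of _ _ "Rn n" F1])
    show "(\<lambda>p. \<tau> (snd p) (fst p)) \<in> Rnt n \<rightarrow>\<^sub>M Rn n"
      unfolding \<tau>_def affine_map_def by (rule measurable_into_Rn) auto
  qed simp
  have slice: "(\<lambda>\<sigma>. F1 (\<tau> \<sigma> y)) \<in> borel_measurable lborel" if "y \<in> space (Rn n)" for y
  proof -
    have "(\<lambda>r. (y, r)) \<in> lborel \<rightarrow>\<^sub>M Rnt n" using that by simp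
    from measurable_compose[OF this m] show ?thesis by simp
  qed
  have ftc: "F (\<tau> 1 y) - F y = (\<integral>\<sigma>. indicator {0..1} \<sigma> * F1 (\<tau> \<sigma> y) \<partial>lborel)" if y: "y \<in> space (Rn n)" for y
  proof -
    have yi: "y(i := x) \<in> space (Rn n)" for x
      using y i by (auto simp: space_Rn PiE_def extensional_def)
    have "((\<lambda>\<sigma>. F1 (\<tau> \<sigma> y)) has_integral F (y(i := y i + 1)) - F (y(i := y i + 0))) {0..1}"
    proof (rule fundamental_theorem_of_calculus)
      fix x :: real
      have "((\<lambda>s. F (y(i := s))) has_real_derivative F1 (y(i := y i + x))) (at (x + y i))"
        using D[OF y, of "x + y i"] by (simp add: add.commute)
      then have "((\<lambda>x. F (y(i := x + y i))) has_real_derivative F1 (y(i := y i + x))) (at x)"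
        by (rule DERIV_shift[THEN iffD1])
      then have "((\<lambda>x. F (y(i := y i + x))) has_real_derivative F1 (\<tau> x y)) (at x)"
        by (simp add: \<tau>[OF y] add.commute)
      then show "((\<lambda>x. F (y(i := y i + x))) has_vector_derivative F1 (\<tau> x y)) (at x within {0..1})"
        by (simp add: has_real_derivative_iff_has_vector_derivative has_vector_derivative_at_within)
    qed simp
    moreover have "set_integrable lborel {0..1} (\<lambda>\<sigma>. F1 (\<tau> \<sigma> y))"
      unfolding set_integrable_def
    proof (rule integrableI_bounded_set[where A="{0..1}" and B=B])
      show "(\<lambda>x. indicat_real {0..1} x *\<^sub>R F1 (\<tau> x y)) \<in> borel_measurable lborel"
        using slice[OF y] by (intro borel_measurable_scaleR) auto
      show "AE x\<in>{0..1} in lborel. norm (indicat_real {0..1} x *\<^sub>R F1 (\<tau> x y)) \<le> B"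
        using B[OF yi] by (auto simp: \<tau>[OF y])
    qed auto
    ultimately show ?thesis
      using set_borel_integral_eq_integral(2)[of "{0..1}" "\<lambda>\<sigma>. F1 (\<tau> \<sigma> y)"] \<tau>[OF y]
      by (simp add: set_lebesgue_integral_def integral_unique)
  qed
  have tr: "integrable (Rn n) (\<lambda>y. G (\<tau> \<sigma> y))" "(\<integral>y. G (\<tau> \<sigma> y) \<partial>Rn n) = (\<integral>y. G y \<partial>Rn n)"
    if "integrable (Rn n) G" for G :: "point \<Rightarrow> real" and \<sigma>
    unfolding \<tau>_def using that by (auto intro!: integrable_affine_map integral_affine_map)
  have ints: "integrable (Rnt n) (\<lambda>(y, \<sigma>). indicator {0..1} \<sigma> * F1 (\<tau> \<sigma> y))"
  proof (rule integrableI_bounded)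
    show "(\<lambda>(y, \<sigma>). indicator {0..1} \<sigma> * F1 (\<tau> \<sigma> y)) \<in> borel_measurable (Rnt n)"
      unfolding split_beta' using m by (intro borel_measurable_times) auto
    then have "(\<integral>\<^sup>+ p. ennreal (norm (case p of (y, \<sigma>) \<Rightarrow> indicator {0..1} \<sigma> * F1 (\<tau> \<sigma> y))) \<partial>(Rnt n))
      = (\<integral>\<^sup>+\<sigma>. (\<integral>\<^sup>+y. ennreal (norm (indicator {0..1} \<sigma> * F1 (\<tau> \<sigma> y))) \<partial>Rn n) \<partial>lborel)"
      by (subst Rn_line.nn_integral_snd[symmetric]) auto
    also have "\<dots> = (\<integral>\<^sup>+\<sigma>. (\<integral>\<^sup>+y. ennreal (norm (F1 y)) \<partial>Rn n) * indicator {0..1::real} \<sigma> \<partial>lborel)"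
    proof (intro nn_integral_cong)
      fix \<sigma> :: real
      show "(\<integral>\<^sup>+y. ennreal (norm (indicator {0..1} \<sigma> * F1 (\<tau> \<sigma> y))) \<partial>Rn n) = (\<integral>\<^sup>+y. ennreal (norm (F1 y)) \<partial>Rn n) * indicator {0..1} \<sigma>"
        using nn_integral_affine_map[of 1 "\<lambda>y. ennreal (norm (F1 y))" n "\<lambda>j. if j = i then \<sigma> else 0"]
        by (cases "\<sigma> \<in> {0..1}") (simp_all add: \<tau>_def)
    qed
    also have "\<dots> = (\<integral>\<^sup>+y. ennreal (norm (F1 y)) \<partial>Rn n)" by (simp add: nn_integral_cmult_indicator)
    also have "\<dots> < \<infinity>" using F1 by (simp add: integrable_iff_bounded)
    finally show "(\<integral>\<^sup>+ p. ennreal (norm (case p of (y, \<sigma>) \<Rightarrow> indicator {0..1} \<sigma> * F1 (\<tau> \<sigma> y))) \<partial>(Rnt n)) < \<infinity>" .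
  qed
  have "0 = (\<integral>y. F (\<tau> 1 y) - F y \<partial>Rn n)" using tr[OF F] F by simp
  also have "\<dots> = (\<integral>y. (\<integral>\<sigma>. indicator {0..1} \<sigma> * F1 (\<tau> \<sigma> y) \<partial>lborel) \<partial>Rn n)"
    by (intro Bochner_Integration.integral_cong ftc) auto
  also have "\<dots> = (\<integral>\<sigma>. (\<integral>y. indicator {0..1} \<sigma> * F1 (\<tau> \<sigma> y) \<partial>Rn n) \<partial>lborel)"
    by (rule Rn_line.Fubini_integral[OF ints, symmetric])
  also have "\<dots> = (\<integral>\<sigma>. indicator {0..1::real} \<sigma> * (\<integral>y. F1 y \<partial>Rn n) \<partial>lborel)"
    by (simp add: tr[OF F1])
  also have "\<dots> = (\<integral>y. F1 y \<partial>Rn n)" by simp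
  finally show ?thesis by simp
qed

lemma nn_integral_inverse_square:
  assumes "s > (0::real)"
  shows "(\<integral>\<^sup>+r. ennreal (indicator {s..} r * (1 / r\<^sup>2)) \<partial>lborel) = ennreal (1 / s)"
proof -
  have "((\<lambda>x. x powr (-2)) has_integral - (s powr (-2 + 1)) / (-2 + 1)) {s..}"
    using assms by (intro has_integral_powr_to_inf) auto
  then have "((\<lambda>x. x powr (-2)) has_integral 1 / s) {s..}"
    using assms by (simp add: powr_minus_divide)
  then have "integral\<^sup>N lborel (\<lambda>x. indicator {s..} x * x powr (-2)) = 1 / s"
    by (intro nn_integral_has_integral_lebesgue) auto
  moreover have "ennreal (indicator {s..} r * (1 / r\<^sup>2)) = ennreal (indicator {s..} r * r powr (-2))" for r :: real
    using assms by (auto simp: indicator_def powr_minus_divide)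
  ultimately show ?thesis by simp
qed

context nice_harmonic
begin

lemma D1': "j \<le> n \<Longrightarrow> (X(j := s)) n > 0 \<Longrightarrow> ((\<lambda>s. u (X(j := s))) has_real_derivative u1 j (X(j := s))) (at s)"
  using D1[of j "X(j := s)"] by simp

lemma D2': "j \<le> n \<Longrightarrow> (X(j := s)) n > 0 \<Longrightarrow> ((\<lambda>s. u1 j (X(j := s))) has_real_derivative u2 j (X(j := s))) (at s)"
  using D2[of j "X(j := s)"] by simp

lemma a_nonneg: "X n > 0 \<Longrightarrow> 0 \<le> a X"
  using bound0[of X] by linarith

lemma A_nonneg: "0 \<le> A"
  using a_nonneg[of "\<lambda>_. 1"] a_le[of "\<lambda>_. 1"] by simp

lemma integrable_a: "t > 0 \<Longrightarrow> integrable (Rn n) (\<lambda>y. a (y(n := t)))"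
  using a_int[of t] a_nonneg
  by (intro integrableI_nonneg measurable_slice(1)[OF measa]) (auto intro: order_le_less_trans)

lemma integrable_slice:
  assumes "t > 0" "g \<in> borel_measurable (Rn n)" "\<And>y. y \<in> space (Rn n) \<Longrightarrow> \<bar>g y\<bar> \<le> C * a (y(n := t))"
  shows "integrable (Rn n) g"
proof (rule Bochner_Integration.integrable_bound)
  show "integrable (Rn n) (\<lambda>y. C * a (y(n := t)))" using integrable_a[OF assms(1)] by simp
  show "AE y in Rn n. norm (g y) \<le> norm (C * a (y(n := t)))"
    using assms(3) by (intro AE_I2) (auto intro: order.trans[OF _ abs_ge_self])
qed (use assms in auto)

lemma bound1_height: "j \<le> n \<Longrightarrow> X n > 0 \<Longrightarrow> \<bar>u1 j X\<bar> \<le> A / X n ^ Suc n"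
  using bound1[of j X] divide_right_mono[OF a_le[of X], of "X n"] by (simp add: mult.commute)

lemma bound2_height: "j \<le> n \<Longrightarrow> X n > 0 \<Longrightarrow> \<bar>u2 j X\<bar> \<le> A / X n ^ Suc (Suc n)"
  using bound2[of j X] divide_right_mono[OF a_le[of X], of "(X n)\<^sup>2"] by (simp add: mult_ac power2_eq_square)

lemma bound0_height: "X n > 0 \<Longrightarrow> \<bar>u X\<bar> \<le> A / X n ^ n"
  using bound0[of X] a_le[of X] by linarith

end

text \<open>Integration by parts on a slice, by integrating the derivative of
  \<open>u1 i * v\<close>. For integrability one factor is bounded by \<open>a\<close>, which is
  integrable on the slice, and the other by its maximum at height \<open>r\<close>.\<close>

lemma (in nice_harmonic) integral_u2_mult:
  assumes v: "nice_harmonic n v v1 v2 b B" and i: "i < n" and r: "r > 0"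
  shows "(\<integral>y. u2 i (y(n := r)) * v (y(n := r)) \<partial>Rn n) = - (\<integral>y. u1 i (y(n := r)) * v1 i (y(n := r)) \<partial>Rn n)"
    and "integrable (Rn n) (\<lambda>y. u2 i (y(n := r)) * v (y(n := r)))"
proof -
  interpret v: nice_harmonic n v v1 v2 b B by (rule v)
  note ms = measurable_slice(1)[OF meas0] measurable_slice(1)[OF meas1] measurable_slice(1)[OF meas2]
     measurable_slice(1)[OF v.meas0] measurable_slice(1)[OF v.meas1] measurable_slice(1)[OF v.meas2]
  have r': "(y(n := r)) n = r" for y by simp
  have k: "\<bar>x * z\<bar> \<le> (K * P) * c" if "\<bar>x\<bar> \<le> P * c" "\<bar>z\<bar> \<le> K" for x z K P c :: real
  proof -
    have "\<bar>x * z\<bar> \<le> (P * c) * K" unfolding abs_mult using that by (intro mult_mono) auto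
    then show ?thesis by (simp add: mult_ac)
  qed
  have b2: "\<bar>u2 i (y(n := r))\<bar> \<le> 1 / r\<^sup>2 * a (y(n := r))" for y
    using bound2[of i "y(n := r)"] i r by simp
  have b1: "\<bar>u1 i (y(n := r))\<bar> \<le> 1 / r * a (y(n := r))" for y
    using bound1[of i "y(n := r)"] i r by simp
  have w0: "\<bar>v (y(n := r))\<bar> \<le> B / r ^ n" for y using v.bound0_height[of "y(n := r)"] r by simp
  have w1: "\<bar>v1 i (y(n := r))\<bar> \<le> B / r ^ Suc n" for y using v.bound1_height[of i "y(n := r)"] i r by simp
  have i2: "integrable (Rn n) (\<lambda>y. u2 i (y(n := r)) * v (y(n := r)))"
    by (rule integrable_slice[OF r _ k[OF b2 w0]]) (intro borel_measurable_times ms less_imp_le i)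
  have i11: "integrable (Rn n) (\<lambda>y. u1 i (y(n := r)) * v1 i (y(n := r)))"
    by (rule integrable_slice[OF r _ k[OF b1 w1]]) (intro borel_measurable_times ms less_imp_le i)
  have i1: "integrable (Rn n) (\<lambda>y. u1 i (y(n := r)) * v (y(n := r)))"
    by (rule integrable_slice[OF r _ k[OF b1 w0]]) (intro borel_measurable_times ms less_imp_le i)
  have "(\<integral>y. u2 i (y(n := r)) * v (y(n := r)) + u1 i (y(n := r)) * v1 i (y(n := r)) \<partial>Rn n) = 0"
  proof (rule integral_partial_derivative_eq_0[OF i _ i1])
    fix y :: "nat \<Rightarrow> real" and s
    have "((\<lambda>s. u1 i ((y(n := r))(i := s)) * v ((y(n := r))(i := s))) has_real_derivative
       u2 i ((y(n := r))(i := s)) * v ((y(n := r))(i := s)) + v1 i ((y(n := r))(i := s)) * u1 i ((y(n := r))(i := s))) (at s)"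
      by (rule DERIV_mult[OF D2' v.D1']) (use i r in auto)
    then show "((\<lambda>s. u1 i ((y(i := s))(n := r)) * v ((y(i := s))(n := r))) has_real_derivative
       u2 i ((y(i := s))(n := r)) * v ((y(i := s))(n := r)) + u1 i ((y(i := s))(n := r)) * v1 i ((y(i := s))(n := r))) (at s)"
      using i by (subst (1 2 3 4 5 6) fun_upd_twist) (auto simp only: mult.commute[of "v1 _ _"])
    show "integrable (Rn n) (\<lambda>y. u2 i (y(n := r)) * v (y(n := r)) + u1 i (y(n := r)) * v1 i (y(n := r)))"
      using i2 i11 by simp
    have "\<bar>u2 i (y(n := r)) * v (y(n := r))\<bar> \<le> A / r ^ Suc (Suc n) * (B / r ^ n)"
      unfolding abs_mult using bound2_height[of i "y(n := r)"] w0 i r A_nonneg by (intro mult_mono) auto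
    moreover have "\<bar>u1 i (y(n := r)) * v1 i (y(n := r))\<bar> \<le> A / r ^ Suc n * (B / r ^ Suc n)"
      unfolding abs_mult using bound1_height[of i "y(n := r)"] w1 i r A_nonneg by (intro mult_mono) auto
    ultimately show "\<bar>u2 i (y(n := r)) * v (y(n := r)) + u1 i (y(n := r)) * v1 i (y(n := r))\<bar>
       \<le> A / r ^ Suc (Suc n) * (B / r ^ n) + A / r ^ Suc n * (B / r ^ Suc n)" by linarith
  qed
  then show "(\<integral>y. u2 i (y(n := r)) * v (y(n := r)) \<partial>Rn n) = - (\<integral>y. u1 i (y(n := r)) * v1 i (y(n := r)) \<partial>Rn n)"
    using i2 i11 by simp
  show "integrable (Rn n) (\<lambda>y. u2 i (y(n := r)) * v (y(n := r)))" by (rule i2)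
qed

definition dotg :: "nat \<Rightarrow> (nat \<Rightarrow> point \<Rightarrow> real) \<Rightarrow> (nat \<Rightarrow> point \<Rightarrow> real) \<Rightarrow> point \<Rightarrow> real" where
  "dotg n u1 v1 X = (\<Sum>i\<le>n. u1 i X * v1 i X)"

text \<open>The density in Green's formula, weighted by the height. It is cut off to positive
  heights because the second factor of \<open>Rnt n\<close> is the whole line.\<close>

abbreviation hdot where
  "hdot n u1 v1 p \<equiv> indicator {0<..} (snd p) * (snd p * dotg n u1 v1 ((fst p)(n := snd p)))"

text \<open>\<open>g2\<close> is the second vertical derivative of \<open>u * v\<close>. The Laplace
  equation trades vertical second derivatives for horizontal ones; integrating by parts in both
  terms yields the horizontal part of \<open>dotg\<close> twice, which joins twice the vertical
  part.\<close>

lemma (in nice_harmonic) integral_second_derivative: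
  assumes v: "nice_harmonic n v v1 v2 b B" and r: "r > 0"
  defines "g2 \<equiv> \<lambda>X. u2 n X * v X + 2 * (u1 n X * v1 n X) + u X * v2 n X"
  shows "(\<integral>y. g2 (y(n := r)) \<partial>Rn n) = (\<integral>y. 2 * dotg n u1 v1 (y(n := r)) \<partial>Rn n)"
proof -
  interpret v: nice_harmonic n v v1 v2 b B by (rule v)
  note ms = measurable_slice(1)[OF meas0] measurable_slice(1)[OF meas1] measurable_slice(1)[OF meas2]
     measurable_slice(1)[OF v.meas0] measurable_slice(1)[OF v.meas1] measurable_slice(1)[OF v.meas2]
  have i11: "integrable (Rn n) (\<lambda>y. u1 i (y(n := r)) * v1 i (y(n := r)))" if "i \<le> n" for i
  proof (rule integrable_slice[OF r])
    fix y :: "nat \<Rightarrow> real"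
    have "\<bar>u1 i (y(n := r)) * v1 i (y(n := r))\<bar> \<le> (a (y(n := r)) / r) * (B / r ^ Suc n)"
      unfolding abs_mult using bound1[of i "y(n := r)"] v.bound1_height[of i "y(n := r)"] that r a_nonneg[of "y(n := r)"]
      by (intro mult_mono) auto
    then show "\<bar>u1 i (y(n := r)) * v1 i (y(n := r))\<bar> \<le> B / r ^ Suc (Suc n) * a (y(n := r))" by (simp add: mult_ac)
  qed (intro borel_measurable_times ms that)
  have lap: "u2 n X = - (\<Sum>i<n. u2 i X)" "v2 n X = - (\<Sum>i<n. v2 i X)" if "X n > 0" for X
    using laplace[of X] v.laplace[of X] that by (simp_all add: lessThan_Suc_atMost[symmetric])
  have vsym: "(\<integral>y. u (y(n := r)) * v2 i (y(n := r)) \<partial>Rn n) = - (\<integral>y. u1 i (y(n := r)) * v1 i (y(n := r)) \<partial>Rn n)"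
    "integrable (Rn n) (\<lambda>y. u (y(n := r)) * v2 i (y(n := r)))" if "i < n" for i
    using v.integral_u2_mult[OF nice_harmonic_axioms that r] by (simp_all add: mult.commute)
  note usym = integral_u2_mult[OF v _ r]
  have "(\<integral>y. g2 (y(n := r)) \<partial>Rn n) = (\<integral>y. - (\<Sum>i<n. u2 i (y(n := r)) * v (y(n := r))) + 2 * (u1 n (y(n := r)) * v1 n (y(n := r)))
     - (\<Sum>i<n. u (y(n := r)) * v2 i (y(n := r))) \<partial>Rn n)"
    unfolding g2_def using r by (intro Bochner_Integration.integral_cong) (simp_all add: lap sum_distrib_left sum_distrib_right)
  also have "\<dots> = 2 * (\<Sum>i<n. \<integral>y. u1 i (y(n := r)) * v1 i (y(n := r)) \<partial>Rn n) + 2 * (\<integral>y. u1 n (y(n := r)) * v1 n (y(n := r)) \<partial>Rn n)"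
  proof -
    have 1: "integrable (Rn n) (\<lambda>y. \<Sum>i<n. u2 i (y(n := r)) * v (y(n := r)))"
      "(\<integral>y. (\<Sum>i<n. u2 i (y(n := r)) * v (y(n := r))) \<partial>Rn n) = - (\<Sum>i<n. \<integral>y. u1 i (y(n := r)) * v1 i (y(n := r)) \<partial>Rn n)"
      using usym by (auto simp: Bochner_Integration.integral_sum sum_negf[symmetric] intro!: Bochner_Integration.integrable_sum sum.cong)
    have 2: "integrable (Rn n) (\<lambda>y. \<Sum>i<n. u (y(n := r)) * v2 i (y(n := r)))"
      "(\<integral>y. (\<Sum>i<n. u (y(n := r)) * v2 i (y(n := r))) \<partial>Rn n) = - (\<Sum>i<n. \<integral>y. u1 i (y(n := r)) * v1 i (y(n := r)) \<partial>Rn n)"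
      using vsym by (auto simp: Bochner_Integration.integral_sum sum_negf[symmetric] intro!: Bochner_Integration.integrable_sum sum.cong)
    have 3: "integrable (Rn n) (\<lambda>y. 2 * (u1 n (y(n := r)) * v1 n (y(n := r))))" using i11[of n] by simp
    have 4: "integrable (Rn n) (\<lambda>y. - (\<Sum>i<n. u2 i (y(n := r)) * v (y(n := r))))" using 1(1) by simp
    show ?thesis
      unfolding Bochner_Integration.integral_diff[OF Bochner_Integration.integrable_add[OF 4 3] 2(1)]
        Bochner_Integration.integral_add[OF 4 3] 2(2) Bochner_Integration.integral_minus 1(2) by simp
  qed
  also have "\<dots> = (\<integral>y. 2 * dotg n u1 v1 (y(n := r)) \<partial>Rn n)"
  proof -
    have "(\<integral>y. 2 * dotg n u1 v1 (y(n := r)) \<partial>Rn n) = 2 * (\<Sum>i\<le>n. \<integral>y. u1 i (y(n := r)) * v1 i (y(n := r)) \<partial>Rn n)"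
      unfolding dotg_def using i11 by (simp add: Bochner_Integration.integral_sum)
    then show ?thesis by (simp add: lessThan_Suc_atMost[symmetric])
  qed
  finally show ?thesis .
qed

lemma (in nice_harmonic) integrable_half_space:
  assumes s: "s > 0"
    and m: "g \<in> borel_measurable (Rnt n)"
    and b: "\<And>y r. y \<in> space (Rn n) \<Longrightarrow> r > s \<Longrightarrow> \<bar>g (y, r)\<bar> \<le> C / r\<^sup>2 * a (y(n := r))"
    and C: "C \<ge> 0"
  shows "integrable (Rnt n) (\<lambda>p. indicator {s<..} (snd p) * g p)"
proof (rule integrableI_bounded)
  have [measurable]: "(\<lambda>p. indicator {s<..} (snd p) * g p) \<in> borel_measurable (Rnt n)"
    using m by (intro borel_measurable_times) auto
  show "(\<lambda>p. indicator {s<..} (snd p) * g p) \<in> borel_measurable (Rnt n)" by fact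
  have "(\<integral>\<^sup>+p. ennreal (norm (indicator {s<..} (snd p) * g p)) \<partial>(Rnt n))
     = (\<integral>\<^sup>+r. (\<integral>\<^sup>+y. ennreal (norm (indicator {s<..} r * g (y, r))) \<partial>Rn n) \<partial>lborel)"
    by (subst Rn_line.nn_integral_snd[symmetric]) auto
  also have "\<dots> \<le> (\<integral>\<^sup>+r. ennreal (C * A) * ennreal (indicator {s..} r * (1 / r\<^sup>2)) \<partial>lborel)"
  proof (intro nn_integral_mono)
    fix r :: real
    show "(\<integral>\<^sup>+y. ennreal (norm (indicator {s<..} r * g (y, r))) \<partial>Rn n) \<le> ennreal (C * A) * ennreal (indicator {s..} r * (1 / r\<^sup>2))"
    proof (cases "r > s")
      case True
      then have r: "r > 0" using s by simp
      have "(\<integral>\<^sup>+y. ennreal (norm (indicator {s<..} r * g (y, r))) \<partial>Rn n) \<le> (\<integral>\<^sup>+y. ennreal (C / r\<^sup>2) * ennreal (a (y(n := r))) \<partial>Rn n)"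
        using b True C by (intro nn_integral_mono) (auto simp: ennreal_mult'[symmetric] intro!: ennreal_leI)
      also have "\<dots> = ennreal (C / r\<^sup>2) * (\<integral>\<^sup>+y. ennreal (a (y(n := r))) \<partial>Rn n)"
        by (intro nn_integral_cmult measurable_compose[OF measurable_slice(1)[OF measa] measurable_ennreal])
      also have "\<dots> \<le> ennreal (C / r\<^sup>2) * ennreal A" by (intro mult_left_mono a_int r) auto
      also have "\<dots> = ennreal (C * A) * ennreal (indicator {s..} r * (1 / r\<^sup>2))"
        using True C A_nonneg by (simp add: ennreal_mult'[symmetric])
      finally show ?thesis .
    qed simp
  qed
  also have "\<dots> = ennreal (C * A) * ennreal (1 / s)"
    using nn_integral_inverse_square[OF s] by (subst nn_integral_cmult) auto
  also have "\<dots> < \<infinity>" by (simp add: ennreal_mult_less_top)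
  finally show "(\<integral>\<^sup>+p. ennreal (norm (indicator {s<..} (snd p) * g p)) \<partial>(Rnt n)) < \<infinity>" .
qed

text \<open>Taylor's formula based at infinity: a function of the height that tends to zero together
  with \<open>r\<close> times its derivative equals at \<open>s\<close> the integral of
  \<open>r - s\<close> times its second derivative over \<open>r > s\<close>. It is applied to
  \<open>u * v\<close> on vertical lines and integrated over the base; the slice integrals of the
  second derivative then become those of the gradient product.\<close>

lemma (in nice_harmonic) integral_mult_slice:
  assumes v: "nice_harmonic n v v1 v2 b B" and s: "s > 0"
  shows "integrable (Rnt n) (\<lambda>p. indicator {s<..} (snd p) * ((snd p - s) * (2 * dotg n u1 v1 ((fst p)(n := snd p)))))"
    and "(\<integral>y. u (y(n := s)) * v (y(n := s)) \<partial>Rn n)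
      = (\<integral>p. indicator {s<..} (snd p) * ((snd p - s) * (2 * dotg n u1 v1 ((fst p)(n := snd p)))) \<partial>(Rnt n))"
proof -
  interpret v: nice_harmonic n v v1 v2 b B by (rule v)
  note ms = meas0 meas1 meas2 v.meas0 v.meas1 v.meas2
  define g where "g X = u X * v X" for X
  define g1 where "g1 X = u1 n X * v X + u X * v1 n X" for X
  define g2 where "g2 X = u2 n X * v X + 2 * (u1 n X * v1 n X) + u X * v2 n X" for X
  have mg2: "(\<lambda>p. g2 ((fst p)(n := snd p))) \<in> borel_measurable (Rnt n)"
    unfolding g2_def by (intro borel_measurable_add borel_measurable_times borel_measurable_const ms) auto
  have mdot: "(\<lambda>p. dotg n u1 v1 ((fst p)(n := snd p))) \<in> borel_measurable (Rnt n)"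
    unfolding dotg_def by (intro borel_measurable_sum borel_measurable_times ms) auto
  have prodb: "\<bar>x * z\<bar> \<le> (P * K) * c" if "\<bar>x\<bar> \<le> P * c" "\<bar>z\<bar> \<le> K" for x z K P c :: real
  proof -
    have "\<bar>x * z\<bar> \<le> (P * c) * K" unfolding abs_mult using that by (intro mult_mono) auto
    then show ?thesis by (simp add: mult_ac)
  qed
  have b0: "\<bar>u X\<bar> \<le> 1 * a X" if "X n > 0" for X using bound0[of X] that by simp
  have b1: "\<bar>u1 i X\<bar> \<le> 1 / X n * a X" if "X n > 0" "i \<le> n" for X i using bound1[of i X] that by simp
  have b2: "\<bar>u2 i X\<bar> \<le> 1 / (X n)\<^sup>2 * a X" if "X n > 0" "i \<le> n" for X i using bound2[of i X] that by simp
  \<comment> \<open>Here \<open>n \<ge> 1\<close> enters: decay of order \<open>n + 1\<close> is at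
    least quadratic, so the vertical integrals converge at infinity.\<close>
  have rn: "1 / r ^ Suc n \<le> 1 / (s ^ (n - 1) * r\<^sup>2)" if "r > s" for r
  proof -
    obtain m where m: "n = Suc m" using n by (cases n) auto
    have "s ^ m * r\<^sup>2 \<le> r ^ m * r\<^sup>2" using that s by (intro mult_right_mono power_mono) auto
    then show ?thesis using that s by (auto simp: m power2_eq_square mult_ac intro!: divide_left_mono)
  qed
  have decay: "B / (r ^ n * r\<^sup>2) * r \<le> B / s ^ (n - 1) / r\<^sup>2" if "r > s" for r
  proof -
    have "B / (r ^ n * r\<^sup>2) * r = B * (1 / r ^ Suc n)" using that s by (simp add: power2_eq_square)
    also have "\<dots> \<le> B * (1 / (s ^ (n - 1) * r\<^sup>2))" using rn[OF that] v.A_nonneg by (rule mult_left_mono)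
    finally show ?thesis by simp
  qed
  have bg2: "\<bar>g2 X\<bar> \<le> 4 * B / (X n ^ n * (X n)\<^sup>2) * a X" if X: "X n > 0" for X
  proof -
    define K where "K = B / (X n ^ n * (X n)\<^sup>2) * a X"
    have "\<bar>u2 n X * v X\<bar> \<le> (1 / (X n)\<^sup>2 * (B / X n ^ n)) * a X"
      using X v.bound0_height[of X] by (intro prodb b2) auto
    moreover have "\<bar>u1 n X * v1 n X\<bar> \<le> (1 / X n * (B / X n ^ Suc n)) * a X"
      using X v.bound1_height[of n X] by (intro prodb b1) auto
    moreover have "\<bar>u X * v2 n X\<bar> \<le> (1 * (B / X n ^ Suc (Suc n))) * a X"
      using X v.bound2_height[of n X] by (intro prodb b0) auto
    moreover have "(1 / (X n)\<^sup>2 * (B / X n ^ n)) * a X = K" "(1 / X n * (B / X n ^ Suc n)) * a X = K" "(1 * (B / X n ^ Suc (Suc n))) * a X = K"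
      unfolding K_def using X by (simp_all add: power2_eq_square mult_ac)
    ultimately have "\<bar>u2 n X * v X\<bar> \<le> K" "\<bar>u1 n X * v1 n X\<bar> \<le> K" "\<bar>u X * v2 n X\<bar> \<le> K" by (simp_all only:)
    then have "\<bar>g2 X\<bar> \<le> 4 * K" unfolding g2_def by (simp add: abs_le_iff)
    then show ?thesis by (simp add: K_def)
  qed
  have bdot: "\<bar>dotg n u1 v1 X\<bar> \<le> real (Suc n) * B / (X n ^ n * (X n)\<^sup>2) * a X" if X: "X n > 0" for X
  proof -
    have "\<bar>dotg n u1 v1 X\<bar> \<le> (\<Sum>i\<le>n. (1 / X n * (B / X n ^ Suc n)) * a X)"
      unfolding dotg_def using X v.bound1_height[of _ X]
      by (intro order.trans[OF sum_abs] sum_mono prodb b1) auto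
    then show ?thesis using X by (simp add: power2_eq_square mult_ac)
  qed
  have hs: "integrable (Rnt n) (\<lambda>p. indicator {s<..} (snd p) * ((snd p - s) * h ((fst p)(n := snd p))))"
    if m: "(\<lambda>p. h ((fst p)(n := snd p))) \<in> borel_measurable (Rnt n)"
      and b: "\<And>X. X n > 0 \<Longrightarrow> \<bar>h X\<bar> \<le> C * B / (X n ^ n * (X n)\<^sup>2) * a X" and C: "C \<ge> 0" for h C
  proof (rule integrable_half_space[OF s, where C="C * (B / s ^ (n - 1))"])
    show "(\<lambda>p. (snd p - s) * h ((fst p)(n := snd p))) \<in> borel_measurable (Rnt n)"
      using m by (intro borel_measurable_times) auto
    show "C * (B / s ^ (n - 1)) \<ge> 0" using C v.A_nonneg s by simp
    fix y r assume r: "r > s"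
    have "\<bar>(r - s) * h (y(n := r))\<bar> \<le> r * (C * B / (r ^ n * r\<^sup>2) * a (y(n := r)))"
      unfolding abs_mult using b[of "y(n := r)"] r s by (intro mult_mono) auto
    also have "\<dots> = (C * a (y(n := r))) * (B / (r ^ n * r\<^sup>2) * r)" by simp
    also have "\<dots> \<le> (C * a (y(n := r))) * (B / s ^ (n - 1) / r\<^sup>2)"
      using decay[OF r] C a_nonneg[of "y(n := r)"] r s by (intro mult_left_mono) auto
    finally show "\<bar>(snd (y, r) - s) * h ((fst (y, r))(n := snd (y, r)))\<bar> \<le> C * (B / s ^ (n - 1)) / r\<^sup>2 * a (y(n := r))"
      by (simp add: mult_ac)
  qed
  have ig2: "integrable (Rnt n) (\<lambda>p. indicator {s<..} (snd p) * ((snd p - s) * g2 ((fst p)(n := snd p))))"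
    by (rule hs[OF mg2, of 4]) (use bg2 in auto)
  have mdot2: "(\<lambda>p. 2 * dotg n u1 v1 ((fst p)(n := snd p))) \<in> borel_measurable (Rnt n)"
    using mdot by (intro borel_measurable_times) auto
  have idot: "integrable (Rnt n) (\<lambda>p. indicator {s<..} (snd p) * ((snd p - s) * (2 * dotg n u1 v1 ((fst p)(n := snd p)))))"
  proof (rule hs[OF mdot2, of "2 * real (Suc n)"])
    fix X :: "nat \<Rightarrow> real" assume X: "X n > 0"
    have "\<bar>2 * dotg n u1 v1 X\<bar> = 2 * \<bar>dotg n u1 v1 X\<bar>" by (simp add: abs_mult)
    also have "\<dots> \<le> 2 * (real (Suc n) * B / (X n ^ n * (X n)\<^sup>2) * a X)"
      using bdot[of X] X by (intro mult_left_mono) auto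
    finally show "\<bar>2 * dotg n u1 v1 X\<bar> \<le> 2 * real (Suc n) * B / (X n ^ n * (X n)\<^sup>2) * a X"
      by (simp only: times_divide_eq_left times_divide_eq_right mult.assoc)
  qed simp
  show "integrable (Rnt n) (\<lambda>p. indicator {s<..} (snd p) * ((snd p - s) * (2 * dotg n u1 v1 ((fst p)(n := snd p)))))"
    by (rule idot)
  have taylor: "g (y(n := s)) = (\<integral>r. indicator {s<..} r * ((r - s) * g2 (y(n := r))) \<partial>lborel)"
    if ir: "integrable lborel (\<lambda>r. indicator {s<..} r * ((r - s) * g2 (y(n := r))))" for y
  proof -
    \<comment> \<open>An antiderivative of \<open>(r - s) * g2\<close> which at \<open>r = s\<close>
      is minus the value sought and which tends to zero at infinity.\<close>
    define G where "G r = (r - s) * g1 (y(n := r)) - g (y(n := r))" for r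
    have DG: "(G has_real_derivative (r - s) * g2 (y(n := r))) (at r)" if "r > 0" for r
    proof -
      have du: "((\<lambda>r. u (y(n := r))) has_real_derivative u1 n (y(n := r))) (at r)"
        and du1: "((\<lambda>r. u1 n (y(n := r))) has_real_derivative u2 n (y(n := r))) (at r)"
        and dv: "((\<lambda>r. v (y(n := r))) has_real_derivative v1 n (y(n := r))) (at r)"
        and dv1: "((\<lambda>r. v1 n (y(n := r))) has_real_derivative v2 n (y(n := r))) (at r)"
        using that by (auto intro!: D1' D2' v.D1' v.D2')
      have alg1: "c * d + e * f = c * d + f * e" for c d e f :: real by simp
      have alg2: "c * d + e * f + (f * e + h * k) = c * d + 2 * (f * e) + k * h" for c d e f h k :: real
        by (simp add: algebra_simps)
      have alg3: "1 * c + d * (r - s) - c = (r - s) * d" for c d :: real by simp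
      have di: "((\<lambda>r. r - s) has_real_derivative 1) (at r)" by (auto intro!: derivative_eq_intros)
      have dg: "((\<lambda>r. g (y(n := r))) has_real_derivative g1 (y(n := r))) (at r)"
        unfolding g_def g1_def by (rule DERIV_cong[OF DERIV_mult[OF du dv]]) (rule alg1)
      have dg1: "((\<lambda>r. g1 (y(n := r))) has_real_derivative g2 (y(n := r))) (at r)"
        unfolding g1_def g2_def
        by (rule DERIV_cong[OF DERIV_add[OF DERIV_mult[OF du1 dv] DERIV_mult[OF du dv1]]]) (rule alg2)
      show ?thesis unfolding G_def
        by (rule DERIV_cong[OF DERIV_diff[OF DERIV_mult[OF di dg1] dg]]) (rule alg3)
    qed
    have part: "(\<integral>r. indicator {s<..real N} r * ((r - s) * g2 (y(n := r))) \<partial>lborel) = G (real N) - G s"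
      if "real N > s" for N
    proof -
      have "((\<lambda>r. (r - s) * g2 (y(n := r))) has_integral G (real N) - G s) {s..real N}"
      proof (rule fundamental_theorem_of_calculus)
        fix x assume "x \<in> {s..real N}"
        then have "x > 0" using s by simp
        from DG[OF this] show "(G has_vector_derivative (x - s) * g2 (y(n := x))) (at x within {s..real N})"
          unfolding has_real_derivative_iff_has_vector_derivative by (rule has_vector_derivative_at_within)
      qed (use that in simp)
      moreover have si: "set_integrable lborel {s..real N} (\<lambda>r. (r - s) * g2 (y(n := r)))"
      proof -
        have "integrable lborel (\<lambda>r. (indicator {s<..} r * ((r - s) * g2 (y(n := r)))) * indicator {s..real N} r)"
          using ir by (intro integrable_real_mult_indicator) auto
        moreover have "(\<lambda>r. (indicator {s<..} r * ((r - s) * g2 (y(n := r)))) * indicator {s..real N} r)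
          = (\<lambda>r. indicator {s..real N} r *\<^sub>R ((r - s) * g2 (y(n := r))))"
          by (intro ext) (auto simp: indicator_def)
        ultimately show ?thesis unfolding set_integrable_def by simp
      qed
      ultimately have "(\<integral>r. indicator {s..real N} r * ((r - s) * g2 (y(n := r))) \<partial>lborel) = G (real N) - G s"
        using set_borel_integral_eq_integral(2)[OF si] by (simp add: set_lebesgue_integral_def integral_unique)
      moreover have "(\<integral>r. indicator {s..real N} r * ((r - s) * g2 (y(n := r))) \<partial>lborel) = (\<integral>r. indicator {s<..real N} r * ((r - s) * g2 (y(n := r))) \<partial>lborel)"
        by (intro Bochner_Integration.integral_cong) (auto simp: indicator_def)
      ultimately show ?thesis by simp
    qed
    have lim1: "(\<lambda>N. \<integral>r. indicator {s<..real N} r * ((r - s) * g2 (y(n := r))) \<partial>lborel) \<longlonglongrightarrow> (\<integral>r. indicator {s<..} r * ((r - s) * g2 (y(n := r))) \<partial>lborel)"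
    proof (rule integral_dominated_convergence[where w="\<lambda>r. \<bar>indicator {s<..} r * ((r - s) * g2 (y(n := r)))\<bar>"])
      show "(\<lambda>r. indicator {s<..} r * ((r - s) * g2 (y(n := r)))) \<in> borel_measurable lborel" by (rule borel_measurable_integrable[OF ir])
      have "(\<lambda>r. indicator {..real N} r * (indicator {s<..} r * ((r - s) * g2 (y(n := r))))) \<in> borel_measurable lborel" for N
        by (intro borel_measurable_times[OF _ borel_measurable_integrable[OF ir]]) auto
      moreover have "indicator {..real N} r * (indicator {s<..} r * ((r - s) * g2 (y(n := r)))) = indicator {s<..real N} r * ((r - s) * g2 (y(n := r)))" for r N
        by (auto simp: indicator_def)
      ultimately show "(\<lambda>r. indicator {s<..real N} r * ((r - s) * g2 (y(n := r)))) \<in> borel_measurable lborel" for N by simp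
      show "AE r in lborel. (\<lambda>N. indicator {s<..real N} r * ((r - s) * g2 (y(n := r)))) \<longlonglongrightarrow> indicator {s<..} r * ((r - s) * g2 (y(n := r)))"
      proof (rule AE_I2)
        fix r :: real
        obtain M :: nat where "r \<le> real M" using real_arch_simple by blast
        then have "eventually (\<lambda>N. indicator {s<..real N} r * ((r - s) * g2 (y(n := r))) = indicator {s<..} r * ((r - s) * g2 (y(n := r)))) sequentially"
          unfolding eventually_sequentially by (intro exI[of _ M]) (auto simp: indicator_def)
        then show "(\<lambda>N. indicator {s<..real N} r * ((r - s) * g2 (y(n := r)))) \<longlonglongrightarrow> indicator {s<..} r * ((r - s) * g2 (y(n := r)))"
          by (rule tendsto_eventually)
      qed
      show "AE r in lborel. norm (indicator {s<..real N} r * ((r - s) * g2 (y(n := r)))) \<le> \<bar>indicator {s<..} r * ((r - s) * g2 (y(n := r)))\<bar>" for N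
        by (intro AE_I2) (auto simp: indicator_def)
      show "integrable lborel (\<lambda>r. \<bar>indicator {s<..} r * ((r - s) * g2 (y(n := r)))\<bar>)"
        by (rule integrable_abs[OF ir])
    qed
    have lim2: "(\<lambda>N. G (real N) - G s) \<longlonglongrightarrow> 0 - G s"
    proof (intro tendsto_diff tendsto_const)
      have "\<bar>G r\<bar> \<le> 3 * A * B / r" if r: "r > s" "r \<ge> 1" for r
      proof -
        have rp: "1 \<le> r ^ k" for k using r(2) by (rule one_le_power)
        define X where "X = y(n := r)"
        have X: "X n = r" "r > 0" using r s by (auto simp: X_def)
        have dd: "C / r ^ k \<le> C / r ^ l" if "l \<le> k" "C \<ge> 0" for k l C
          using that r X by (intro divide_left_mono power_increasing mult_pos_pos zero_less_power) auto
        have c0: "A / r ^ n \<le> A / r" "B / r ^ n \<le> B"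
          using dd[of 1 n A] dd[of 0 n B] n A_nonneg v.A_nonneg by simp_all
        have c1: "A / r ^ Suc n \<le> A / (r * r)" "B / r ^ Suc n \<le> B / r"
          using dd[of 2 "Suc n" A] dd[of 1 "Suc n" B] n A_nonneg v.A_nonneg by (simp_all add: power2_eq_square)
        have u0: "\<bar>u X\<bar> \<le> A / r" and w0: "\<bar>v X\<bar> \<le> B"
          using bound0_height[of X] v.bound0_height[of X] c0 X by auto
        have u1: "\<bar>u1 n X\<bar> \<le> A / (r * r)" and w1: "\<bar>v1 n X\<bar> \<le> B / r"
          using bound1_height[of n X] v.bound1_height[of n X] c1 X by auto
        have p1: "\<bar>u1 n X * v X\<bar> \<le> A / (r * r) * B" unfolding abs_mult using u1 w0 A_nonneg X by (intro mult_mono) auto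
        have p2: "\<bar>u X * v1 n X\<bar> \<le> A / r * (B / r)" unfolding abs_mult using u0 w1 A_nonneg X by (intro mult_mono) auto
        have p0: "\<bar>u X * v X\<bar> \<le> A / r * B" unfolding abs_mult using u0 w0 A_nonneg X by (intro mult_mono) auto
        have "\<bar>g1 X\<bar> \<le> 2 * (A * B / (r * r))"
          unfolding g1_def using p1 p2 abs_triangle_ineq[of "u1 n X * v X" "u X * v1 n X"] by simp
        then have "\<bar>r - s\<bar> * \<bar>g1 X\<bar> \<le> r * (2 * (A * B / (r * r)))"
          using r s by (intro mult_mono) auto
        then have "\<bar>(r - s) * g1 X\<bar> \<le> 2 * (A * B / r)" using X by (simp add: abs_mult)
        then have "\<bar>(r - s) * g1 X - g X\<bar> \<le> 2 * (A * B / r) + A / r * B"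
          using p0 unfolding g_def by linarith
        then show ?thesis by (simp add: G_def X_def)
      qed
      moreover obtain M :: nat where M: "max s 1 < real M" using reals_Archimedean2 by blast
      ultimately have "eventually (\<lambda>N. norm (G (real N)) \<le> 3 * A * B / real N) sequentially"
        unfolding eventually_sequentially by (intro exI[of _ M]) auto
      then show "(\<lambda>N. G (real N)) \<longlonglongrightarrow> 0"
        by (rule Lim_null_comparison) (rule lim_const_over_n)
    qed
    have "eventually (\<lambda>N. (\<integral>r. indicator {s<..real N} r * ((r - s) * g2 (y(n := r))) \<partial>lborel) = G (real N) - G s) sequentially"
    proof -
      obtain M :: nat where "s < real M" using reals_Archimedean2 by blast
      then show ?thesis unfolding eventually_sequentially by (intro exI[of _ M] allI impI part) auto
    qed
    from tendsto_cong[OF this] lim1 lim2 have "(\<integral>r. indicator {s<..} r * ((r - s) * g2 (y(n := r))) \<partial>lborel) = 0 - G s"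
      using LIMSEQ_unique by blast
    then show ?thesis by (simp add: G_def)
  qed
  have "(\<integral>y. g (y(n := s)) \<partial>Rn n) = (\<integral>y. (\<integral>r. indicator {s<..} r * ((r - s) * g2 (y(n := r))) \<partial>lborel) \<partial>Rn n)"
  proof (rule integral_cong_AE)
    show "(\<lambda>y. g (y(n := s))) \<in> borel_measurable (Rn n)"
      unfolding g_def by (intro borel_measurable_times measurable_slice(1) ms)
    show "(\<lambda>y. (\<integral>r. indicator {s<..} r * ((r - s) * g2 (y(n := r))) \<partial>lborel)) \<in> borel_measurable (Rn n)"
      using borel_measurable_integrable[OF ig2] by (intro lborel.borel_measurable_lebesgue_integral) (simp add: split_beta')
    \<comment> \<open>Taylor's formula asks for integrability along the vertical line, which
      Fubini's theorem grants for almost every base point.\<close>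
    show "AE y in Rn n. g (y(n := s)) = (\<integral>r. indicator {s<..} r * ((r - s) * g2 (y(n := r))) \<partial>lborel)"
      using Rn_line.AE_integrable_fst'[OF ig2] by eventually_elim (use taylor in simp)
  qed
  also have "\<dots> = (\<integral>r. (\<integral>y. indicator {s<..} r * ((r - s) * g2 (y(n := r))) \<partial>Rn n) \<partial>lborel)"
    using ig2 by (intro Rn_line.Fubini_integral[symmetric]) (simp add: split_beta')
  also have "\<dots> = (\<integral>r. (\<integral>y. indicator {s<..} r * ((r - s) * (2 * dotg n u1 v1 (y(n := r)))) \<partial>Rn n) \<partial>lborel)"
  proof (rule Bochner_Integration.integral_cong[OF refl])
    fix r :: real
    show "(\<integral>y. indicator {s<..} r * ((r - s) * g2 (y(n := r))) \<partial>Rn n) = (\<integral>y. indicator {s<..} r * ((r - s) * (2 * dotg n u1 v1 (y(n := r)))) \<partial>Rn n)"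
    proof (cases "r > s")
      case True
      then show ?thesis
        using integral_second_derivative[OF v, of r] s by (simp add: g2_def)
    qed simp
  qed
  also have "\<dots> = (\<integral>p. indicator {s<..} (snd p) * ((snd p - s) * (2 * dotg n u1 v1 ((fst p)(n := snd p)))) \<partial>(Rnt n))"
    using Rn_line.integral_snd[of n "\<lambda>y r. indicator {s<..} r * ((r - s) * (2 * dotg n u1 v1 (y(n := r))))"] idot
    by (simp add: split_beta')
  finally show "(\<integral>y. u (y(n := s)) * v (y(n := s)) \<partial>Rn n)
      = (\<integral>p. indicator {s<..} (snd p) * ((snd p - s) * (2 * dotg n u1 v1 ((fst p)(n := snd p)))) \<partial>(Rnt n))"
    by (simp add: g_def)
qed

text \<open>Dominated convergence as the slice descends to the boundary: the weights
  \<open>r - s\<close> increase to \<open>r\<close>, so the limit integrand dominates. Its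
  integrability is a hypothesis; the duality estimate supplies it for the pairing, and the decay of
  the kernel for the representation formula.\<close>

lemma (in nice_harmonic) integral_mult_limit:
  assumes v: "nice_harmonic n v v1 v2 b B"
    and int: "integrable (Rnt n) (\<lambda>p. hdot n u1 v1 p)"
    and \<sigma>: "\<And>k. \<sigma> k > 0" "\<sigma> \<longlonglongrightarrow> 0"
  shows "(\<lambda>k. \<integral>y. u (y(n := \<sigma> k)) * v (y(n := \<sigma> k)) \<partial>Rn n)
    \<longlonglongrightarrow> 2 * (\<integral>p. hdot n u1 v1 p \<partial>(Rnt n))"
proof -
  let ?d = "\<lambda>p. dotg n u1 v1 ((fst p)(n := snd p))"
  have "(\<lambda>k. \<integral>p. indicator {\<sigma> k<..} (snd p) * ((snd p - \<sigma> k) * (2 * ?d p)) \<partial>(Rnt n))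
     \<longlonglongrightarrow> (\<integral>p. 2 * (indicator {0<..} (snd p) * (snd p * ?d p)) \<partial>(Rnt n))"
  proof (rule integral_dominated_convergence[where w="\<lambda>p. 2 * \<bar>indicator {0<..} (snd p) * (snd p * ?d p)\<bar>"])
    show "(\<lambda>p. 2 * (indicator {0<..} (snd p) * (snd p * ?d p))) \<in> borel_measurable (Rnt n)"
      by (rule borel_measurable_times[OF borel_measurable_const borel_measurable_integrable[OF int]])
    show "(\<lambda>p. indicator {\<sigma> k<..} (snd p) * ((snd p - \<sigma> k) * (2 * ?d p))) \<in> borel_measurable (Rnt n)" for k
      by (rule borel_measurable_integrable[OF integral_mult_slice(1)[OF v \<sigma>(1)]])
    show "integrable (Rnt n) (\<lambda>p. 2 * \<bar>indicator {0<..} (snd p) * (snd p * ?d p)\<bar>)"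
      by (rule integrable_mult_right[OF integrable_abs[OF int]])
    show "AE p in Rnt n. (\<lambda>k. indicator {\<sigma> k<..} (snd p) * ((snd p - \<sigma> k) * (2 * ?d p)))
       \<longlonglongrightarrow> 2 * (indicator {0<..} (snd p) * (snd p * ?d p))"
    proof (rule AE_I2)
      fix p :: "point \<times> real"
      show "(\<lambda>k. indicator {\<sigma> k<..} (snd p) * ((snd p - \<sigma> k) * (2 * ?d p))) \<longlonglongrightarrow> 2 * (indicator {0<..} (snd p) * (snd p * ?d p))"
      proof (cases "snd p > 0")
        case True
        have "(\<lambda>k. (snd p - \<sigma> k) * (2 * ?d p)) \<longlonglongrightarrow> (snd p - 0) * (2 * ?d p)"
          by (intro tendsto_intros \<sigma>)
        moreover have "eventually (\<lambda>k. indicator {\<sigma> k<..} (snd p) * ((snd p - \<sigma> k) * (2 * ?d p)) = (snd p - \<sigma> k) * (2 * ?d p)) sequentially"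
          using order_tendstoD(2)[OF \<sigma>(2) True] by eventually_elim simp
        ultimately have "(\<lambda>k. indicator {\<sigma> k<..} (snd p) * ((snd p - \<sigma> k) * (2 * ?d p))) \<longlonglongrightarrow> (snd p - 0) * (2 * ?d p)"
          using tendsto_cong by fast
        then show ?thesis using True by (simp add: mult_ac)
      next
        case False
        then have "indicator {\<sigma> k<..} (snd p) = (0::real)" for k using \<sigma>(1)[of k] by simp
        then show ?thesis using False by simp
      qed
    qed
    show "AE p in Rnt n. norm (indicator {\<sigma> k<..} (snd p) * ((snd p - \<sigma> k) * (2 * ?d p)))
       \<le> 2 * \<bar>indicator {0<..} (snd p) * (snd p * ?d p)\<bar>" for k
    proof (rule AE_I2)
      fix p :: "point \<times> real"
      show "norm (indicator {\<sigma> k<..} (snd p) * ((snd p - \<sigma> k) * (2 * ?d p))) \<le> 2 * \<bar>indicator {0<..} (snd p) * (snd p * ?d p)\<bar>"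
      proof (cases "snd p > \<sigma> k")
        case True
        with \<sigma>(1)[of k] have "\<bar>snd p - \<sigma> k\<bar> * \<bar>?d p\<bar> \<le> \<bar>snd p\<bar> * \<bar>?d p\<bar>" by (intro mult_right_mono) auto
        then show ?thesis using True \<sigma>(1)[of k] by (simp add: abs_mult)
      qed simp
    qed
  qed
  moreover have "(\<integral>p. 2 * (indicator {0<..} (snd p) * (snd p * ?d p)) \<partial>(Rnt n))
     = 2 * (\<integral>p. indicator {0<..} (snd p) * (snd p * ?d p) \<partial>(Rnt n))"
    by (rule integral_mult_right_zero)
  ultimately show ?thesis using integral_mult_slice(2)[OF v \<sigma>(1)] by simp
qed

section \<open>Convergence of Poisson extensions to the function in the mean\<close>

lemma U_measurable:
  assumes "f \<in> borel_measurable (Rn n)"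
  shows "(\<lambda>y. U n f (y(n := t))) \<in> borel_measurable (Rn n)"
proof (rule measurable_slice(1))
  show "(\<lambda>p. U n f ((fst p)(n := snd p))) \<in> borel_measurable (Rnt n)"
    unfolding U_def using assms by (intro measurable_half_space_integral measurable_pk) auto
qed

lemma U_contraction_nn:
  assumes f: "integrable (Rn n) f" and t: "t > 0"
  shows "(\<integral>\<^sup>+y. ennreal \<bar>U n f (y(n := t))\<bar> \<partial>Rn n) \<le> ennreal (\<integral>z. \<bar>f z\<bar> \<partial>Rn n)"
  unfolding U_abs_bounds(5)[OF f t, symmetric]
  using U_abs_bounds(1)[OF f] t by (intro nn_integral_mono ennreal_leI) auto

lemma U_integrable:
  assumes f: "integrable (Rn n) f" and t: "t > 0"
  shows "integrable (Rn n) (\<lambda>y. U n f (y(n := t)))"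
proof (rule integrableI_bounded)
  show "(\<lambda>y. U n f (y(n := t))) \<in> borel_measurable (Rn n)" using f by (intro U_measurable) auto
  show "(\<integral>\<^sup>+y. ennreal (norm (U n f (y(n := t)))) \<partial>Rn n) < \<infinity>"
    using U_contraction_nn[OF f t] by (simp add: order_le_less_trans)
qed

lemma U_contraction:
  assumes f: "integrable (Rn n) f" and t: "t > 0"
  shows "(\<integral>y. \<bar>U n f (y(n := t))\<bar> \<partial>Rn n) \<le> (\<integral>z. \<bar>f z\<bar> \<partial>Rn n)"
proof -
  have "ennreal (\<integral>y. \<bar>U n f (y(n := t))\<bar> \<partial>Rn n) \<le> ennreal (\<integral>z. \<bar>f z\<bar> \<partial>Rn n)"
    using U_contraction_nn[OF f t] U_integrable[OF f t] by (subst nn_integral_eq_integral[symmetric]) auto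
  then show ?thesis by (subst (asm) ennreal_le_iff) auto
qed

lemma U_add: "integrable (Rn n) f \<Longrightarrow> integrable (Rn n) g \<Longrightarrow> X n > 0 \<Longrightarrow>
    U n (\<lambda>z. f z + g z) X = U n f X + U n g X"
  unfolding U_def by (simp add: distrib_left integrable_pk_mult)

lemma U_diff: "integrable (Rn n) f \<Longrightarrow> integrable (Rn n) g \<Longrightarrow> X n > 0 \<Longrightarrow>
    U n (\<lambda>z. f z - g z) X = U n f X - U n g X"
  unfolding U_def by (simp add: right_diff_distrib integrable_pk_mult)

lemma U_cmult: "U n (\<lambda>z. c * f z) X = c * U n f X"
proof -
  have "(\<lambda>z. pk n (sh n X z) * (c * f z)) = (\<lambda>z. c * (pk n (sh n X z) * f z))" by (auto simp: mult_ac)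
  then show ?thesis unfolding U_def by simp
qed

text \<open>At distance at least \<open>d\<close> from the pole the denominator is comparable with
  that at height one, and the numerator contributes the factor \<open>X n\<close>. The mass of the
  kernel away from its pole is thus of the order of the height.\<close>

lemma pk_le_unit_height:
  assumes d: "d > 0" and X: "X n > 0" and far: "d\<^sup>2 \<le> (\<Sum>i<n. (X i)\<^sup>2)"
  shows "pk n X \<le> X n * (1 + 1 / d\<^sup>2) powr pm n * pk n (X(n := 1))"
proof -
  define R where "R = (\<Sum>i<n. (X i)\<^sup>2)"
  have R: "R > 0" "1 \<le> R / d\<^sup>2" using far d order.strict_trans2[OF zero_less_power[OF d, of 2] far] by (auto simp: R_def)
  have s1: "ssq n (X(n := 1)) = 1 + R" by (simp add: ssq_split R_def)
  have p: "1 + 1 / d\<^sup>2 > 0" using zero_less_power[OF d, of 2] by (simp add: add_pos_pos)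
  have "1 + R \<le> R * (1 + 1 / d\<^sup>2)" using R by (simp add: distrib_left)
  with p have "(1 + R) / (1 + 1 / d\<^sup>2) \<le> R" by (simp only: pos_divide_le_eq)
  also have "R \<le> ssq n X" by (simp add: ssq_split R_def)
  finally have "ssq n X powr (- pm n) \<le> ((1 + R) / (1 + 1 / d\<^sup>2)) powr (- pm n)"
    using R d pm_pos[of n] by (intro powr_mono2' divide_pos_pos) (auto intro: add_pos_pos)
  also have "\<dots> = (1 + 1 / d\<^sup>2) powr pm n * (1 + R) powr (- pm n)"
    using R d by (simp add: powr_divide powr_minus_divide)
  finally have "pc n * X n * ssq n X powr (- pm n) \<le> pc n * X n * ((1 + 1 / d\<^sup>2) powr pm n * (1 + R) powr (- pm n))"
    using pc_pos[of n] X by (intro mult_left_mono) auto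
  then show ?thesis by (simp add: pk_def s1 mult_ac)
qed

text \<open>Near \<open>y\<close> the difference \<open>f z - f y\<close> vanishes, and elsewhere
  the kernel has mass of order \<open>s\<close>. This simple case of convergence at a point is
  enough for indicators of boxes.\<close>

lemma U_tendsto_locally_constant:
  assumes f: "integrable (Rn n) f" and B: "\<And>z. z \<in> space (Rn n) \<Longrightarrow> \<bar>f z\<bar> \<le> B"
    and d: "d > 0" and loc: "\<And>z. z \<in> space (Rn n) \<Longrightarrow> (\<And>i. i < n \<Longrightarrow> \<bar>y i - z i\<bar> < d) \<Longrightarrow> f z = f y"
    and y: "y \<in> space (Rn n)"
    and \<sigma>: "\<And>k. \<sigma> k > 0" "\<sigma> \<longlonglongrightarrow> 0"
  shows "(\<lambda>k. U n f (y(n := \<sigma> k))) \<longlonglongrightarrow> f y"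
proof -
  define K where "K = (1 + 1 / d\<^sup>2) powr pm n"
  have K: "K \<ge> 0" by (simp add: K_def)
  have B0: "B \<ge> 0" using B[OF y] by linarith
  have "\<bar>U n f (y(n := s)) - f y\<bar> \<le> 2 * B * K * s" if s: "s > 0" for s
  proof -
    have i1: "integrable (Rn n) (\<lambda>z. pk n (sh n (y(n := s)) z) * f z)" by (rule integrable_pk_mult[OF f]) (use s in simp)
    have i2: "integrable (Rn n) (\<lambda>z. pk n (sh n (y(n := s)) z))" by (rule integrable_pk) (use s in simp)
    have "U n f (y(n := s)) - f y = (\<integral>z. pk n (sh n (y(n := s)) z) * f z \<partial>Rn n) - f y * (\<integral>z. pk n (sh n (y(n := s)) z) \<partial>Rn n)"
      using s by (simp add: U_def integral_pk)
    also have "\<dots> = (\<integral>z. pk n (sh n (y(n := s)) z) * (f z - f y) \<partial>Rn n)"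
    proof -
      have "(\<integral>z. pk n (sh n (y(n := s)) z) * (f z - f y) \<partial>Rn n) = (\<integral>z. pk n (sh n (y(n := s)) z) * f z - f y * pk n (sh n (y(n := s)) z) \<partial>Rn n)"
        by (intro Bochner_Integration.integral_cong) (simp_all add: algebra_simps)
      then show ?thesis using Bochner_Integration.integral_diff[OF i1 integrable_mult_right[OF i2, of "f y"]] by simp
    qed
    also have "\<bar>\<dots>\<bar> \<le> (\<integral>z. 2 * B * K * s * pk n (sh n (y(n := 1)) z) \<partial>Rn n)"
    proof (rule abs_integral_le)
      show "integrable (Rn n) (\<lambda>z. 2 * B * K * s * pk n (sh n (y(n := 1)) z))"
        by (rule integrable_mult_right, rule integrable_pk) simp
      fix z assume z: "z \<in> space (Rn n)"
      have p1: "pk n (sh n (y(n := 1)) z) \<ge> 0" by (rule pk_nonneg) simp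
      have ps: "pk n (sh n (y(n := s)) z) \<ge> 0" by (rule pk_nonneg) (use s in simp)
      show "\<bar>pk n (sh n (y(n := s)) z) * (f z - f y)\<bar> \<le> 2 * B * K * s * pk n (sh n (y(n := 1)) z)"
      proof (cases "\<forall>i<n. \<bar>y i - z i\<bar> < d")
        case True
        then show ?thesis using loc[OF z] p1 B0 K s by simp
      next
        case False
        then obtain i where i: "i < n" "d \<le> \<bar>y i - z i\<bar>" by (auto simp: not_less)
        have "d\<^sup>2 \<le> (y i - z i)\<^sup>2" using i d by (metis abs_le_square_iff abs_of_pos)
        also have "\<dots> \<le> (\<Sum>i<n. (sh n (y(n := s)) z i)\<^sup>2)"
          using i by (intro order.trans[OF _ member_le_sum[of i]]) (auto simp: sh_def)
        finally have "pk n (sh n (y(n := s)) z) \<le> s * K * pk n ((sh n (y(n := s)) z)(n := 1))"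
          using pk_le_unit_height[OF d, of "sh n (y(n := s)) z" n] s by (simp add: K_def)
        moreover have "(sh n (y(n := s)) z)(n := 1) = sh n (y(n := 1)) z" by (auto simp: sh_def)
        ultimately have "pk n (sh n (y(n := s)) z) * \<bar>f z - f y\<bar> \<le> s * K * pk n (sh n (y(n := 1)) z) * (2 * B)"
          using B[OF z] B[OF y] ps p1 K s by (intro mult_mono) auto
        then show ?thesis using ps by (simp add: abs_mult mult_ac)
      qed
    qed
    also have "\<dots> = 2 * B * K * s" by (simp add: integral_pk)
    finally show ?thesis .
  qed
  then have ev: "eventually (\<lambda>k. norm (U n f (y(n := \<sigma> k)) - f y) \<le> 2 * B * K * \<sigma> k) sequentially"
    using \<sigma>(1) by simp
  have lim: "(\<lambda>k. 2 * B * K * \<sigma> k) \<longlonglongrightarrow> 0" using tendsto_mult_left[OF \<sigma>(2), of "2 * B * K"] by simp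
  have "(\<lambda>k. U n f (y(n := \<sigma> k)) - f y) \<longlonglongrightarrow> 0"
    by (rule Lim_null_comparison[OF ev lim])
  then show ?thesis by (rule LIM_zero_cancel)
qed

lemma AE_component_neq:
  assumes "i < n" shows "AE y in Rn n. y i \<noteq> c"
proof -
  have eq: "{y \<in> space (Rn n). y i = c} = (\<Pi>\<^sub>E j\<in>{..<n}. if j = i then {c} else UNIV)"
  proof (intro set_eqI iffI)
    fix y assume "y \<in> {y \<in> space (Rn n). y i = c}"
    then show "y \<in> (\<Pi>\<^sub>E j\<in>{..<n}. if j = i then {c} else UNIV)" by (simp add: space_Rn PiE_iff)
  next
    fix y assume y: "y \<in> (\<Pi>\<^sub>E j\<in>{..<n}. if j = i then {c} else UNIV)"
    from PiE_mem[OF y, of i] assms have "y i = c" by simp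
    with y show "y \<in> {y \<in> space (Rn n). y i = c}" by (simp add: space_Rn PiE_iff)
  qed
  have "emeasure (Rn n) (\<Pi>\<^sub>E j\<in>{..<n}. if j = i then {c} else UNIV) = (\<Prod>j\<in>{..<n}. emeasure lborel (if j = i then {c} else UNIV))"
    unfolding Rn_def by (rule lborel_product.emeasure_PiM) auto
  also have "\<dots> = 0" using assms by (intro prod_zero) auto
  finally have "emeasure (Rn n) {y \<in> space (Rn n). y i = c} = 0" by (simp add: eq)
  moreover have "(\<Pi>\<^sub>E j\<in>{..<n}. if j = i then {c} else UNIV) \<in> sets (Rn n)"
    unfolding Rn_def by (intro sets_PiM_I_finite) auto
  then have "{y \<in> space (Rn n). y i = c} \<in> sets (Rn n)" by (simp only: eq)
  ultimately show ?thesis by (intro AE_I[of _ _ "{y \<in> space (Rn n). y i = c}"]) auto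
qed

text \<open>Convergence in the mean of the extensions along the heights \<open>\<sigma> k\<close>,
  packaged as a predicate for an induction: boxes have the property, and sums, multiples and limits
  preserve it.\<close>

definition l1_approx :: "nat \<Rightarrow> point \<Rightarrow> (point \<Rightarrow> real) \<Rightarrow> bool" where
  "l1_approx n \<sigma> f \<longleftrightarrow> integrable (Rn n) f \<and> (\<lambda>k. \<integral>y. \<bar>U n f (y(n := \<sigma> k)) - f y\<bar> \<partial>Rn n) \<longlonglongrightarrow> 0"

context
  fixes n :: nat and \<sigma> :: "nat \<Rightarrow> real"
  assumes \<sigma>: "\<And>k. \<sigma> k > 0" "\<sigma> \<longlonglongrightarrow> 0"
begin

text \<open>Three errors of size \<open>e / 3\<close>: the contraction property bounds the extension
  of \<open>s j - f\<close> by the norm of \<open>s j - f\<close> at every height, so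
  \<open>j\<close> can be fixed before \<open>k\<close>.\<close>

lemma l1_approx_limit:
  assumes s: "\<And>j. l1_approx n \<sigma> (s j)" and f: "integrable (Rn n) f"
    and lim: "(\<lambda>j. \<integral>y. \<bar>s j y - f y\<bar> \<partial>Rn n) \<longlonglongrightarrow> 0"
  shows "l1_approx n \<sigma> f"
  unfolding l1_approx_def
proof (intro conjI f LIMSEQ_I)
  fix e :: real assume e: "e > 0"
  obtain j where j: "(\<integral>y. \<bar>s j y - f y\<bar> \<partial>Rn n) < e / 3"
    using LIMSEQ_D[OF lim, of "e / 3"] e by auto
  have sj: "integrable (Rn n) (s j)" "(\<lambda>k. \<integral>y. \<bar>U n (s j) (y(n := \<sigma> k)) - s j y\<bar> \<partial>Rn n) \<longlonglongrightarrow> 0"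
    using s[of j] by (auto simp: l1_approx_def)
  obtain N where N: "\<And>k. k \<ge> N \<Longrightarrow> (\<integral>y. \<bar>U n (s j) (y(n := \<sigma> k)) - s j y\<bar> \<partial>Rn n) < e / 3"
    using LIMSEQ_D[OF sj(2), of "e / 3"] e by auto
  show "\<exists>N. \<forall>k\<ge>N. norm ((\<integral>y. \<bar>U n f (y(n := \<sigma> k)) - f y\<bar> \<partial>Rn n) - 0) < e"
  proof (intro exI[of _ N] allI impI)
    fix k assume k: "k \<ge> N"
    have fs: "integrable (Rn n) (\<lambda>y. s j y - f y)" using sj f by simp
    note I = U_integrable[OF f \<sigma>(1)[of k]] U_integrable[OF sj(1) \<sigma>(1)[of k]] U_integrable[OF fs \<sigma>(1)[of k]]
    have "(\<integral>y. \<bar>U n f (y(n := \<sigma> k)) - f y\<bar> \<partial>Rn n)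
       \<le> (\<integral>y. \<bar>U n (\<lambda>y. s j y - f y) (y(n := \<sigma> k))\<bar> + \<bar>U n (s j) (y(n := \<sigma> k)) - s j y\<bar> + \<bar>s j y - f y\<bar> \<partial>Rn n)"
    proof (rule integral_mono)
      fix y show "\<bar>U n f (y(n := \<sigma> k)) - f y\<bar> \<le> \<bar>U n (\<lambda>y. s j y - f y) (y(n := \<sigma> k))\<bar> + \<bar>U n (s j) (y(n := \<sigma> k)) - s j y\<bar> + \<bar>s j y - f y\<bar>"
        using U_diff[OF sj(1) f, of "y(n := \<sigma> k)"] \<sigma>(1)[of k] by simp
    qed (use I sj f fs in \<open>auto intro!: integrable_abs Bochner_Integration.integrable_add Bochner_Integration.integrable_diff\<close>)
    also have "\<dots> = (\<integral>y. \<bar>U n (\<lambda>y. s j y - f y) (y(n := \<sigma> k))\<bar> \<partial>Rn n) + (\<integral>y. \<bar>U n (s j) (y(n := \<sigma> k)) - s j y\<bar> \<partial>Rn n) + (\<integral>y. \<bar>s j y - f y\<bar> \<partial>Rn n)"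
      using integrable_abs[OF I(3)] integrable_abs[OF Bochner_Integration.integrable_diff[OF I(2) sj(1)]] integrable_abs[OF fs]
      by (simp only: Bochner_Integration.integral_add Bochner_Integration.integrable_add)
    also have "\<dots> < e" using U_contraction[OF fs \<sigma>(1)[of k]] N[OF k] j by linarith
    finally show "norm ((\<integral>y. \<bar>U n f (y(n := \<sigma> k)) - f y\<bar> \<partial>Rn n) - 0) < e" by simp
  qed
qed

text \<open>The factor 2 is the one that the limit case of \<open>integrable_induct\<close>
  provides.\<close>

lemma l1_approx_dominated_limit:
  assumes s: "\<And>j. l1_approx n \<sigma> (s j)" and f: "integrable (Rn n) f"
    and lim: "\<And>y. y \<in> space (Rn n) \<Longrightarrow> (\<lambda>j. s j y) \<longlonglongrightarrow> f y"
    and b: "\<And>j y. y \<in> space (Rn n) \<Longrightarrow> \<bar>s j y\<bar> \<le> 2 * \<bar>f y\<bar>"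
  shows "l1_approx n \<sigma> f"
proof (rule l1_approx_limit[OF s f])
  have si: "integrable (Rn n) (s j)" for j using s by (auto simp: l1_approx_def)
  have "(\<lambda>j. \<integral>y. \<bar>s j y - f y\<bar> \<partial>Rn n) \<longlonglongrightarrow> (\<integral>y. 0 \<partial>Rn n)"
  proof (rule integral_dominated_convergence[where w="\<lambda>y. 3 * \<bar>f y\<bar>"])
    show "AE y in Rn n. (\<lambda>j. \<bar>s j y - f y\<bar>) \<longlonglongrightarrow> 0"
    proof (rule AE_I2)
      fix y assume "y \<in> space (Rn n)"
      then have "(\<lambda>j. \<bar>s j y - f y\<bar>) \<longlonglongrightarrow> \<bar>f y - f y\<bar>" by (intro tendsto_intros lim)
      then show "(\<lambda>j. \<bar>s j y - f y\<bar>) \<longlonglongrightarrow> 0" by simp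
    qed
    show "AE y in Rn n. norm \<bar>s j y - f y\<bar> \<le> 3 * \<bar>f y\<bar>" for j
      using b by (intro AE_I2) (auto intro: order.trans[OF abs_triangle_ineq4] simp: add_increasing2)
  qed (use si f in auto)
  then show "(\<lambda>j. \<integral>y. \<bar>s j y - f y\<bar> \<partial>Rn n) \<longlonglongrightarrow> 0" by simp
qed

lemma l1_approx_add:
  assumes "l1_approx n \<sigma> f" "l1_approx n \<sigma> g"
  shows "l1_approx n \<sigma> (\<lambda>y. f y + g y)"
proof -
  have f: "integrable (Rn n) f" "(\<lambda>k. \<integral>y. \<bar>U n f (y(n := \<sigma> k)) - f y\<bar> \<partial>Rn n) \<longlonglongrightarrow> 0"
    and g: "integrable (Rn n) g" "(\<lambda>k. \<integral>y. \<bar>U n g (y(n := \<sigma> k)) - g y\<bar> \<partial>Rn n) \<longlonglongrightarrow> 0"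
    using assms by (auto simp: l1_approx_def)
  have If: "integrable (Rn n) (\<lambda>y. \<bar>U n f (y(n := \<sigma> k)) - f y\<bar>)" for k
    using U_integrable[OF f(1) \<sigma>(1)] f by (intro integrable_abs Bochner_Integration.integrable_diff)
  have Ig: "integrable (Rn n) (\<lambda>y. \<bar>U n g (y(n := \<sigma> k)) - g y\<bar>)" for k
    using U_integrable[OF g(1) \<sigma>(1)] g by (intro integrable_abs Bochner_Integration.integrable_diff)
  have "norm (\<integral>y. \<bar>U n (\<lambda>y. f y + g y) (y(n := \<sigma> k)) - (f y + g y)\<bar> \<partial>Rn n) \<le>
     (\<integral>y. \<bar>U n f (y(n := \<sigma> k)) - f y\<bar> \<partial>Rn n) + (\<integral>y. \<bar>U n g (y(n := \<sigma> k)) - g y\<bar> \<partial>Rn n)" for k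
    unfolding Bochner_Integration.integral_add[OF If Ig, symmetric] real_norm_def
  proof (rule abs_integral_le[OF Bochner_Integration.integrable_add[OF If Ig]])
    fix y :: "nat \<Rightarrow> real"
    have "U n (\<lambda>y. f y + g y) (y(n := \<sigma> k)) = U n f (y(n := \<sigma> k)) + U n g (y(n := \<sigma> k))"
      by (rule U_add) (use f g \<sigma> in auto)
    then show "\<bar>\<bar>U n (\<lambda>y. f y + g y) (y(n := \<sigma> k)) - (f y + g y)\<bar>\<bar> \<le> \<bar>U n f (y(n := \<sigma> k)) - f y\<bar> + \<bar>U n g (y(n := \<sigma> k)) - g y\<bar>"
      by linarith
  qed
  then have ev: "eventually (\<lambda>k. norm (\<integral>y. \<bar>U n (\<lambda>y. f y + g y) (y(n := \<sigma> k)) - (f y + g y)\<bar> \<partial>Rn n) \<le>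
     (\<integral>y. \<bar>U n f (y(n := \<sigma> k)) - f y\<bar> \<partial>Rn n) + (\<integral>y. \<bar>U n g (y(n := \<sigma> k)) - g y\<bar> \<partial>Rn n)) sequentially"
    by (rule always_eventually[OF allI])
  have lim: "(\<lambda>k. (\<integral>y. \<bar>U n f (y(n := \<sigma> k)) - f y\<bar> \<partial>Rn n) + (\<integral>y. \<bar>U n g (y(n := \<sigma> k)) - g y\<bar> \<partial>Rn n)) \<longlonglongrightarrow> 0"
    using tendsto_add[OF f(2) g(2)] by simp
  have "(\<lambda>k. \<integral>y. \<bar>U n (\<lambda>y. f y + g y) (y(n := \<sigma> k)) - (f y + g y)\<bar> \<partial>Rn n) \<longlonglongrightarrow> 0"
    by (rule Lim_null_comparison[OF ev lim])
  then show ?thesis using f g by (simp add: l1_approx_def)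
qed

lemma l1_approx_cmult:
  assumes "l1_approx n \<sigma> f"
  shows "l1_approx n \<sigma> (\<lambda>y. c * f y)"
proof -
  have "(\<lambda>k. \<bar>c\<bar> * (\<integral>y. \<bar>U n f (y(n := \<sigma> k)) - f y\<bar> \<partial>Rn n)) \<longlonglongrightarrow> \<bar>c\<bar> * 0"
    using assms by (intro tendsto_mult_left) (auto simp: l1_approx_def)
  then show ?thesis using assms
    unfolding l1_approx_def U_cmult by (simp add: right_diff_distrib[symmetric] abs_mult)
qed

text \<open>Off the boundary faces, a null set, the indicator is locally constant, so the extensions
  converge almost everywhere. As extending does not increase the norm, Scheffe's lemma turns this
  into convergence in the mean.\<close>

lemma l1_approx_box:
  "l1_approx n \<sigma> (indicator (\<Pi>\<^sub>E i\<in>{..<n}. {a i<..<b i}))"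
proof -
  define A where "A = (\<Pi>\<^sub>E i\<in>{..<n}. {a i<..<b i :: real})"
  have A: "A \<in> sets (Rn n)" unfolding A_def Rn_def by (intro sets_PiM_I_finite) auto
  have "emeasure (Rn n) A = (\<Prod>i\<in>{..<n}. emeasure lborel {a i<..<b i})"
    unfolding A_def Rn_def by (rule lborel_product.emeasure_PiM) auto
  also have "\<dots> < \<infinity>"
  proof -
    have "emeasure lborel {a i<..<b i} \<noteq> \<infinity>" for i by (cases "a i \<le> b i") auto
    then show ?thesis by (simp add: ennreal_prod_eq_top less_top[symmetric])
  qed
  finally have fin: "emeasure (Rn n) A < \<infinity>" .
  define f where "f = (indicator A :: point \<Rightarrow> real)"
  have f: "integrable (Rn n) f" unfolding f_def using A fin by (simp add: less_top)
  have ae: "AE y in Rn n. (\<lambda>k. U n f (y(n := \<sigma> k))) \<longlonglongrightarrow> f y"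
  proof -
    have "AE y in Rn n. \<forall>i\<in>{..<n}. y i \<noteq> a i \<and> y i \<noteq> b i"
      by (rule AE_finite_allI) (auto intro: AE_component_neq)
    then show ?thesis
      using AE_space
    proof eventually_elim
      case (elim y)
      have "\<exists>d>0. \<forall>z\<in>space (Rn n). (\<forall>i<n. \<bar>y i - z i\<bar> < d) \<longrightarrow> f z = f y"
      proof (cases "y \<in> A")
        case True
        define d where "d = Min (insert 1 ((\<lambda>i. min (y i - a i) (b i - y i)) ` {..<n}))"
        have "d > 0" unfolding d_def using True by (subst Min_gr_iff) (auto simp: A_def PiE_iff)
        moreover have "f z = f y" if z: "z \<in> space (Rn n)" "\<forall>i<n. \<bar>y i - z i\<bar> < d" for z
        proof -
          have "z i \<in> {a i<..<b i}" if i: "i < n" for i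
          proof -
            have "d \<le> min (y i - a i) (b i - y i)" unfolding d_def using i by (intro Min_le) auto
            then show ?thesis using z(2) i by (auto simp: abs_less_iff)
          qed
          then have "z \<in> A" using z(1) by (auto simp: A_def space_Rn PiE_iff)
          then show ?thesis using True by (simp add: f_def)
        qed
        ultimately show ?thesis by blast
      next
        case False
        then obtain i where i: "i < n" "y i \<le> a i \<or> b i \<le> y i"
          using elim(2) by (auto simp: A_def space_Rn PiE_iff not_less)
        define d where "d = (if y i \<le> a i then a i - y i else y i - b i)"
        have "y i \<noteq> a i" "y i \<noteq> b i" using i elim(1) by auto
        then have "d > 0" using i by (auto simp: d_def less_le)
        moreover have "f z = f y" if z: "\<forall>i<n. \<bar>y i - z i\<bar> < d" for z
        proof -
          have "z i \<notin> {a i<..<b i}" using z i by (auto simp: d_def abs_less_iff split: if_splits)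
          then have "z \<notin> A" using i(1) by (auto simp: A_def PiE_iff)
          then show ?thesis using False by (simp add: f_def)
        qed
        ultimately show ?thesis by blast
      qed
      then obtain d where d: "d > 0" "\<And>z. z \<in> space (Rn n) \<Longrightarrow> (\<And>i. i < n \<Longrightarrow> \<bar>y i - z i\<bar> < d) \<Longrightarrow> f z = f y" by blast
      show ?case
        by (rule U_tendsto_locally_constant[OF f _ d elim(2) \<sigma>, of 1]) (auto simp: f_def)
    qed
  qed
  have "(\<lambda>k. \<integral>\<^sup>+y. norm (U n f (y(n := \<sigma> k)) - f y) \<partial>Rn n) \<longlonglongrightarrow> 0"
  proof (rule Scheffe_lemma2[OF _ f ae])
    show "(\<lambda>y. U n f (y(n := \<sigma> k))) \<in> borel_measurable (Rn n)" for k using f by (intro U_measurable) auto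
    show "(\<integral>\<^sup>+y. norm (U n f (y(n := \<sigma> k))) \<partial>Rn n) \<le> (\<integral>\<^sup>+y. norm (f y) \<partial>Rn n)" for k
      using U_contraction_nn[OF f \<sigma>(1)[of k]] f by (subst (2) nn_integral_eq_integral) auto
  qed
  moreover have "(\<integral>\<^sup>+y. norm (U n f (y(n := \<sigma> k)) - f y) \<partial>Rn n) = ennreal (\<integral>y. \<bar>U n f (y(n := \<sigma> k)) - f y\<bar> \<partial>Rn n)" for k
    unfolding real_norm_def
    by (rule nn_integral_eq_integral[OF integrable_abs[OF Bochner_Integration.integrable_diff[OF U_integrable[OF f \<sigma>(1)] f]]]) simp
  ultimately have "(\<lambda>k. ennreal (\<integral>y. \<bar>U n f (y(n := \<sigma> k)) - f y\<bar> \<partial>Rn n)) \<longlonglongrightarrow> ennreal 0" by simp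
  then have "(\<lambda>k. \<integral>y. \<bar>U n f (y(n := \<sigma> k)) - f y\<bar> \<partial>Rn n) \<longlonglongrightarrow> 0"
    by (subst (asm) tendsto_ennreal_iff) auto
  then show ?thesis using f by (simp add: l1_approx_def f_def A_def)
qed

text \<open>Bounded boxes are taken as generators because their indicators are integrable.\<close>

lemma sets_Rn_boxes:
  "sets (Rn n) = sigma_sets (space (Rn n)) {\<Pi>\<^sub>E i\<in>{..<n}. {a i<..<b i} | a b. True}"
proof -
  define E where "E = range (\<lambda>(a, b). {a<..<b :: real})"
  have PiE_eq: "(\<Pi>\<^sub>E i\<in>{..<n}. S i) = {f \<in> {..<n} \<rightarrow>\<^sub>E UNIV. \<forall>i\<in>{..<n}. f i \<in> S i}" for S :: "nat \<Rightarrow> real set"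
    by (intro set_eqI) (simp add: PiE_iff conj_commute)
  have sb: "sets (lborel :: real measure) = sets (sigma UNIV E)"
    unfolding sets_lborel E_def borel_eq_box by (simp add: box_real(1)[abs_def])
  have "sets (Rn n) = sets (\<Pi>\<^sub>M i\<in>{..<n}. sigma UNIV E)"
    unfolding Rn_def by (rule sets_PiM_cong[OF refl]) (rule sb)
  also have "\<dots> = sets (sigma (\<Pi>\<^sub>E i\<in>{..<n}. UNIV) {{f\<in>(\<Pi>\<^sub>E i\<in>{..<n}. UNIV). \<forall>i\<in>j. f i \<in> A i} | A j. j \<in> {{..<n}} \<and> A \<in> Pi j (\<lambda>_. E)})"
  proof (rule sets_PiM_sigma)
    show "\<exists>S\<subseteq>E. countable S \<and> UNIV = \<Union>S"
    proof (intro exI[of _ "range (\<lambda>k::nat. {- real k<..<real k})"] conjI)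
      show "UNIV = \<Union>(range (\<lambda>k::nat. {- real k<..<real k}))"
      proof (intro equalityI subsetI)
        fix x :: real
        obtain k :: nat where "\<bar>x\<bar> < real k" using reals_Archimedean2 by blast
        then show "x \<in> \<Union>(range (\<lambda>k::nat. {- real k<..<real k}))" by (auto simp: abs_less_iff intro!: exI[of _ k])
      qed simp
    qed (auto simp: E_def)
  qed auto
  also have "\<dots> = sigma_sets (\<Pi>\<^sub>E i\<in>{..<n}. UNIV) {{f\<in>(\<Pi>\<^sub>E i\<in>{..<n}. UNIV). \<forall>i\<in>j. f i \<in> A i} | A j. j \<in> {{..<n}} \<and> A \<in> Pi j (\<lambda>_. E)}"
    by (rule sets_measure_of) auto
  also have "{{f\<in>(\<Pi>\<^sub>E i\<in>{..<n}. UNIV :: real set). \<forall>i\<in>j. f i \<in> A i} | A j. j \<in> {{..<n}} \<and> A \<in> Pi j (\<lambda>_. E)}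
     = {\<Pi>\<^sub>E i\<in>{..<n}. {a i<..<b i} | a b. True}" (is "?L = ?R")
  proof (intro equalityI subsetI)
    fix Z assume "Z \<in> ?L"
    then obtain A where A: "Z = {f\<in>(\<Pi>\<^sub>E i\<in>{..<n}. UNIV). \<forall>i\<in>{..<n}. f i \<in> A i}" "A \<in> {..<n} \<rightarrow> E" by auto
    have "\<exists>p. A i = {fst p<..<snd p}" if "i < n" for i
    proof -
      have "A i \<in> E" using A(2) that by auto
      then obtain q where "A i = (\<lambda>(a, b). {a<..<b}) q" unfolding E_def by (rule rangeE)
      then show ?thesis by (intro exI[of _ q]) (simp add: split_beta)
    qed
    then obtain p where p: "\<And>i. i < n \<Longrightarrow> A i = {fst (p i)<..<snd (p i)}" by metis
    have "Z = (\<Pi>\<^sub>E i\<in>{..<n}. {fst (p i)<..<snd (p i)})" unfolding A using p by (auto simp: PiE_iff extensional_def)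
    then show "Z \<in> ?R"
      by - (rule CollectI, rule exI[of _ "\<lambda>i. fst (p i)"], rule exI[of _ "\<lambda>i. snd (p i)"], simp)
  next
    fix Z assume "Z \<in> ?R"
    then obtain a b where Z: "Z = (\<Pi>\<^sub>E i\<in>{..<n}. {a i<..<b i :: real})" by auto
    show "Z \<in> ?L"
      unfolding Z
    proof (rule CollectI, rule exI[of _ "\<lambda>i. {a i<..<b i}"], rule exI[of _ "{..<n}"], intro conjI)
      show "(\<Pi>\<^sub>E i\<in>{..<n}. {a i<..<b i}) = {f \<in> {..<n} \<rightarrow>\<^sub>E UNIV. \<forall>i\<in>{..<n}. f i \<in> {a i<..<b i}}"
        by (rule PiE_eq)
      have "{x<..<y} \<in> E" for x y unfolding E_def by (rule range_eqI[of _ _ "(x, y)"]) simp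
      then show "(\<lambda>i. {a i<..<b i}) \<in> {..<n} \<rightarrow> E" by (intro Pi_I)
    qed simp
  qed
  finally show ?thesis by (simp add: space_Rn)
qed

text \<open>Dynkin's argument, from boxes to all measurable sets through complements and disjoint
  unions. Intersecting with a fixed window keeps all measures finite, so a complement can be formed
  by subtracting from the indicator of the window.\<close>

lemma l1_approx_bounded_set:
  assumes "A \<in> sets (Rn n)"
  shows "l1_approx n \<sigma> (indicator (A \<inter> (\<Pi>\<^sub>E i\<in>{..<n}. {- real N<..<real N})))"
proof -
  define W where "W = (\<Pi>\<^sub>E i\<in>{..<n}. {- real N<..<real N})"
  have W: "l1_approx n \<sigma> (indicator W)" unfolding W_def by (rule l1_approx_box)
  have Wsp: "W \<subseteq> space (Rn n)" by (auto simp: W_def space_Rn PiE_iff)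
  have Ws: "W \<in> sets (Rn n)" unfolding W_def Rn_def by (intro sets_PiM_I_finite) auto
  have boxInt: "(\<Pi>\<^sub>E i\<in>{..<n}. {a i<..<b i}) \<inter> (\<Pi>\<^sub>E i\<in>{..<n}. {c i<..<d i}) = (\<Pi>\<^sub>E i\<in>{..<n}. {max (a i) (c i)<..<min (b i) (d i :: real)})" for a b c d
    unfolding PiE_Int by (intro PiE_cong) auto
  have "l1_approx n \<sigma> (indicator (A \<inter> W))"
  proof (rule sigma_sets_induct_disjoint[of "{\<Pi>\<^sub>E i\<in>{..<n}. {a i<..<b i} | a b. True}" "space (Rn n)" A])
    show "Int_stable {\<Pi>\<^sub>E i\<in>{..<n}. {a i<..<b i :: real} | a b. True}"
    proof (rule Int_stableI)
      fix X Y assume "X \<in> {\<Pi>\<^sub>E i\<in>{..<n}. {a i<..<b i :: real} | a b. True}" "Y \<in> {\<Pi>\<^sub>E i\<in>{..<n}. {a i<..<b i :: real} | a b. True}"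
      then obtain a b c d where "X = (\<Pi>\<^sub>E i\<in>{..<n}. {a i<..<b i :: real})" "Y = (\<Pi>\<^sub>E i\<in>{..<n}. {c i<..<d i :: real})" by auto
      then have "X \<inter> Y = (\<Pi>\<^sub>E i\<in>{..<n}. {max (a i) (c i)<..<min (b i) (d i)})" by (simp only: boxInt)
      then show "X \<inter> Y \<in> {\<Pi>\<^sub>E i\<in>{..<n}. {a i<..<b i :: real} | a b. True}"
        by - (rule CollectI, rule exI[of _ "\<lambda>i. max (a i) (c i)"], rule exI[of _ "\<lambda>i. min (b i) (d i)"], simp)
    qed
    show "{\<Pi>\<^sub>E i\<in>{..<n}. {a i<..<b i} | a b. True} \<subseteq> Pow (space (Rn n))" by (auto simp: space_Rn PiE_iff)
    show "A \<in> sigma_sets (space (Rn n)) {\<Pi>\<^sub>E i\<in>{..<n}. {a i<..<b i} | a b. True}" using assms sets_Rn_boxes by simp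
    fix B assume "B \<in> {\<Pi>\<^sub>E i\<in>{..<n}. {a i<..<b i :: real} | a b. True}"
    then obtain a b where "B = (\<Pi>\<^sub>E i\<in>{..<n}. {a i<..<b i :: real})" by auto
    then show "l1_approx n \<sigma> (indicator (B \<inter> W))" unfolding W_def by (simp only: boxInt l1_approx_box)
  next
    show "l1_approx n \<sigma> (indicator ({} \<inter> W))"
      using l1_approx_cmult[OF W, of 0] by (simp add: indicator_def[abs_def])
  next
    fix B assume B: "l1_approx n \<sigma> (indicator (B \<inter> W))"
    have "l1_approx n \<sigma> (\<lambda>y. indicator W y + (-1) * indicator (B \<inter> W) y)"
      by (intro l1_approx_add W l1_approx_cmult B)
    also have "(\<lambda>y. indicator W y + (-1) * indicator (B \<inter> W) y) = (indicator ((space (Rn n) - B) \<inter> W) :: _ \<Rightarrow> real)"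
      using Wsp by (auto simp: indicator_def fun_eq_iff)
    finally show "l1_approx n \<sigma> (indicator ((space (Rn n) - B) \<inter> W))" .
  next
    fix B :: "nat \<Rightarrow> point set"
    assume dis: "disjoint_family B" and Bs: "range B \<subseteq> sigma_sets (space (Rn n)) {\<Pi>\<^sub>E i\<in>{..<n}. {a i<..<b i} | a b. True}"
      and B: "\<And>i. l1_approx n \<sigma> (indicator (B i \<inter> W))"
    have Bm: "B i \<in> sets (Rn n)" for i using Bs sets_Rn_boxes by auto
    have part: "l1_approx n \<sigma> (\<lambda>y. \<Sum>i<j. indicator (B i \<inter> W) y)" for j
    proof (induction j)
      case 0
      then show ?case using l1_approx_cmult[OF W, of 0] by simp
    next
      case (Suc j)
      from l1_approx_add[OF this B[of j]] show ?case by simp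
    qed
    have eq: "(\<Sum>i<j. indicator (B i \<inter> W) y) = (indicator ((\<Union>i<j. B i) \<inter> W) y :: real)" for j y
    proof (cases "y \<in> W")
      case True
      have "disjoint_family_on B {..<j}" using dis by (rule disjoint_family_on_mono[rotated]) simp
      note U = indicator_UN_disjoint[OF finite_lessThan this, of y]
      have "(\<Sum>i<j. indicator (B i \<inter> W) y) = (\<Sum>i<j. indicator (B i) y :: real)"
        using True by (intro sum.cong refl) (simp add: indicator_def)
      also have "\<dots> = indicator ((\<Union>i<j. B i) \<inter> W) y"
        using True U[symmetric] by (simp only: indicator_inter_arith indicator_simps mult_1_right)
      finally show ?thesis .
    qed (simp add: indicator_def)
    show "l1_approx n \<sigma> (indicator ((\<Union>i. B i) \<inter> W))"
    proof (rule l1_approx_dominated_limit[of "\<lambda>j y. indicator ((\<Union>i<j. B i) \<inter> W) y"])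
      show "l1_approx n \<sigma> (indicator ((\<Union>i<j. B i) \<inter> W))" for j using part[of j] by (simp add: eq)
      have iW: "integrable (Rn n) (indicator W :: _ \<Rightarrow> real)" using W unfolding l1_approx_def by (rule conjunct1)
      have "integrable (Rn n) (\<lambda>y. indicator W y * indicator (\<Union>i. B i) y :: real)"
        by (rule integrable_real_mult_indicator[OF _ iW]) (use Bm in blast)
      moreover have "(\<lambda>y. indicator W y * indicator (\<Union>i. B i) y :: real) = indicator ((\<Union>i. B i) \<inter> W)"
        by (rule ext) (simp only: indicator_inter_arith mult.commute)
      ultimately show "integrable (Rn n) (indicator ((\<Union>i. B i) \<inter> W) :: _ \<Rightarrow> real)" by (simp only:)
      fix y
      show "(\<lambda>j. indicator ((\<Union>i<j. B i) \<inter> W) y) \<longlonglongrightarrow> (indicator ((\<Union>i. B i) \<inter> W) y :: real)"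
      proof (cases "y \<in> (\<Union>i. B i) \<inter> W")
        case True
        then obtain i where i: "y \<in> B i" by auto
        have "eventually (\<lambda>j. indicator ((\<Union>i<j. B i) \<inter> W) y = (indicator ((\<Union>i. B i) \<inter> W) y :: real)) sequentially"
          unfolding eventually_sequentially using True i by (intro exI[of _ "Suc i"]) (auto simp: indicator_def)
        then show ?thesis by (rule tendsto_eventually)
      next
        case False
        then have "(indicator ((\<Union>i<j. B i) \<inter> W) y :: real) = 0" for j by (auto simp: indicator_def)
        then show ?thesis using False by simp
      qed
      show "\<bar>indicator ((\<Union>i<j. B i) \<inter> W) y :: real\<bar> \<le> 2 * \<bar>indicator ((\<Union>i. B i) \<inter> W) y\<bar>" for j
        by (auto simp: indicator_def)
    qed
  qed
  then show ?thesis by (simp add: W_def)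
qed

theorem l1_approx_integrable:
  assumes "integrable (Rn n) f"
  shows "l1_approx n \<sigma> f"
  using assms
proof (induction rule: integrable_induct)
  case (base A c)
  have "l1_approx n \<sigma> (indicator A)"
  proof (rule l1_approx_dominated_limit[of "\<lambda>N y. indicator (A \<inter> (\<Pi>\<^sub>E i\<in>{..<n}. {- real N<..<real N})) y"])
    show "l1_approx n \<sigma> (indicator (A \<inter> (\<Pi>\<^sub>E i\<in>{..<n}. {- real N<..<real N})))" for N
      by (rule l1_approx_bounded_set) fact
    show "integrable (Rn n) (indicator A :: _ \<Rightarrow> real)" using base by (simp add: less_top)
    fix y assume y: "y \<in> space (Rn n)"
    show "\<bar>indicator (A \<inter> (\<Pi>\<^sub>E i\<in>{..<n}. {- real N<..<real N})) y :: real\<bar> \<le> 2 * \<bar>indicator A y\<bar>" for N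
      by (auto simp: indicator_def)
    obtain N0 :: nat where N0: "(\<Sum>i<n. \<bar>y i\<bar>) < real N0" using reals_Archimedean2 by blast
    have "y \<in> (\<Pi>\<^sub>E i\<in>{..<n}. {- real N<..<real N})" if N: "N \<ge> N0" for N
    proof -
      have "\<bar>y i\<bar> < real N" if "i < n" for i
        using member_le_sum[of i "{..<n}" "\<lambda>i. \<bar>y i\<bar>"] that N0 N by auto
      then show ?thesis using y by (auto simp: space_Rn PiE_iff abs_less_iff) (metis minus_less_iff)
    qed
    then have "eventually (\<lambda>N. indicator (A \<inter> (\<Pi>\<^sub>E i\<in>{..<n}. {- real N<..<real N})) y = (indicator A y :: real)) sequentially"
      unfolding eventually_sequentially by (intro exI[of _ N0]) (auto simp: indicator_def)
    then show "(\<lambda>N. indicator (A \<inter> (\<Pi>\<^sub>E i\<in>{..<n}. {- real N<..<real N})) y) \<longlonglongrightarrow> (indicator A y :: real)"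
      by (rule tendsto_eventually)
  qed
  from l1_approx_cmult[OF this, of c] show ?case by (simp add: mult.commute)
next
  case (add f g)
  then show ?case by (intro l1_approx_add)
next
  case (lim f s)
  then show ?case by (intro l1_approx_dominated_limit[of s f]) auto
qed

end

section \<open>Dyadic cubes and averages over strips\<close>

lemma side_cube:
  assumes "n \<ge> 1" "l > 0"
  shows "side n (cube n a l) = l"
  unfolding side_def
proof (rule the_equality)
  show "0 < l \<and> (\<exists>b. cube n a l = cube n b l)" using assms by auto
  fix l' assume l': "0 < l' \<and> (\<exists>b. cube n a l = cube n b l')"
  then obtain b where b: "cube n a l = cube n b l'" by auto
  have "{a 0..<a 0 + l} = {b 0..<b 0 + l'}"
    using b assms l' unfolding cube_def by (subst (asm) PiE_eq_iff_not_empty) auto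
  then show "l' = l" using assms l' by (auto simp: Ico_eq_Ico)
qed

lemma sets_cube[measurable]: "cube n a l \<in> sets (Rn n)"
  unfolding cube_def Rn_def by (intro sets_PiM_I_finite) auto

lemma emeasure_cube:
  assumes "l > 0" shows "emeasure (Rn n) (cube n a l) = ennreal (l ^ n)"
proof -
  have "emeasure (Rn n) (cube n a l) = (\<Prod>i\<in>{..<n}. emeasure lborel {a i..<a i + l})"
    unfolding cube_def Rn_def by (rule lborel_product.emeasure_PiM) auto
  then show ?thesis using assms by (simp add: ennreal_power)
qed

lemma vol_cube: "l > 0 \<Longrightarrow> vol n (cube n a l) = l ^ n"
  by (simp add: vol_def measure_def emeasure_cube)

text \<open>The heights in the top half of a cube of side \<open>2 powi k\<close>. Carleson boxes
  contain their top and not their bottom, whence the form of the interval; the strips tile the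
  positive half line.\<close>

definition strip :: "int \<Rightarrow> real set" where
  "strip k = {2 powi (k - 1) <.. 2 powi k}"

lemma strip_disjoint:
  assumes "t \<in> strip j" "t \<in> strip k" shows "j = k"
proof -
  have "j \<le> k" if "t \<in> strip j" "t \<in> strip k" for j k
  proof (rule ccontr)
    assume "\<not> j \<le> k"
    then have "(2::real) powi k \<le> 2 powi (j - 1)" by (intro power_int_increasing) auto
    then show False using that by (auto simp: strip_def)
  qed
  then show ?thesis using assms by (meson antisym)
qed

lemma ex_strip:
  assumes "t > 0" shows "\<exists>k. t \<in> strip k"
proof
  define k where "k = \<lceil>log 2 t\<rceil>"
  have k: "real_of_int k - 1 < log 2 t" "log 2 t \<le> real_of_int k"
    unfolding k_def by linarith+
  have "2 powr (real_of_int (k - 1)) < t" using k(1) assms by (subst powr_less_iff) auto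
  moreover have "t \<le> 2 powr (real_of_int k)" using k(2) assms by (subst le_powr_iff) auto
  moreover have "2 powr (real_of_int j) = (2::real) powi j" for j by (rule powr_real_of_int') auto
  ultimately show "t \<in> strip k" by (simp only: strip_def greaterThanAtMost_iff)
qed

lemma strip_pos: "t \<in> strip k \<Longrightarrow> t > 0"
  unfolding strip_def greaterThanAtMost_iff by (rule less_trans[OF zero_less_power_int[of "2::real" "k - 1"]]) auto

lemma strip_measurable[measurable]: "strip k \<in> sets borel"
  by (simp add: strip_def)

locale dyadic =
  fixes n :: nat and D :: "point set set"
  assumes n: "n \<ge> 1" and D: "dyadic_lattice n D"
begin

definition cubk :: "int \<Rightarrow> point \<Rightarrow> point set" where
  "cubk k x = (THE I. I \<in> D \<and> side n I = 2 powi k \<and> x \<in> I)"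

definition vk :: "int \<Rightarrow> real" where "vk k = (2 powi k) ^ n"

lemma vk_pos: "vk k > 0" by (simp add: vk_def)

lemma D_cubes: "\<forall>I\<in>D. \<exists>a. \<exists>k::int. I = cube n a (2 powi k)"
  and D_ex1: "\<forall>k::int. \<forall>x\<in>space (Rn n). \<exists>!I. I \<in> D \<and> side n I = 2 powi k \<and> x \<in> I"
  and D_nested: "\<forall>I\<in>D. \<forall>J\<in>D. I \<subseteq> J \<or> J \<subseteq> I \<or> I \<inter> J = {}"
  using D unfolding dyadic_lattice_def by simp_all

lemma D_cube: assumes "I \<in> D" obtains a k where "I = cube n a (2 powi k)" "side n I = 2 powi k"
proof -
  obtain a k where I: "I = cube n a (2 powi k)" using D_cubes assms by meson
  have "side n I = 2 powi k" unfolding I by (rule side_cube[OF n]) simp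
  with I show ?thesis by (rule that)
qed

lemma cubk:
  assumes "x \<in> space (Rn n)"
  shows "cubk k x \<in> D" "side n (cubk k x) = 2 powi k" "x \<in> cubk k x"
proof -
  have "\<exists>!I. I \<in> D \<and> side n I = 2 powi k \<and> x \<in> I" using D_ex1 assms by simp
  from theI'[OF this] show "cubk k x \<in> D" "side n (cubk k x) = 2 powi k" "x \<in> cubk k x"
    unfolding cubk_def by auto
qed

lemma cubk_unique:
  assumes "x \<in> space (Rn n)" "I \<in> D" "side n I = 2 powi k" "x \<in> I"
  shows "cubk k x = I"
proof -
  have "\<exists>!I. I \<in> D \<and> side n I = 2 powi k \<and> x \<in> I" using D_ex1 assms by simp
  with cubk[OF assms(1), of k] assms show ?thesis by blast
qed

lemma cubk_cube:
  assumes "x \<in> space (Rn n)" obtains a where "cubk k x = cube n a (2 powi k)"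
proof -
  obtain a j where a: "cubk k x = cube n a (2 powi j)" "side n (cubk k x) = 2 powi j"
    using D_cube[OF cubk(1)[OF assms]] by metis
  then have "(2::real) powi j = 2 powi k" using cubk(2)[OF assms, of k] by simp
  with a that show ?thesis by metis
qed

lemma D_subset_space: "I \<in> D \<Longrightarrow> I \<subseteq> space (Rn n)"
  by (erule D_cube) (auto simp: cube_def space_Rn PiE_def)

lemma cubk_eq:
  assumes "x \<in> space (Rn n)" "y \<in> cubk k x" shows "cubk k y = cubk k x"
  using assms cubk[OF assms(1), of k] D_subset_space by (intro cubk_unique) auto

lemma sets_cubk[measurable]: "x \<in> space (Rn n) \<Longrightarrow> cubk k x \<in> sets (Rn n)"
  by (erule cubk_cube[of x k]) auto

lemma emeasure_cubk: "x \<in> space (Rn n) \<Longrightarrow> emeasure (Rn n) (cubk k x) = ennreal (vk k)"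
  by (erule cubk_cube[of x k]) (simp add: emeasure_cube vk_def)

lemma vol_cubk: "x \<in> space (Rn n) \<Longrightarrow> vol n (cubk k x) = vk k"
  by (erule cubk_cube[of x k]) (simp add: vol_cube vk_def)

lemma cubk_dist:
  assumes "x \<in> space (Rn n)" "y \<in> cubk k x" "i < n" shows "\<bar>y i - x i\<bar> \<le> 2 powi k"
proof -
  obtain a where a: "cubk k x = cube n a (2 powi k)" by (rule cubk_cube[OF assms(1)])
  have "x \<in> cube n a (2 powi k)" "y \<in> cube n a (2 powi k)"
    using assms(2) cubk(3)[OF assms(1), of k] by (simp_all only: a)
  from this[unfolded cube_def, THEN PiE_mem, of i] assms(3)
  have "x i \<in> {a i..<a i + 2 powi k}" "y i \<in> {a i..<a i + 2 powi k}" by simp_all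
  then show ?thesis by auto
qed

text \<open>Two cubes through \<open>x\<close> are comparable by nestedness, and their volumes rule
  out that the coarser one lies properly inside the finer one.\<close>

lemma cubk_mono:
  assumes x: "x \<in> space (Rn n)" and jk: "j \<le> k" shows "cubk j x \<subseteq> cubk k x"
proof -
  have "cubk j x \<subseteq> cubk k x \<or> cubk k x \<subseteq> cubk j x \<or> cubk j x \<inter> cubk k x = {}"
    using D_nested cubk(1)[OF x] by simp
  moreover have "cubk j x = cubk k x" if "cubk k x \<subseteq> cubk j x"
  proof -
    have "emeasure (Rn n) (cubk k x) \<le> emeasure (Rn n) (cubk j x)"
      using that x by (intro emeasure_mono) auto
    then have "vk k \<le> vk j" using vk_pos[of j] by (simp add: emeasure_cubk x)
    then have "(2::real) powi k \<le> 2 powi j"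
      unfolding vk_def using n by (subst (asm) power_mono_iff) auto
    then have "j = k" using jk power_int_strict_increasing[of j k "2::real"] by (cases "j = k") auto
    then show ?thesis by simp
  qed
  ultimately show ?thesis using cubk(3)[OF x] by blast
qed

text \<open>Each cube contains a point with rational coordinates, and within one generation the
  choice is injective because only one cube passes through a point. Countability makes
  \<open>same\<close> a measurable set.\<close>

lemma countable_D: "countable D"
proof -
  define Dk where "Dk k = {I \<in> D. side n I = 2 powi k}" for k :: int
  have "countable (Dk k)" for k
  proof -
    have "\<exists>q. q \<in> (\<Pi>\<^sub>E i\<in>{..<n}. \<rat>) \<and> q \<in> I" if "I \<in> D" for I
    proof -
      obtain a j where a: "I = cube n a (2 powi j)" by (rule D_cube[OF \<open>I \<in> D\<close>])
      have "\<exists>q\<in>\<rat>. a i < q \<and> q < a i + 2 powi j" for i by (intro Rats_dense_in_real) simp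
      then obtain q where q: "\<And>i. q i \<in> \<rat>" "\<And>i. a i < q i" "\<And>i. q i < a i + 2 powi j" by metis
      show ?thesis
        by (intro exI[of _ "\<lambda>i\<in>{..<n}. q i"]) (auto simp: a cube_def q(1,3) intro!: less_imp_le[OF q(2)])
    qed
    then obtain q where q: "\<And>I. I \<in> D \<Longrightarrow> q I \<in> (\<Pi>\<^sub>E i\<in>{..<n}. \<rat>) \<and> q I \<in> I" by metis
    have "inj_on q (Dk k)"
    proof (rule inj_onI)
      fix I J assume I: "I \<in> Dk k" and J: "J \<in> Dk k" and e: "q I = q J"
      have s: "q I \<in> space (Rn n)" using q[of I] I D_subset_space[of I] by (auto simp: Dk_def)
      have "cubk k (q I) = I" using I q[of I] by (intro cubk_unique s) (auto simp: Dk_def)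
      moreover have "cubk k (q I) = J" unfolding e using J q[of J] s e by (intro cubk_unique) (auto simp: Dk_def)
      ultimately show "I = J" by simp
    qed
    moreover have "countable (q ` Dk k)"
    proof (rule countable_subset)
      show "q ` Dk k \<subseteq> (\<Pi>\<^sub>E i\<in>{..<n}. \<rat>)" using q by (auto simp: Dk_def)
      show "countable (\<Pi>\<^sub>E i\<in>{..<n}. \<rat> :: real set)" by (intro countable_PiE) (auto simp: countable_rat)
    qed
    ultimately show ?thesis by (simp add: countable_image_inj_eq)
  qed
  moreover have "D \<subseteq> (\<Union>k. Dk k)"
  proof
    fix I assume I: "I \<in> D"
    then obtain a k where "side n I = 2 powi k" by (rule D_cube)
    with I show "I \<in> (\<Union>k. Dk k)" by (auto simp: Dk_def)
  qed
  ultimately show ?thesis by (intro countable_subset[of D "\<Union>k. Dk k"]) auto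
qed

text \<open>The relation of lying in a common cube of generation \<open>k\<close>, as a subset of
  the product space. Averages over the cube around a varying point become integrals of a jointly
  measurable symmetric kernel, and sums over the cubes of a generation turn into uses of Tonelli's
  theorem.\<close>

definition same :: "int \<Rightarrow> (point \<times> point) set" where
  "same k = (\<Union>I\<in>{I \<in> D. side n I = 2 powi k}. I \<times> I)"

lemma sets_same: "same k \<in> sets (Rn n \<Otimes>\<^sub>M Rn n)"
  unfolding same_def
proof (rule sets.countable_UN'')
  show "countable {I \<in> D. side n I = 2 powi k}" by (rule countable_subset[OF _ countable_D]) auto
  fix I assume "I \<in> {I \<in> D. side n I = 2 powi k}"
  then have "I \<in> D" by simp
  then obtain a j where "I = cube n a (2 powi j)" by (rule D_cube)
  then show "I \<times> I \<in> sets (Rn n \<Otimes>\<^sub>M Rn n)" by (intro pair_measureI) auto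
qed

lemma same_iff:
  assumes "x \<in> space (Rn n)" shows "(x, y) \<in> same k \<longleftrightarrow> y \<in> cubk k x"
  using cubk[OF assms, of k] cubk_unique[OF assms, of _ k] unfolding same_def by blast

abbreviation ind :: "int \<Rightarrow> point \<Rightarrow> point \<Rightarrow> ennreal" where
  "ind k x y \<equiv> indicator (same k) (x, y)"

lemma measurable_ind:
  assumes "X \<in> M \<rightarrow>\<^sub>M Rn n" "Y \<in> M \<rightarrow>\<^sub>M Rn n"
  shows "(\<lambda>\<omega>. ind k (X \<omega>) (Y \<omega>)) \<in> borel_measurable M"
  by (rule measurable_compose[OF measurable_Pair[OF assms] borel_measurable_indicator[OF sets_same]])

lemma ind_sym: "ind k x y = ind k y x"
  by (auto simp: indicator_def same_def)

lemma nn_integral_ind: "x \<in> space (Rn n) \<Longrightarrow> (\<integral>\<^sup>+y. ind k x y \<partial>Rn n) = ennreal (vk k)"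
proof -
  assume x: "x \<in> space (Rn n)"
  have "(\<integral>\<^sup>+y. ind k x y \<partial>Rn n) = (\<integral>\<^sup>+y. indicator (cubk k x) y \<partial>Rn n)"
    using same_iff[OF x] by (intro nn_integral_cong) (auto simp: indicator_def)
  also have "\<dots> = ennreal (vk k)" using emeasure_cubk[OF x] x by simp
  finally show ?thesis .
qed

definition const_on :: "int \<Rightarrow> (point \<Rightarrow> ennreal) \<Rightarrow> bool" where
  "const_on k c \<longleftrightarrow> (\<forall>x\<in>space (Rn n). \<forall>y\<in>cubk k x. c y = c x)"

lemma const_on_ind:
  assumes "const_on k c" "x \<in> space (Rn n)" "y \<in> space (Rn n)"
  shows "c x * ind k x y = c y * ind k x y"
proof (cases "(x, y) \<in> same k")
  case True
  then have "c y = c x" using assms same_iff[OF assms(2)] unfolding const_on_def by blast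
  then show ?thesis by simp
qed simp

lemma const_on_antimono:
  assumes "const_on k c" "j \<le> k" shows "const_on j c"
  using assms cubk_mono[of _ j k] unfolding const_on_def by blast

lemma const_on_cong:
  assumes "\<And>x y. x \<in> space (Rn n) \<Longrightarrow> y \<in> space (Rn n) \<Longrightarrow> cubk k x = cubk k y \<Longrightarrow> c x = c y"
  shows "const_on k c"
  unfolding const_on_def
proof (intro ballI)
  fix x y assume "x \<in> space (Rn n)" "y \<in> cubk k x"
  then show "c y = c x"
    using cubk_eq[of x y k] cubk(1)[of x k] D_subset_space[of "cubk k x"] by (intro assms) auto
qed

text \<open>Up to the factor \<open>vk k\<close> the inner integral is the conditional expectation
  on generation \<open>k\<close>. Its kernel is symmetric with mass \<open>vk k\<close>, and
  \<open>c\<close> has the same value at both arguments where the kernel does not vanish, so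
  Tonelli's theorem removes the average.\<close>

lemma nn_integral_average:
  assumes c: "const_on k c" and [measurable]: "c \<in> borel_measurable (Rn n)" "g \<in> borel_measurable (Rn n)"
  shows "(\<integral>\<^sup>+x. c x * (\<integral>\<^sup>+y. ind k x y * g y \<partial>Rn n) \<partial>Rn n) = ennreal (vk k) * (\<integral>\<^sup>+y. c y * g y \<partial>Rn n)"
proof -
  have m1: "(\<lambda>y. ind k x y) \<in> borel_measurable (Rn n)" if "x \<in> space (Rn n)" for x
    using that by (intro measurable_ind) auto
  have m2: "(\<lambda>x. ind k x y) \<in> borel_measurable (Rn n)" if "y \<in> space (Rn n)" for y
    using that by (intro measurable_ind) auto
  have m: "(\<lambda>(x, y). c x * (ind k x y * g y)) \<in> borel_measurable (Rn n \<Otimes>\<^sub>M Rn n)"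
    unfolding split_beta' by (intro borel_measurable_times_ennreal measurable_ind) auto
  have "(\<integral>\<^sup>+x. c x * (\<integral>\<^sup>+y. ind k x y * g y \<partial>Rn n) \<partial>Rn n) = (\<integral>\<^sup>+x. (\<integral>\<^sup>+y. c x * (ind k x y * g y) \<partial>Rn n) \<partial>Rn n)"
    using m1 by (intro nn_integral_cong nn_integral_cmult[symmetric] borel_measurable_times_ennreal) auto
  also have "\<dots> = (\<integral>\<^sup>+y. (\<integral>\<^sup>+x. c x * (ind k x y * g y) \<partial>Rn n) \<partial>Rn n)"
    by (rule Rn_Rn.Fubini'[symmetric, OF m])
  also have "\<dots> = (\<integral>\<^sup>+y. (\<integral>\<^sup>+x. c y * g y * ind k y x \<partial>Rn n) \<partial>Rn n)"
  proof (intro nn_integral_cong)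
    fix x y assume xy: "y \<in> space (Rn n)" "x \<in> space (Rn n)"
    have "c x * (ind k x y * g y) = (c x * ind k x y) * g y" by (simp add: mult.assoc)
    also have "\<dots> = (c y * ind k x y) * g y" using const_on_ind[OF c xy(2,1)] by simp
    also have "\<dots> = c y * g y * ind k y x" unfolding ind_sym[of k x y] by (simp add: mult_ac)
    finally show "c x * (ind k x y * g y) = c y * g y * ind k y x" .
  qed
  also have "\<dots> = (\<integral>\<^sup>+y. c y * g y * ennreal (vk k) \<partial>Rn n)"
    using m1 by (intro nn_integral_cong) (simp add: nn_integral_cmult nn_integral_ind)
  also have "\<dots> = ennreal (vk k) * (\<integral>\<^sup>+y. c y * g y \<partial>Rn n)"
    by (subst nn_integral_cmult[symmetric]) (auto simp: mult_ac)
  finally show ?thesis .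
qed

definition line_int :: "real set \<Rightarrow> (point \<times> real \<Rightarrow> ennreal) \<Rightarrow> point \<Rightarrow> ennreal" where
  "line_int S G y = (\<integral>\<^sup>+t. indicator S t * G (y, t) \<partial>lborel)"

text \<open>The mass that \<open>G\<close> gives to the top half of the cube of generation
  \<open>k\<close> around \<open>x\<close>, per unit volume of the cube. As a function of
  \<open>x\<close> it is constant on the cubes of this generation.\<close>

definition tent_avg :: "int \<Rightarrow> (point \<times> real \<Rightarrow> ennreal) \<Rightarrow> point \<Rightarrow> ennreal" where
  "tent_avg k G x = ennreal (1 / vk k) * (\<integral>\<^sup>+y. ind k x y * line_int (strip k) G y \<partial>Rn n)"

lemma measurable_line_int:
  assumes "G \<in> borel_measurable (Rnt n)" "S \<in> sets borel"
  shows "line_int S G \<in> borel_measurable (Rn n)"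
  unfolding line_int_def
  using assms by (intro lborel.borel_measurable_nn_integral) (auto simp: split_beta' intro!: borel_measurable_times_ennreal)

lemma measurable_tent_avg:
  assumes "G \<in> borel_measurable (Rnt n)"
  shows "tent_avg k G \<in> borel_measurable (Rn n)"
proof -
  have "(\<lambda>(x, y). ind k x y * line_int (strip k) G y) \<in> borel_measurable (Rn n \<Otimes>\<^sub>M Rn n)"
    unfolding split_beta'
    using measurable_line_int[OF assms, of "strip k"] by (intro borel_measurable_times_ennreal measurable_ind) auto
  then have "(\<lambda>x. \<integral>\<^sup>+y. ind k x y * line_int (strip k) G y \<partial>Rn n) \<in> borel_measurable (Rn n)"
    by (rule Rn.borel_measurable_nn_integral)
  then show ?thesis unfolding tent_avg_def by (intro borel_measurable_times_ennreal) auto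
qed

lemma const_on_tent_avg: "const_on k (tent_avg k G)"
proof (rule const_on_cong)
  fix x y assume xy: "x \<in> space (Rn n)" "y \<in> space (Rn n)" "cubk k x = cubk k y"
  then have "ind k x z = ind k y z" for z by (simp add: indicator_def same_iff)
  then show "tent_avg k G x = tent_avg k G y" by (simp add: tent_avg_def)
qed

lemma nn_integral_tent_avg:
  assumes c: "const_on k c" "c \<in> borel_measurable (Rn n)" and G: "G \<in> borel_measurable (Rnt n)"
  shows "(\<integral>\<^sup>+x. c x * tent_avg k G x \<partial>Rn n) = (\<integral>\<^sup>+y. c y * line_int (strip k) G y \<partial>Rn n)"
proof -
  have mg: "line_int (strip k) G \<in> borel_measurable (Rn n)" by (rule measurable_line_int[OF G]) simp
  have "(\<lambda>(x, y). ind k x y * line_int (strip k) G y) \<in> borel_measurable (Rn n \<Otimes>\<^sub>M Rn n)"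
    unfolding split_beta' using mg by (intro borel_measurable_times_ennreal measurable_ind) auto
  then have m: "(\<lambda>x. \<integral>\<^sup>+y. ind k x y * line_int (strip k) G y \<partial>Rn n) \<in> borel_measurable (Rn n)"
    by (rule Rn.borel_measurable_nn_integral)
  have "(\<integral>\<^sup>+x. c x * tent_avg k G x \<partial>Rn n) = (\<integral>\<^sup>+x. ennreal (1 / vk k) * (c x * (\<integral>\<^sup>+y. ind k x y * line_int (strip k) G y \<partial>Rn n)) \<partial>Rn n)"
    by (intro nn_integral_cong) (simp add: tent_avg_def mult_ac)
  also have "\<dots> = ennreal (1 / vk k) * (ennreal (vk k) * (\<integral>\<^sup>+y. c y * line_int (strip k) G y \<partial>Rn n))"
    using c m by (simp add: nn_integral_cmult nn_integral_average[OF c mg])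
  also have "\<dots> = (\<integral>\<^sup>+y. c y * line_int (strip k) G y \<partial>Rn n)"
    using vk_pos[of k] by (simp add: mult.assoc[symmetric] ennreal_mult'[symmetric])
  finally show ?thesis .
qed

lemma line_int_sum_strips:
  assumes "finite S" "\<And>k. k \<in> S \<Longrightarrow> strip k \<subseteq> W" and G: "G \<in> borel_measurable (Rnt n)" and y: "y \<in> space (Rn n)"
  shows "(\<Sum>k\<in>S. line_int (strip k) G y) \<le> line_int W G y"
proof -
  have m: "(\<lambda>t. G (y, t)) \<in> borel_measurable lborel"
    using measurable_compose[OF measurable_Pair1'[OF y] G] by simp
  have "(\<Sum>k\<in>S. line_int (strip k) G y) = (\<integral>\<^sup>+t. (\<Sum>k\<in>S. indicator (strip k) t * G (y, t)) \<partial>lborel)"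
    unfolding line_int_def using m by (intro nn_integral_sum[symmetric] borel_measurable_times_ennreal) auto
  also have "\<dots> \<le> line_int W G y"
    unfolding line_int_def
  proof (intro nn_integral_mono)
    fix t :: real
    have "disjoint_family_on strip S" using strip_disjoint by (auto simp: disjoint_family_on_def)
    from indicator_UN_disjoint[OF assms(1) this, of t]
    have "(\<Sum>k\<in>S. indicator (strip k) t) = (indicator (\<Union>k\<in>S. strip k) t :: ennreal)"
      by (simp add: indicator_UN_disjoint assms(1) \<open>disjoint_family_on strip S\<close>)
    also have "\<dots> \<le> indicator W t" using assms(2) by (auto simp: indicator_def)
    finally show "(\<Sum>k\<in>S. indicator (strip k) t * G (y, t)) \<le> indicator W t * G (y, t)"
      unfolding sum_distrib_right[symmetric] by (intro mult_right_mono) auto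
  qed
  finally show ?thesis .
qed

lemma strip_subset: "k \<le> j \<Longrightarrow> strip k \<subseteq> {0<..2 powi j}"
  using power_int_increasing[of k j "2::real"] strip_pos[of _ k] by (auto simp: strip_def)

text \<open>The Carleson condition indexed by a point and a generation instead of a cube. The left
  side is the integral over the Carleson box of \<open>cubk k x\<close>, and \<open>M\<close>
  corresponds to the square of the constant in \<open>bmo_bound\<close>.\<close>

definition carleson :: "(point \<times> real \<Rightarrow> ennreal) \<Rightarrow> real \<Rightarrow> bool" where
  "carleson G M \<longleftrightarrow> (\<forall>x\<in>space (Rn n). \<forall>k. (\<integral>\<^sup>+y. ind k x y * line_int {0<..2 powi k} G y \<partial>Rn n) \<le> ennreal (M * vk k))"

text \<open>Multiplying the condition at \<open>x\<close> by \<open>c x\<close> and integrating adds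
  it up over all cubes of generation \<open>j\<close>; the factor \<open>vk j\<close> appears on
  both sides and cancels.\<close>

lemma nn_integral_carleson:
  assumes G: "G \<in> borel_measurable (Rnt n)" and car: "carleson G M" and M: "M \<ge> 0"
    and c: "const_on j c" "c \<in> borel_measurable (Rn n)"
  shows "(\<integral>\<^sup>+y. c y * line_int {0<..2 powi j} G y \<partial>Rn n) \<le> ennreal M * (\<integral>\<^sup>+x. c x \<partial>Rn n)"
proof -
  have mg: "line_int {0<..2 powi j} G \<in> borel_measurable (Rn n)" by (rule measurable_line_int[OF G]) simp
  let ?I = "\<integral>\<^sup>+y. c y * line_int {0<..2 powi j} G y \<partial>Rn n"
  have "ennreal (vk j) * ?I = (\<integral>\<^sup>+x. c x * (\<integral>\<^sup>+y. ind j x y * line_int {0<..2 powi j} G y \<partial>Rn n) \<partial>Rn n)"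
    by (rule nn_integral_average[OF c mg, symmetric])
  also have "\<dots> \<le> (\<integral>\<^sup>+x. c x * ennreal (M * vk j) \<partial>Rn n)"
    using car by (intro nn_integral_mono mult_left_mono) (auto simp: carleson_def)
  also have "\<dots> = ennreal (vk j) * (ennreal M * (\<integral>\<^sup>+x. c x \<partial>Rn n))"
    using c M vk_pos[of j] by (subst nn_integral_multc) (auto simp: ennreal_mult mult_ac less_imp_le)
  finally have *: "ennreal (vk j) * ?I \<le> ennreal (vk j) * (ennreal M * (\<integral>\<^sup>+x. c x \<partial>Rn n))" .
  have one: "ennreal (1 / vk j) * (ennreal (vk j) * z) = z" for z
    using vk_pos[of j] by (simp add: mult.assoc[symmetric] ennreal_mult'[symmetric])
  from mult_left_mono[OF *, of "ennreal (1 / vk j)"] show ?thesis by (simp only: one zero_le)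
qed

text \<open>A weight constant on cubes of generation \<open>j\<close> is constant on finer ones, so
  the averages of all generations up to \<open>j\<close> can be undone under it. The strips involved
  are disjoint and lie within the heights of the Carleson boxes of generation \<open>j\<close>, so
  no doubling constant appears.\<close>

lemma nn_integral_carleson_sum:
  assumes G: "G \<in> borel_measurable (Rnt n)" and car: "carleson G M" and M: "M \<ge> 0"
    and c: "const_on j c" "c \<in> borel_measurable (Rn n)" and S: "finite S" "\<And>k. k \<in> S \<Longrightarrow> k \<le> j"
  shows "(\<integral>\<^sup>+x. c x * (\<Sum>k\<in>S. tent_avg k G x) \<partial>Rn n) \<le> ennreal M * (\<integral>\<^sup>+x. c x \<partial>Rn n)"
proof -
  have mt: "tent_avg k G \<in> borel_measurable (Rn n)" for k by (rule measurable_tent_avg[OF G])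
  have mg: "line_int (strip k) G \<in> borel_measurable (Rn n)" for k by (rule measurable_line_int[OF G]) simp
  have "(\<integral>\<^sup>+x. c x * (\<Sum>k\<in>S. tent_avg k G x) \<partial>Rn n) = (\<Sum>k\<in>S. \<integral>\<^sup>+x. c x * tent_avg k G x \<partial>Rn n)"
    unfolding sum_distrib_left using c mt by (intro nn_integral_sum borel_measurable_times_ennreal) auto
  also have "\<dots> = (\<Sum>k\<in>S. \<integral>\<^sup>+y. c y * line_int (strip k) G y \<partial>Rn n)"
    by (intro sum.cong refl nn_integral_tent_avg const_on_antimono[OF c(1)] S(2) c(2) G)
  also have "\<dots> = (\<integral>\<^sup>+y. (\<Sum>k\<in>S. c y * line_int (strip k) G y) \<partial>Rn n)"
    using c mg by (intro nn_integral_sum[symmetric] borel_measurable_times_ennreal) auto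
  also have "\<dots> \<le> (\<integral>\<^sup>+y. c y * line_int {0<..2 powi j} G y \<partial>Rn n)"
    unfolding sum_distrib_left[symmetric]
    by (intro nn_integral_mono mult_left_mono line_int_sum_strips[OF S(1) _ G] strip_subset S(2)) auto
  also have "\<dots> \<le> ennreal M * (\<integral>\<^sup>+x. c x \<partial>Rn n)" by (rule nn_integral_carleson[OF G car M c])
  finally show ?thesis .
qed

end

section \<open>Duality of Carleson measures and tent averages\<close>

lemma ennsqrt_measurable: "ennsqrt \<in> borel_measurable borel"
  unfolding ennsqrt_def by measurable

lemma ennsqrt_mono: "a \<le> b \<Longrightarrow> ennsqrt a \<le> ennsqrt b"
  by (auto simp: ennsqrt_def top_unique less_top[symmetric] intro!: ennreal_leI real_sqrt_le_mono enn2real_mono)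

lemma ennreal_sqrt_le_ennsqrt: "ennreal (sqrt (enn2real a)) \<le> ennsqrt a"
  by (auto simp: ennsqrt_def)

lemma ennsqrt_less_top: "ennsqrt a < \<infinity> \<Longrightarrow> a < \<infinity>"
  by (auto simp: ennsqrt_def less_top split: if_splits)

lemma young_sqrt:
  assumes "p \<ge> 0" "q \<ge> 0" "l > (0::real)"
  shows "sqrt (p * q) \<le> l / 2 * q + 1 / (2 * l) * p"
proof -
  have "0 \<le> (sqrt (l * q) - sqrt (p / l))\<^sup>2" by simp
  also have "\<dots> = l * q + p / l - 2 * (sqrt (l * q) * sqrt (p / l))"
    using assms by (simp add: power2_diff)
  also have "sqrt (l * q) * sqrt (p / l) = sqrt (p * q)"
    using assms by (simp add: real_sqrt_mult[symmetric])
  finally show ?thesis by simp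
qed

text \<open>The discrete counterpart of the derivative of the square root. Dividing by the root at
  the larger end point gives the inequality this direction.\<close>

lemma increment_div_sqrt:
  fixes a S :: real
  assumes "a \<ge> 0" "S \<ge> 0" "S + a > 0"
  shows "a / sqrt (S + a) \<le> 2 * (sqrt (S + a) - sqrt S)"
proof -
  have "a = (sqrt (S + a))\<^sup>2 - (sqrt S)\<^sup>2" using assms by simp
  also have "\<dots> = (sqrt (S + a) - sqrt S) * (sqrt (S + a) + sqrt S)" by (simp add: power2_eq_square algebra_simps)
  also have "\<dots> \<le> (sqrt (S + a) - sqrt S) * (2 * sqrt (S + a))"
    using assms by (intro mult_left_mono) auto
  finally have "a \<le> 2 * (sqrt (S + a) - sqrt S) * sqrt (S + a)" by (simp only: mult_ac)
  then show ?thesis using assms by (subst pos_divide_le_eq) auto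
qed

context dyadic
begin

text \<open>The sum over all generations as a supremum of symmetric windows; its square root is the
  square function attached to \<open>G\<close>.\<close>

definition tent_total :: "(point \<times> real \<Rightarrow> ennreal) \<Rightarrow> point \<Rightarrow> ennreal" where
  "tent_total G x = (SUP K::nat. \<Sum>k\<in>{- int K..int K}. tent_avg k G x)"

lemma measurable_tent_total:
  "G \<in> borel_measurable (Rnt n) \<Longrightarrow> tent_total G \<in> borel_measurable (Rn n)"
  unfolding tent_total_def by (intro borel_measurable_SUP borel_measurable_sum measurable_tent_avg) auto

lemma line_int_add_cmult:
  assumes "G \<in> borel_measurable (Rnt n)" "H \<in> borel_measurable (Rnt n)"
    and y: "y \<in> space (Rn n)" and S: "S \<in> sets borel"
  shows "line_int S (\<lambda>p. a * G p + b * H p) y = a * line_int S G y + b * line_int S H y"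
proof -
  have m: "(\<lambda>t. G (y, t)) \<in> borel_measurable lborel" "(\<lambda>t. H (y, t)) \<in> borel_measurable lborel"
    using measurable_compose[OF measurable_Pair1'[OF y] assms(1)] measurable_compose[OF measurable_Pair1'[OF y] assms(2)] by simp_all
  have "line_int S (\<lambda>p. a * G p + b * H p) y = (\<integral>\<^sup>+t. a * (indicator S t * G (y, t)) + b * (indicator S t * H (y, t)) \<partial>lborel)"
    unfolding line_int_def by (intro nn_integral_cong) (simp add: algebra_simps)
  also have "\<dots> = a * line_int S G y + b * line_int S H y"
    unfolding line_int_def using m S
    by (subst nn_integral_add) (auto simp: nn_integral_cmult intro!: borel_measurable_times_ennreal)
  finally show ?thesis .
qed

lemma tent_avg_add_cmult:
  assumes G: "G \<in> borel_measurable (Rnt n)" and H: "H \<in> borel_measurable (Rnt n)"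
    and x: "x \<in> space (Rn n)"
  shows "tent_avg k (\<lambda>p. a * G p + b * H p) x = a * tent_avg k G x + b * tent_avg k H x"
proof -
  have mi: "(\<lambda>y. ind k x y) \<in> borel_measurable (Rn n)" using x by (intro measurable_ind) auto
  have mg: "line_int (strip k) G \<in> borel_measurable (Rn n)" "line_int (strip k) H \<in> borel_measurable (Rn n)"
    using measurable_line_int[OF G] measurable_line_int[OF H] by auto
  have "(\<integral>\<^sup>+y. ind k x y * line_int (strip k) (\<lambda>p. a * G p + b * H p) y \<partial>Rn n)
      = (\<integral>\<^sup>+y. a * (ind k x y * line_int (strip k) G y) + b * (ind k x y * line_int (strip k) H y) \<partial>Rn n)"
    by (intro nn_integral_cong) (simp add: line_int_add_cmult[OF G H] algebra_simps)
  also have "\<dots> = a * (\<integral>\<^sup>+y. ind k x y * line_int (strip k) G y \<partial>Rn n) + b * (\<integral>\<^sup>+y. ind k x y * line_int (strip k) H y \<partial>Rn n)"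
    using mi mg by (subst nn_integral_add) (auto simp: nn_integral_cmult intro!: borel_measurable_times_ennreal)
  finally show ?thesis unfolding tent_avg_def by (simp add: algebra_simps)
qed

lemma tent_avg_mono: "(\<And>p. G p \<le> H p) \<Longrightarrow> tent_avg k G x \<le> tent_avg k H x"
  unfolding tent_avg_def line_int_def by (intro mult_left_mono nn_integral_mono) auto

lemma carleson_tent_avg_le:
  assumes "carleson G M" "x \<in> space (Rn n)" "M \<ge> 0"
  shows "tent_avg k G x \<le> ennreal M"
proof -
  have "(\<integral>\<^sup>+y. ind k x y * line_int (strip k) G y \<partial>Rn n) \<le> (\<integral>\<^sup>+y. ind k x y * line_int {0<..2 powi k} G y \<partial>Rn n)"
    unfolding line_int_def using strip_subset[of k k]
    by (intro nn_integral_mono mult_left_mono mult_right_mono) (auto simp: indicator_def)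
  also have "\<dots> \<le> ennreal (M * vk k)" using assms unfolding carleson_def by auto
  finally have "tent_avg k G x \<le> ennreal (1 / vk k) * ennreal (M * vk k)"
    unfolding tent_avg_def by (intro mult_left_mono) auto
  also have "\<dots> = ennreal M" using vk_pos[of k] assms by (simp add: ennreal_mult'[symmetric])
  finally show ?thesis .
qed

context
  fixes P Q :: "point \<times> real \<Rightarrow> real" and C0 :: real
  assumes mP: "P \<in> borel_measurable (Rnt n)" and mQ: "Q \<in> borel_measurable (Rnt n)"
    and P0: "\<And>p. P p \<ge> 0" and Q0: "\<And>p. Q p \<ge> 0" and C0: "C0 > 0"
    and car: "carleson (\<lambda>p. ennreal (snd p * P p)) (C0\<^sup>2)"
begin

abbreviation "GP \<equiv> \<lambda>p. ennreal (snd p * P p)"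
abbreviation "GQ \<equiv> \<lambda>p. ennreal (snd p * Q p)"
abbreviation "GR \<equiv> \<lambda>p. ennreal (snd p * sqrt (P p * Q p))"

lemma mG: "GP \<in> borel_measurable (Rnt n)" "GQ \<in> borel_measurable (Rnt n)"
    "GR \<in> borel_measurable (Rnt n)"
  using mP mQ by measurable

lemma tent_avg_young:
  assumes "l > 0" "x \<in> space (Rn n)"
  shows "tent_avg k GR x \<le> ennreal (l / 2) * tent_avg k GQ x + ennreal (1 / (2 * l)) * tent_avg k GP x"
proof -
  have "GR p \<le> ennreal (l / 2) * GQ p + ennreal (1 / (2 * l)) * GP p" for p
  proof (cases "snd p > 0")
    case True
    have "snd p * sqrt (P p * Q p) \<le> snd p * (l / 2 * Q p + 1 / (2 * l) * P p)"
      using True young_sqrt[OF P0 Q0 assms(1), of p p] by (intro mult_left_mono) auto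
    also have "\<dots> = l / 2 * (snd p * Q p) + 1 / (2 * l) * (snd p * P p)" by (simp add: algebra_simps)
    finally have "GR p \<le> ennreal (l / 2 * (snd p * Q p) + 1 / (2 * l) * (snd p * P p))" by (rule ennreal_leI)
    also have "\<dots> = ennreal (l / 2) * GQ p + ennreal (1 / (2 * l)) * GP p"
      using True assms P0[of p] Q0[of p] by (subst ennreal_plus) (auto simp: ennreal_mult'[symmetric])
    finally show ?thesis .
  next
    case False
    have "snd p * sqrt (P p * Q p) \<le> 0" using False P0[of p] Q0[of p] by (intro mult_nonpos_nonneg) auto
    then show ?thesis by (simp add: ennreal_neg)
  qed
  then have "tent_avg k GR x \<le> tent_avg k (\<lambda>p. ennreal (l / 2) * GQ p + ennreal (1 / (2 * l)) * GP p) x"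
    by (rule tent_avg_mono)
  also have "\<dots> = ennreal (l / 2) * tent_avg k GQ x + ennreal (1 / (2 * l)) * tent_avg k GP x"
    by (rule tent_avg_add_cmult[OF mG(2,1) assms(2)])
  finally show ?thesis .
qed

text \<open>Where the average for \<open>Q\<close> vanishes, Young's inequality may be used with an
  arbitrarily large weight, while the average for \<open>P\<close> stays below the Carleson
  constant. This covers the points at which dividing by the square function would make no
  sense.\<close>

lemma tent_avg_zero:
  assumes "tent_avg k GQ x = 0" "x \<in> space (Rn n)"
  shows "tent_avg k GR x = 0"
proof -
  have "tent_avg k GR x \<le> ennreal e" if e: "e > 0" for e
  proof -
    have "tent_avg k GR x \<le> ennreal (1 / (2 * (C0\<^sup>2 / e))) * tent_avg k GP x"
      using tent_avg_young[of "C0\<^sup>2 / e" x k] assms C0 e by simp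
    also have "\<dots> \<le> ennreal (1 / (2 * (C0\<^sup>2 / e))) * ennreal (C0\<^sup>2)"
      using carleson_tent_avg_le[OF car assms(2)] by (intro mult_left_mono) auto
    also have "\<dots> \<le> ennreal e" using C0 e by (subst ennreal_mult'[symmetric]) (auto intro!: ennreal_leI)
    finally show ?thesis .
  qed
  then have "tent_avg k GR x \<le> 0 + ennreal e" if "e > 0" for e using that by simp
  then have "tent_avg k GR x \<le> 0" by (rule ennreal_le_epsilon)
  then show ?thesis by simp
qed

text \<open>The index \<open>i\<close> counts generations downwards from \<open>k0\<close>, so
  \<open>S i\<close> collects coarse cubes first. Finiteness almost everywhere makes the passage to
  real numbers faithful. Relative to \<open>C0 * r N\<close>, the increments of \<open>r\<close>
  contribute 1 and the Carleson part contributes 1/2.\<close>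

lemma carleson_duality_finite:
  fixes k0 :: int and N :: nat
  assumes fin: "AE x in Rn n. (\<Sum>i<N. tent_avg (k0 - int i) GQ x) < \<infinity>"
  shows "(\<integral>\<^sup>+x. (\<Sum>i<N. tent_avg (k0 - int i) GR x) \<partial>Rn n)
     \<le> ennreal (3 / 2 * C0) * (\<integral>\<^sup>+x. ennsqrt (\<Sum>i<N. tent_avg (k0 - int i) GQ x) \<partial>Rn n)"
proof -
  define \<alpha> where "\<alpha> i = tent_avg (k0 - int i) GQ" for i
  define \<beta> where "\<beta> i = tent_avg (k0 - int i) GP" for i
  define \<gamma> where "\<gamma> i = tent_avg (k0 - int i) GR" for i
  define S where "S i x = (\<Sum>j<i. \<alpha> j x)" for i x
  define r where "r i x = sqrt (enn2real (S i x))" for i x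
  define \<delta> where "\<delta> i x = r (Suc i) x - r i x" for i x
  have [measurable]: "\<alpha> i \<in> borel_measurable (Rn n)" "\<beta> i \<in> borel_measurable (Rn n)" "\<gamma> i \<in> borel_measurable (Rn n)" for i
    unfolding \<alpha>_def \<beta>_def \<gamma>_def by (rule measurable_tent_avg[OF mG(2)] measurable_tent_avg[OF mG(1)] measurable_tent_avg[OF mG(3)])+
  have [measurable]: "S i \<in> borel_measurable (Rn n)" for i unfolding S_def by measurable
  have [measurable]: "r i \<in> borel_measurable (Rn n)" for i unfolding r_def by measurable
  have [measurable]: "\<delta> i \<in> borel_measurable (Rn n)" for i unfolding \<delta>_def by measurable
  have S_mono: "S i x \<le> S j x" if "i \<le> j" for i j x
    unfolding S_def using that by (intro sum_mono2) auto
  \<comment> \<open>Young's inequality with weight \<open>C0 / r (Suc i)\<close>. The sum under the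
    root includes the current generation: either the root is positive and
    \<open>increment_div_sqrt\<close> applies, or the current average vanishes too.\<close>
  have key: "\<delta> i x \<ge> 0 \<and> \<gamma> i x \<le> ennreal (C0 * \<delta> i x) + ennreal (r (Suc i) x / (2 * C0)) * \<beta> i x"
    if x: "x \<in> space (Rn n)" and f: "S N x < \<infinity>" and i: "i < N" for i x
  proof -
    have f1: "S (Suc i) x < \<infinity>" using S_mono[of "Suc i" N x] i f by (auto intro: order_le_less_trans)
    then have fa: "\<alpha> i x < \<infinity>" "S i x < \<infinity>" by (auto simp: S_def)
    define a where "a = enn2real (\<alpha> i x)"
    define s where "s = enn2real (S i x)"
    have a: "a \<ge> 0" "\<alpha> i x = ennreal a" using fa by (auto simp: a_def)
    have s: "s \<ge> 0" by (simp add: s_def)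
    have e: "enn2real (S (Suc i) x) = s + a"
      using fa by (simp add: S_def s_def a_def enn2real_plus)
    have r: "r (Suc i) x = sqrt (s + a)" "r i x = sqrt s" by (simp_all add: r_def e s_def)
    have d0: "\<delta> i x \<ge> 0" using a by (simp add: \<delta>_def r)
    moreover have "\<gamma> i x \<le> ennreal (C0 * \<delta> i x) + ennreal (r (Suc i) x / (2 * C0)) * \<beta> i x"
    proof (cases "s + a > 0")
      case False
      then have "a = 0" using a s by linarith
      then have "\<gamma> i x = 0" unfolding \<gamma>_def using a x by (intro tent_avg_zero) (auto simp: \<alpha>_def)
      then show ?thesis by simp
    next
      case True
      define q where "q = r (Suc i) x"
      have q: "q > 0" using True by (simp add: q_def r)
      have "\<gamma> i x \<le> ennreal (C0 / q / 2) * \<alpha> i x + ennreal (1 / (2 * (C0 / q))) * \<beta> i x"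
        unfolding \<alpha>_def \<beta>_def \<gamma>_def by (rule tent_avg_young) (use C0 q x in auto)
      also have "ennreal (C0 / q / 2) * \<alpha> i x \<le> ennreal (C0 * \<delta> i x)"
      proof -
        have "C0 / q / 2 * a = C0 / 2 * (a / sqrt (s + a))" by (simp add: q_def r)
        also have "\<dots> \<le> C0 / 2 * (2 * (sqrt (s + a) - sqrt s))"
          using C0 increment_div_sqrt[OF a(1) s True] by (intro mult_left_mono) auto
        also have "\<dots> = C0 * \<delta> i x" by (simp add: \<delta>_def r)
        finally show ?thesis using C0 q unfolding a(2) by (subst ennreal_mult'[symmetric]) (auto intro!: ennreal_leI)
      qed
      also have "1 / (2 * (C0 / q)) = q / (2 * C0)" by simp
      finally show ?thesis by (simp add: q_def add_right_mono)
    qed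
    ultimately show ?thesis by blast
  qed
  have tel: "r i x = (\<Sum>j<i. \<delta> j x)" for i x
  proof -
    have "(\<Sum>j<i. \<delta> j x) = r i x - r 0 x" unfolding \<delta>_def by (rule sum_lessThan_telescope)
    then show ?thesis by (simp add: r_def S_def)
  qed
  have fin': "AE x in Rn n. S N x < \<infinity>" using fin by (simp add: S_def \<alpha>_def)
  have pw: "AE x in Rn n. (\<Sum>i<N. \<gamma> i x) \<le> ennreal (C0 * r N x) + (\<Sum>j<N. ennreal (\<delta> j x / (2 * C0)) * (\<Sum>i\<in>{j..<N}. \<beta> i x))"
    using fin' AE_space
  proof eventually_elim
    case (elim x)
    have d: "\<delta> i x \<ge> 0" if "i < N" for i using key[OF elim(2,1) that] by blast
    have "(\<Sum>i<N. \<gamma> i x) \<le> (\<Sum>i<N. ennreal (C0 * \<delta> i x) + ennreal (r (Suc i) x / (2 * C0)) * \<beta> i x)"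
      using key[OF elim(2,1)] by (intro sum_mono) auto
    also have "\<dots> = (\<Sum>i<N. ennreal (C0 * \<delta> i x)) + (\<Sum>i<N. ennreal (r (Suc i) x / (2 * C0)) * \<beta> i x)"
      by (rule sum.distrib)
    also have "(\<Sum>i<N. ennreal (C0 * \<delta> i x)) = ennreal (C0 * r N x)"
      using d C0 unfolding tel[of N x] sum_distrib_left by (intro sum_ennreal) auto
    \<comment> \<open>Summation by parts: \<open>r (Suc i)\<close> is the sum of the increments up
      to index \<open>i\<close>, and interchanging the sums leaves each \<open>\<delta> j\<close>
      multiplied by all averages of generation \<open>k0 - j\<close> and finer.\<close>
    also have "(\<Sum>i<N. ennreal (r (Suc i) x / (2 * C0)) * \<beta> i x) = (\<Sum>i<N. \<Sum>j<N. if j \<le> i then ennreal (\<delta> j x / (2 * C0)) * \<beta> i x else 0)"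
    proof (rule sum.cong[OF refl])
      fix i assume i: "i \<in> {..<N}"
      have "ennreal (r (Suc i) x / (2 * C0)) = (\<Sum>j<Suc i. ennreal (\<delta> j x / (2 * C0)))"
        unfolding tel[of "Suc i" x] sum_divide_distrib using d C0 i by (intro sum_ennreal[symmetric]) auto
      then have "ennreal (r (Suc i) x / (2 * C0)) * \<beta> i x = (\<Sum>j<Suc i. ennreal (\<delta> j x / (2 * C0)) * \<beta> i x)"
        by (simp only: sum_distrib_right)
      also have "\<dots> = (\<Sum>j<N. if j \<le> i then ennreal (\<delta> j x / (2 * C0)) * \<beta> i x else 0)"
        using i by (intro sum.mono_neutral_cong_left) auto
      finally show "ennreal (r (Suc i) x / (2 * C0)) * \<beta> i x = (\<Sum>j<N. if j \<le> i then ennreal (\<delta> j x / (2 * C0)) * \<beta> i x else 0)" .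
    qed
    also have "\<dots> = (\<Sum>j<N. \<Sum>i<N. if j \<le> i then ennreal (\<delta> j x / (2 * C0)) * \<beta> i x else 0)" by (rule sum.swap)
    also have "\<dots> = (\<Sum>j<N. ennreal (\<delta> j x / (2 * C0)) * (\<Sum>i\<in>{j..<N}. \<beta> i x))"
      unfolding sum_distrib_left by (intro sum.cong refl sum.mono_neutral_cong_right) auto
    finally show ?case .
  qed
  have "(\<integral>\<^sup>+x. (\<Sum>i<N. \<gamma> i x) \<partial>Rn n) \<le> (\<integral>\<^sup>+x. ennreal (C0 * r N x) + (\<Sum>j<N. ennreal (\<delta> j x / (2 * C0)) * (\<Sum>i\<in>{j..<N}. \<beta> i x)) \<partial>Rn n)"
    by (rule nn_integral_mono_AE[OF pw])
  also have "\<dots> = (\<integral>\<^sup>+x. ennreal (C0 * r N x) \<partial>Rn n) + (\<Sum>j<N. \<integral>\<^sup>+x. ennreal (\<delta> j x / (2 * C0)) * (\<Sum>i\<in>{j..<N}. \<beta> i x) \<partial>Rn n)"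
    by (subst nn_integral_add) (auto simp: nn_integral_sum)
  also have "(\<Sum>j<N. \<integral>\<^sup>+x. ennreal (\<delta> j x / (2 * C0)) * (\<Sum>i\<in>{j..<N}. \<beta> i x) \<partial>Rn n) \<le> (\<Sum>j<N. ennreal (C0\<^sup>2) * (\<integral>\<^sup>+x. ennreal (\<delta> j x / (2 * C0)) \<partial>Rn n))"
  proof (rule sum_mono)
    fix j assume "j \<in> {..<N}"
    \<comment> \<open>\<open>\<delta> j\<close> involves only the averages of the generations from
      \<open>k0\<close> down to \<open>k0 - j\<close>, so it is an admissible weight for the
      Carleson sum over generations at most \<open>k0 - j\<close>.\<close>
    have "const_on (k0 - int j) (\<lambda>x. ennreal (\<delta> j x / (2 * C0)))"
      unfolding const_on_def
    proof (intro ballI)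
      fix x y assume xy: "x \<in> space (Rn n)" "y \<in> cubk (k0 - int j) x"
      have "\<alpha> i y = \<alpha> i x" if "i \<le> j" for i
      proof -
        have "const_on (k0 - int j) (\<alpha> i)"
          unfolding \<alpha>_def by (rule const_on_antimono[OF const_on_tent_avg]) (use that in simp)
        then show ?thesis using xy unfolding const_on_def by blast
      qed
      then have "S (Suc j) y = S (Suc j) x" "S j y = S j x" unfolding S_def by (auto intro!: sum.cong)
      then show "ennreal (\<delta> j y / (2 * C0)) = ennreal (\<delta> j x / (2 * C0))" by (simp add: \<delta>_def r_def)
    qed
    then have "(\<integral>\<^sup>+x. ennreal (\<delta> j x / (2 * C0)) * (\<Sum>k\<in>(\<lambda>i. k0 - int i) ` {j..<N}. tent_avg k GP x) \<partial>Rn n)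
      \<le> ennreal (C0\<^sup>2) * (\<integral>\<^sup>+x. ennreal (\<delta> j x / (2 * C0)) \<partial>Rn n)"
      by (intro nn_integral_carleson_sum[OF mG(1) car]) auto
    moreover have "(\<Sum>k\<in>(\<lambda>i. k0 - int i) ` {j..<N}. tent_avg k GP x) = (\<Sum>i\<in>{j..<N}. \<beta> i x)" for x
      by (subst sum.reindex) (auto simp: inj_on_def \<beta>_def)
    ultimately show "(\<integral>\<^sup>+x. ennreal (\<delta> j x / (2 * C0)) * (\<Sum>i\<in>{j..<N}. \<beta> i x) \<partial>Rn n) \<le> ennreal (C0\<^sup>2) * (\<integral>\<^sup>+x. ennreal (\<delta> j x / (2 * C0)) \<partial>Rn n)"
      by simp
  qed
  also have "(\<Sum>j<N. ennreal (C0\<^sup>2) * (\<integral>\<^sup>+x. ennreal (\<delta> j x / (2 * C0)) \<partial>Rn n)) = (\<integral>\<^sup>+x. (\<Sum>j<N. ennreal (C0\<^sup>2) * ennreal (\<delta> j x / (2 * C0))) \<partial>Rn n)"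
    by (subst nn_integral_sum) (auto simp: nn_integral_cmult)
  \<comment> \<open>The square of \<open>C0\<close> over \<open>2 * C0\<close> is the
    \<open>C0 / 2\<close> of the constant, and the increments add up to \<open>r N\<close> once
    more.\<close>
  also have "\<dots> = (\<integral>\<^sup>+x. ennreal (C0 / 2 * r N x) \<partial>Rn n)"
  proof (rule nn_integral_cong_AE)
    show "AE x in Rn n. (\<Sum>j<N. ennreal (C0\<^sup>2) * ennreal (\<delta> j x / (2 * C0))) = ennreal (C0 / 2 * r N x)"
      using fin' AE_space
    proof eventually_elim
      case (elim x)
      have d: "\<delta> i x \<ge> 0" if "i < N" for i using key[OF elim(2,1) that] by blast
      have "(\<Sum>j<N. ennreal (C0\<^sup>2) * ennreal (\<delta> j x / (2 * C0))) = (\<Sum>j<N. ennreal (C0 / 2 * \<delta> j x))"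
        using C0 d by (intro sum.cong refl) (simp add: ennreal_mult'[symmetric] power2_eq_square)
      also have "\<dots> = ennreal (C0 / 2 * r N x)"
        using d C0 unfolding tel[of N x] sum_distrib_left by (intro sum_ennreal) auto
      finally show ?case .
    qed
  qed
  finally have "(\<integral>\<^sup>+x. (\<Sum>i<N. \<gamma> i x) \<partial>Rn n) \<le> (\<integral>\<^sup>+x. ennreal (C0 * r N x) \<partial>Rn n) + (\<integral>\<^sup>+x. ennreal (C0 / 2 * r N x) \<partial>Rn n)"
    by (simp add: add_left_mono)
  also have "\<dots> = (\<integral>\<^sup>+x. ennreal (3 / 2 * C0) * ennreal (r N x) \<partial>Rn n)"
    by (subst nn_integral_add[symmetric]) (use C0 in \<open>auto simp: ennreal_mult'[symmetric] r_def ennreal_plus[symmetric] intro!: nn_integral_cong simp del: ennreal_plus\<close>)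
  also have "\<dots> = ennreal (3 / 2 * C0) * (\<integral>\<^sup>+x. ennreal (r N x) \<partial>Rn n)" by (rule nn_integral_cmult) simp
  also have "\<dots> \<le> ennreal (3 / 2 * C0) * (\<integral>\<^sup>+x. ennsqrt (S N x) \<partial>Rn n)"
    unfolding r_def by (intro mult_left_mono nn_integral_mono ennreal_sqrt_le_ennsqrt) auto
  finally show ?thesis by (simp add: \<gamma>_def S_def \<alpha>_def)
qed

text \<open>The generations are exhausted by the windows from \<open>- int K\<close> to
  \<open>int K\<close>, which are \<open>2 * K + 1\<close> generations counted down from
  \<open>int K\<close>. If the right side is finite, the square function is finite almost
  everywhere, as the finite version requires; monotone convergence does the rest.\<close>

theorem carleson_duality:
  "(\<integral>\<^sup>+p. indicator {0<..} (snd p) * GR p \<partial>(Rnt n))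
     \<le> ennreal (3 / 2 * C0) * (\<integral>\<^sup>+x. ennsqrt (tent_total GQ x) \<partial>Rn n)"
proof (cases "(\<integral>\<^sup>+x. ennsqrt (tent_total GQ x) \<partial>Rn n) = \<infinity>")
  case True
  then show ?thesis using C0 by (simp add: ennreal_mult_top)
next
  case False
  have mt: "(\<lambda>x. ennsqrt (tent_total GQ x)) \<in> borel_measurable (Rn n)"
    by (rule measurable_compose[OF measurable_tent_total[OF mG(2)] ennsqrt_measurable])
  have "AE x in Rn n. ennsqrt (tent_total GQ x) \<noteq> \<infinity>" by (rule nn_integral_PInf_AE[OF mt False])
  then have fin: "AE x in Rn n. tent_total GQ x < \<infinity>"
    by eventually_elim (rule ennsqrt_less_top, simp add: less_top)
  define F where "F K p = (\<Sum>k\<in>{- int K..int K}. indicator (strip k) (snd p) * GR p)" for K :: nat and p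
  have re: "(\<Sum>k\<in>{- int K..int K}. h k) = (\<Sum>i<2 * K + 1. h (int K - int i))" for K and h :: "int \<Rightarrow> ennreal"
    by (rule sum.reindex_bij_witness[of _ "\<lambda>i. int K - int i" "\<lambda>k. nat (int K - k)"]) auto
  have le: "(\<Sum>k\<in>{- int K..int K}. tent_avg k GQ x) \<le> tent_total GQ x" for K x
    unfolding tent_total_def by (rule SUP_upper) simp
  have le': "(\<Sum>i<2 * K + 1. tent_avg (int K - int i) GQ x) \<le> tent_total GQ x" for K x
    using le[of x K] by (simp only: re)
  have bound: "(\<integral>\<^sup>+p. F K p \<partial>(Rnt n)) \<le> ennreal (3 / 2 * C0) * (\<integral>\<^sup>+x. ennsqrt (tent_total GQ x) \<partial>Rn n)" for K
  proof -
    have ms: "(\<lambda>p. indicator (strip k) (snd p) * GR p) \<in> borel_measurable (Rnt n)" for k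
      using mG(3) by (intro borel_measurable_times_ennreal) auto
    have "(\<integral>\<^sup>+p. F K p \<partial>(Rnt n)) = (\<Sum>k\<in>{- int K..int K}. \<integral>\<^sup>+p. indicator (strip k) (snd p) * GR p \<partial>(Rnt n))"
      unfolding F_def by (rule nn_integral_sum[OF ms])
    also have "\<dots> = (\<Sum>k\<in>{- int K..int K}. \<integral>\<^sup>+x. tent_avg k GR x \<partial>Rn n)"
    proof (rule sum.cong[OF refl])
      fix k
      have "(\<integral>\<^sup>+p. indicator (strip k) (snd p) * GR p \<partial>(Rnt n)) = (\<integral>\<^sup>+y. line_int (strip k) GR y \<partial>Rn n)"
        unfolding line_int_def by (subst lborel.nn_integral_fst[OF ms, symmetric]) simp
      also have "\<dots> = (\<integral>\<^sup>+x. tent_avg k GR x \<partial>Rn n)"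
        using nn_integral_tent_avg[of k "\<lambda>_. 1" GR] mG(3) by (simp add: const_on_def)
      finally show "(\<integral>\<^sup>+p. indicator (strip k) (snd p) * GR p \<partial>(Rnt n)) = (\<integral>\<^sup>+x. tent_avg k GR x \<partial>Rn n)" .
    qed
    also have "\<dots> = (\<integral>\<^sup>+x. (\<Sum>k\<in>{- int K..int K}. tent_avg k GR x) \<partial>Rn n)"
      by (rule nn_integral_sum[OF measurable_tent_avg[OF mG(3)], symmetric])
    also have "\<dots> = (\<integral>\<^sup>+x. (\<Sum>i<2 * K + 1. tent_avg (int K - int i) GR x) \<partial>Rn n)" by (simp only: re)
    also have "\<dots> \<le> ennreal (3 / 2 * C0) * (\<integral>\<^sup>+x. ennsqrt (\<Sum>i<2 * K + 1. tent_avg (int K - int i) GQ x) \<partial>Rn n)"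
    proof (rule carleson_duality_finite)
      show "AE x in Rn n. (\<Sum>i<2 * K + 1. tent_avg (int K - int i) GQ x) < \<infinity>"
        using fin by eventually_elim (rule order_le_less_trans[OF le'])
    qed
    also have "\<dots> \<le> ennreal (3 / 2 * C0) * (\<integral>\<^sup>+x. ennsqrt (tent_total GQ x) \<partial>Rn n)"
      by (intro mult_left_mono nn_integral_mono ennsqrt_mono le') auto
    finally show ?thesis .
  qed
  have sup: "indicator {0<..} (snd p) * GR p = (SUP K. F K p)" for p
  proof (cases "snd p > 0")
    case True
    then obtain k where k: "snd p \<in> strip k" using ex_strip by blast
    have Fv: "F K p = (if k \<in> {- int K..int K} then GR p else 0)" for K
    proof -
      have "F K p = (\<Sum>j\<in>{- int K..int K}. if j = k then GR p else 0)"
        unfolding F_def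
      proof (rule sum.cong[OF refl])
        fix j
        show "indicator (strip j) (snd p) * GR p = (if j = k then GR p else 0)"
        proof (cases "j = k")
          case False
          then have "snd p \<notin> strip j" using strip_disjoint k by blast
          then show ?thesis using False by simp
        qed (use k in simp)
      qed
      then show ?thesis by (simp add: sum.delta)
    qed
    have "(SUP K. F K p) = GR p"
    proof (rule antisym)
      show "(SUP K. F K p) \<le> GR p" by (intro SUP_least) (simp add: Fv)
      have "k \<in> {- int (nat \<bar>k\<bar>)..int (nat \<bar>k\<bar>)}" by (auto simp: abs_if)
      then have "GR p = F (nat \<bar>k\<bar>) p" by (simp only: Fv if_True)
      also have "\<dots> \<le> (SUP K. F K p)" by (intro SUP_upper) simp
      finally show "GR p \<le> (SUP K. F K p)" .
    qed
    then show ?thesis using True by simp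
  next
    case False
    then have "snd p \<notin> strip k" for k using strip_pos by blast
    then have "F K p = 0" for K unfolding F_def by simp
    then show ?thesis using False by simp
  qed
  have "(\<integral>\<^sup>+p. indicator {0<..} (snd p) * GR p \<partial>(Rnt n)) = (SUP K. \<integral>\<^sup>+p. F K p \<partial>(Rnt n))"
    unfolding sup
  proof (rule nn_integral_monotone_convergence_SUP)
    show "incseq F"
      unfolding incseq_def le_fun_def F_def by (intro allI impI sum_mono2) auto
    show "F K \<in> borel_measurable (Rnt n)" for K
      unfolding F_def using mG(3) by (intro borel_measurable_sum borel_measurable_times_ennreal) auto
  qed
  also have "\<dots> \<le> ennreal (3 / 2 * C0) * (\<integral>\<^sup>+x. ennsqrt (tent_total GQ x) \<partial>Rn n)"
    by (intro SUP_least bound)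
  finally show ?thesis .
qed

end

end

section \<open>Gradients of harmonic extensions\<close>

text \<open>The energy density of the extension with derivatives given by integral kernels, which
  makes measurability and bounds available; \<open>grad_sq\<close> is identified with it at positive
  heights.\<close>

definition gsq :: "nat \<Rightarrow> (point \<Rightarrow> real) \<Rightarrow> point \<times> real \<Rightarrow> real" where
  "gsq n f p = (\<Sum>i\<le>n. (U1 n f i ((fst p)(n := snd p)))\<^sup>2)"

lemma gsq_nonneg: "gsq n f p \<ge> 0"
  by (simp add: gsq_def sum_nonneg)

lemma U1_le_sqrt_gsq: "i \<le> n \<Longrightarrow> \<bar>U1 n f i ((fst p)(n := snd p))\<bar> \<le> sqrt (gsq n f p)"
  unfolding gsq_def by (rule real_le_rsqrt, simp) (rule member_le_sum, auto)

lemma U1_measurable: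
  assumes "f \<in> borel_measurable (Rn n)" "i \<le> n"
  shows "(\<lambda>p. U1 n f i ((fst p)(n := snd p))) \<in> borel_measurable (Rnt n)"
  unfolding U1_def using assms by (intro measurable_half_space_integral measurable_pk1) auto

lemma gsq_measurable:
  assumes "f \<in> borel_measurable (Rn n)"
  shows "gsq n f \<in> borel_measurable (Rnt n)"
proof -
  have "(\<lambda>p. gsq n f p) \<in> borel_measurable (Rnt n)"
    unfolding gsq_def using assms by (intro borel_measurable_sum borel_measurable_power U1_measurable) auto
  then show ?thesis by simp
qed

lemma harmonic_ext_eq_U: "harmonic_ext n f y t = U n f (y(n := t))"
proof -
  have "poisson_kernel n t (\<lambda>i. y i - z i) = pk n (sh n (y(n := t)) z)" for z
    unfolding poisson_kernel_def pk_def
    by (simp add: ssq_split pc_def pm_def powr_minus_divide) (simp add: sh_def)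
  then show ?thesis by (simp add: harmonic_ext_def U_def)
qed

lemma grad_sq_eq_gsq:
  assumes "n \<ge> 1" "integrable (Rn n) f" "t > 0"
  shows "grad_sq n f y t = gsq n f (y, t)"
proof -
  interpret nice_harmonic n "U n f" "U1 n f" "U2 n f" "\<lambda>X. pC n * U n (\<lambda>z. \<bar>f z\<bar>) X" "pC n * (1 + pc n) * (\<integral>z. \<bar>f z\<bar> \<partial>Rn n)"
    by (rule nice_harmonic_U[OF assms(1,2)])
  have "deriv (\<lambda>s. harmonic_ext n f (y(i := s)) t) (y i) = U1 n f i (y(n := t))" if i: "i < n" for i
  proof (rule DERIV_imp_deriv)
    have "((\<lambda>s. U n f ((y(n := t))(i := s))) has_real_derivative U1 n f i (y(n := t))) (at ((y(n := t)) i))"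
      by (rule D1) (use i assms in auto)
    then have "((\<lambda>s. U n f ((y(i := s))(n := t))) has_real_derivative U1 n f i (y(n := t))) (at (y i))"
      using i by (subst fun_upd_twist) auto
    then show "((\<lambda>s. harmonic_ext n f (y(i := s)) t) has_real_derivative U1 n f i (y(n := t))) (at (y i))"
      by (simp only: harmonic_ext_eq_U)
  qed
  moreover have "deriv (\<lambda>s. harmonic_ext n f y s) t = U1 n f n (y(n := t))"
  proof (rule DERIV_imp_deriv)
    have "((\<lambda>s. U n f (y(n := s))) has_real_derivative U1 n f n (y(n := t))) (at t)"
      by (rule D1') (use assms in auto)
    then show "((\<lambda>s. harmonic_ext n f y s) has_real_derivative U1 n f n (y(n := t))) (at t)"
      by (simp only: harmonic_ext_eq_U)
  qed
  ultimately show ?thesis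
    by (simp add: grad_sq_def gsq_def lessThan_Suc_atMost[symmetric])
qed

text \<open>Moving the base point by at most the height in each coordinate changes the squared
  distance at most by the factor \<open>2 * n + 2\<close>. So a Poisson weight varies by a bounded
  factor on a dyadic cube whose side is at most its height.\<close>

lemma ssq_sh_harnack:
  assumes X: "X n > 0" and d: "\<And>i. i < n \<Longrightarrow> \<bar>y i - y' i\<bar> \<le> X n" and e: "e \<ge> 0"
  shows "ssq n (sh n X y) powr (- e) \<le> (2 * real n + 2) powr e * ssq n (sh n X y') powr (- e)"
proof -
  have p: "ssq n (sh n X z) > 0" for z using X by (intro ssq_pos) auto
  have "(\<Sum>i<n. (X i - y' i)\<^sup>2) \<le> (\<Sum>i<n. 2 * (X i - y i)\<^sup>2 + 2 * (X n)\<^sup>2)"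
  proof (rule sum_mono)
    fix i assume "i \<in> {..<n}"
    then have "(y i - y' i)\<^sup>2 \<le> (X n)\<^sup>2" using d[of i] X by (simp add: abs_le_square_iff[symmetric])
    moreover have "(X i - y' i)\<^sup>2 \<le> 2 * (X i - y i)\<^sup>2 + 2 * (y i - y' i)\<^sup>2"
      using sum_squares_bound[of "X i - y i" "y i - y' i"] by (simp add: power2_eq_square algebra_simps)
    ultimately show "(X i - y' i)\<^sup>2 \<le> 2 * (X i - y i)\<^sup>2 + 2 * (X n)\<^sup>2" by linarith
  qed
  also have "\<dots> = 2 * (\<Sum>i<n. (X i - y i)\<^sup>2) + 2 * real n * (X n)\<^sup>2"
    by (simp add: sum.distrib sum_distrib_left)
  finally have le: "(\<Sum>i<n. (X i - y' i)\<^sup>2) \<le> 2 * (\<Sum>i<n. (X i - y i)\<^sup>2) + 2 * real n * (X n)\<^sup>2" .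
  have "ssq n (sh n X y') = (X n)\<^sup>2 + (\<Sum>i<n. (X i - y' i)\<^sup>2)"
    by (simp add: ssq_split) (simp add: sh_def)
  with le zero_le_power2[of "X n"]
  have "ssq n (sh n X y') \<le> (2 * real n + 2) * (X n)\<^sup>2 + 2 * (\<Sum>i<n. (X i - y i)\<^sup>2)"
    unfolding distrib_right by linarith
  also have "\<dots> \<le> (2 * real n + 2) * (X n)\<^sup>2 + (2 * real n + 2) * (\<Sum>i<n. (X i - y i)\<^sup>2)"
    by (intro add_left_mono mult_right_mono) (auto simp: sum_nonneg)
  also have "\<dots> = (2 * real n + 2) * ssq n (sh n X y)"
    by (simp add: ssq_split) (simp add: sh_def algebra_simps)
  finally have "((2 * real n + 2) * ssq n (sh n X y)) powr (- e) \<le> ssq n (sh n X y') powr (- e)"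
    using p e by (intro powr_mono2') auto
  then have "(2 * real n + 2) powr (- e) * ssq n (sh n X y) powr (- e) \<le> ssq n (sh n X y') powr (- e)"
    using p[of y] by (simp add: powr_mult)
  then have "(2 * real n + 2) powr e * ((2 * real n + 2) powr (- e) * ssq n (sh n X y) powr (- e)) \<le> (2 * real n + 2) powr e * ssq n (sh n X y') powr (- e)"
    by (intro mult_left_mono) auto
  moreover have "(2 * real n + 2) powr e * (2 * real n + 2) powr (- e) = 1"
    by (subst powr_mult_powr[of _ _ 0]) auto
  ultimately show ?thesis by (simp add: mult.assoc[symmetric])
qed

text \<open>Moving one coordinate by at most half the height reduces the distance to the origin at
  most by half: if the height itself moves, it keeps half of its value; otherwise the unchanged
  height absorbs the displacement.\<close>

lemma ssq_fun_upd_lower: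
  assumes j: "j \<le> n" and Z: "Z n > 0" and x: "\<bar>\<xi> - Z j\<bar> \<le> Z n / 2"
  shows "ssq n Z / 4 \<le> ssq n (Z(j := \<xi>))"
proof -
  define R where "R = (\<Sum>i\<in>{..n} - {j}. (Z i)\<^sup>2)"
  have R: "R \<ge> 0" by (simp add: R_def sum_nonneg)
  have s: "ssq n (Z(j := \<xi>)) = R + \<xi>\<^sup>2" by (simp add: ssq_fun_upd[OF j] R_def)
  have s0: "ssq n Z = R + (Z j)\<^sup>2" using ssq_fun_upd[OF j, of Z "Z j"] by (simp add: R_def)
  show ?thesis
  proof (cases "j = n")
    case True
    have "Z n / 2 \<le> \<xi>" using x Z True by (auto simp: abs_if split: if_splits)
    then have "(Z n / 2)\<^sup>2 \<le> \<xi>\<^sup>2" using Z by (intro power_mono) auto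
    then show ?thesis unfolding s s0 using R by (simp add: True power_divide)
  next
    case False
    have "(Z n)\<^sup>2 \<le> R" unfolding R_def using False by (intro member_le_sum) auto
    moreover have "(Z j)\<^sup>2 \<le> 2 * \<xi>\<^sup>2 + 2 * (\<xi> - Z j)\<^sup>2"
      using sum_squares_bound[of \<xi> "Z j - \<xi>"] by (simp add: power2_eq_square algebra_simps)
    moreover have "(\<xi> - Z j)\<^sup>2 \<le> (Z n / 2)\<^sup>2" using x Z by (simp add: abs_le_square_iff[symmetric])
    then have "(\<xi> - Z j)\<^sup>2 \<le> (Z n)\<^sup>2 / 4" by (simp add: power_divide)
    ultimately have "(Z j)\<^sup>2 \<le> 2 * \<xi>\<^sup>2 + R / 2" by linarith
    moreover have "r + z \<le> 4 * (r + x)" if "z \<le> 2 * x + r / 2" "0 \<le> r" "0 \<le> x" for r x z :: real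
      using that by simp
    ultimately have "R + (Z j)\<^sup>2 \<le> 4 * (R + \<xi>\<^sup>2)" using R zero_le_power2[of \<xi>] by blast
    then show ?thesis unfolding s s0 by simp
  qed
qed

lemma pk1_lipschitz:
  assumes i: "i \<le> n" and j: "j \<le> n" and Z: "Z n > 0" and h: "\<bar>h\<bar> \<le> Z n / 2"
  shows "\<bar>pk1 n i (Z(j := Z j + h)) - pk1 n i Z\<bar>
     \<le> \<bar>h\<bar> * (pc n * pC n * 4 powr (pm n + 1/2) * ssq n Z powr (- pm n - 1/2))"
proof -
  define K where "K = pc n * pC n * 4 powr (pm n + 1/2) * ssq n Z powr (- pm n - 1/2)"
  have sZ: "ssq n Z > 0" using Z by (intro ssq_pos) auto
  define S where "S = {\<xi>. \<bar>\<xi> - Z j\<bar> \<le> Z n / 2}"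
  have S: "S = cball (Z j) (Z n / 2)" by (auto simp: S_def dist_real_def abs_minus_commute)
  have "norm (pk1 n i (Z(j := Z j + h)) - pk1 n i (Z(j := Z j))) \<le> K * norm (Z j + h - Z j)"
  proof (rule field_differentiable_bound[of S "\<lambda>\<xi>. pk1 n i (Z(j := \<xi>))" "\<lambda>\<xi>. pk2 n i j (Z(j := \<xi>))"])
    show "convex S" unfolding S by simp
    fix \<xi> assume x: "\<xi> \<in> S"
    have low: "ssq n Z / 4 \<le> ssq n (Z(j := \<xi>))" using x Z by (intro ssq_fun_upd_lower[OF j]) (simp_all add: S_def)
    then have pos: "ssq n (Z(j := \<xi>)) > 0" using sZ by linarith
    show "((\<lambda>\<xi>. pk1 n i (Z(j := \<xi>))) has_field_derivative pk2 n i j (Z(j := \<xi>))) (at \<xi> within S)"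
      by (rule has_field_derivative_at_within[OF DERIV_pk1[OF j pos]])
    have "ssq n (Z(j := \<xi>)) powr (- pm n - 1/2) \<le> (ssq n Z / 4) powr (- pm n - 1/2)"
      using low sZ pm_pos[of n] by (intro powr_mono2') auto
    also have "\<dots> = 4 powr (pm n + 1/2) * ssq n Z powr (- pm n - 1/2)"
    proof -
      have e: "- pm n - 1/2 = - (pm n + 1/2)" by simp
      show ?thesis unfolding e using sZ by (simp only: powr_divide powr_minus_divide) simp
    qed
    finally have "pc n * pC n * ssq n (Z(j := \<xi>)) powr (- pm n - 1/2) \<le> K"
      unfolding K_def mult.assoc using pc_pos[of n] pC_ge_1[of n] by (intro mult_left_mono) auto
    then show "norm (pk2 n i j (Z(j := \<xi>))) \<le> K" using abs_pk2_le[OF i j pos] by simp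
  qed (use h Z in \<open>auto simp: S_def\<close>)
  then show ?thesis by (simp add: K_def mult.commute)
qed

text \<open>The difference vector between \<open>X0\<close> and the mirror image of \<open>X\<close>
  in the boundary: horizontal coordinates are subtracted and heights added. The kernel at this
  vector is regular in \<open>X\<close> up to the boundary, where it is the Poisson kernel of
  \<open>X0\<close>.\<close>

definition reflect :: "nat \<Rightarrow> point \<Rightarrow> point \<Rightarrow> nat \<Rightarrow> real" where
  "reflect n X0 X = (\<lambda>i. if i < n then X0 i - X i else X0 i + X i)"

lemma reflect_n[simp]: "reflect n X0 X n = X0 n + X n"
  by (simp add: reflect_def)

lemma reflect_slice: "reflect n X0 (y(n := t)) i = sh n (X0(n := X0 n + t)) y i" if "i \<le> n"
  using that by (auto simp: reflect_def sh_def)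

lemma ssq_cong: "(\<And>i. i \<le> n \<Longrightarrow> X i = Y i) \<Longrightarrow> ssq n X = ssq n Y"
  by (simp add: ssq_def)

lemma pk_cong: "(\<And>i. i \<le> n \<Longrightarrow> X i = Y i) \<Longrightarrow> pk n X = pk n Y"
  using ssq_cong[of n X Y] by (simp add: pk_def)

lemma pk_reflect_slice: "pk n (reflect n X0 (y(n := t))) = pk n (sh n (X0(n := X0 n + t)) y)"
  by (rule pk_cong) (rule reflect_slice)

lemma measurable_reflect_component:
  assumes "i \<le> n"
  shows "(\<lambda>p. reflect n X0 ((fst p)(n := snd p)) i) \<in> borel_measurable (Rnt n)"
proof -
  have "(\<lambda>p::point \<times> real. ((fst p)(n := snd p)) i) \<in> borel_measurable (Rnt n)"
    using assms by (intro measurable_half_space_component) auto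
  then show ?thesis unfolding reflect_def by (cases "i < n") (auto simp del: fun_upd_apply)
qed

text \<open>The sign for \<open>j < n\<close> is the inner derivative of the reflection and squares
  to one in the second derivatives. The kernel bounds hold at the height \<open>X0 n + X n\<close>
  and are weakened to the height \<open>X n\<close>.\<close>

lemma nice_harmonic_reflect:
  assumes "n \<ge> 1" and X0: "X0 n > 0"
  shows "nice_harmonic n (\<lambda>X. pk n (reflect n X0 X)) (\<lambda>j X. (if j < n then -1 else 1) * pk1 n j (reflect n X0 X))
     (\<lambda>j X. pk2 n j j (reflect n X0 X)) (\<lambda>X. pC n * pk n (reflect n X0 X)) (pC n * (1 + pc n))"
proof
  have upd: "reflect n X0 (X(j := s)) = (reflect n X0 X)(j := X0 j + (if j < n then -1 else 1) * s)" for X j s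
    by (auto simp: reflect_def)
  have pos: "ssq n (reflect n X0 X) > 0" if "X n > 0" for X using that X0 by (intro ssq_pos) auto
  have inner: "((\<lambda>s. X0 j + (if j < n then -1 else 1) * s) has_real_derivative (if j < n then -1 else 1)) (at s)" for j s
    by (auto intro!: derivative_eq_intros)
  have der: "((\<lambda>s. k (reflect n X0 (X(j := s)))) has_real_derivative k1 (reflect n X0 X) * (if j < n then -1 else 1)) (at (X j))"
    if "X n > 0" "j \<le> n"
      and k: "\<And>Y s. ssq n (Y(j := s)) > 0 \<Longrightarrow> ((\<lambda>s. k (Y(j := s))) has_real_derivative k1 (Y(j := s))) (at s)" for k k1 X j
  proof -
    have e: "(reflect n X0 X)(j := X0 j + (if j < n then -1 else 1) * X j) = reflect n X0 X"
      using upd[of X j "X j"] by simp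
    have "((\<lambda>s. k ((reflect n X0 X)(j := s))) has_real_derivative k1 ((reflect n X0 X)(j := X0 j + (if j < n then -1 else 1) * X j)))
        (at (X0 j + (if j < n then -1 else 1) * X j))"
      by (rule k) (simp only: e pos that)
    from DERIV_chain2[OF this inner] show ?thesis unfolding upd e .
  qed
  show "n \<ge> 1" by fact
  show "((\<lambda>s. pk n (reflect n X0 (X(j := s)))) has_real_derivative (if j < n then -1 else 1) * pk1 n j (reflect n X0 X)) (at (X j))"
    if "j \<le> n" "X n > 0" for j X
    by (rule DERIV_cong[OF der[where k="pk n" and ?k1.0="pk1 n j"]]) (use that in \<open>auto intro: DERIV_pk simp del: fun_upd_apply\<close>)
  show "((\<lambda>s. (if j < n then -1 else 1) * pk1 n j (reflect n X0 (X(j := s)))) has_real_derivative pk2 n j j (reflect n X0 X)) (at (X j))"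
    if "j \<le> n" "X n > 0" for j X
    by (rule DERIV_cong[OF DERIV_cmult[OF der[where k="pk1 n j" and ?k1.0="pk2 n j j"]]])
      (use that in \<open>auto intro: DERIV_pk1 simp del: fun_upd_apply\<close>)
  show "(\<Sum>j\<le>n. pk2 n j j (reflect n X0 X)) = 0" if "X n > 0" for X by (rule pk2_laplace) (use pos[of X] that in simp)
  show m: "(\<lambda>p. pk n (reflect n X0 ((fst p)(n := snd p)))) \<in> borel_measurable (Rnt n)"
    by (intro measurable_pk measurable_reflect_component)
  show "(\<lambda>p. (if j < n then -1 else 1) * pk1 n j (reflect n X0 ((fst p)(n := snd p)))) \<in> borel_measurable (Rnt n)" if "j \<le> n" for j
    by (intro borel_measurable_times borel_measurable_const measurable_pk1 measurable_reflect_component that)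
  show "(\<lambda>p. pk2 n j j (reflect n X0 ((fst p)(n := snd p)))) \<in> borel_measurable (Rnt n)" if "j \<le> n" for j
    by (intro measurable_pk2 measurable_reflect_component that)
  show "(\<lambda>p. pC n * pk n (reflect n X0 ((fst p)(n := snd p)))) \<in> borel_measurable (Rnt n)"
    by (intro borel_measurable_times borel_measurable_const m)
  fix X :: "nat \<Rightarrow> real" assume X: "X n > 0"
  have pk0: "pk n (reflect n X0 X) \<ge> 0" using X X0 by (intro pk_nonneg) simp
  show "\<bar>pk n (reflect n X0 X)\<bar> \<le> pC n * pk n (reflect n X0 X)"
    using pk0 mult_right_mono[OF pC_ge_1[of n] pk0] by simp
  have cp: "pC n * pk n (reflect n X0 X) \<ge> 0" using pk0 pC_ge_1[of n] by simp
  show "\<bar>(if j < n then -1 else 1) * pk1 n j (reflect n X0 X)\<bar> \<le> pC n * pk n (reflect n X0 X) / X n" if "j \<le> n" for j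
  proof -
    have "\<bar>pk1 n j (reflect n X0 X)\<bar> \<le> pC n * pk n (reflect n X0 X) / (X0 n + X n)"
      using abs_pk1_le_pk[of j n "reflect n X0 X"] that X X0 by simp
    also have "\<dots> \<le> pC n * pk n (reflect n X0 X) / X n" using cp X X0 by (intro divide_left_mono) auto
    finally show ?thesis by (simp add: abs_mult)
  qed
  show "\<bar>pk2 n j j (reflect n X0 X)\<bar> \<le> pC n * pk n (reflect n X0 X) / (X n)\<^sup>2" if "j \<le> n" for j
  proof -
    have "\<bar>pk2 n j j (reflect n X0 X)\<bar> \<le> pC n * pk n (reflect n X0 X) / (X0 n + X n)\<^sup>2"
      using abs_pk2_le_pk[of j n j "reflect n X0 X"] that X X0 by simp
    also have "\<dots> \<le> pC n * pk n (reflect n X0 X) / (X n)\<^sup>2" using cp X X0 by (intro divide_left_mono power_mono mult_pos_pos) auto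
    finally show ?thesis .
  qed
  have "pk n (reflect n X0 X) \<le> pc n / (X0 n + X n) ^ n"
    using pk_le[of "reflect n X0 X" n] X X0 by simp
  also have "\<dots> \<le> (1 + pc n) / X n ^ n" using X X0 pc_pos[of n] by (intro frac_le power_mono) auto
  finally have "pC n * pk n (reflect n X0 X) \<le> pC n * ((1 + pc n) / X n ^ n)"
    using pC_ge_1[of n] by (intro mult_left_mono) auto
  then show "pC n * pk n (reflect n X0 X) \<le> pC n * (1 + pc n) / X n ^ n" by simp
next
  fix t :: real assume t: "t > 0"
  have "(\<integral>\<^sup>+y. ennreal (pC n * pk n (reflect n X0 (y(n := t)))) \<partial>Rn n) = (\<integral>\<^sup>+y. ennreal (pC n) * ennreal (pk n (sh n (X0(n := X0 n + t)) y)) \<partial>Rn n)"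
    unfolding pk_reflect_slice using pC_ge_1[of n] by (intro nn_integral_cong) (simp add: ennreal_mult')
  also have "\<dots> = ennreal (pC n) * 1"
    using nn_integral_pk[of "X0(n := X0 n + t)" n] t X0
    by (subst nn_integral_cmult) (auto intro!: measurable_compose[OF measurable_pk_sh measurable_ennreal] simp del: fun_upd_apply simp: fun_upd_same)
  also have "\<dots> \<le> ennreal (pC n * (1 + pc n))"
    using pC_ge_1[of n] pc_pos[of n] by (auto intro!: ennreal_leI simp: distrib_left)
  finally show "(\<integral>\<^sup>+y. ennreal (pC n * pk n (reflect n X0 (y(n := t)))) \<partial>Rn n) \<le> ennreal (pC n * (1 + pc n))" .
qed

section \<open>Pointwise gradient bound under the Carleson condition\<close>

lemma nn_integral_shifted_inverse_square:
  assumes "T > (0::real)"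
  shows "(\<integral>\<^sup>+r. ennreal (indicator {0<..} r * (1 / (T + r)\<^sup>2)) \<partial>lborel) \<le> ennreal (1 / T)"
proof -
  have "(\<integral>\<^sup>+r. ennreal (indicator {T..} r * (1 / r\<^sup>2)) \<partial>lborel) = (\<integral>\<^sup>+r. ennreal (indicator {T..} (T + 1 * r) * (1 / (T + 1 * r)\<^sup>2)) \<partial>lborel)"
    by (subst nn_integral_real_affine[of _ 1 T]) auto
  moreover have "(\<integral>\<^sup>+r. ennreal (indicator {0<..} r * (1 / (T + r)\<^sup>2)) \<partial>lborel) \<le> (\<integral>\<^sup>+r. ennreal (indicator {T..} (T + 1 * r) * (1 / (T + 1 * r)\<^sup>2)) \<partial>lborel)"
    by (intro nn_integral_mono ennreal_leI) (auto simp: indicator_def)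
  ultimately show ?thesis using nn_integral_inverse_square[OF assms] by simp
qed

text \<open>In contrast to \<open>integrable_half_space\<close> the region reaches down to the
  boundary; a vertical weight integrable over all positive heights pays for it.\<close>

lemma (in nice_harmonic) integrable_half_space_weight:
  assumes m: "g \<in> borel_measurable (Rnt n)"
    and b: "\<And>y r. y \<in> space (Rn n) \<Longrightarrow> r > 0 \<Longrightarrow> \<bar>g (y, r)\<bar> \<le> w r * a (y(n := r))"
    and w: "\<And>r. r > 0 \<Longrightarrow> w r \<ge> 0" "w \<in> borel_measurable lborel"
    and W: "(\<integral>\<^sup>+r. ennreal (indicator {0<..} r * w r) \<partial>lborel) < \<infinity>"
  shows "integrable (Rnt n) (\<lambda>p. indicator {0<..} (snd p) * g p)"
proof (rule integrableI_bounded)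
  have mi: "(\<lambda>p. indicator {0<..} (snd p) * g p) \<in> borel_measurable (Rnt n)"
    using m by (intro borel_measurable_times) auto
  show "(\<lambda>p. indicator {0<..} (snd p) * g p) \<in> borel_measurable (Rnt n)" by (rule mi)
  have mw: "(\<lambda>r. indicator {0<..} r * w r) \<in> borel_measurable lborel"
    using w(2) by (intro borel_measurable_times) auto
  have "(\<integral>\<^sup>+p. ennreal (norm (indicator {0<..} (snd p) * g p)) \<partial>(Rnt n))
     = (\<integral>\<^sup>+r. (\<integral>\<^sup>+y. ennreal (norm (indicator {0<..} r * g (y, r))) \<partial>Rn n) \<partial>lborel)"
    using measurable_compose[OF measurable_compose[OF mi borel_measurable_norm] measurable_ennreal]
    by (subst Rn_line.nn_integral_snd[symmetric]) auto
  also have "\<dots> \<le> (\<integral>\<^sup>+r. ennreal A * ennreal (indicator {0<..} r * w r) \<partial>lborel)"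
  proof (intro nn_integral_mono)
    fix r :: real
    show "(\<integral>\<^sup>+y. ennreal (norm (indicator {0<..} r * g (y, r))) \<partial>Rn n) \<le> ennreal A * ennreal (indicator {0<..} r * w r)"
    proof (cases "r > 0")
      case True
      have "(\<integral>\<^sup>+y. ennreal (norm (indicator {0<..} r * g (y, r))) \<partial>Rn n) \<le> (\<integral>\<^sup>+y. ennreal (w r) * ennreal (a (y(n := r))) \<partial>Rn n)"
        using b[OF _ True] w(1)[OF True] True by (intro nn_integral_mono) (auto simp: ennreal_mult'[symmetric] intro!: ennreal_leI)
      also have "\<dots> = ennreal (w r) * (\<integral>\<^sup>+y. ennreal (a (y(n := r))) \<partial>Rn n)"
        by (intro nn_integral_cmult measurable_compose[OF measurable_slice(1)[OF measa] measurable_ennreal])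
      also have "\<dots> \<le> ennreal (w r) * ennreal A" by (intro mult_left_mono a_int True) auto
      finally show ?thesis using True by (simp add: mult.commute)
    qed simp
  qed
  also have "\<dots> = ennreal A * (\<integral>\<^sup>+r. ennreal (indicator {0<..} r * w r) \<partial>lborel)"
    by (intro nn_integral_cmult measurable_compose[OF mw measurable_ennreal])
  also have "\<dots> < \<infinity>" using W by (simp add: ennreal_mult_less_top)
  finally show "(\<integral>\<^sup>+p. ennreal (norm (indicator {0<..} (snd p) * g p)) \<partial>(Rnt n)) < \<infinity>" .
qed

abbreviation v1 :: "nat \<Rightarrow> point \<Rightarrow> nat \<Rightarrow> point \<Rightarrow> real" where
  "v1 n X0 \<equiv> \<lambda>j X. (if j < n then -1 else 1) * pk1 n j (reflect n X0 X)"

text \<open>By the semigroup property, the extension of the kernel at \<open>X0\<close> is the kernel at the reflection of \<open>X0\<close>, so Green's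
formula reproduces the values of the extension of \<open>f\<close>.\<close>

lemma U_representation:
  assumes n: "n \<ge> 1" and f: "integrable (Rn n) f" and X0: "X0 n > 0"
  shows "integrable (Rnt n) (\<lambda>p. hdot n (U1 n f) (v1 n X0) p)"
    and "U n f X0 = 2 * (\<integral>p. hdot n (U1 n f) (v1 n X0) p \<partial>(Rnt n))"
proof -
  interpret u: nice_harmonic n "U n f" "U1 n f" "U2 n f" "\<lambda>X. pC n * U n (\<lambda>z. \<bar>f z\<bar>) X" "pC n * (1 + pc n) * (\<integral>z. \<bar>f z\<bar> \<partial>Rn n)"
    by (rule nice_harmonic_U[OF n f])
  have v: "nice_harmonic n (\<lambda>X. pk n (reflect n X0 X)) (v1 n X0)
     (\<lambda>j X. pk2 n j j (reflect n X0 X)) (\<lambda>X. pC n * pk n (reflect n X0 X)) (pC n * (1 + pc n))"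
    by (rule nice_harmonic_reflect[of n X0]) (use n X0 in auto)
  interpret v: nice_harmonic n "\<lambda>X. pk n (reflect n X0 X)" "v1 n X0"
     "\<lambda>j X. pk2 n j j (reflect n X0 X)" "\<lambda>X. pC n * pk n (reflect n X0 X)" "pC n * (1 + pc n)"
    by (rule v)
  define T where "T = X0 n"
  have T: "T > 0" using X0 by (simp add: T_def)
  define K where "K = real (Suc n) * (pC n * pc n) / T ^ (n - 1)"
  have K: "K \<ge> 0" using T pc_pos[of n] pC_ge_1[of n] by (simp add: K_def)
  \<comment> \<open>The weight \<open>r\<close> cancels the \<open>1 / r\<close> in the gradient
    bound of the extension. The kernel gradient at height \<open>T + r\<close> contributes a power
    \<open>-(n + 1)\<close>, of which two orders are kept for integrability in \<open>r\<close> and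
    the others are estimated at \<open>T\<close>.\<close>
  have bnd: "\<bar>r * dotg n (U1 n f) (v1 n X0) (y(n := r))\<bar> \<le> K * (1 / (T + r)\<^sup>2) * (pC n * U n (\<lambda>z. \<bar>f z\<bar>) (y(n := r)))"
    if r: "r > 0" for y r
  proof -
    let ?a = "pC n * U n (\<lambda>z. \<bar>f z\<bar>) (y(n := r))"
    have a: "?a \<ge> 0" using u.a_nonneg[of "y(n := r)"] r by simp
    have v1b: "\<bar>v1 n X0 i (y(n := r))\<bar> \<le> pC n * pc n / (T ^ (n - 1) * (T + r)\<^sup>2)" if "i \<le> n" for i
    proof -
      have "\<bar>v1 n X0 i (y(n := r))\<bar> \<le> pC n * pc n / (T + r) ^ Suc n"
        using abs_pk1_le_height[of i n "reflect n X0 (y(n := r))"] that r T by (cases "i = n") (simp_all add: abs_mult T_def)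
      also have "\<dots> \<le> pC n * pc n / (T ^ (n - 1) * (T + r)\<^sup>2)"
      proof (rule divide_left_mono)
        have "T ^ (n - 1) * (T + r)\<^sup>2 \<le> (T + r) ^ (n - 1) * (T + r)\<^sup>2" using T r by (intro mult_right_mono power_mono) auto
        also have "\<dots> = (T + r) ^ Suc n" using n by (simp add: power_add[symmetric])
        finally show "T ^ (n - 1) * (T + r)\<^sup>2 \<le> (T + r) ^ Suc n" .
      qed (use T r pc_pos[of n] pC_ge_1[of n] in auto)
      finally show ?thesis .
    qed
    have "\<bar>dotg n (U1 n f) (v1 n X0) (y(n := r))\<bar> \<le> (\<Sum>i\<le>n. (?a / r) * (pC n * pc n / (T ^ (n - 1) * (T + r)\<^sup>2)))"
      unfolding dotg_def
    proof (rule order.trans[OF sum_abs], rule sum_mono)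
      fix i assume i: "i \<in> {..n}"
      have "\<bar>U1 n f i (y(n := r))\<bar> \<le> ?a / r" using u.bound1[of i "y(n := r)"] i r by simp
      then show "\<bar>U1 n f i (y(n := r)) * v1 n X0 i (y(n := r))\<bar> \<le> (?a / r) * (pC n * pc n / (T ^ (n - 1) * (T + r)\<^sup>2))"
        unfolding abs_mult[of "U1 _ _ _ _"] using v1b[of i] i a r by (intro mult_mono) auto
    qed
    then have "\<bar>r\<bar> * \<bar>dotg n (U1 n f) (v1 n X0) (y(n := r))\<bar> \<le> r * (real (Suc n) * ((?a / r) * (pC n * pc n / (T ^ (n - 1) * (T + r)\<^sup>2))))"
      using r by (intro mult_mono) auto
    also have "\<dots> = K * (1 / (T + r)\<^sup>2) * ?a" using r by (simp add: K_def)
    finally show ?thesis by (simp only: abs_mult)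
  qed
  show int: "integrable (Rnt n) (\<lambda>p. hdot n (U1 n f) (v1 n X0) p)"
  proof (rule u.integrable_half_space_weight[where w="\<lambda>r. K * (1 / (T + r)\<^sup>2)"])
    show "(\<lambda>p. snd p * dotg n (U1 n f) (v1 n X0) ((fst p)(n := snd p))) \<in> borel_measurable (Rnt n)"
      unfolding dotg_def by (intro borel_measurable_times borel_measurable_sum u.meas1 v.meas1) auto
    show "\<bar>snd (y, r) * dotg n (U1 n f) (v1 n X0) ((fst (y, r))(n := snd (y, r)))\<bar> \<le> K * (1 / (T + r)\<^sup>2) * (pC n * U n (\<lambda>z. \<bar>f z\<bar>) (y(n := r)))"
      if "r > 0" for y r using bnd[OF that] by simp
    have "(\<integral>\<^sup>+r. ennreal (indicator {0<..} r * (K * (1 / (T + r)\<^sup>2))) \<partial>lborel) = (\<integral>\<^sup>+r. ennreal K * ennreal (indicator {0<..} r * (1 / (T + r)\<^sup>2)) \<partial>lborel)"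
      using K by (intro nn_integral_cong) (simp add: ennreal_mult'[symmetric] mult_ac)
    also have "\<dots> = ennreal K * (\<integral>\<^sup>+r. ennreal (indicator {0<..} r * (1 / (T + r)\<^sup>2)) \<partial>lborel)" by (rule nn_integral_cmult) simp
    also have "\<dots> \<le> ennreal K * ennreal (1 / T)" by (intro mult_left_mono nn_integral_shifted_inverse_square T) auto
    also have "\<dots> < \<infinity>" by (simp add: ennreal_mult_less_top)
    finally show "(\<integral>\<^sup>+r. ennreal (indicator {0<..} r * (K * (1 / (T + r)\<^sup>2))) \<partial>lborel) < \<infinity>" .
  qed (use K in auto)
  define \<sigma> where "\<sigma> k = 1 / real (Suc k)" for k
  have \<sigma>: "\<And>k. \<sigma> k > 0" "\<sigma> \<longlonglongrightarrow> 0"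
    unfolding \<sigma>_def using LIMSEQ_inverse_real_of_nat by (auto simp: inverse_eq_divide)
  have lim1: "(\<lambda>k. \<integral>y. U n f (y(n := \<sigma> k)) * pk n (reflect n X0 (y(n := \<sigma> k))) \<partial>Rn n)
    \<longlonglongrightarrow> 2 * (\<integral>p. hdot n (U1 n f) (v1 n X0) p \<partial>(Rnt n))"
    by (rule u.integral_mult_limit[OF v int \<sigma>])
  have pkb: "\<bar>pk n (reflect n X0 (y(n := s)))\<bar> \<le> pc n / T ^ n" if "s \<ge> 0" for y s
  proof -
    have "\<bar>pk n (reflect n X0 (y(n := s)))\<bar> \<le> pc n / (T + s) ^ n"
      using abs_pk_le[of "reflect n X0 (y(n := s))" n] that T by (simp add: T_def)
    also have "\<dots> \<le> pc n / T ^ n" using T that pc_pos[of n] by (intro divide_left_mono power_mono mult_pos_pos) auto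
    finally show ?thesis .
  qed
  have pkm: "(\<lambda>y. pk n (reflect n X0 (y(n := s)))) \<in> borel_measurable (Rn n)" for s
    by (rule measurable_slice(1)[OF v.meas0])
  have fm: "f \<in> borel_measurable (Rn n)" using f by auto
  have ip: "integrable (Rn n) (\<lambda>y. pk n (reflect n X0 (y(n := s))) * h y)" if "integrable (Rn n) h" "s \<ge> 0" for h s
    by (rule integrable_bounded_mult[OF that(1) pkm pkb[OF that(2)]])
  \<comment> \<open>The limit of the slice integrals is also computed directly: here the extension
    is replaced by \<open>f\<close>, at a cost controlled by convergence in the mean and the bound
    on the kernel; afterwards the kernel descends to height zero.\<close>
  have lima: "(\<lambda>k. \<integral>y. pk n (reflect n X0 (y(n := \<sigma> k))) * (U n f (y(n := \<sigma> k)) - f y) \<partial>Rn n) \<longlonglongrightarrow> 0"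
  proof (rule Lim_null_comparison)
    have "l1_approx n \<sigma> f" by (rule l1_approx_integrable[OF \<sigma> f])
    then have "(\<lambda>k. \<integral>y. \<bar>U n f (y(n := \<sigma> k)) - f y\<bar> \<partial>Rn n) \<longlonglongrightarrow> 0" by (simp add: l1_approx_def)
    from tendsto_mult_left[OF this, of "pc n / T ^ n"]
    show "(\<lambda>k. pc n / T ^ n * (\<integral>y. \<bar>U n f (y(n := \<sigma> k)) - f y\<bar> \<partial>Rn n)) \<longlonglongrightarrow> 0" by simp
    show "eventually (\<lambda>k. norm (\<integral>y. pk n (reflect n X0 (y(n := \<sigma> k))) * (U n f (y(n := \<sigma> k)) - f y) \<partial>Rn n) \<le> pc n / T ^ n * (\<integral>y. \<bar>U n f (y(n := \<sigma> k)) - f y\<bar> \<partial>Rn n)) sequentially"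
    proof (rule always_eventually, rule allI)
      fix k
      have id: "integrable (Rn n) (\<lambda>y. \<bar>U n f (y(n := \<sigma> k)) - f y\<bar>)"
        by (intro integrable_abs Bochner_Integration.integrable_diff U_integrable[OF f \<sigma>(1)] f)
      have "\<bar>\<integral>y. pk n (reflect n X0 (y(n := \<sigma> k))) * (U n f (y(n := \<sigma> k)) - f y) \<partial>Rn n\<bar> \<le> (\<integral>y. pc n / T ^ n * \<bar>U n f (y(n := \<sigma> k)) - f y\<bar> \<partial>Rn n)"
        using id pkb[OF less_imp_le[OF \<sigma>(1)]]
        by (intro abs_integral_le integrable_mult_right) (auto simp only: abs_mult intro!: mult_right_mono)
      then show "norm (\<integral>y. pk n (reflect n X0 (y(n := \<sigma> k))) * (U n f (y(n := \<sigma> k)) - f y) \<partial>Rn n) \<le> pc n / T ^ n * (\<integral>y. \<bar>U n f (y(n := \<sigma> k)) - f y\<bar> \<partial>Rn n)"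
        by simp
    qed
  qed
  have limb: "(\<lambda>k. \<integral>y. pk n (reflect n X0 (y(n := \<sigma> k))) * f y \<partial>Rn n) \<longlonglongrightarrow> (\<integral>y. pk n (reflect n X0 (y(n := 0))) * f y \<partial>Rn n)"
  proof (rule integral_dominated_convergence[where w="\<lambda>y. pc n / T ^ n * \<bar>f y\<bar>"])
    show "(\<lambda>y. pk n (reflect n X0 (y(n := 0))) * f y) \<in> borel_measurable (Rn n)" by (intro borel_measurable_times pkm fm)
    show "(\<lambda>y. pk n (reflect n X0 (y(n := \<sigma> k))) * f y) \<in> borel_measurable (Rn n)" for k by (intro borel_measurable_times pkm fm)
    show "integrable (Rn n) (\<lambda>y. pc n / T ^ n * \<bar>f y\<bar>)" using f by simp
    show "AE y in Rn n. norm (pk n (reflect n X0 (y(n := \<sigma> k))) * f y) \<le> pc n / T ^ n * \<bar>f y\<bar>" for k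
      using pkb[OF less_imp_le[OF \<sigma>(1)]] by (intro AE_I2) (auto simp only: real_norm_def abs_mult intro!: mult_right_mono)
    show "AE y in Rn n. (\<lambda>k. pk n (reflect n X0 (y(n := \<sigma> k))) * f y) \<longlonglongrightarrow> pk n (reflect n X0 (y(n := 0))) * f y"
    proof (rule AE_I2)
      fix y
      let ?Z = "reflect n X0 (y(n := 0))"
      have e: "reflect n X0 (y(n := s)) = ?Z(n := T + s)" for s by (auto simp: reflect_def T_def)
      have "isCont (\<lambda>s. pk n (?Z(n := s))) T"
        using T by (intro DERIV_isCont[OF DERIV_pk] ssq_pos) auto
      moreover have "(\<lambda>k. T + \<sigma> k) \<longlonglongrightarrow> T" using tendsto_add[OF tendsto_const[of T] \<sigma>(2)] by simp
      ultimately have "(\<lambda>k. pk n (?Z(n := T + \<sigma> k))) \<longlonglongrightarrow> pk n (?Z(n := T))"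
        by (rule isCont_tendsto_compose)
      then have "(\<lambda>k. pk n (reflect n X0 (y(n := \<sigma> k)))) \<longlonglongrightarrow> pk n ?Z"
        using e[of 0] by (simp only: e[of "\<sigma> _"] add_0_right)
      then show "(\<lambda>k. pk n (reflect n X0 (y(n := \<sigma> k))) * f y) \<longlonglongrightarrow> pk n ?Z * f y"
        by (rule tendsto_mult_right)
    qed
  qed
  have "(\<integral>y. U n f (y(n := \<sigma> k)) * pk n (reflect n X0 (y(n := \<sigma> k))) \<partial>Rn n)
     = (\<integral>y. pk n (reflect n X0 (y(n := \<sigma> k))) * (U n f (y(n := \<sigma> k)) - f y) \<partial>Rn n) + (\<integral>y. pk n (reflect n X0 (y(n := \<sigma> k))) * f y \<partial>Rn n)" for k
  proof -
    have s: "\<sigma> k \<ge> 0" using \<sigma>(1)[of k] by simp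
    have 1: "integrable (Rn n) (\<lambda>y. U n f (y(n := \<sigma> k)) - f y)"
      by (intro Bochner_Integration.integrable_diff U_integrable[OF f \<sigma>(1)] f)
    show ?thesis
      unfolding Bochner_Integration.integral_add[OF ip[OF 1 s] ip[OF f s], symmetric]
      by (intro Bochner_Integration.integral_cong refl) (simp only: right_diff_distrib mult.commute diff_add_cancel)
  qed
  with tendsto_add[OF lima limb] have lim2: "(\<lambda>k. \<integral>y. U n f (y(n := \<sigma> k)) * pk n (reflect n X0 (y(n := \<sigma> k))) \<partial>Rn n)
     \<longlonglongrightarrow> (\<integral>y. pk n (reflect n X0 (y(n := 0))) * f y \<partial>Rn n)" by simp
  have "(\<integral>y. pk n (reflect n X0 (y(n := 0))) * f y \<partial>Rn n) = U n f X0"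
    unfolding U_def pk_reflect_slice by simp
  with LIMSEQ_unique[OF lim1 lim2]
  show "U n f X0 = 2 * (\<integral>p. hdot n (U1 n f) (v1 n X0) p \<partial>(Rnt n))"
    by simp
qed

lemma integral_le_nn_integral_bound:
  fixes g :: "'a \<Rightarrow> real"
  assumes "g \<in> borel_measurable M" "\<And>x. x \<in> space M \<Longrightarrow> g x \<ge> 0" "(\<integral>\<^sup>+x. ennreal (g x) \<partial>M) \<le> ennreal c" "c \<ge> 0"
  shows "integrable M g" "(\<integral>x. g x \<partial>M) \<le> c"
proof -
  show i: "integrable M g"
    using assms by (intro integrableI_nonneg) (auto intro: order_le_less_trans)
  have "ennreal (\<integral>x. g x \<partial>M) = (\<integral>\<^sup>+x. ennreal (g x) \<partial>M)"
    using i assms by (intro nn_integral_eq_integral[symmetric]) auto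
  then have "ennreal (\<integral>x. g x \<partial>M) \<le> ennreal c" using assms by simp
  then show "(\<integral>x. g x \<partial>M) \<le> c" using assms by (subst (asm) ennreal_le_iff) auto
qed

text \<open>Bounds on increments suffice for a gradient bound, so the Green representation need not
  be differentiated under the integral.\<close>

lemma abs_deriv_le_of_lipschitz:
  assumes D: "(g has_real_derivative d) (at x)" and \<delta>: "\<delta> > 0"
    and L: "\<And>h. \<bar>h\<bar> \<le> \<delta> \<Longrightarrow> \<bar>g (x + h) - g x\<bar> \<le> \<bar>h\<bar> * L"
  shows "\<bar>d\<bar> \<le> L"
proof (rule tendsto_upperbound)
  show "((\<lambda>h. \<bar>(g (x + h) - g x) / h\<bar>) \<longlongrightarrow> \<bar>d\<bar>) (at 0)"
    using D unfolding DERIV_def by (rule tendsto_rabs)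
  have "eventually (\<lambda>h::real. h \<in> ball 0 \<delta> - {0}) (at 0)"
    using \<delta> by (intro eventually_at_in_open) auto
  then show "eventually (\<lambda>h. \<bar>(g (x + h) - g x) / h\<bar> \<le> L) (at 0)"
  proof eventually_elim
    case (elim h)
    then have "\<bar>h\<bar> \<le> \<delta>" "h \<noteq> 0" by auto
    with L[of h] show ?case by (simp add: abs_divide divide_le_eq mult.commute)
  qed
qed simp

context dyadic
begin

abbreviation carleson_grad :: "(point \<Rightarrow> real) \<Rightarrow> real \<Rightarrow> bool" where
  "carleson_grad f M \<equiv> carleson (\<lambda>p. ennreal (snd p * gsq n f p)) M"

text \<open>The weight is not constant on cubes but comparable, with factor \<open>C\<close>, at
  points of a common cube. Averaging over the cubes of generation \<open>k\<close> and freezing the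
  weight at \<open>x\<close> reduces the estimate to the Carleson condition.\<close>

lemma nn_integral_weighted_carleson:
  fixes \<omega> :: "point \<Rightarrow> real"
  assumes G: "G \<in> borel_measurable (Rnt n)" and car: "carleson G M" and M: "M \<ge> 0" and C: "C \<ge> 0"
    and m: "\<omega> \<in> borel_measurable (Rn n)" and pos: "\<And>y. \<omega> y \<ge> 0"
    and H: "\<And>x y. x \<in> space (Rn n) \<Longrightarrow> y \<in> cubk k x \<Longrightarrow> \<omega> y \<le> C * \<omega> x"
  shows "(\<integral>\<^sup>+y. ennreal (\<omega> y) * line_int {0<..2 powi k} G y \<partial>Rn n) \<le> ennreal (C * M) * (\<integral>\<^sup>+y. ennreal (\<omega> y) \<partial>Rn n)"
proof -
  let ?b = "line_int {0<..2 powi k} G"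
  let ?I = "\<integral>\<^sup>+y. ennreal (\<omega> y) * ?b y \<partial>Rn n"
  have mb: "?b \<in> borel_measurable (Rn n)" by (rule measurable_line_int[OF G]) simp
  have mw: "(\<lambda>y. ennreal (\<omega> y)) \<in> borel_measurable (Rn n)" using m by simp
  have "ennreal (vk k) * (\<integral>\<^sup>+y. 1 * (ennreal (\<omega> y) * ?b y) \<partial>Rn n) = (\<integral>\<^sup>+x. 1 * (\<integral>\<^sup>+y. ind k x y * (ennreal (\<omega> y) * ?b y) \<partial>Rn n) \<partial>Rn n)"
    by (rule nn_integral_average[symmetric]) (use mw mb in \<open>auto simp: const_on_def intro: borel_measurable_times_ennreal\<close>)
  then have "ennreal (vk k) * ?I = (\<integral>\<^sup>+x. (\<integral>\<^sup>+y. ind k x y * (ennreal (\<omega> y) * ?b y) \<partial>Rn n) \<partial>Rn n)" by simp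
  also have "\<dots> \<le> (\<integral>\<^sup>+x. ennreal (C * M * vk k) * ennreal (\<omega> x) \<partial>Rn n)"
  proof (intro nn_integral_mono)
    fix x assume x: "x \<in> space (Rn n)"
    have mi: "(\<lambda>y. ind k x y) \<in> borel_measurable (Rn n)" using x by (intro measurable_ind) auto
    have "(\<integral>\<^sup>+y. ind k x y * (ennreal (\<omega> y) * ?b y) \<partial>Rn n) \<le> (\<integral>\<^sup>+y. ennreal (C * \<omega> x) * (ind k x y * ?b y) \<partial>Rn n)"
    proof (intro nn_integral_mono)
      fix y
      show "ind k x y * (ennreal (\<omega> y) * ?b y) \<le> ennreal (C * \<omega> x) * (ind k x y * ?b y)"
      proof (cases "(x, y) \<in> same k")
        case True
        then have "ennreal (\<omega> y) \<le> ennreal (C * \<omega> x)" using H[OF x] same_iff[OF x] by (intro ennreal_leI) auto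
        then show ?thesis using True by (simp add: mult_right_mono)
      qed simp
    qed
    also have "\<dots> = ennreal (C * \<omega> x) * (\<integral>\<^sup>+y. ind k x y * ?b y \<partial>Rn n)"
      using mi mb by (intro nn_integral_cmult borel_measurable_times_ennreal)
    also have "\<dots> \<le> ennreal (C * \<omega> x) * ennreal (M * vk k)"
      using car x unfolding carleson_def by (intro mult_left_mono) auto
    also have "\<dots> = ennreal (C * M * vk k) * ennreal (\<omega> x)"
      using C M pos[of x] vk_pos[of k] by (simp add: ennreal_mult'[symmetric] mult_ac)
    finally show "(\<integral>\<^sup>+y. ind k x y * (ennreal (\<omega> y) * ?b y) \<partial>Rn n) \<le> ennreal (C * M * vk k) * ennreal (\<omega> x)" .
  qed
  also have "\<dots> = ennreal (vk k) * (ennreal (C * M) * (\<integral>\<^sup>+y. ennreal (\<omega> y) \<partial>Rn n))"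
    using C M vk_pos[of k] mw by (subst nn_integral_cmult) (auto simp: ennreal_mult mult_ac less_imp_le)
  finally have *: "ennreal (vk k) * ?I \<le> ennreal (vk k) * (ennreal (C * M) * (\<integral>\<^sup>+y. ennreal (\<omega> y) \<partial>Rn n))" .
  have one: "ennreal (1 / vk k) * (ennreal (vk k) * z) = z" for z
    using vk_pos[of k] by (simp add: mult.assoc[symmetric] ennreal_mult'[symmetric])
  from mult_left_mono[OF *, of "ennreal (1 / vk k)"] show ?thesis by (simp only: one zero_le)
qed

context
  fixes f :: "point \<Rightarrow> real" and M0 :: real
  assumes f: "integrable (Rn n) f" and M0: "M0 \<ge> 0"
    and car: "carleson_grad f M0"
begin

lemma gsq_meas: "gsq n f \<in> borel_measurable (Rnt n)"
  using f by (intro gsq_measurable) auto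

text \<open>Young's inequality replaces the gradient norm by its square: for heights
  \<open>t\<close> up to \<open>R = 2 powi k\<close>, \<open>t\<close> times the norm is at most
  \<open>R\<close> times \<open>t\<close> times the energy density, plus 1. The 1 integrates to
  \<open>R\<close> along the vertical line, so both parts are of order \<open>R\<close>.\<close>

lemma carleson_first_order:
  assumes w: "\<omega> \<in> borel_measurable (Rn n)" "\<And>y. \<omega> y \<ge> 0"
    and H: "\<And>x y. x \<in> space (Rn n) \<Longrightarrow> y \<in> cubk k x \<Longrightarrow> \<omega> y \<le> C * \<omega> x" and C: "C \<ge> 0"
  shows "(\<integral>\<^sup>+y. ennreal (\<omega> y) * line_int {0<..2 powi k} (\<lambda>p. ennreal (snd p * sqrt (gsq n f p))) y \<partial>Rn n)
     \<le> ennreal (2 powi k * (C * M0 + 1)) * (\<integral>\<^sup>+y. ennreal (\<omega> y) \<partial>Rn n)"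
proof -
  define R :: real where "R = 2 powi k"
  have R: "R > 0" by (simp add: R_def)
  let ?G1 = "\<lambda>p. ennreal (snd p * gsq n f p)"
  let ?G2 = "\<lambda>p. ennreal (snd p * sqrt (gsq n f p))"
  have mG1: "?G1 \<in> borel_measurable (Rnt n)" using gsq_meas by measurable
  have mb: "line_int {0<..R} ?G1 \<in> borel_measurable (Rn n)" by (rule measurable_line_int[OF mG1]) simp
  have pw: "line_int {0<..R} ?G2 y \<le> ennreal R * line_int {0<..R} ?G1 y + ennreal R" if y: "y \<in> space (Rn n)" for y
  proof -
    have m: "(\<lambda>t. ?G1 (y, t)) \<in> borel_measurable lborel"
      using measurable_compose[OF measurable_Pair1'[OF y] mG1] by simp
    have "line_int {0<..R} ?G2 y \<le> (\<integral>\<^sup>+t. ennreal R * (indicator {0<..R} t * ?G1 (y, t)) + indicator {0<..R} t \<partial>lborel)"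
      unfolding line_int_def
    proof (intro nn_integral_mono)
      fix t :: real
      show "indicator {0<..R} t * ?G2 (y, t) \<le> ennreal R * (indicator {0<..R} t * ?G1 (y, t)) + indicator {0<..R} t"
      proof (cases "t \<in> {0<..R}")
        case True
        define g where "g = gsq n f (y, t)"
        have g: "g \<ge> 0" by (simp add: g_def gsq_nonneg)
        have "sqrt (1 * g) \<le> R / 2 * g + 1 / (2 * R) * 1" by (rule young_sqrt) (use g R in auto)
        then have "t * sqrt g \<le> t * (R / 2 * g + 1 / (2 * R))" using True by (intro mult_left_mono) auto
        also have "\<dots> \<le> R * (t * g) + 1"
        proof -
          have "t * (1 / (2 * R)) \<le> 1" using True R by (simp add: divide_le_eq)
          moreover have "t * (R / 2 * g) \<le> R * (t * g)" using True R g by simp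
          ultimately show ?thesis unfolding distrib_left by linarith
        qed
        finally have "ennreal (t * sqrt g) \<le> ennreal (R * (t * g) + 1)" by (rule ennreal_leI)
        also have "\<dots> = ennreal R * ennreal (t * g) + 1"
          using True R g by (subst ennreal_plus) (auto simp: ennreal_mult')
        finally show ?thesis using True by (simp add: g_def)
      qed simp
    qed
    also have "\<dots> = ennreal R * line_int {0<..R} ?G1 y + emeasure lborel {0<..R}"
      unfolding line_int_def using m
      by (subst nn_integral_add) (auto simp: nn_integral_cmult intro!: borel_measurable_times_ennreal)
    finally show ?thesis using R by simp
  qed
  have mw: "(\<lambda>y. ennreal (\<omega> y)) \<in> borel_measurable (Rn n)" using w by simp
  have "(\<integral>\<^sup>+y. ennreal (\<omega> y) * line_int {0<..R} ?G2 y \<partial>Rn n) \<le> (\<integral>\<^sup>+y. ennreal R * (ennreal (\<omega> y) * line_int {0<..R} ?G1 y) + ennreal R * ennreal (\<omega> y) \<partial>Rn n)"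
  proof (intro nn_integral_mono)
    fix y assume y: "y \<in> space (Rn n)"
    have "ennreal (\<omega> y) * line_int {0<..R} ?G2 y \<le> ennreal (\<omega> y) * (ennreal R * line_int {0<..R} ?G1 y + ennreal R)"
      by (intro mult_left_mono pw y) auto
    then show "ennreal (\<omega> y) * line_int {0<..R} ?G2 y \<le> ennreal R * (ennreal (\<omega> y) * line_int {0<..R} ?G1 y) + ennreal R * ennreal (\<omega> y)"
      by (simp add: distrib_left mult_ac)
  qed
  also have "\<dots> = ennreal R * (\<integral>\<^sup>+y. ennreal (\<omega> y) * line_int {0<..R} ?G1 y \<partial>Rn n) + ennreal R * (\<integral>\<^sup>+y. ennreal (\<omega> y) \<partial>Rn n)"
    using mw mb by (subst nn_integral_add) (auto simp: nn_integral_cmult intro!: borel_measurable_times_ennreal)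
  also have "\<dots> \<le> ennreal R * (ennreal (C * M0) * (\<integral>\<^sup>+y. ennreal (\<omega> y) \<partial>Rn n)) + ennreal R * (\<integral>\<^sup>+y. ennreal (\<omega> y) \<partial>Rn n)"
    unfolding R_def
    by (intro add_right_mono mult_left_mono nn_integral_weighted_carleson[OF mG1 car M0 C w(1,2) H]) auto
  also have "\<dots> = (ennreal R * ennreal (C * M0) + ennreal R) * (\<integral>\<^sup>+y. ennreal (\<omega> y) \<partial>Rn n)"
    by (simp add: distrib_right mult.assoc)
  also have "ennreal R * ennreal (C * M0) + ennreal R = ennreal (R * (C * M0 + 1))"
    using R C M0 by (simp add: ennreal_mult'[symmetric] ennreal_plus[symmetric] distrib_left del: ennreal_plus)
  finally show ?thesis by (simp add: R_def)
qed

text \<open>The half space is cut into dyadic scales from the height \<open>T\<close> of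
  \<open>X0\<close> upwards. At scale \<open>k\<close> the kernel is comparable with its value at
  height \<open>2 powi k\<close>; the first-order bound contributes a factor \<open>2 powi k\<close>
  and the mass of the kernel is of order \<open>1 / (2 powi k)\<^sup>2\<close>. The scales therefore
  form a geometric series of size \<open>1 / T\<close>.\<close>

lemma nn_integral_grad_kernel:
  assumes X0: "X0 n > 0"
  shows "(\<integral>\<^sup>+p. ennreal (indicator {0<..} (snd p) * (snd p * sqrt (gsq n f p) * ssq n (reflect n X0 ((fst p)(n := snd p))) powr (- pm n - 1/2))) \<partial>(Rnt n))
     \<le> ennreal (4 powr (pm n + 1/2) * (((2 * real n + 2) powr (pm n + 1/2)) * M0 + 1) * bq n (real n + 2) * 2 / X0 n)"
proof -
  define T where "T = X0 n"
  have T: "T > 0" using X0 by (simp add: T_def)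
  obtain k1 where k1: "T \<in> strip k1" using ex_strip[OF T] by blast
  define e where "e = pm n + 1/2"
  have e: "e \<ge> 0" using pm_pos[of n] by (simp add: e_def)
  have e': "- pm n - 1/2 = - e" by (simp add: e_def)
  define C where "C = (2 * real n + 2) powr e"
  have C: "C \<ge> 0" by (simp add: C_def)
  define \<omega> where "\<omega> k y = ssq n (sh n (X0(n := 2 powi k)) y) powr (- e)" for k :: int and y
  have wm: "\<omega> k \<in> borel_measurable (Rn n)" for k
    unfolding \<omega>_def by (intro powr_real_measurable measurable_ssq measurable_sh_component) auto
  have w0: "\<omega> k y \<ge> 0" for k y by (simp add: \<omega>_def)
  have wH: "\<omega> k y \<le> C * \<omega> k x" if "x \<in> space (Rn n)" "y \<in> cubk k x" for k x y
    unfolding \<omega>_def C_def using cubk_dist[OF that] by (intro ssq_sh_harnack e) auto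
  have wI: "(\<integral>\<^sup>+y. ennreal (\<omega> k y) \<partial>Rn n) = ennreal (bq n (real n + 2) / (2 powi k)\<^sup>2)" for k
  proof -
    have "- (real n + 2) / 2 = - e" by (simp add: e_def pm_def field_simps)
    then have "(\<integral>\<^sup>+y. ennreal (\<omega> k y) \<partial>Rn n) = ennreal (bq n (real n + 2) * (X0(n := 2 powi k)) n powr (real n - (real n + 2)))"
      unfolding \<omega>_def using nn_integral_ssq_powr[of n "real n + 2" "X0(n := 2 powi k)"] by simp
    also have "(X0(n := 2 powi k)) n powr (real n - (real n + 2)) = 1 / (2 powi k)\<^sup>2"
      by (simp add: powr_minus_divide)
    finally show ?thesis by simp
  qed
  let ?G2 = "\<lambda>p. ennreal (snd p * sqrt (gsq n f p))"
  have mG2: "?G2 \<in> borel_measurable (Rnt n)" using gsq_meas by measurable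
  define F where "F i p = ennreal (4 powr e) * (ennreal (\<omega> (k1 + int i) (fst p)) * (indicator {0<..2 powi (k1 + int i)} (snd p) * ?G2 p))" for i p
  have mF: "F i \<in> borel_measurable (Rnt n)" for i
  proof -
    have "(\<lambda>p. \<omega> (k1 + int i) (fst p)) \<in> borel_measurable (Rnt n)" by (rule measurable_compose[OF measurable_fst wm])
    from measurable_compose[OF this measurable_ennreal]
    have "(\<lambda>p. ennreal (\<omega> (k1 + int i) (fst p))) \<in> borel_measurable (Rnt n)" .
    then have "(\<lambda>p. F i p) \<in> borel_measurable (Rnt n)"
      unfolding F_def using mG2 by (intro borel_measurable_times_ennreal) auto
    then show ?thesis by simp
  qed
  have pw: "ennreal (indicator {0<..} (snd p) * (snd p * sqrt (gsq n f p) * ssq n (reflect n X0 ((fst p)(n := snd p))) powr (- pm n - 1/2))) \<le> (\<Sum>i. F i p)" for p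
  proof (cases "snd p > 0")
    case True
    define s where "s = snd p"
    obtain ks where ks: "s \<in> strip ks" using ex_strip True unfolding s_def by blast
    \<comment> \<open>A point of height \<open>s\<close> is assigned the larger of the scales of
      \<open>T\<close> and \<open>s\<close>, so that \<open>T + s\<close> is at least half of
      \<open>2 powi k\<close>. This costs the factor \<open>4 powr e\<close>.\<close>
    define k where "k = max k1 ks"
    define i where "i = nat (k - k1)"
    have ki: "k1 + int i = k" by (simp add: i_def k_def)
    have sk: "s \<in> {0<..2 powi k}" using strip_subset[of ks k] ks by (auto simp: k_def)
    have half: "2 powi (k - 1) \<le> T + s"
      using k1 ks True T by (auto simp: k_def strip_def s_def max_def)
    have "(2::real) powi k = 2 powi (k - 1) * 2" using power_int_add[of "2::real" "k - 1" 1] by simp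
    then have "(2 powi k)\<^sup>2 / 4 = ((2::real) powi (k - 1))\<^sup>2" by (simp add: power_mult_distrib)
    also have "\<dots> \<le> (T + s)\<^sup>2" using half by (intro power_mono) auto
    finally have h4: "(2 powi k)\<^sup>2 / 4 \<le> (T + s)\<^sup>2" .
    define N where "N = (\<Sum>i<n. (X0 i - fst p i)\<^sup>2)"
    have N: "N \<ge> 0" by (simp add: N_def sum_nonneg)
    have s1: "ssq n (reflect n X0 ((fst p)(n := snd p))) = (T + s)\<^sup>2 + N"
      by (simp add: ssq_split) (simp add: reflect_def N_def T_def s_def)
    have s2: "ssq n (sh n (X0(n := 2 powi k)) (fst p)) = (2 powi k)\<^sup>2 + N"
      by (simp add: ssq_split) (simp add: sh_def N_def)
    have "((T + s)\<^sup>2 + N) powr (- e) \<le> (((2 powi k)\<^sup>2 + N) / 4) powr (- e)"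
    proof (rule powr_mono2')
      show "((2 powi k)\<^sup>2 + N) / 4 \<le> (T + s)\<^sup>2 + N" using h4 N by simp
    qed (use e N in \<open>auto intro: add_pos_nonneg\<close>)
    also have "\<dots> = 4 powr e * ((2 powi k)\<^sup>2 + N) powr (- e)"
      using N by (simp only: powr_divide powr_minus_divide) simp
    finally have "ssq n (reflect n X0 ((fst p)(n := snd p))) powr (- e) \<le> 4 powr e * \<omega> k (fst p)"
      by (simp add: s1 s2 \<omega>_def)
    then have "s * sqrt (gsq n f p) * ssq n (reflect n X0 ((fst p)(n := snd p))) powr (- e) \<le> s * sqrt (gsq n f p) * (4 powr e * \<omega> k (fst p))"
      using True gsq_nonneg[of n f p] by (intro mult_left_mono) (auto simp: s_def)
    then have "ennreal (s * sqrt (gsq n f p) * ssq n (reflect n X0 ((fst p)(n := snd p))) powr (- e)) \<le> ennreal (4 powr e * (\<omega> k (fst p) * (s * sqrt (gsq n f p))))"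
      by (intro ennreal_leI) (simp add: mult_ac)
    also have "\<dots> = F i p"
      unfolding F_def ki using sk w0[of k "fst p"] by (simp add: ennreal_mult' s_def)
    also have "\<dots> \<le> (\<Sum>i. F i p)"
      using sum_le_suminf[of "\<lambda>i. F i p" "{i}"] by simp
    finally show ?thesis using True unfolding e' by (simp add: s_def)
  qed simp
  have piece: "(\<integral>\<^sup>+p. F i p \<partial>(Rnt n)) \<le> ennreal (4 powr e * (C * M0 + 1) * bq n (real n + 2) / 2 powi k1 * (1/2) ^ i)" for i
  proof -
    let ?k = "k1 + int i"
    let ?R = "2 powi ?k :: real"
    have "(\<integral>\<^sup>+p. F i p \<partial>(Rnt n)) = (\<integral>\<^sup>+y. (\<integral>\<^sup>+t. F i (y, t) \<partial>lborel) \<partial>Rn n)"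
      by (rule lborel.nn_integral_fst[OF mF, symmetric])
    also have "\<dots> = (\<integral>\<^sup>+y. ennreal (4 powr e) * (ennreal (\<omega> ?k y) * line_int {0<..?R} ?G2 y) \<partial>Rn n)"
    proof (intro nn_integral_cong)
      fix y assume y: "y \<in> space (Rn n)"
      have m: "(\<lambda>t. indicator {0<..?R} t * ?G2 (y, t)) \<in> borel_measurable lborel"
        using measurable_compose[OF measurable_Pair1'[OF y] mG2] by (intro borel_measurable_times_ennreal) auto
      show "(\<integral>\<^sup>+t. F i (y, t) \<partial>lborel) = ennreal (4 powr e) * (ennreal (\<omega> ?k y) * line_int {0<..?R} ?G2 y)"
        unfolding F_def line_int_def using m
        by (simp only: fst_conv snd_conv nn_integral_cmult borel_measurable_times_ennreal borel_measurable_const)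
    qed
    also have "\<dots> = ennreal (4 powr e) * (\<integral>\<^sup>+y. ennreal (\<omega> ?k y) * line_int {0<..?R} ?G2 y \<partial>Rn n)"
      using wm by (intro nn_integral_cmult borel_measurable_times_ennreal measurable_line_int mG2) auto
    also have "\<dots> \<le> ennreal (4 powr e) * (ennreal (?R * (C * M0 + 1)) * (\<integral>\<^sup>+y. ennreal (\<omega> ?k y) \<partial>Rn n))"
      by (intro mult_left_mono carleson_first_order[OF wm w0 wH C]) auto
    also have "\<dots> = ennreal (4 powr e * (?R * (C * M0 + 1) * (bq n (real n + 2) / ?R\<^sup>2)))"
      unfolding wI using C M0 bq_pos[of n "real n + 2"] by (simp add: ennreal_mult'[symmetric])
    also have "4 powr e * (?R * (C * M0 + 1) * (bq n (real n + 2) / ?R\<^sup>2)) = 4 powr e * (C * M0 + 1) * bq n (real n + 2) / ?R"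
      by (simp add: power2_eq_square)
    also have "?R = 2 powi k1 * 2 ^ i" using power_int_add[of "2::real" k1 "int i"] by simp
    finally show ?thesis by (simp add: power_one_over mult_ac)
  qed
  define c where "c = 4 powr e * (C * M0 + 1) * bq n (real n + 2) / 2 powi k1"
  have c: "c \<ge> 0" using C M0 bq_pos[of n "real n + 2"] by (simp add: c_def)
  have "(\<integral>\<^sup>+p. ennreal (indicator {0<..} (snd p) * (snd p * sqrt (gsq n f p) * ssq n (reflect n X0 ((fst p)(n := snd p))) powr (- pm n - 1/2))) \<partial>(Rnt n))
     \<le> (\<integral>\<^sup>+p. (\<Sum>i. F i p) \<partial>(Rnt n))"
    by (intro nn_integral_mono pw)
  also have "\<dots> = (\<Sum>i. \<integral>\<^sup>+p. F i p \<partial>(Rnt n))" by (rule nn_integral_suminf[OF mF])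
  also have "\<dots> \<le> (\<Sum>i. ennreal (c * (1/2) ^ i))"
    using piece by (intro suminf_le) (auto simp: c_def)
  also have "\<dots> = ennreal (\<Sum>i. c * (1/2) ^ i)"
    using c by (intro suminf_ennreal2) (auto intro!: summable_mult summable_geometric)
  also have "(\<Sum>i. c * (1/2) ^ i) = c * 2"
    using suminf_geometric[of "1/2::real"] by (subst suminf_mult) (auto intro!: summable_geometric)
  also have "ennreal (c * 2) \<le> ennreal (4 powr e * (C * M0 + 1) * bq n (real n + 2) * 2 / T)"
  proof (rule ennreal_leI)
    have "T \<le> 2 powi k1" using k1 by (simp add: strip_def)
    then have "4 powr e * (C * M0 + 1) * bq n (real n + 2) * 2 / 2 powi k1 \<le> 4 powr e * (C * M0 + 1) * bq n (real n + 2) * 2 / T"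
      using C M0 bq_pos[of n "real n + 2"] T by (intro divide_left_mono) auto
    then show "c * 2 \<le> 4 powr e * (C * M0 + 1) * bq n (real n + 2) * 2 / T" by (simp add: c_def)
  qed
  finally show ?thesis by (simp only: e_def C_def T_def)
qed

text \<open>The Carleson condition implies a Bloch condition. An increment of the extension is
  written by the Green representation with two poles; the kernel gradient is Lipschitz in the pole
  with the constant from the second derivatives, and \<open>nn_integral_grad_kernel\<close>
  integrates that against the gradient. The factor 2 in \<open>M\<close> is that of the
  representation, and \<open>Suc n\<close> counts the partial derivatives.\<close>

lemma gradient_bound:
  obtains M where "M \<ge> 0" "\<And>i X. i \<le> n \<Longrightarrow> X n > 0 \<Longrightarrow> \<bar>U1 n f i X\<bar> \<le> M / X n"
proof -
  define K where "K = 4 powr (pm n + 1/2) * (((2 * real n + 2) powr (pm n + 1/2)) * M0 + 1) * bq n (real n + 2) * 2"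
  have K: "K \<ge> 0" using M0 bq_pos[of n "real n + 2"] by (simp add: K_def)
  define L where "L = pc n * pC n * 4 powr (pm n + 1/2)"
  have L: "L \<ge> 0" using pc_pos[of n] pC_ge_1[of n] by (simp add: L_def)
  define M where "M = 2 * (real (Suc n) * L * K)"
  interpret u: nice_harmonic n "U n f" "U1 n f" "U2 n f" "\<lambda>X. pC n * U n (\<lambda>z. \<bar>f z\<bar>) X" "pC n * (1 + pc n) * (\<integral>z. \<bar>f z\<bar> \<partial>Rn n)"
    by (rule nice_harmonic_U[OF n f])
  have "\<bar>U1 n f j X0\<bar> \<le> M / X0 n" if j: "j \<le> n" and X0: "X0 n > 0" for j X0
  proof (rule abs_deriv_le_of_lipschitz[where \<delta>="X0 n / 2"])
    show "((\<lambda>s. U n f (X0(j := s))) has_real_derivative U1 n f j X0) (at (X0 j))" by (rule u.D1) (use j X0 in auto)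
    show "X0 n / 2 > 0" using X0 by simp
    fix h assume h: "\<bar>h\<bar> \<le> X0 n / 2"
    define X1 where "X1 = X0(j := X0 j + h)"
    have X1: "X1 n > 0" using h X0 by (auto simp: X1_def abs_le_iff)
    define W where "W p = indicator {0<..} (snd p) * (snd p * sqrt (gsq n f p) * ssq n (reflect n X0 ((fst p)(n := snd p))) powr (- pm n - 1/2))" for p
    have mW: "W \<in> borel_measurable (Rnt n)"
    proof -
      have "(\<lambda>p. ssq n (reflect n X0 ((fst p)(n := snd p))) powr (- pm n - 1/2)) \<in> borel_measurable (Rnt n)"
        by (intro powr_real_measurable measurable_ssq measurable_reflect_component) auto
      moreover have "(\<lambda>p. sqrt (gsq n f p)) \<in> borel_measurable (Rnt n)" using gsq_meas by measurable
      ultimately have "(\<lambda>p. W p) \<in> borel_measurable (Rnt n)"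
        unfolding W_def by (intro borel_measurable_times) auto
      then show ?thesis by simp
    qed
    have W0: "W p \<ge> 0" for p using gsq_nonneg[of n f p] by (auto simp: W_def indicator_def)
    have WI: "(\<integral>\<^sup>+p. ennreal (W p) \<partial>(Rnt n)) \<le> ennreal (K / X0 n)"
      unfolding W_def K_def by (rule nn_integral_grad_kernel[of X0]) (rule X0)
    have KT: "K / X0 n \<ge> 0" using K X0 by simp
    note WB = integral_le_nn_integral_bound[OF mW W0 WI KT]
    define I where "I X p = hdot n (U1 n f) (v1 n X) p" for X and p :: "point \<times> real"
    have I: "integrable (Rnt n) (I X)" "U n f X = 2 * (\<integral>p. I X p \<partial>(Rnt n))" if "X n > 0" for X
      using U_representation[OF n f, of X] that by (simp_all add: I_def[abs_def])
    have "U n f X1 - U n f X0 = 2 * (\<integral>p. I X1 p - I X0 p \<partial>(Rnt n))"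
      using I[of X1] I[of X0] X1 X0 by simp
    moreover have "\<bar>\<integral>p. I X1 p - I X0 p \<partial>(Rnt n)\<bar> \<le> (\<integral>p. \<bar>h\<bar> * (real (Suc n) * L) * W p \<partial>(Rnt n))"
    proof (rule abs_integral_le)
      show "integrable (Rnt n) (\<lambda>p. \<bar>h\<bar> * (real (Suc n) * L) * W p)" using WB(1) by simp
      fix p :: "point \<times> real"
      show "\<bar>I X1 p - I X0 p\<bar> \<le> \<bar>h\<bar> * (real (Suc n) * L) * W p"
      proof (cases "snd p > 0")
        case True
        let ?X = "(fst p)(n := snd p)"
        let ?Z = "reflect n X0 ?X"
        define B where "B = L * ssq n ?Z powr (- pm n - 1/2)"
        have alg: "s * (c * (g * (b * (l * q)))) = b * (c * l) * (1 * (s * g * q))" for s c g b l q :: real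
          by simp
        have Zn: "?Z n > 0" using True X0 by simp
        have rX1: "reflect n X1 ?X = ?Z(j := ?Z j + h)" by (auto simp: reflect_def X1_def)
        have d: "\<bar>v1 n X1 i ?X - v1 n X0 i ?X\<bar> \<le> \<bar>h\<bar> * B" if i: "i \<le> n" for i
        proof -
          have "\<bar>pk1 n i (?Z(j := ?Z j + h)) - pk1 n i ?Z\<bar> \<le> \<bar>h\<bar> * (pc n * pC n * 4 powr (pm n + 1/2) * ssq n ?Z powr (- pm n - 1/2))"
            by (rule pk1_lipschitz[of i n j ?Z]) (use i j Zn h True in auto)
          moreover have "\<bar>v1 n X1 i ?X - v1 n X0 i ?X\<bar> = \<bar>pk1 n i (?Z(j := ?Z j + h)) - pk1 n i ?Z\<bar>"
            unfolding rX1 by (auto simp: abs_minus_commute)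
          ultimately show ?thesis by (simp only: B_def L_def)
        qed
        have e1: "I X1 p - I X0 p = snd p * (\<Sum>i\<le>n. U1 n f i ?X * (v1 n X1 i ?X - v1 n X0 i ?X))"
          using True by (simp add: I_def dotg_def right_diff_distrib sum_subtractf)
        have e2: "\<bar>I X1 p - I X0 p\<bar> \<le> snd p * (\<Sum>i\<le>n. sqrt (gsq n f p) * (\<bar>h\<bar> * B))"
          unfolding e1 abs_mult[of "snd p"] using True
        proof (intro mult_mono)
          show "\<bar>\<Sum>i\<le>n. U1 n f i ?X * (v1 n X1 i ?X - v1 n X0 i ?X)\<bar> \<le> (\<Sum>i\<le>n. sqrt (gsq n f p) * (\<bar>h\<bar> * B))"
          proof (rule order.trans[OF sum_abs], rule sum_mono)
            fix i assume i: "i \<in> {..n}"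
            show "\<bar>U1 n f i ?X * (v1 n X1 i ?X - v1 n X0 i ?X)\<bar> \<le> sqrt (gsq n f p) * (\<bar>h\<bar> * B)"
              unfolding abs_mult[of "U1 n f i ?X"]
            proof (rule mult_mono)
              show "\<bar>U1 n f i ?X\<bar> \<le> sqrt (gsq n f p)" by (rule U1_le_sqrt_gsq) (use i in simp)
              show "\<bar>v1 n X1 i ?X - v1 n X0 i ?X\<bar> \<le> \<bar>h\<bar> * B" by (rule d) (use i in simp)
            qed (simp_all only: real_sqrt_ge_zero gsq_nonneg abs_ge_zero)
          qed
        qed simp_all
        have e3: "snd p * (\<Sum>i\<le>n. sqrt (gsq n f p) * (\<bar>h\<bar> * B)) = \<bar>h\<bar> * (real (Suc n) * L) * (1 * (snd p * sqrt (gsq n f p) * ssq n ?Z powr (- pm n - 1/2)))"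
          unfolding B_def sum_constant card_atMost by (rule alg)
        have e4: "W p = 1 * (snd p * sqrt (gsq n f p) * ssq n ?Z powr (- pm n - 1/2))"
          unfolding W_def using True by (simp only: indicator_simps greaterThan_iff)
        show ?thesis using e2 unfolding e3 e4 .
      qed (simp add: I_def W_def)
    qed
    moreover have "(\<integral>p. \<bar>h\<bar> * (real (Suc n) * L) * W p \<partial>(Rnt n)) \<le> \<bar>h\<bar> * (real (Suc n) * L) * (K / X0 n)"
      unfolding integral_mult_right_zero using L by (intro mult_left_mono[OF WB(2)]) simp
    ultimately have "\<bar>U n f X1 - U n f X0\<bar> \<le> 2 * (\<bar>h\<bar> * (real (Suc n) * L) * (K / X0 n))"
      by (simp add: abs_mult)
    also have "\<dots> = \<bar>h\<bar> * (M / X0 n)" by (simp add: M_def)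
    finally show "\<bar>U n f (X0(j := X0 j + h)) - U n f (X0(j := X0 j))\<bar> \<le> \<bar>h\<bar> * (M / X0 n)" by (simp add: X1_def)
  qed
  moreover have "M \<ge> 0" using K L by (simp add: M_def)
  ultimately show ?thesis using that by blast
qed

end

end

section \<open>From the Carleson condition to the Garcia condition\<close>

lemma measurable_indicator_snd:
  "S \<in> sets borel \<Longrightarrow> (\<lambda>p :: point \<times> real. indicator S (snd p) :: real) \<in> borel_measurable (Rnt n)"
  by (rule measurable_compose[OF measurable_snd]) simp

lemma integrable_strip_mult:
  fixes w :: "point \<Rightarrow> real" and a b :: real
  assumes w: "integrable (Rn n) w" and ab: "a \<le> b"
  shows "integrable (Rnt n) (\<lambda>p. indicator {a<..b} (snd p) * w (fst p))"
proof (rule integrableI_bounded)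
  have wm: "w \<in> borel_measurable (Rn n)" using w by auto
  have wf: "(\<lambda>p. w (fst p)) \<in> borel_measurable (Rnt n)" by (rule measurable_compose[OF measurable_fst wm])
  show m: "(\<lambda>p. indicator {a<..b} (snd p) * w (fst p)) \<in> borel_measurable (Rnt n)"
    by (intro borel_measurable_times measurable_indicator_snd wf) simp
  have "(\<integral>\<^sup>+p. ennreal (norm (indicator {a<..b} (snd p) * w (fst p))) \<partial>(Rnt n))
     = (\<integral>\<^sup>+y. (\<integral>\<^sup>+r. ennreal \<bar>w y\<bar> * indicator {a<..b} r \<partial>lborel) \<partial>Rn n)"
    using measurable_compose[OF measurable_compose[OF m borel_measurable_norm] measurable_ennreal]
    by (subst lborel.nn_integral_fst[symmetric]) (auto simp: indicator_def intro!: nn_integral_cong)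
  also have "\<dots> = (\<integral>\<^sup>+y. ennreal (b - a) * ennreal \<bar>w y\<bar> \<partial>Rn n)"
    using ab by (intro nn_integral_cong) (simp add: nn_integral_cmult_indicator mult.commute)
  also have "\<dots> = ennreal (b - a) * (\<integral>\<^sup>+y. ennreal \<bar>w y\<bar> \<partial>Rn n)" using wm by (intro nn_integral_cmult) auto
  also have "\<dots> < \<infinity>" using w by (simp add: integrable_iff_bounded ennreal_mult_less_top)
  finally show "(\<integral>\<^sup>+p. ennreal (norm (indicator {a<..b} (snd p) * w (fst p))) \<partial>(Rnt n)) < \<infinity>" .
qed

text \<open>The logarithm is traded for a power small enough for the later weights to stay
  integrable: \<open>(T / s) powr (1/4)\<close> near \<open>s = 0\<close>, and the square of the
  spatial growth factor against the Poisson kernel.\<close>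

lemma ln_le_fourth_root: "x \<ge> 1 \<Longrightarrow> ln x \<le> 4 * x powr (1/4)" for x :: real
proof -
  assume x: "x \<ge> 1"
  have "ln x = 4 * ln (x powr (1/4))" using x by (simp add: ln_powr)
  also have "\<dots> \<le> 4 * x powr (1/4)" using x ln_le_minus_one[of "x powr (1/4)"] by simp
  finally show ?thesis .
qed

text \<open>The weight \<open>w\<close> is a function of the base point alone, so vertical
  differentiation of \<open>(u - c)\<^sup>2 * w\<close> does not touch it. Its derivatives
  \<open>w1\<close> enter through the horizontal integration by parts in
  \<open>integral_h2\<close>.\<close>

locale weighted_harmonic = nice_harmonic +
  fixes w :: "point \<Rightarrow> real" and w1 :: "nat \<Rightarrow> point \<Rightarrow> real" and W :: real and c :: real
  assumes w: "integrable (Rn n) w" and w1: "\<And>i. i < n \<Longrightarrow> integrable (Rn n) (w1 i)"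
    and Dw: "\<And>i y s. i < n \<Longrightarrow> ((\<lambda>s. w (y(i := s))) has_real_derivative w1 i (y(i := s))) (at s)"
    and bw: "\<And>y. \<bar>w y\<bar> \<le> W" and bw1: "\<And>i y. i < n \<Longrightarrow> \<bar>w1 i y\<bar> \<le> W"
begin

text \<open>The second vertical derivative of \<open>(u - c)\<^sup>2\<close>, as \<open>h1\<close>
  is the first.\<close>

definition h2 :: "point \<Rightarrow> real" where
  "h2 X = 2 * (u1 n X)\<^sup>2 + 2 * ((u X - c) * u2 n X)"

definition h1 :: "point \<Rightarrow> real" where
  "h1 X = 2 * ((u X - c) * u1 n X)"

lemma u_bounded: "X n > 0 \<Longrightarrow> \<bar>u X - c\<bar> \<le> A / X n ^ n + \<bar>c\<bar>"
  using bound0_height[of X] by linarith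

lemma meas_uc: "(\<lambda>p. u ((fst p)(n := snd p)) - c) \<in> borel_measurable (Rnt n)"
  by (intro borel_measurable_diff meas0 borel_measurable_const)

lemma meas_h2: "(\<lambda>p. h2 ((fst p)(n := snd p))) \<in> borel_measurable (Rnt n)"
  unfolding h2_def
  by (intro borel_measurable_add borel_measurable_times borel_measurable_const borel_measurable_power meas_uc meas1 meas2 order_refl)

text \<open>The Laplace equation replaces the vertical second derivative by horizontal ones, which
  are integrated by parts: the terms without \<open>w1\<close> complete the energy density, and the
  terms in which the derivative falls on \<open>w\<close> remain as an error.\<close>

lemma integral_h2:
  assumes s: "s > 0"
  shows "integrable (Rn n) (\<lambda>y. h2 (y(n := s)) * w y)"
    and "(\<integral>y. h2 (y(n := s)) * w y \<partial>Rn n)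
      = (\<integral>y. 2 * (\<Sum>i\<le>n. (u1 i (y(n := s)))\<^sup>2) * w y + 2 * (\<Sum>i<n. (u (y(n := s)) - c) * u1 i (y(n := s)) * w1 i y) \<partial>Rn n)"
    and "integrable (Rn n) (\<lambda>y. 2 * (\<Sum>i\<le>n. (u1 i (y(n := s)))\<^sup>2) * w y + 2 * (\<Sum>i<n. (u (y(n := s)) - c) * u1 i (y(n := s)) * w1 i y))"
proof -
  define K0 where "K0 = A / s ^ n + \<bar>c\<bar>"
  define K1 where "K1 = A / s ^ Suc n"
  define K2 where "K2 = A / s ^ Suc (Suc n)"
  have b0: "\<bar>u (y(n := s)) - c\<bar> \<le> K0" for y using u_bounded[of "y(n := s)"] s by (simp add: K0_def)
  have b1: "\<bar>u1 i (y(n := s))\<bar> \<le> K1" if "i \<le> n" for i y using bound1_height[of i "y(n := s)"] s that by (simp add: K1_def)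
  have b2: "\<bar>u2 i (y(n := s))\<bar> \<le> K2" if "i \<le> n" for i y using bound2_height[of i "y(n := s)"] s that by (simp add: K2_def)
  have K: "K0 \<ge> 0" "K1 \<ge> 0" "K2 \<ge> 0" using A_nonneg s by (auto simp: K0_def K1_def K2_def)
  have m0: "(\<lambda>y. u (y(n := s)) - c) \<in> borel_measurable (Rn n)"
    by (intro borel_measurable_diff measurable_slice(1)[OF meas0] borel_measurable_const)
  note m1 = measurable_slice(1)[OF meas1] and m2 = measurable_slice(1)[OF meas2]
  have p: "\<bar>x * z\<bar> \<le> P * Q" if "\<bar>x\<bar> \<le> P" "\<bar>z\<bar> \<le> Q" for x z P Q :: real
    unfolding abs_mult using that by (intro mult_mono) auto
  have i1: "integrable (Rn n) (\<lambda>y. (u1 i (y(n := s)))\<^sup>2 * w y)" if "i \<le> n" for i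
    unfolding power2_eq_square
    by (rule integrable_bounded_mult[OF w, where B="K1 * K1"]) (intro borel_measurable_times m1 that, rule p[OF b1[OF that] b1[OF that]])
  have i2: "integrable (Rn n) (\<lambda>y. ((u (y(n := s)) - c) * u2 i (y(n := s))) * w y)" if "i \<le> n" for i
    by (rule integrable_bounded_mult[OF w, where B="K0 * K2"]) (intro borel_measurable_times m0 m2 that, rule p[OF b0 b2[OF that]])
  have i3: "integrable (Rn n) (\<lambda>y. ((u (y(n := s)) - c) * u1 i (y(n := s))) * w1 i y)" if "i < n" for i
    by (rule integrable_bounded_mult[OF w1[OF that], where B="K0 * K1"]) (intro borel_measurable_times m0 m1 less_imp_le that, rule p[OF b0 b1[OF less_imp_le[OF that]]])
  have i4: "integrable (Rn n) (\<lambda>y. ((u (y(n := s)) - c) * u1 i (y(n := s))) * w y)" if "i < n" for i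
    by (rule integrable_bounded_mult[OF w, where B="K0 * K1"]) (intro borel_measurable_times m0 m1 less_imp_le that, rule p[OF b0 b1[OF less_imp_le[OF that]]])
  \<comment> \<open>The derivative in direction \<open>i\<close> of
    \<open>(u - c) * u1 i * w\<close>, whose integral over the slice vanishes.\<close>
  define E where "E i y = (u1 i (y(n := s)))\<^sup>2 * w y + ((u (y(n := s)) - c) * u2 i (y(n := s))) * w y + ((u (y(n := s)) - c) * u1 i (y(n := s))) * w1 i y" for i y
  have iE: "integrable (Rn n) (E i)" if "i < n" for i
    using Bochner_Integration.integrable_add[OF Bochner_Integration.integrable_add[OF i1 i2] i3] that by (simp add: E_def[abs_def])
  have E0: "(\<integral>y. E i y \<partial>Rn n) = 0" if i: "i < n" for i
  proof (rule integral_partial_derivative_eq_0[OF i _ i4[OF i] iE[OF i]])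
    fix y :: "nat \<Rightarrow> real" and t
    let ?X = "(y(n := s))(i := t)"
    have tw: "(y(i := r))(n := s) = (y(n := s))(i := r)" for r using i by (simp add: fun_upd_twist)
    have d0: "((\<lambda>t. u ((y(n := s))(i := t)) - c) has_real_derivative u1 i ?X) (at t)"
      using DERIV_diff[OF D1' DERIV_const, of i "y(n := s)" t c] i s by simp
    have d1: "((\<lambda>t. u1 i ((y(n := s))(i := t))) has_real_derivative u2 i ?X) (at t)"
      by (rule D2') (use i s in auto)
    have alg: "(x1 * z + z2 * x) * v + q * (x * z) = z * x1 * v + (x * z2) * v + (x * z) * q" for x1 z z2 x v q :: real
      by (simp add: algebra_simps)
    have "((\<lambda>t. ((u ((y(n := s))(i := t)) - c) * u1 i ((y(n := s))(i := t))) * w (y(i := t))) has_real_derivative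
       u1 i ?X * u1 i ?X * w (y(i := t)) + ((u ?X - c) * u2 i ?X) * w (y(i := t)) + ((u ?X - c) * u1 i ?X) * w1 i (y(i := t))) (at t)"
      by (rule DERIV_cong[OF DERIV_mult[OF DERIV_mult[OF d0 d1] Dw[OF i]]]) (rule alg)
    then show "((\<lambda>t. ((u ((y(i := t))(n := s)) - c) * u1 i ((y(i := t))(n := s))) * w (y(i := t))) has_real_derivative E i (y(i := t))) (at t)"
      unfolding E_def tw power2_eq_square .
    show "\<bar>E i y\<bar> \<le> K1 * K1 * W + K0 * K2 * W + K0 * K1 * W"
      unfolding E_def power2_eq_square using i
      by (intro order.trans[OF abs_triangle_ineq] add_mono p b0 b1 b2 bw bw1) auto
  qed
  have lap: "u2 n (y(n := s)) = - (\<Sum>i<n. u2 i (y(n := s)))" for y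
    using laplace[of "y(n := s)"] s by (simp add: lessThan_Suc_atMost[symmetric])
  have h2i: "integrable (Rn n) (\<lambda>y. h2 (y(n := s)) * w y)"
  proof -
    have "integrable (Rn n) (\<lambda>y. 2 * ((u1 n (y(n := s)))\<^sup>2 * w y) + 2 * (((u (y(n := s)) - c) * u2 n (y(n := s))) * w y))"
      by (intro Bochner_Integration.integrable_add integrable_mult_right i1 i2 order_refl)
    then show ?thesis by (simp only: h2_def distrib_right mult.assoc)
  qed
  then show "integrable (Rn n) (\<lambda>y. h2 (y(n := s)) * w y)" .
  have iS: "integrable (Rn n) (\<lambda>y. 2 * (\<Sum>i<n. E i y))"
    using iE by (intro integrable_mult_right Bochner_Integration.integrable_sum) auto
  have eq: "2 * (\<Sum>i\<le>n. (u1 i (y(n := s)))\<^sup>2) * w y + 2 * (\<Sum>i<n. (u (y(n := s)) - c) * u1 i (y(n := s)) * w1 i y)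
     = h2 (y(n := s)) * w y + 2 * (\<Sum>i<n. E i y)" for y
  proof -
    have a1: "(\<Sum>i\<le>n. (u1 i (y(n := s)))\<^sup>2) = (\<Sum>i<n. (u1 i (y(n := s)))\<^sup>2) + (u1 n (y(n := s)))\<^sup>2"
      by (simp add: lessThan_Suc_atMost[symmetric])
    have a2: "(\<Sum>i<n. E i y) = (\<Sum>i<n. (u1 i (y(n := s)))\<^sup>2) * w y + ((u (y(n := s)) - c) * (\<Sum>i<n. u2 i (y(n := s)))) * w y
       + (\<Sum>i<n. (u (y(n := s)) - c) * u1 i (y(n := s)) * w1 i y)"
      unfolding E_def sum.distrib by (simp only: sum_distrib_left sum_distrib_right)
    have alg: "2 * (q + b) * v + 2 * r = (2 * b + 2 * (x * - z)) * v + 2 * (q * v + (x * z) * v + r)" for q b v r x z :: real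
      by (simp add: algebra_simps)
    show ?thesis unfolding a1 a2 h2_def lap by (rule alg)
  qed
  have "(\<integral>y. 2 * (\<Sum>i<n. E i y) \<partial>Rn n) = 0"
    using iE E0 by (simp add: Bochner_Integration.integral_sum)
  then show "(\<integral>y. h2 (y(n := s)) * w y \<partial>Rn n)
      = (\<integral>y. 2 * (\<Sum>i\<le>n. (u1 i (y(n := s)))\<^sup>2) * w y + 2 * (\<Sum>i<n. (u (y(n := s)) - c) * u1 i (y(n := s)) * w1 i y) \<partial>Rn n)"
    unfolding eq Bochner_Integration.integral_add[OF h2i iS] by simp
  show "integrable (Rn n) (\<lambda>y. 2 * (\<Sum>i\<le>n. (u1 i (y(n := s)))\<^sup>2) * w y + 2 * (\<Sum>i<n. (u (y(n := s)) - c) * u1 i (y(n := s)) * w1 i y))"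
    unfolding eq by (rule Bochner_Integration.integrable_add[OF h2i iS])
qed

text \<open>Taylor's formula between \<epsilon> and \<open>T\<close> instead of up to infinity,
  because \<open>u - c\<close> need not decay; the boundary terms at \<open>T\<close> remain. All
  bounds on \<open>u\<close> and its derivatives are taken at height \<epsilon>, where they are
  largest.\<close>

lemma weighted_taylor:
  assumes \<epsilon>: "0 < \<epsilon>" "\<epsilon> < T"
  shows "integrable (Rn n) (\<lambda>y. (u (y(n := \<epsilon>)) - c)\<^sup>2 * w y)"
    and "integrable lborel (\<lambda>r. indicator {\<epsilon><..T} r * ((r - \<epsilon>) * (\<integral>y. h2 (y(n := r)) * w y \<partial>Rn n)))"
    and "(\<integral>y. (u (y(n := \<epsilon>)) - c)\<^sup>2 * w y \<partial>Rn n)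
      = (\<integral>r. indicator {\<epsilon><..T} r * ((r - \<epsilon>) * (\<integral>y. h2 (y(n := r)) * w y \<partial>Rn n)) \<partial>lborel)
        + (\<integral>y. ((u (y(n := T)) - c)\<^sup>2 - (T - \<epsilon>) * h1 (y(n := T))) * w y \<partial>Rn n)"
proof -
  define K0 where "K0 = A / \<epsilon> ^ n + \<bar>c\<bar>"
  define K1 where "K1 = A / \<epsilon> ^ Suc n"
  define K2 where "K2 = A / \<epsilon> ^ Suc (Suc n)"
  have T: "T > 0" using \<epsilon> by simp
  have dn: "A / t ^ m \<le> A / \<epsilon> ^ m" if "t \<ge> \<epsilon>" for t m
    using A_nonneg \<epsilon> that by (intro divide_left_mono power_mono mult_pos_pos zero_less_power) auto
  have b0: "\<bar>u X - c\<bar> \<le> K0" if "X n \<ge> \<epsilon>" for X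
    using u_bounded[of X] dn[OF that, of n] that \<epsilon> unfolding K0_def by linarith
  have b1: "\<bar>u1 n X\<bar> \<le> K1" if "X n \<ge> \<epsilon>" for X
    using bound1_height[of n X] dn[OF that, of "Suc n"] that \<epsilon> unfolding K1_def by linarith
  have b2: "\<bar>u2 n X\<bar> \<le> K2" if "X n \<ge> \<epsilon>" for X
    using bound2_height[of n X] dn[OF that, of "Suc (Suc n)"] that \<epsilon> unfolding K2_def by linarith
  have p: "\<bar>x * z\<bar> \<le> P * Q" if "\<bar>x\<bar> \<le> P" "\<bar>z\<bar> \<le> Q" for x z P Q :: real
    unfolding abs_mult using that by (intro mult_mono) auto
  have bh2: "\<bar>h2 X\<bar> \<le> 2 * (K1 * K1) + 2 * (K0 * K2)" if "X n \<ge> \<epsilon>" for X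
  proof -
    have "\<bar>u1 n X * u1 n X\<bar> \<le> K1 * K1" "\<bar>(u X - c) * u2 n X\<bar> \<le> K0 * K2"
      using b0[of X] b1[of X] b2[of X] that by (simp_all only: p)
    then show ?thesis unfolding h2_def power2_eq_square by linarith
  qed
  have wm: "w \<in> borel_measurable (Rn n)" using w by auto
  have m0: "(\<lambda>y. u (y(n := t)) - c) \<in> borel_measurable (Rn n)" for t
    by (intro borel_measurable_diff measurable_slice(1)[OF meas0] borel_measurable_const)
  have sq: "integrable (Rn n) (\<lambda>y. (u (y(n := t)) - c)\<^sup>2 * w y)" if "t \<ge> \<epsilon>" for t
    unfolding power2_eq_square
    by (rule integrable_bounded_mult[OF w, where B="K0 * K0"]) (intro borel_measurable_times m0, intro p b0, simp_all add: that)
  then show "integrable (Rn n) (\<lambda>y. (u (y(n := \<epsilon>)) - c)\<^sup>2 * w y)" by simp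
  have ih1: "integrable (Rn n) (\<lambda>y. ((T - \<epsilon>) * h1 (y(n := T))) * w y)"
    unfolding h1_def
    by (rule integrable_bounded_mult[OF w, where B="\<bar>T - \<epsilon>\<bar> * (2 * (K0 * K1))"])
      (intro borel_measurable_times borel_measurable_const m0 measurable_slice(1)[OF meas1] order_refl,
       intro p b0 b1, use \<epsilon> in simp_all)
  have iend: "integrable (Rn n) (\<lambda>y. ((u (y(n := T)) - c)\<^sup>2 - (T - \<epsilon>) * h1 (y(n := T))) * w y)"
  proof -
    have "integrable (Rn n) (\<lambda>y. (u (y(n := T)) - c)\<^sup>2 * w y - ((T - \<epsilon>) * h1 (y(n := T))) * w y)"
      using \<epsilon> by (intro Bochner_Integration.integrable_diff sq ih1) simp
    then show ?thesis
      by (rule Bochner_Integration.integrable_cong[THEN iffD1, OF refl, rotated]) (rule left_diff_distrib[symmetric])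
  qed
  have prod: "integrable (Rnt n) (\<lambda>p. indicator {\<epsilon><..T} (snd p) * ((snd p - \<epsilon>) * (h2 ((fst p)(n := snd p)) * w (fst p))))"
  proof (rule Bochner_Integration.integrable_bound)
    show "integrable (Rnt n) (\<lambda>p. (T * (2 * (K1 * K1) + 2 * (K0 * K2))) * (indicator {\<epsilon><..T} (snd p) * w (fst p)))"
      using \<epsilon> by (intro integrable_mult_right integrable_strip_mult w) simp
    have wf: "(\<lambda>p. w (fst p)) \<in> borel_measurable (Rnt n)" by (rule measurable_compose[OF measurable_fst wm])
    show "(\<lambda>p. indicator {\<epsilon><..T} (snd p) * ((snd p - \<epsilon>) * (h2 ((fst p)(n := snd p)) * w (fst p)))) \<in> borel_measurable (Rnt n)"
      by (intro borel_measurable_times measurable_indicator_snd wf meas_h2) auto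
    show "AE p in Rnt n. norm (indicator {\<epsilon><..T} (snd p) * ((snd p - \<epsilon>) * (h2 ((fst p)(n := snd p)) * w (fst p))))
       \<le> norm ((T * (2 * (K1 * K1) + 2 * (K0 * K2))) * (indicator {\<epsilon><..T} (snd p) * w (fst p)))"
    proof (rule AE_I2)
      fix p :: "point \<times> real"
      show "norm (indicator {\<epsilon><..T} (snd p) * ((snd p - \<epsilon>) * (h2 ((fst p)(n := snd p)) * w (fst p))))
       \<le> norm ((T * (2 * (K1 * K1) + 2 * (K0 * K2))) * (indicator {\<epsilon><..T} (snd p) * w (fst p)))"
      proof (cases "snd p \<in> {\<epsilon><..T}")
        case True
        have h: "\<bar>h2 ((fst p)(n := snd p))\<bar> \<le> 2 * (K1 * K1) + 2 * (K0 * K2)" using True by (intro bh2) simp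
        have "\<bar>snd p - \<epsilon>\<bar> * \<bar>h2 ((fst p)(n := snd p))\<bar> * \<bar>w (fst p)\<bar> \<le> T * (2 * (K1 * K1) + 2 * (K0 * K2)) * \<bar>w (fst p)\<bar>"
          using True \<epsilon> h by (intro mult_right_mono mult_mono) auto
        also have "\<dots> \<le> \<bar>T * (2 * (K1 * K1) + 2 * (K0 * K2))\<bar> * \<bar>w (fst p)\<bar>" by (intro mult_right_mono) auto
        finally show ?thesis using True by (simp only: real_norm_def abs_mult indicator_simps abs_one mult_1 mult.assoc)
      qed simp
    qed
  qed
  have taylor: "(u (y(n := \<epsilon>)) - c)\<^sup>2 = (\<integral>r. indicator {\<epsilon><..T} r * ((r - \<epsilon>) * h2 (y(n := r))) \<partial>lborel) + ((u (y(n := T)) - c)\<^sup>2 - (T - \<epsilon>) * h1 (y(n := T)))"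
    if y: "y \<in> space (Rn n)" for y
  proof -
    define G where "G r = (r - \<epsilon>) * h1 (y(n := r)) - (u (y(n := r)) - c)\<^sup>2" for r
    have DG: "(G has_real_derivative (r - \<epsilon>) * h2 (y(n := r))) (at r)" if "r > 0" for r
    proof -
      have du: "((\<lambda>r. u (y(n := r)) - c) has_real_derivative u1 n (y(n := r))) (at r)"
        using DERIV_diff[OF D1' DERIV_const, of n y r c] that by simp
      have du1: "((\<lambda>r. u1 n (y(n := r))) has_real_derivative u2 n (y(n := r))) (at r)"
        by (rule D2') (use that in auto)
      have alg1: "x1 * x + x1 * x = 2 * (x * x1)" for x x1 :: real by simp
      have alg2: "2 * (x1 * x1 + x2 * x) = 2 * x1\<^sup>2 + 2 * (x * x2)" for x x1 x2 :: real by (simp add: power2_eq_square)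
      have alg3: "1 * q + d * (r - \<epsilon>) - q = (r - \<epsilon>) * d" for q d :: real by simp
      have di: "((\<lambda>r. r - \<epsilon>) has_real_derivative 1) (at r)" by (auto intro!: derivative_eq_intros)
      have dg: "((\<lambda>r. (u (y(n := r)) - c)\<^sup>2) has_real_derivative h1 (y(n := r))) (at r)"
        unfolding h1_def power2_eq_square by (rule DERIV_cong[OF DERIV_mult[OF du du]]) (rule alg1)
      have dg1: "((\<lambda>r. h1 (y(n := r))) has_real_derivative h2 (y(n := r))) (at r)"
        unfolding h1_def h2_def by (rule DERIV_cong[OF DERIV_cmult[OF DERIV_mult[OF du du1]]]) (rule alg2)
      show ?thesis unfolding G_def
        by (rule DERIV_cong[OF DERIV_diff[OF DERIV_mult[OF di dg1] dg]]) (rule alg3)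
    qed
    have hi: "((\<lambda>r. (r - \<epsilon>) * h2 (y(n := r))) has_integral G T - G \<epsilon>) {\<epsilon>..T}"
    proof (rule fundamental_theorem_of_calculus)
      fix x assume "x \<in> {\<epsilon>..T}"
      then have "x > 0" using \<epsilon> by simp
      from DG[OF this] show "(G has_vector_derivative (x - \<epsilon>) * h2 (y(n := x))) (at x within {\<epsilon>..T})"
        unfolding has_real_derivative_iff_has_vector_derivative by (rule has_vector_derivative_at_within)
    qed (use \<epsilon> in simp)
    have mh: "(\<lambda>r. (r - \<epsilon>) * h2 (y(n := r))) \<in> borel_measurable lborel"
      by (rule borel_measurable_times[OF _ measurable_slice(2)[OF meas_h2 y]]) simp
    have si: "set_integrable lborel {\<epsilon>..T} (\<lambda>r. (r - \<epsilon>) * h2 (y(n := r)))"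
      unfolding set_integrable_def
    proof (rule integrableI_bounded_set[where A="{\<epsilon>..T}" and B="T * (2 * (K1 * K1) + 2 * (K0 * K2))"])
      show "(\<lambda>x. indicat_real {\<epsilon>..T} x *\<^sub>R ((x - \<epsilon>) * h2 (y(n := x)))) \<in> borel_measurable lborel"
        using mh by (intro borel_measurable_scaleR) auto
      show "AE x\<in>{\<epsilon>..T} in lborel. norm (indicat_real {\<epsilon>..T} x *\<^sub>R ((x - \<epsilon>) * h2 (y(n := x)))) \<le> T * (2 * (K1 * K1) + 2 * (K0 * K2))"
      proof (rule AE_I2, rule impI)
        fix x assume x: "x \<in> {\<epsilon>..T}"
        have "\<bar>h2 (y(n := x))\<bar> \<le> 2 * (K1 * K1) + 2 * (K0 * K2)" using x by (intro bh2) simp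
        moreover have "\<bar>x - \<epsilon>\<bar> \<le> T" using x \<epsilon> by simp
        ultimately show "norm (indicat_real {\<epsilon>..T} x *\<^sub>R ((x - \<epsilon>) * h2 (y(n := x)))) \<le> T * (2 * (K1 * K1) + 2 * (K0 * K2))"
          using x T by (simp only: indicator_simps scaleR_one real_norm_def) (rule p)
      qed
    qed (use T in \<open>auto simp: emeasure_lborel_Icc_eq\<close>)
    have "(\<integral>r. indicator {\<epsilon>..T} r * ((r - \<epsilon>) * h2 (y(n := r))) \<partial>lborel) = G T - G \<epsilon>"
      using set_borel_integral_eq_integral(2)[OF si] hi by (simp add: set_lebesgue_integral_def integral_unique)
    moreover have "(\<integral>r. indicator {\<epsilon>..T} r * ((r - \<epsilon>) * h2 (y(n := r))) \<partial>lborel) = (\<integral>r. indicator {\<epsilon><..T} r * ((r - \<epsilon>) * h2 (y(n := r))) \<partial>lborel)"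
      by (intro Bochner_Integration.integral_cong refl) (auto simp: indicator_def)
    ultimately show ?thesis by (simp add: G_def)
  qed
  have fst_int: "integrable (Rn n) (\<lambda>y. (\<integral>r. indicator {\<epsilon><..T} r * ((r - \<epsilon>) * (h2 (y(n := r)) * w y)) \<partial>lborel))"
    using Rn_line.integrable_fst[of n "\<lambda>y r. indicator {\<epsilon><..T} r * ((r - \<epsilon>) * (h2 (y(n := r)) * w y))"] prod by (simp add: split_beta')
  have snd_int: "integrable lborel (\<lambda>r. (\<integral>y. indicator {\<epsilon><..T} r * ((r - \<epsilon>) * (h2 (y(n := r)) * w y)) \<partial>Rn n))"
    using Rn_line.integrable_snd[of n "\<lambda>y r. indicator {\<epsilon><..T} r * ((r - \<epsilon>) * (h2 (y(n := r)) * w y))"] prod by (simp add: split_beta')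
  then show "integrable lborel (\<lambda>r. indicator {\<epsilon><..T} r * ((r - \<epsilon>) * (\<integral>y. h2 (y(n := r)) * w y \<partial>Rn n)))"
    by (simp only: integral_mult_right_zero)
  have "(\<integral>y. (u (y(n := \<epsilon>)) - c)\<^sup>2 * w y \<partial>Rn n) = (\<integral>y. (\<integral>r. indicator {\<epsilon><..T} r * ((r - \<epsilon>) * (h2 (y(n := r)) * w y)) \<partial>lborel) + ((u (y(n := T)) - c)\<^sup>2 - (T - \<epsilon>) * h1 (y(n := T))) * w y \<partial>Rn n)"
  proof (rule Bochner_Integration.integral_cong[OF refl])
    fix y assume y: "y \<in> space (Rn n)"
    have "(\<integral>r. indicator {\<epsilon><..T} r * ((r - \<epsilon>) * (h2 (y(n := r)) * w y)) \<partial>lborel) = (\<integral>r. (indicator {\<epsilon><..T} r * ((r - \<epsilon>) * h2 (y(n := r)))) * w y \<partial>lborel)"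
      by (simp only: mult.assoc)
    also have "\<dots> = (\<integral>r. indicator {\<epsilon><..T} r * ((r - \<epsilon>) * h2 (y(n := r))) \<partial>lborel) * w y" by (rule integral_mult_left_zero)
    finally have e: "(\<integral>r. indicator {\<epsilon><..T} r * ((r - \<epsilon>) * (h2 (y(n := r)) * w y)) \<partial>lborel) = (\<integral>r. indicator {\<epsilon><..T} r * ((r - \<epsilon>) * h2 (y(n := r))) \<partial>lborel) * w y" .
    show "(u (y(n := \<epsilon>)) - c)\<^sup>2 * w y = (\<integral>r. indicator {\<epsilon><..T} r * ((r - \<epsilon>) * (h2 (y(n := r)) * w y)) \<partial>lborel) + ((u (y(n := T)) - c)\<^sup>2 - (T - \<epsilon>) * h1 (y(n := T))) * w y"
      unfolding e taylor[OF y] distrib_right ..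
  qed
  also have "\<dots> = (\<integral>y. (\<integral>r. indicator {\<epsilon><..T} r * ((r - \<epsilon>) * (h2 (y(n := r)) * w y)) \<partial>lborel) \<partial>Rn n) + (\<integral>y. ((u (y(n := T)) - c)\<^sup>2 - (T - \<epsilon>) * h1 (y(n := T))) * w y \<partial>Rn n)"
    by (rule Bochner_Integration.integral_add[OF fst_int iend])
  also have "(\<integral>y. (\<integral>r. indicator {\<epsilon><..T} r * ((r - \<epsilon>) * (h2 (y(n := r)) * w y)) \<partial>lborel) \<partial>Rn n) = (\<integral>r. (\<integral>y. indicator {\<epsilon><..T} r * ((r - \<epsilon>) * (h2 (y(n := r)) * w y)) \<partial>Rn n) \<partial>lborel)"
    using prod by (intro Rn_line.Fubini_integral[symmetric]) (simp add: split_beta')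
  also have "\<dots> = (\<integral>r. indicator {\<epsilon><..T} r * ((r - \<epsilon>) * (\<integral>y. h2 (y(n := r)) * w y \<partial>Rn n)) \<partial>lborel)"
    by (simp only: integral_mult_right_zero)
  finally show "(\<integral>y. (u (y(n := \<epsilon>)) - c)\<^sup>2 * w y \<partial>Rn n)
      = (\<integral>r. indicator {\<epsilon><..T} r * ((r - \<epsilon>) * (\<integral>y. h2 (y(n := r)) * w y \<partial>Rn n)) \<partial>lborel)
        + (\<integral>y. ((u (y(n := T)) - c)\<^sup>2 - (T - \<epsilon>) * h1 (y(n := T))) * w y \<partial>Rn n)" .
qed

end

section \<open>Growth of harmonic functions whose gradient is bounded by a multiple of one over the
  height\<close>

context nice_harmonic
begin

context
  fixes M :: real
  assumes M: "M \<ge> 0" and gb: "\<And>i X. i \<le> n \<Longrightarrow> X n > 0 \<Longrightarrow> \<bar>u1 i X\<bar> \<le> M / X n"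
begin

text \<open>Adding \<open>M * ln\<close> to \<open>u\<close> or to its negative gives a function
  that does not decrease with the height.\<close>

lemma vertical_growth:
  assumes s: "0 < s" "s \<le> t"
  shows "\<bar>u (y(n := s)) - u (y(n := t))\<bar> \<le> M * ln (t / s)"
proof -
  have mono: "M * ln s + e * u (y(n := s)) \<le> M * ln t + e * u (y(n := t))" if e: "e = 1 \<or> e = -1" for e :: real
  proof (rule DERIV_nonneg_imp_nondecreasing[OF s(2)])
    fix r assume "s \<le> r" "r \<le> t"
    then have r: "r > 0" using s by simp
    have d: "((\<lambda>r. M * ln r + e * u (y(n := r))) has_real_derivative M * (1 / r) + e * u1 n (y(n := r))) (at r)"
      using D1'[of n "y" r] r by (intro DERIV_add DERIV_cmult) (auto intro!: DERIV_ln_divide)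
    have "\<bar>u1 n (y(n := r))\<bar> \<le> M / r" using gb[of n "y(n := r)"] r by simp
    then have "M * (1 / r) + e * u1 n (y(n := r)) \<ge> 0" using e by auto
    then show "\<exists>z. ((\<lambda>r. M * ln r + e * u (y(n := r))) has_real_derivative z) (at r) \<and> 0 \<le> z" using d by blast
  qed
  have "ln (t / s) = ln t - ln s" using s by (simp add: ln_div)
  then show ?thesis using mono[of 1] mono[of "-1"] by (simp add: abs_le_iff right_diff_distrib)
qed

text \<open>The coordinates are exchanged one at a time through the points \<open>z m\<close>, each
  exchange by the mean value theorem.\<close>

lemma horizontal_growth:
  assumes t: "t > 0" and y: "y \<in> space (Rn n)" "y0 \<in> space (Rn n)"
  shows "\<bar>u (y(n := t)) - u (y0(n := t))\<bar> \<le> M / t * (\<Sum>i<n. \<bar>y i - y0 i\<bar>)"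
proof -
  define z where "z m i = (if i < m then y i else y0 i)" for m i :: nat
  have "\<bar>u ((z m)(n := t)) - u (y0(n := t))\<bar> \<le> M / t * (\<Sum>i<m. \<bar>y i - y0 i\<bar>)" if "m \<le> n" for m
    using that
  proof (induction m)
    case 0
    then show ?case by (simp add: z_def)
  next
    case (Suc m)
    let ?Z = "(z m)(n := t)"
    have e1: "(z (Suc m))(n := t) = ?Z(m := y m)" and e2: "?Z = ?Z(m := y0 m)"
      using Suc.prems by (auto simp: z_def fun_eq_iff less_Suc_eq)
    have "norm (u (?Z(m := y m)) - u (?Z(m := y0 m))) \<le> M / t * norm (y m - y0 m)"
    proof (rule field_differentiable_bound[of UNIV "\<lambda>s. u (?Z(m := s))" "\<lambda>s. u1 m (?Z(m := s))"])
      fix s :: real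
      have p: "(?Z(m := s)) n > 0" using t Suc.prems by simp
      have "((\<lambda>r. u (?Z(m := r))) has_real_derivative u1 m (?Z(m := s))) (at s)"
        using D1[of m "?Z(m := s)"] p Suc.prems by simp
      then show "((\<lambda>s. u (?Z(m := s))) has_field_derivative u1 m (?Z(m := s))) (at s within UNIV)" by simp
      show "norm (u1 m (?Z(m := s))) \<le> M / t" using gb[of m "?Z(m := s)"] p t Suc.prems by simp
    qed auto
    then have "\<bar>u ((z (Suc m))(n := t)) - u ?Z\<bar> \<le> M / t * \<bar>y m - y0 m\<bar>"
      using e1 e2 by simp
    moreover have "\<bar>u ?Z - u (y0(n := t))\<bar> \<le> M / t * (\<Sum>i<m. \<bar>y i - y0 i\<bar>)" by (rule Suc.IH) (use Suc.prems in simp)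
    ultimately show ?case unfolding sum.lessThan_Suc distrib_left by linarith
  qed
  from this[of n] have "\<bar>u ((z n)(n := t)) - u (y0(n := t))\<bar> \<le> M / t * (\<Sum>i<n. \<bar>y i - y0 i\<bar>)" by simp
  moreover have "z n = y"
    using y by (auto simp: z_def fun_eq_iff space_Rn PiE_def extensional_def)
  ultimately show ?thesis by simp
qed

text \<open>Climbing to the height of the distance to the base point costs a logarithm on either side.\<close>

lemma logarithmic_growth:
  assumes s: "0 < s" "s \<le> T" and y: "y \<in> space (Rn n)" "y0 \<in> space (Rn n)"
  shows "\<bar>u (y(n := s)) - u (y0(n := T))\<bar>
    \<le> (8 + real n) * M * ((T / s) powr (1/4) * (ssq n (sh n (y0(n := T)) y) / T\<^sup>2) powr (1/8))"
    and "(ssq n (sh n (y0(n := T)) y) / T\<^sup>2) powr (1/8) \<ge> 1"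
proof -
  define \<rho> where "\<rho> = ssq n (sh n (y0(n := T)) y)"
  define gw where "gw = (\<rho> / T\<^sup>2) powr (1/8)"
  \<comment> \<open>The crossing height: at least \<open>T\<close> and at least every horizontal
    displacement, so that the horizontal path costs only \<open>real n * M\<close>.\<close>
  define l where "l = sqrt \<rho>"
  have T: "T > 0" using s by simp
  have \<rho>T: "\<rho> \<ge> T\<^sup>2" unfolding \<rho>_def ssq_split by (simp add: sum_nonneg)
  have \<rho>: "\<rho> > 0" using \<rho>T T by (smt (verit) zero_less_power)
  have lT: "l \<ge> T" unfolding l_def using \<rho>T T by (intro real_le_rsqrt)
  have l: "l > 0" using lT T by simp
  have q1: "\<rho> / T\<^sup>2 \<ge> 1" using \<rho>T T by simp
  show gw1: "gw \<ge> 1" unfolding gw_def using q1 by (rule ge_one_powr_ge_zero) simp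
  have lq: "(l / T) powr (1/4) = gw"
  proof -
    have "l / T = (\<rho> / T\<^sup>2) powr (1/2)" using T \<rho> by (simp add: l_def powr_half_sqrt real_sqrt_divide)
    then show ?thesis unfolding gw_def by (simp add: powr_powr)
  qed
  have st: "(T / s) powr (1/4) \<ge> 1" using s by (intro ge_one_powr_ge_zero) auto
  define K where "K = (T / s) powr (1/4) * gw"
  have Kgw: "gw \<le> K" unfolding K_def using mult_right_mono[OF st, of gw] gw1 by simp
  have a: "\<bar>u (y(n := s)) - u (y(n := l))\<bar> \<le> M * (4 * K)"
  proof -
    have e: "l / s = (T / s) * (l / T)" using T by simp
    have "ln (l / s) \<le> 4 * (l / s) powr (1/4)" using s lT l by (intro ln_le_fourth_root) auto
    also have "(l / s) powr (1/4) = K" unfolding e K_def lq[symmetric] by (rule powr_mult)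
    finally show ?thesis using vertical_growth[of s l y] s lT M by (meson mult_left_mono order.trans)
  qed
  have b: "\<bar>u (y(n := l)) - u (y0(n := l))\<bar> \<le> real n * M"
  proof -
    have c: "\<bar>y i - y0 i\<bar> \<le> l" if i: "i < n" for i
      unfolding l_def
    proof (rule real_le_rsqrt)
      have "(sh n (y0(n := T)) y i)\<^sup>2 \<le> \<rho>" unfolding \<rho>_def using i by (intro component_sq_le_ssq) auto
      then show "\<bar>y i - y0 i\<bar>\<^sup>2 \<le> \<rho>" using i by (simp add: sh_def power2_commute)
    qed
    have "\<bar>u (y(n := l)) - u (y0(n := l))\<bar> \<le> M / l * (\<Sum>i<n. \<bar>y i - y0 i\<bar>)" by (rule horizontal_growth[OF l y])
    also have "\<dots> \<le> M / l * (\<Sum>i<n. l)" using M l c by (intro mult_left_mono sum_mono) auto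
    also have "\<dots> = real n * M" using l by simp
    finally show ?thesis .
  qed
  have d: "\<bar>u (y0(n := T)) - u (y0(n := l))\<bar> \<le> M * (4 * gw)"
  proof -
    have "ln (l / T) \<le> 4 * (l / T) powr (1/4)" using T lT by (intro ln_le_fourth_root) auto
    then show ?thesis using vertical_growth[of T l y0] T lT M unfolding lq by (meson mult_left_mono order.trans)
  qed
  have K1: "1 \<le> K" using Kgw gw1 by simp
  have "\<bar>u (y(n := s)) - u (y0(n := T))\<bar> \<le> M * (4 * K) + real n * M + M * (4 * gw)" using a b d by linarith
  also have "\<dots> \<le> M * (4 * K) + real n * M * K + M * (4 * K)"
    using Kgw M mult_left_mono[OF K1, of "real n * M"] by (intro add_mono mult_left_mono) auto
  also have "\<dots> = (8 + real n) * M * K" by (simp add: algebra_simps)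
  finally show "\<bar>u (y(n := s)) - u (y0(n := T))\<bar> \<le> (8 + real n) * M * ((T / s) powr (1/4) * gw)" by (simp only: K_def)
qed

end

end

text \<open>The squared growth factor weakens the exponent of \<open>ssq\<close> in the kernel from
  \<open>-(n + 1) / 2\<close> to \<open>-(n + 1/2) / 2\<close>, which is still integrable, and all
  powers of the height cancel.\<close>

lemma nn_integral_growth_weight:
  assumes T: "X n > 0"
  shows "(\<integral>\<^sup>+y. ennreal (((ssq n (sh n X y) / (X n)\<^sup>2) powr (1/8))\<^sup>2 * pk n (sh n X y)) \<partial>Rn n) = ennreal (pc n * bq n (real n + 1/2))"
proof -
  define T where "T = X n"
  have T0: "T > 0" using T by (simp add: T_def)
  have e: "((ssq n (sh n X y) / T\<^sup>2) powr (1/8))\<^sup>2 * pk n (sh n X y) = pc n * T powr (1/2) * ssq n (sh n X y) powr (- (real n + 1/2) / 2)" for y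
  proof -
    define \<rho> where "\<rho> = ssq n (sh n X y)"
    have \<rho>: "\<rho> > 0" unfolding \<rho>_def using T by (intro ssq_pos) simp
    have "((\<rho> / T\<^sup>2) powr (1/8))\<^sup>2 = (\<rho> / T\<^sup>2) powr (1/4)" by (simp only: power2_eq_square powr_add[symmetric]) simp
    also have "\<dots> = \<rho> powr (1/4) / T powr (1/2)"
    proof -
      have "(T\<^sup>2) powr (1/4) = T powr (1/2)" using T0 powr_powr[of T 2 "1/4"] by simp
      then show ?thesis by (simp only: powr_divide)
    qed
    finally have a: "((\<rho> / T\<^sup>2) powr (1/8))\<^sup>2 = \<rho> powr (1/4) / T powr (1/2)" .
    have b: "\<rho> powr (1/4) * \<rho> powr (- pm n) = \<rho> powr (- (real n + 1/2) / 2)"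
      unfolding powr_add[symmetric] by (rule arg_cong[of _ _ "\<lambda>e. \<rho> powr e"]) (simp add: pm_def field_simps)
    have c: "T / T powr (1/2) = T powr (1/2)" using T0 by (simp only: powr_half_sqrt real_div_sqrt less_imp_le)
    have "((\<rho> / T\<^sup>2) powr (1/8))\<^sup>2 * (pc n * T * \<rho> powr (- pm n)) = pc n * (T / T powr (1/2)) * (\<rho> powr (1/4) * \<rho> powr (- pm n))"
      unfolding a by simp
    then show ?thesis unfolding b c by (simp only: pk_def sh_n T_def \<rho>_def)
  qed
  have "(\<integral>\<^sup>+y. ennreal (pc n * T powr (1/2) * ssq n (sh n X y) powr (- (real n + 1/2) / 2)) \<partial>Rn n)
    = ennreal (pc n * T powr (1/2)) * (\<integral>\<^sup>+y. ennreal (ssq n (sh n X y) powr (- (real n + 1/2) / 2)) \<partial>Rn n)"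
  proof (subst nn_integral_cmult[symmetric])
    show "(\<lambda>y. ennreal (ssq n (sh n X y) powr (- (real n + 1/2) / 2))) \<in> borel_measurable (Rn n)"
      by (intro measurable_compose[OF _ measurable_ennreal] powr_real_measurable measurable_ssq measurable_sh_component) auto
  qed (use pc_pos[of n] in \<open>simp add: ennreal_mult'\<close>)
  also have "\<dots> = ennreal (pc n * T powr (1/2)) * ennreal (bq n (real n + 1/2) * T powr (real n - (real n + 1/2)))"
    unfolding T_def using T by (subst nn_integral_ssq_powr) auto
  also have "\<dots> = ennreal (pc n * bq n (real n + 1/2))"
  proof -
    have "T powr (1/2) * T powr (real n - (real n + 1/2)) = 1" using T0 by (simp add: powr_add[symmetric])
    then have "(pc n * T powr (1/2)) * (bq n (real n + 1/2) * T powr (real n - (real n + 1/2))) = pc n * bq n (real n + 1/2)"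
      by (simp add: mult_ac)
    then show ?thesis using pc_pos[of n] bq_pos[of n "real n + 1/2"] by (subst ennreal_mult[symmetric]) auto
  qed
  finally show ?thesis unfolding T_def[symmetric] e .
qed

lemma weighted_harmonic_pk:
  assumes N: "nice_harmonic n u u1 u2 a A" and X: "X n > 0"
  shows "weighted_harmonic n u u1 u2 a A (\<lambda>y. pk n (sh n X y)) (\<lambda>i y. - pk1 n i (sh n X y)) (pc n / X n ^ n + pC n * pc n / X n ^ Suc n)"
proof -
  interpret nice_harmonic n u u1 u2 a A by (rule N)
  have p: "pc n / X n ^ n \<ge> 0" "pC n * pc n / X n ^ Suc n \<ge> 0" using X pc_pos[of n] pC_ge_1[of n] by auto
  show ?thesis
  proof unfold_locales
    show "integrable (Rn n) (\<lambda>y. pk n (sh n X y))" by (rule integrable_pk[of X, OF X])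
    fix i assume i: "i < n"
    show "integrable (Rn n) (\<lambda>y. - pk1 n i (sh n X y))"
    proof (rule Bochner_Integration.integrable_bound)
      show "integrable (Rn n) (\<lambda>y. pC n / X n * pk n (sh n X y))" using integrable_pk[of X, OF X] by simp
      show "(\<lambda>y. - pk1 n i (sh n X y)) \<in> borel_measurable (Rn n)" using i by (intro borel_measurable_uminus measurable_pk1_sh) simp
      show "AE y in Rn n. norm (- pk1 n i (sh n X y)) \<le> norm (pC n / X n * pk n (sh n X y))"
        using abs_pk1_le_pk[of i n "sh n X _"] i X pk_nonneg[of "sh n X _" n] pC_ge_1[of n] by (intro AE_I2) (simp add: abs_mult)
    qed
    fix y :: "nat \<Rightarrow> real" and s
    have e: "sh n X (y(i := r)) = (sh n X y)(i := X i - r)" for r using i by (auto simp: sh_def)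
    have "((\<lambda>r. pk n ((sh n X y)(i := X i - r))) has_real_derivative pk1 n i ((sh n X y)(i := X i - s)) * (0 - 1)) (at s)"
    proof (rule DERIV_chain'[of "\<lambda>r. X i - r" _ _ _ "\<lambda>r. pk n ((sh n X y)(i := r))"])
      show "((\<lambda>r. X i - r) has_real_derivative 0 - 1) (at s)" by (intro DERIV_diff DERIV_const DERIV_ident)
      show "((\<lambda>r. pk n ((sh n X y)(i := r))) has_real_derivative pk1 n i ((sh n X y)(i := X i - s))) (at (X i - s))"
        using i X by (intro DERIV_pk ssq_pos) auto
    qed
    then show "((\<lambda>s. pk n (sh n X (y(i := s)))) has_real_derivative - pk1 n i (sh n X (y(i := s)))) (at s)"
      unfolding e by simp
  next
    fix y
    show "\<bar>pk n (sh n X y)\<bar> \<le> pc n / X n ^ n + pC n * pc n / X n ^ Suc n"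
      using abs_pk_le[of "sh n X y" n] X p by simp
    fix i assume "i < n"
    then show "\<bar>- pk1 n i (sh n X y)\<bar> \<le> pc n / X n ^ n + pC n * pc n / X n ^ Suc n"
      using abs_pk1_le_height[of i n "sh n X y"] X p by simp
  qed
qed

text \<open>No sign is required of \<open>f\<close>, since the nonnegative integral sees only its
  positive part. This matters for the Taylor integral, whose integrand may change sign.\<close>

lemma integral_le_of_nn_integral_le:
  fixes f :: "'a \<Rightarrow> real"
  assumes "integrable M f" "(\<integral>\<^sup>+x. ennreal (f x) \<partial>M) \<le> ennreal c" "c \<ge> 0"
  shows "(\<integral>x. f x \<partial>M) \<le> c"
proof -
  have "(\<integral>x. f x \<partial>M) \<le> enn2real (\<integral>\<^sup>+x. ennreal (f x) \<partial>M)"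
    unfolding real_lebesgue_integral_def[OF assms(1)] by simp
  also have "\<dots> \<le> c" using assms(2,3) by (metis enn2real_ennreal enn2real_mono ennreal_less_top)
  finally show ?thesis .
qed

lemma nn_integral_fourth_root:
  assumes "T > (0::real)"
  shows "(\<integral>\<^sup>+r. ennreal ((T / r) powr (1/4)) * indicator {0<..T} r \<partial>lborel) \<le> ennreal (2 * T)"
proof -
  have "((\<lambda>x. T powr (1/4) * x powr (-1/4)) has_integral T powr (1/4) * (T powr (-1/4 + 1) / (-1/4 + 1))) {0..T}"
    using assms by (intro has_integral_mult_right has_integral_powr_from_0) auto
  from nn_integral_has_integral_lebesgue'[OF _ this]
  have "(\<integral>\<^sup>+r. ennreal (T powr (1/4) * r powr (-1/4)) * indicator {0..T} r \<partial>lborel) = ennreal (T powr (1/4) * (T powr (-1/4 + 1) / (-1/4 + 1)))"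
    by simp
  also have "T powr (1/4) * (T powr (-1/4 + 1) / (-1/4 + 1)) = 4/3 * T"
    using assms by (simp add: powr_add[symmetric])
  finally have e: "(\<integral>\<^sup>+r. ennreal (T powr (1/4) * r powr (-1/4)) * indicator {0..T} r \<partial>lborel) = ennreal (4/3 * T)" .
  have "(\<integral>\<^sup>+r. ennreal ((T / r) powr (1/4)) * indicator {0<..T} r \<partial>lborel) \<le> (\<integral>\<^sup>+r. ennreal (T powr (1/4) * r powr (-1/4)) * indicator {0..T} r \<partial>lborel)"
  proof (rule nn_integral_mono)
    fix r
    have "(T / r) powr (1/4) = T powr (1/4) * r powr (-1/4)" if "r > 0"
      using that assms by (simp add: powr_divide powr_minus_divide)
    then show "ennreal ((T / r) powr (1/4)) * indicator {0<..T} r \<le> ennreal (T powr (1/4) * r powr (-1/4)) * indicator {0..T} r"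
      by (auto simp: indicator_def)
  qed
  also have "\<dots> \<le> ennreal (2 * T)" unfolding e using assms by (intro ennreal_leI) simp
  finally show ?thesis .
qed

context dyadic
begin

context
  fixes f :: "point \<Rightarrow> real" and M0 :: real
  assumes f: "integrable (Rn n) f" and M0: "M0 \<ge> 0"
    and car: "carleson_grad f M0"
begin

text \<open>\<open>weighted_taylor\<close> is used with \<open>T = 2 powi k\<close>, the Poisson
  kernel at \<open>(x, T)\<close> as weight and the extension at that point as constant
  \<open>c\<close>. The energy term is bounded by the Carleson condition with Harnack's inequality
  for the weight; the term with the derivative of the weight and the boundary terms at
  \<open>T\<close> are bounded by logarithmic growth. None of the bounds depends on
  \<epsilon>.\<close>

lemma garcia_bound_above:
  obtains M' where "M' \<ge> 0"
    "\<And>x k \<epsilon>. x \<in> space (Rn n) \<Longrightarrow> 0 < \<epsilon> \<Longrightarrow> \<epsilon> < 2 powi k \<Longrightarrow>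
      (\<integral>\<^sup>+y. ennreal ((U n f (y(n := \<epsilon>)) - U n f (x(n := 2 powi k)))\<^sup>2 * pk n (sh n (x(n := 2 powi k)) y)) \<partial>Rn n) \<le> ennreal M'"
proof -
  obtain M where M: "M \<ge> 0" and gb: "\<And>i X. i \<le> n \<Longrightarrow> X n > 0 \<Longrightarrow> \<bar>U1 n f i X\<bar> \<le> M / X n"
    using gradient_bound[OF f M0 car] by metis
  note N = nice_harmonic_U[OF n f]
  define Cp where "Cp = (2 * real n + 2) powr pm n"
  define E where "E = (8 + real n) * M"
  define L where "L = pc n * bq n (real n + 1/2)"
  define K0 where "K0 = 2 * real n * E * M * pC n * L"
  \<comment> \<open>The three summands belong to the energy term, the error term with the derivative
    of the weight, and the boundary terms at \<open>T\<close>.\<close>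
  define M' where "M' = 2 * (Cp * M0) + 2 * K0 + (E\<^sup>2 + 2 * E * M) * L"
  have E: "E \<ge> 0" using M by (simp add: E_def)
  have L: "L \<ge> 0" using pc_pos[of n] bq_pos[of n "real n + 1/2"] by (simp add: L_def)
  have Cp: "Cp \<ge> 0" by (simp add: Cp_def)
  have pC: "pC n \<ge> 0" using pC_ge_1[of n] by simp
  have K0: "K0 \<ge> 0" using E M pC L by (simp add: K0_def)
  have M': "M' \<ge> 0" using Cp M0 K0 E M L by (simp add: M'_def)
  have mG: "(\<lambda>p. ennreal (snd p * gsq n f p)) \<in> borel_measurable (Rnt n)"
    using gsq_meas[OF f M0 car] by measurable
  have "(\<integral>\<^sup>+y. ennreal ((U n f (y(n := \<epsilon>)) - U n f (x(n := 2 powi k)))\<^sup>2 * pk n (sh n (x(n := 2 powi k)) y)) \<partial>Rn n) \<le> ennreal M'"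
    if x: "x \<in> space (Rn n)" and \<epsilon>: "0 < \<epsilon>" "\<epsilon> < 2 powi k" for x k \<epsilon>
  proof -
    define T where "T = (2::real) powi k"
    define X where "X = x(n := T)"
    define c where "c = U n f X"
    define w where "w y = pk n (sh n X y)" for y
    define w1 where "w1 i y = - pk1 n i (sh n X y)" for i y
    define g where "g y = (ssq n (sh n X y) / T\<^sup>2) powr (1/8)" for y
    have T: "T > 0" by (simp add: T_def)
    have Xn: "X n = T" by (simp add: X_def)
    have X: "X n > 0" using T Xn by simp
    have \<epsilon>T: "\<epsilon> < T" using \<epsilon> by (simp add: T_def)
    interpret weighted_harmonic n "U n f" "U1 n f" "U2 n f" "\<lambda>X. pC n * U n (\<lambda>z. \<bar>f z\<bar>) X" "pC n * (1 + pc n) * (\<integral>z. \<bar>f z\<bar> \<partial>Rn n)"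
      w w1 "pc n / X n ^ n + pC n * pc n / X n ^ Suc n" c
      using weighted_harmonic_pk[OF N, of X, OF X] by (simp add: w_def[abs_def] w1_def[abs_def])
    have w0: "w y \<ge> 0" for y unfolding w_def using X by (intro pk_nonneg) simp
    have wm: "w \<in> borel_measurable (Rn n)" using w by auto
    have w1b: "\<bar>w1 i y\<bar> \<le> pC n * w y / T" if "i \<le> n" for i y
      using abs_pk1_le_pk[of i n "sh n X y"] that X by (simp add: w1_def w_def Xn)
    have gr: "\<bar>U n f (y(n := s)) - c\<bar> \<le> E * ((T / s) powr (1/4) * g y)" and g1: "g y \<ge> 1" if "0 < s" "s \<le> T" "y \<in> space (Rn n)" for s y
      using logarithmic_growth[OF M gb that(1,2,3) x] by (simp_all only: E_def g_def c_def X_def)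
    have gg: "g y \<le> (g y)\<^sup>2" if "y \<in> space (Rn n)" for y
      using g1[OF T order_refl that] by (simp add: power2_eq_square)
    have gm: "g \<in> borel_measurable (Rn n)"
      unfolding g_def[abs_def] by (intro powr_real_measurable borel_measurable_divide measurable_ssq measurable_sh_component) auto
    have gI: "integrable (Rn n) (\<lambda>y. (g y)\<^sup>2 * w y)" "(\<integral>y. (g y)\<^sup>2 * w y \<partial>Rn n) \<le> L"
    proof -
      have "(\<integral>\<^sup>+y. ennreal ((g y)\<^sup>2 * w y) \<partial>Rn n) \<le> ennreal L"
        using nn_integral_growth_weight[of X n, OF X] by (simp add: g_def w_def L_def Xn)
      from integral_le_nn_integral_bound[OF _ _ this L]
      show "integrable (Rn n) (\<lambda>y. (g y)\<^sup>2 * w y)" "(\<integral>y. (g y)\<^sup>2 * w y \<partial>Rn n) \<le> L"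
        using gm wm w0 by auto
    qed
    have gsb: "\<bar>gsq n f (y, r)\<bar> \<le> real (Suc n) * (M / r)\<^sup>2" if "r > 0" for y r
    proof -
      have "gsq n f (y, r) \<le> (\<Sum>i\<le>n. (M / r)\<^sup>2)"
        unfolding gsq_def fst_conv snd_conv
      proof (rule sum_mono)
        fix i assume "i \<in> {..n}"
        then have "\<bar>U1 n f i (y(n := r))\<bar> \<le> M / r" using gb[of i "y(n := r)"] that by simp
        then show "(U1 n f i (y(n := r)))\<^sup>2 \<le> (M / r)\<^sup>2" by (rule power2_le_iff_abs_le[THEN iffD2, rotated]) (use M that in simp)
      qed
      then show ?thesis using gsq_nonneg[of n f "(y, r)"] by simp
    qed
    have gsm: "(\<lambda>y. gsq n f (y, r)) \<in> borel_measurable (Rn n)" for r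
      by (rule measurable_compose[OF _ gsq_meas[OF f M0 car]]) measurable
    have gsI: "integrable (Rn n) (\<lambda>y. gsq n f (y, r) * w y)" if "r > 0" for r
      by (rule integrable_bounded_mult[OF w gsm gsb[OF that]])
    define Gr where "Gr r = (\<integral>y. gsq n f (y, r) * w y \<partial>Rn n)" for r
    have Gr0: "Gr r \<ge> 0" for r unfolding Gr_def using gsq_nonneg w0 by (intro Bochner_Integration.integral_nonneg) auto
    define K1 where "K1 r = 2 * real n * E * M * pC n * ((T / r) powr (1/4) / (T * r))" for r
    have K1: "K1 r \<ge> 0" if "r > 0" for r using E M pC T that by (simp add: K1_def)
    \<comment> \<open>The error term contains a gradient of size \<open>M / r\<close>, a derivative
      of the weight at cost \<open>1 / T\<close>, and the growth of \<open>u - c\<close>. After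
      multiplication by the height \<open>r\<close> there remains a multiple of
      \<open>(T / r) powr (1/4) / T\<close>, whose integral over heights up to \<open>T\<close> is
      bounded independently of \<open>T\<close>.\<close>
    have H: "(\<integral>y. h2 (y(n := r)) * w y \<partial>Rn n) \<le> 2 * Gr r + K1 r * L" if r: "0 < r" "r \<le> T" for r
    proof -
      have "(\<integral>y. h2 (y(n := r)) * w y \<partial>Rn n) \<le> (\<integral>y. 2 * (gsq n f (y, r) * w y) + K1 r * ((g y)\<^sup>2 * w y) \<partial>Rn n)"
        unfolding integral_h2(2)[OF r(1)]
      proof (rule integral_mono')
        show "integrable (Rn n) (\<lambda>y. 2 * (gsq n f (y, r) * w y) + K1 r * ((g y)\<^sup>2 * w y))"
          by (intro Bochner_Integration.integrable_add integrable_mult_right gsI gI r)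
        fix y assume y: "y \<in> space (Rn n)"
        show "0 \<le> 2 * (gsq n f (y, r) * w y) + K1 r * ((g y)\<^sup>2 * w y)"
          using K1[OF r(1)] w0 gsq_nonneg by simp
        have "(\<Sum>i<n. (U n f (y(n := r)) - c) * U1 n f i (y(n := r)) * w1 i y)
            \<le> (\<Sum>i<n. (E * ((T / r) powr (1/4) * (g y)\<^sup>2)) * (M / r) * (pC n * w y / T))"
        proof (rule sum_mono)
          fix i assume i: "i \<in> {..<n}"
          have a: "\<bar>U n f (y(n := r)) - c\<bar> \<le> E * ((T / r) powr (1/4) * (g y)\<^sup>2)"
            using gr[OF r y] E gg[OF y] by (meson mult_left_mono order.trans powr_ge_zero)
          have b: "\<bar>U1 n f i (y(n := r))\<bar> \<le> M / r" using gb[of i "y(n := r)"] i r by simp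
          have d: "\<bar>w1 i y\<bar> \<le> pC n * w y / T" using w1b[of i y] i by simp
          have "\<bar>(U n f (y(n := r)) - c) * U1 n f i (y(n := r)) * w1 i y\<bar> \<le> (E * ((T / r) powr (1/4) * (g y)\<^sup>2)) * (M / r) * (pC n * w y / T)"
            unfolding abs_mult using a b d E M r by (intro mult_mono mult_nonneg_nonneg) auto
          then show "(U n f (y(n := r)) - c) * U1 n f i (y(n := r)) * w1 i y \<le> (E * ((T / r) powr (1/4) * (g y)\<^sup>2)) * (M / r) * (pC n * w y / T)"
            by linarith
        qed
        also have "\<dots> = K1 r / 2 * ((g y)\<^sup>2 * w y)" by (simp add: K1_def mult_ac)
        finally have "2 * (\<Sum>i<n. (U n f (y(n := r)) - c) * U1 n f i (y(n := r)) * w1 i y) \<le> K1 r * ((g y)\<^sup>2 * w y)" by simp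
        then show "2 * (\<Sum>i\<le>n. (U1 n f i (y(n := r)))\<^sup>2) * w y + 2 * (\<Sum>i<n. (U n f (y(n := r)) - c) * U1 n f i (y(n := r)) * w1 i y)
           \<le> 2 * (gsq n f (y, r) * w y) + K1 r * ((g y)\<^sup>2 * w y)"
          by (simp add: gsq_def)
      qed
      also have "\<dots> = 2 * Gr r + K1 r * (\<integral>y. (g y)\<^sup>2 * w y \<partial>Rn n)"
        unfolding Gr_def by (subst Bochner_Integration.integral_add) (use gsI[OF r(1)] gI in simp_all)
      also have "\<dots> \<le> 2 * Gr r + K1 r * L" by (intro add_left_mono mult_left_mono gI K1 r)
      finally show ?thesis .
    qed
    define F where "F p = ennreal (w (fst p)) * (indicator {0<..T} (snd p) * ennreal (snd p * gsq n f p))" for p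
    have mF: "F \<in> borel_measurable (Rnt n)"
      unfolding F_def[abs_def] using measurable_compose[OF measurable_compose[OF measurable_fst wm] measurable_ennreal] mG
      by (intro borel_measurable_times_ennreal) auto
    have dom: "ennreal (indicator {\<epsilon><..T} r * ((r - \<epsilon>) * (\<integral>y. h2 (y(n := r)) * w y \<partial>Rn n)))
      \<le> 2 * (\<integral>\<^sup>+y. F (y, r) \<partial>Rn n) + ennreal (K0 / T) * (ennreal ((T / r) powr (1/4)) * indicator {0<..T} r)" for r
    proof (cases "r \<in> {\<epsilon><..T}")
      case True
      then have r: "0 < r" "r \<le> T" "r > \<epsilon>" using \<epsilon> by auto
      then have i1: "indicator {\<epsilon><..T} r = (1 :: real)" and i2: "indicator {0<..T} r = (1 :: ennreal)" using True by auto
      have "(r - \<epsilon>) * (\<integral>y. h2 (y(n := r)) * w y \<partial>Rn n) \<le> r * (2 * Gr r + K1 r * L)"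
        using r \<epsilon> Gr0[of r] K1[OF r(1)] L H[OF r(1,2)] by (intro order.trans[OF mult_left_mono mult_right_mono]) auto
      also have "\<dots> = 2 * (r * Gr r) + K0 / T * (T / r) powr (1/4)" using r by (simp add: K1_def K0_def distrib_left)
      finally have "ennreal ((r - \<epsilon>) * (\<integral>y. h2 (y(n := r)) * w y \<partial>Rn n)) \<le> ennreal (2 * (r * Gr r) + K0 / T * (T / r) powr (1/4))"
        by (rule ennreal_leI)
      also have "\<dots> = 2 * (ennreal r * ennreal (Gr r)) + ennreal (K0 / T) * ennreal ((T / r) powr (1/4))"
      proof -
        have "ennreal (2 * (r * Gr r)) = 2 * (ennreal r * ennreal (Gr r))" using r Gr0[of r] by (simp add: ennreal_mult)
        moreover have "ennreal (K0 / T * (T / r) powr (1/4)) = ennreal (K0 / T) * ennreal ((T / r) powr (1/4))"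
          using K0 T by (intro ennreal_mult) auto
        moreover have "ennreal (2 * (r * Gr r) + K0 / T * (T / r) powr (1/4)) = ennreal (2 * (r * Gr r)) + ennreal (K0 / T * (T / r) powr (1/4))"
          using r Gr0[of r] K0 T by (intro ennreal_plus) auto
        ultimately show ?thesis by simp
      qed
      also have "ennreal r * ennreal (Gr r) = (\<integral>\<^sup>+y. F (y, r) \<partial>Rn n)"
      proof -
        have "ennreal (Gr r) = (\<integral>\<^sup>+y. ennreal (gsq n f (y, r) * w y) \<partial>Rn n)"
          unfolding Gr_def using gsq_nonneg w0 by (intro nn_integral_eq_integral[symmetric] gsI r) auto
        then have "ennreal r * ennreal (Gr r) = (\<integral>\<^sup>+y. ennreal r * ennreal (gsq n f (y, r) * w y) \<partial>Rn n)"
          using gsm wm by (simp add: nn_integral_cmult)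
        also have "\<dots> = (\<integral>\<^sup>+y. F (y, r) \<partial>Rn n)"
          using r gsq_nonneg w0 by (intro nn_integral_cong) (simp add: F_def ennreal_mult' ennreal_mult'' mult_ac)
        finally show ?thesis .
      qed
      finally show ?thesis unfolding i1 i2 mult_1 mult_1_right .
    qed simp
    have "(\<integral>\<^sup>+r. (\<integral>\<^sup>+y. F (y, r) \<partial>Rn n) \<partial>lborel) = (\<integral>\<^sup>+y. ennreal (w y) * line_int {0<..T} (\<lambda>p. ennreal (snd p * gsq n f p)) y \<partial>Rn n)"
    proof -
      have ml: "(\<lambda>r. indicator {0<..T} r * ennreal (r * gsq n f (y, r))) \<in> borel_measurable lborel" if y: "y \<in> space (Rn n)" for y
        using measurable_compose[OF measurable_Pair1'[OF y] mG] by (intro borel_measurable_times_ennreal) auto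
      have "(\<integral>\<^sup>+r. (\<integral>\<^sup>+y. F (y, r) \<partial>Rn n) \<partial>lborel) = (\<integral>\<^sup>+y. (\<integral>\<^sup>+r. F (y, r) \<partial>lborel) \<partial>Rn n)"
        by (rule Rn_line.Fubini[OF mF])
      also have "\<dots> = (\<integral>\<^sup>+y. ennreal (w y) * line_int {0<..T} (\<lambda>p. ennreal (snd p * gsq n f p)) y \<partial>Rn n)"
        unfolding line_int_def F_def fst_conv snd_conv using ml by (intro nn_integral_cong nn_integral_cmult)
      finally show ?thesis .
    qed
    also have "\<dots> \<le> ennreal (Cp * M0) * (\<integral>\<^sup>+y. ennreal (w y) \<partial>Rn n)"
      unfolding T_def
    proof (rule nn_integral_weighted_carleson[OF mG car M0 Cp wm w0])
      fix x' y assume a: "x' \<in> space (Rn n)" "y \<in> cubk k x'"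
      have "ssq n (sh n X y) powr (- pm n) \<le> Cp * ssq n (sh n X x') powr (- pm n)"
        unfolding Cp_def using cubk_dist[OF a] pm_pos[of n] X by (intro ssq_sh_harnack) (auto simp: Xn T_def)
      then show "w y \<le> Cp * w x'"
        unfolding w_def pk_def sh_n using mult_left_mono[of _ _ "pc n * X n"] X pc_pos[of n] by (simp add: mult_ac)
    qed
    also have "(\<integral>\<^sup>+y. ennreal (w y) \<partial>Rn n) = 1" unfolding w_def by (rule nn_integral_pk[of X, OF X])
    finally have A: "(\<integral>\<^sup>+r. (\<integral>\<^sup>+y. F (y, r) \<partial>Rn n) \<partial>lborel) \<le> ennreal (Cp * M0)" by simp
    have "(\<integral>\<^sup>+r. ennreal (indicator {\<epsilon><..T} r * ((r - \<epsilon>) * (\<integral>y. h2 (y(n := r)) * w y \<partial>Rn n))) \<partial>lborel)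
      \<le> (\<integral>\<^sup>+r. 2 * (\<integral>\<^sup>+y. F (y, r) \<partial>Rn n) + ennreal (K0 / T) * (ennreal ((T / r) powr (1/4)) * indicator {0<..T} r) \<partial>lborel)"
      by (rule nn_integral_mono) (rule dom)
    also have "\<dots> = 2 * (\<integral>\<^sup>+r. (\<integral>\<^sup>+y. F (y, r) \<partial>Rn n) \<partial>lborel) + ennreal (K0 / T) * (\<integral>\<^sup>+r. ennreal ((T / r) powr (1/4)) * indicator {0<..T} r \<partial>lborel)"
    proof -
      have "(\<lambda>r. \<integral>\<^sup>+y. F (y, r) \<partial>Rn n) \<in> borel_measurable lborel"
        using mF by (intro Rn.borel_measurable_nn_integral) (auto intro!: measurable_compose[OF _ mF] simp: split_beta')
      then show ?thesis by (subst nn_integral_add) (auto simp: nn_integral_cmult)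
    qed
    also have "\<dots> \<le> 2 * ennreal (Cp * M0) + ennreal (K0 / T) * ennreal (2 * T)"
      by (intro add_mono mult_left_mono A nn_integral_fourth_root T) auto
    also have "\<dots> = ennreal (2 * (Cp * M0) + 2 * K0)"
    proof -
      have "K0 / T * (2 * T) = 2 * K0" using T by simp
      then have "ennreal (K0 / T) * ennreal (2 * T) = ennreal (2 * K0)" using K0 T by (simp add: ennreal_mult[symmetric])
      moreover have "2 * ennreal (Cp * M0) = ennreal (2 * (Cp * M0))" using Cp M0 by (simp add: ennreal_mult')
      ultimately show ?thesis using Cp M0 K0 by simp
    qed
    finally have first: "(\<integral>r. indicator {\<epsilon><..T} r * ((r - \<epsilon>) * (\<integral>y. h2 (y(n := r)) * w y \<partial>Rn n)) \<partial>lborel) \<le> 2 * (Cp * M0) + 2 * K0"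
      using Cp M0 K0 by (intro integral_le_of_nn_integral_le weighted_taylor(2) \<epsilon> \<epsilon>T) auto
    have "(\<integral>y. ((U n f (y(n := T)) - c)\<^sup>2 - (T - \<epsilon>) * h1 (y(n := T))) * w y \<partial>Rn n)
      \<le> (\<integral>y. (E\<^sup>2 + 2 * E * M) * ((g y)\<^sup>2 * w y) \<partial>Rn n)"
    proof (rule integral_mono')
      show "integrable (Rn n) (\<lambda>y. (E\<^sup>2 + 2 * E * M) * ((g y)\<^sup>2 * w y))" using gI by simp
      fix y assume y: "y \<in> space (Rn n)"
      show "0 \<le> (E\<^sup>2 + 2 * E * M) * ((g y)\<^sup>2 * w y)" using E M w0 by simp
      have a: "\<bar>U n f (y(n := T)) - c\<bar> \<le> E * g y" using gr[OF T order_refl y] T by simp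
      have a2: "(U n f (y(n := T)) - c)\<^sup>2 \<le> E\<^sup>2 * (g y)\<^sup>2"
        using power_mono[OF a, of 2] by (simp add: power_mult_distrib)
      have "\<bar>(T - \<epsilon>) * h1 (y(n := T))\<bar> = (T - \<epsilon>) * (2 * (\<bar>U n f (y(n := T)) - c\<bar> * \<bar>U1 n f n (y(n := T))\<bar>))"
        using \<epsilon>T by (simp add: h1_def abs_mult)
      also have "\<dots> \<le> T * (2 * ((E * (g y)\<^sup>2) * (M / T)))"
        using a gb[of n "y(n := T)"] \<epsilon> \<epsilon>T T E M gg[OF y] by (intro mult_mono order.trans[OF a] mult_left_mono) auto
      also have "\<dots> = 2 * E * M * (g y)\<^sup>2" using T by simp
      finally have "(U n f (y(n := T)) - c)\<^sup>2 - (T - \<epsilon>) * h1 (y(n := T)) \<le> E\<^sup>2 * (g y)\<^sup>2 + 2 * E * M * (g y)\<^sup>2"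
        using a2 by linarith
      from mult_right_mono[OF this w0[of y]]
      show "((U n f (y(n := T)) - c)\<^sup>2 - (T - \<epsilon>) * h1 (y(n := T))) * w y \<le> (E\<^sup>2 + 2 * E * M) * ((g y)\<^sup>2 * w y)"
        by (simp only: distrib_right mult.assoc)
    qed
    also have "\<dots> \<le> (E\<^sup>2 + 2 * E * M) * L" using gI(2) E M by (simp add: mult_left_mono)
    finally have "(\<integral>y. (U n f (y(n := \<epsilon>)) - c)\<^sup>2 * w y \<partial>Rn n) \<le> M'"
      using first weighted_taylor(3)[OF \<epsilon>(1) \<epsilon>T] unfolding M'_def by linarith
    moreover have "(\<integral>\<^sup>+y. ennreal ((U n f (y(n := \<epsilon>)) - c)\<^sup>2 * w y) \<partial>Rn n) = ennreal (\<integral>y. (U n f (y(n := \<epsilon>)) - c)\<^sup>2 * w y \<partial>Rn n)"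
      using w0 by (intro nn_integral_eq_integral weighted_taylor(1)[OF \<epsilon>(1) \<epsilon>T]) auto
    ultimately show ?thesis unfolding c_def w_def X_def T_def by (simp add: ennreal_leI)
  qed
  with M' show ?thesis using that by blast
qed

end

end

section \<open>From the Garcia condition to the Carleson condition\<close>

text \<open>Fatou's lemma in the form of an upper bound inherited by almost everywhere
  limits.\<close>

lemma nn_integral_liminf_le:
  assumes m: "\<And>j. G j \<in> borel_measurable M"
    and lim: "AE x in M. (\<lambda>j. G j x) \<longlonglongrightarrow> g x"
    and b: "eventually (\<lambda>j. (\<integral>\<^sup>+x. G j x \<partial>M) \<le> c) sequentially"
  shows "(\<integral>\<^sup>+x. g x \<partial>M) \<le> (c :: ennreal)"
proof -
  have "(\<integral>\<^sup>+x. g x \<partial>M) = (\<integral>\<^sup>+x. liminf (\<lambda>j. G j x) \<partial>M)"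
  proof (rule nn_integral_cong_AE)
    show "AE x in M. g x = liminf (\<lambda>j. G j x)"
      using lim by eventually_elim (rule lim_imp_Liminf[symmetric], auto)
  qed
  also have "\<dots> \<le> liminf (\<lambda>j. \<integral>\<^sup>+x. G j x \<partial>M)" by (rule nn_integral_liminf[OF m])
  also have "\<dots> \<le> liminf (\<lambda>j. c)" by (rule Liminf_mono[OF b])
  also have "\<dots> = c" by (rule Liminf_const) simp
  finally show ?thesis .
qed

text \<open>Constants extend to constants: the kernel has mass 1 at every point, so the derivative
  of its mass vanishes. Hence a constant may be subtracted from a function before its gradient is
  estimated, although constants are not integrable.\<close>

lemma pk1_integrable: "i \<le> n \<Longrightarrow> X n > 0 \<Longrightarrow> integrable (Rn n) (\<lambda>z. pk1 n i (sh n X z))"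
  and integral_pk1: "i \<le> n \<Longrightarrow> X n > 0 \<Longrightarrow> (\<integral>z. pk1 n i (sh n X z) \<partial>Rn n) = 0"
proof -
  assume i: "i \<le> n" and X: "X n > 0"
  show "integrable (Rn n) (\<lambda>z. pk1 n i (sh n X z))"
  proof (rule Bochner_Integration.integrable_bound)
    show "integrable (Rn n) (\<lambda>z. pC n / X n * pk n (sh n X z))" using integrable_pk[of X, OF X] by simp
    show "(\<lambda>z. pk1 n i (sh n X z)) \<in> borel_measurable (Rn n)" using i by (rule measurable_pk1_sh)
    show "AE y in Rn n. norm (pk1 n i (sh n X y)) \<le> norm (pC n / X n * pk n (sh n X y))"
      using abs_pk1_le_pk[of i n "sh n X _"] i X pk_nonneg[of "sh n X _" n] pC_ge_1[of n] by (intro AE_I2) (simp add: abs_mult)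
  qed
  \<comment> \<open>With a constant in place of an integrable function the majorant has to decay by
    itself, so it is a multiple of the kernel at \<open>X\<close>; the factor
    \<open>4 powr pm n\<close> pays for moving one coordinate by half a height.\<close>
  define B where "B z = pC n * 4 powr pm n / X n * pk n (sh n X z)" for z
  have "((\<lambda>s. \<integral>z. pk n (sh n (X(i := s)) z) \<partial>Rn n) has_real_derivative (\<integral>z. pk1 n i (sh n (X(i := X i)) z) \<partial>Rn n)) (at (X i))"
  proof (rule has_real_derivative_integral[where \<delta>="X n / 2" and B=B])
    show "X n / 2 > 0" using X by simp
    show "integrable (Rn n) B" unfolding B_def[abs_def] using integrable_pk[of X, OF X] by simp
    show "(\<lambda>z. pk1 n i (sh n (X(i := X i)) z)) \<in> borel_measurable (Rn n)" using i by (rule measurable_pk1_sh)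
    fix s assume s: "\<bar>s - X i\<bar> < X n / 2"
    have Xs: "(X(i := s)) n > 0" using X s by (cases "i = n") (auto simp: abs_if split: if_splits)
    show "integrable (Rn n) (\<lambda>z. pk n (sh n (X(i := s)) z))" by (rule integrable_pk[of "X(i := s)", OF Xs])
    fix z
    let ?Z = "sh n X z"
    let ?s = "s - (if i < n then z i else 0)"
    have Zs: "sh n (X(i := s)) z = ?Z(i := ?s)" by (rule sh_fun_upd)
    have p: "ssq n (sh n (X(i := s)) z) > 0" using Xs by (intro ssq_pos) auto
    have low: "ssq n ?Z / 4 \<le> ssq n (?Z(i := ?s))"
      by (rule ssq_fun_upd_lower[OF i]) (use s X i in \<open>auto simp: sh_def\<close>)
    have pZ: "ssq n ?Z > 0" using X by (intro ssq_pos) auto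
    have e: "(X(i := r)) = (X(i := s))(i := r)" for r by simp
    have "((\<lambda>r. pk n (?Z(i := r - (if i < n then z i else 0)))) has_real_derivative pk1 n i (?Z(i := ?s)) * (1 - 0)) (at s)"
    proof (rule DERIV_chain'[of "\<lambda>r. r - (if i < n then z i else 0)" _ _ _ "\<lambda>r. pk n (?Z(i := r))"])
      show "((\<lambda>r. r - (if i < n then z i else 0)) has_real_derivative 1 - 0) (at s)"
        by (intro DERIV_diff DERIV_ident DERIV_const)
      show "((\<lambda>r. pk n (?Z(i := r))) has_real_derivative pk1 n i (?Z(i := ?s))) (at ?s)"
        using p unfolding Zs by (intro DERIV_pk i)
    qed
    then show "((\<lambda>s. pk n (sh n (X(i := s)) z)) has_real_derivative pk1 n i (sh n (X(i := s)) z)) (at s)"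
      unfolding sh_fun_upd by simp
    have "\<bar>pk1 n i (?Z(i := ?s))\<bar> \<le> pc n * pC n * ssq n (?Z(i := ?s)) powr (- pm n)"
      using p unfolding Zs by (rule abs_pk1_le[OF i])
    also have "\<dots> \<le> pc n * pC n * (ssq n ?Z / 4) powr (- pm n)"
      using low pZ pm_pos[of n] pc_pos[of n] pC_ge_1[of n] by (intro mult_left_mono powr_mono2') auto
    also have "(ssq n ?Z / 4) powr (- pm n) = 4 powr pm n * ssq n ?Z powr (- pm n)"
      by (simp only: powr_divide powr_minus_divide) simp
    also have "pc n * pC n * (4 powr pm n * ssq n ?Z powr (- pm n)) = B z"
      using X by (simp add: B_def pk_def)
    finally show "\<bar>pk1 n i (sh n (X(i := s)) z)\<bar> \<le> B z" unfolding Zs .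
  qed
  then have d: "((\<lambda>s. \<integral>z. pk n (sh n (X(i := s)) z) \<partial>Rn n) has_real_derivative (\<integral>z. pk1 n i (sh n X z) \<partial>Rn n)) (at (X i))" by simp
  show "(\<integral>z. pk1 n i (sh n X z) \<partial>Rn n) = 0"
  proof (rule DERIV_local_const[OF d])
    show "X n / 2 > 0" using X by simp
    show "\<forall>s. \<bar>X i - s\<bar> < X n / 2 \<longrightarrow> (\<integral>z. pk n (sh n (X(i := X i)) z) \<partial>Rn n) = (\<integral>z. pk n (sh n (X(i := s)) z) \<partial>Rn n)"
    proof (intro allI impI)
      fix s assume s: "\<bar>X i - s\<bar> < X n / 2"
      have Xs: "(X(i := s)) n > 0" using X s by (cases "i = n") (auto simp: abs_if split: if_splits)
      show "(\<integral>z. pk n (sh n (X(i := X i)) z) \<partial>Rn n) = (\<integral>z. pk n (sh n (X(i := s)) z) \<partial>Rn n)"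
        using integral_pk[of "X(i := s)", OF Xs] integral_pk[of X, OF X] by simp
    qed
  qed
qed

text \<open>Jensen's inequality, as nonnegativity of the variance with respect to the Poisson
  kernel, which is a probability density.\<close>

lemma U_square_le:
  assumes g: "integrable (Rn n) g" and g2: "integrable (Rn n) (\<lambda>z. (g z)\<^sup>2)" and X: "X n > 0"
  shows "(U n g X)\<^sup>2 \<le> U n (\<lambda>z. (g z)\<^sup>2) X"
proof -
  define m where "m = U n g X"
  note i0 = integrable_pk[of X, OF X]
  have i1: "integrable (Rn n) (\<lambda>z. pk n (sh n X z) * g z)" by (rule integrable_pk_mult[of n g X, OF g X])
  have i2: "integrable (Rn n) (\<lambda>z. pk n (sh n X z) * (g z)\<^sup>2)" by (rule integrable_pk_mult[of n _ X, OF g2 X])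
  have "0 \<le> (\<integral>z. pk n (sh n X z) * (g z - m)\<^sup>2 \<partial>Rn n)"
    using X by (intro Bochner_Integration.integral_nonneg mult_nonneg_nonneg pk_nonneg) auto
  also have "\<dots> = (\<integral>z. pk n (sh n X z) * (g z)\<^sup>2 - 2 * m * (pk n (sh n X z) * g z) + m\<^sup>2 * pk n (sh n X z) \<partial>Rn n)"
    by (intro Bochner_Integration.integral_cong refl) (simp add: power2_eq_square algebra_simps)
  also have "\<dots> = U n (\<lambda>z. (g z)\<^sup>2) X - 2 * m * m + m\<^sup>2 * 1"
    unfolding integral_pk[of X, OF X, symmetric] m_def U_def using i0 i1 i2 by simp
  finally show ?thesis by (simp add: m_def power2_eq_square)
qed

text \<open>Green's formula for a function paired with itself, above the slice of height
  \<open>\<sigma> j\<close>. The slice norm is controlled by Jensen's inequality and the contraction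
  property applied to \<open>(g z)\<^sup>2\<close>, and Fatou's lemma lets the slice descend to the
  boundary. The factor 2 of Green's formula is given away.\<close>

lemma half_space_energy_le:
  assumes n: "n \<ge> 1" and g: "integrable (Rn n) g" and g2: "integrable (Rn n) (\<lambda>z. (g z)\<^sup>2)"
  shows "(\<integral>\<^sup>+p. ennreal (indicator {0<..} (snd p) * (snd p * gsq n g p)) \<partial>(Rnt n)) \<le> ennreal (\<integral>z. (g z)\<^sup>2 \<partial>Rn n)"
proof -
  note N = nice_harmonic_U[OF n g]
  interpret nice_harmonic n "U n g" "U1 n g" "U2 n g" "\<lambda>X. pC n * U n (\<lambda>z. \<bar>g z\<bar>) X" "pC n * (1 + pc n) * (\<integral>z. \<bar>g z\<bar> \<partial>Rn n)"
    by (rule N)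
  define Q where "Q = (\<integral>z. (g z)\<^sup>2 \<partial>Rn n)"
  have dg: "dotg n (U1 n g) (U1 n g) ((fst p)(n := snd p)) = gsq n g p" for p
    by (simp add: dotg_def gsq_def power2_eq_square)
  define \<sigma> where "\<sigma> j = inverse (real (Suc j))" for j
  have \<sigma>: "\<sigma> j > 0" for j by (simp add: \<sigma>_def)
  have \<sigma>0: "\<sigma> \<longlonglongrightarrow> 0" unfolding \<sigma>_def by (rule LIMSEQ_inverse_real_of_nat)
  have gm: "gsq n g \<in> borel_measurable (Rnt n)" using g by (intro gsq_measurable) auto
  show ?thesis unfolding Q_def[symmetric]
  proof (rule nn_integral_liminf_le[where G="\<lambda>j p. ennreal (indicator {\<sigma> j<..} (snd p) * ((snd p - \<sigma> j) * gsq n g p))"])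
    show "(\<lambda>p. ennreal (indicator {\<sigma> j<..} (snd p) * ((snd p - \<sigma> j) * gsq n g p))) \<in> borel_measurable (Rnt n)" for j
      by (intro measurable_compose[OF _ measurable_ennreal] borel_measurable_times measurable_indicator_snd gm) auto
    show "AE p in Rnt n. (\<lambda>j. ennreal (indicator {\<sigma> j<..} (snd p) * ((snd p - \<sigma> j) * gsq n g p)))
      \<longlonglongrightarrow> ennreal (indicator {0<..} (snd p) * (snd p * gsq n g p))"
    proof (rule AE_I2, rule tendsto_ennrealI)
      fix p :: "point \<times> real"
      show "(\<lambda>j. indicator {\<sigma> j<..} (snd p) * ((snd p - \<sigma> j) * gsq n g p)) \<longlonglongrightarrow> indicator {0<..} (snd p) * (snd p * gsq n g p)"
      proof (cases "snd p > 0")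
        case True
        have l: "(\<lambda>j. (snd p - \<sigma> j) * gsq n g p) \<longlonglongrightarrow> (snd p - 0) * gsq n g p"
          by (intro tendsto_intros \<sigma>0)
        have "eventually (\<lambda>j. \<sigma> j < snd p) sequentially" by (rule order_tendstoD(2)[OF \<sigma>0 True])
        then have "eventually (\<lambda>j. (snd p - \<sigma> j) * gsq n g p = indicator {\<sigma> j<..} (snd p) * ((snd p - \<sigma> j) * gsq n g p)) sequentially"
          by eventually_elim simp
        from Lim_transform_eventually[OF l this] show ?thesis using True by simp
      next
        case False
        have "\<not> \<sigma> j < snd p" for j using \<sigma>[of j] False by linarith
        then show ?thesis using False by simp
      qed
    qed
    show "eventually (\<lambda>j. (\<integral>\<^sup>+p. ennreal (indicator {\<sigma> j<..} (snd p) * ((snd p - \<sigma> j) * gsq n g p)) \<partial>(Rnt n)) \<le> ennreal Q) sequentially"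
    proof (rule always_eventually, rule allI)
      fix j
      let ?F = "\<lambda>p. indicator {\<sigma> j<..} (snd p) * ((snd p - \<sigma> j) * (2 * gsq n g p))"
      have F0: "?F p \<ge> 0" for p :: "point \<times> real" using gsq_nonneg[of n g p] by (simp add: indicator_def)
      have le: "indicator {\<sigma> j<..} (snd p) * ((snd p - \<sigma> j) * gsq n g p) \<le> ?F p" for p :: "point \<times> real"
        using F0[of p] by (simp add: mult_ac)
      have "(\<integral>\<^sup>+p. ennreal (indicator {\<sigma> j<..} (snd p) * ((snd p - \<sigma> j) * gsq n g p)) \<partial>(Rnt n))
        \<le> (\<integral>\<^sup>+p. ennreal (?F p) \<partial>(Rnt n))" by (intro nn_integral_mono ennreal_leI le)
      also have "\<dots> = ennreal (\<integral>p. ?F p \<partial>(Rnt n))"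
        using integral_mult_slice(1)[OF N \<sigma>[of j]] unfolding dg by (intro nn_integral_eq_integral AE_I2 F0)
      also have "\<dots> \<le> ennreal Q"
      proof (rule ennreal_leI)
        have "(\<integral>p. ?F p \<partial>(Rnt n)) = (\<integral>y. U n g (y(n := \<sigma> j)) * U n g (y(n := \<sigma> j)) \<partial>Rn n)"
          using integral_mult_slice(2)[OF N \<sigma>[of j]] unfolding dg by simp
        also have "\<dots> \<le> (\<integral>y. \<bar>U n (\<lambda>z. (g z)\<^sup>2) (y(n := \<sigma> j))\<bar> \<partial>Rn n)"
        proof (rule integral_mono')
          show "integrable (Rn n) (\<lambda>y. \<bar>U n (\<lambda>z. (g z)\<^sup>2) (y(n := \<sigma> j))\<bar>)"
            by (intro integrable_abs U_integrable g2 \<sigma>)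
          fix y
          show "U n g (y(n := \<sigma> j)) * U n g (y(n := \<sigma> j)) \<le> \<bar>U n (\<lambda>z. (g z)\<^sup>2) (y(n := \<sigma> j))\<bar>"
            using U_square_le[OF g g2, of "y(n := \<sigma> j)"] \<sigma>[of j] by (simp add: power2_eq_square)
        qed simp
        also have "\<dots> \<le> Q" using U_contraction[OF g2 \<sigma>[of j]] by (simp add: Q_def)
        finally show "(\<integral>p. ?F p \<partial>(Rnt n)) \<le> Q" .
      qed
      finally show "(\<integral>\<^sup>+p. ennreal (indicator {\<sigma> j<..} (snd p) * ((snd p - \<sigma> j) * gsq n g p)) \<partial>(Rnt n)) \<le> ennreal Q" .
    qed
  qed
qed

text \<open>Convergence in the mean yields almost everywhere convergence along a subsequence of
  heights. Fatou's lemma and dominated convergence ask for no more.\<close>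

lemma poisson_approx_AE:
  fixes f :: "point \<Rightarrow> real"
  assumes f: "integrable (Rn n) f"
  obtains \<sigma> :: "nat \<Rightarrow> real" where "\<And>j. \<sigma> j > 0" "\<sigma> \<longlonglongrightarrow> 0" "AE y in Rn n. (\<lambda>j. U n f (y(n := \<sigma> j))) \<longlonglongrightarrow> f y"
proof -
  define \<tau> where "\<tau> j = inverse (real (Suc j))" for j
  have \<tau>: "\<tau> j > 0" for j by (simp add: \<tau>_def)
  have \<tau>0: "\<tau> \<longlonglongrightarrow> 0" unfolding \<tau>_def by (rule LIMSEQ_inverse_real_of_nat)
  have L1: "(\<lambda>j. \<integral>y. norm (U n f (y(n := \<tau> j)) - f y) \<partial>Rn n) \<longlonglongrightarrow> 0"
    using l1_approx_integrable[OF \<tau> \<tau>0 f] by (simp add: l1_approx_def)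
  have "\<exists>r::nat\<Rightarrow>nat. strict_mono r \<and> (AE y in Rn n. (\<lambda>j. U n f (y(n := \<tau> (r j))) - f y) \<longlonglongrightarrow> 0)"
    by (rule tendsto_L1_AE_subseq[OF _ L1]) (intro Bochner_Integration.integrable_diff U_integrable f \<tau>)
  then obtain r :: "nat \<Rightarrow> nat" where r: "strict_mono r" and ae: "AE y in Rn n. (\<lambda>j. U n f (y(n := \<tau> (r j))) - f y) \<longlonglongrightarrow> 0" by blast
  have "AE y in Rn n. (\<lambda>j. U n f (y(n := \<tau> (r j)))) \<longlonglongrightarrow> f y"
    using ae by eventually_elim (rule LIM_zero_cancel)
  moreover have "(\<lambda>j. \<tau> (r j)) \<longlonglongrightarrow> 0" using LIMSEQ_subseq_LIMSEQ[OF \<tau>0 r] by (simp add: o_def)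
  ultimately show ?thesis using that[of "\<lambda>j. \<tau> (r j)"] \<tau> by blast
qed

lemma (in dyadic) garcia_bound:
  assumes f: "integrable (Rn n) f" and M0: "M0 \<ge> 0" and car: "carleson_grad f M0"
  obtains M' where "M' \<ge> 0"
    "\<And>x k. x \<in> space (Rn n) \<Longrightarrow>
      (\<integral>\<^sup>+y. ennreal ((f y - U n f (x(n := 2 powi k)))\<^sup>2 * pk n (sh n (x(n := 2 powi k)) y)) \<partial>Rn n) \<le> ennreal M'"
proof -
  obtain M' where M': "M' \<ge> 0"
    and b: "\<And>x k \<epsilon>. x \<in> space (Rn n) \<Longrightarrow> 0 < \<epsilon> \<Longrightarrow> \<epsilon> < 2 powi k \<Longrightarrow>
      (\<integral>\<^sup>+y. ennreal ((U n f (y(n := \<epsilon>)) - U n f (x(n := 2 powi k)))\<^sup>2 * pk n (sh n (x(n := 2 powi k)) y)) \<partial>Rn n) \<le> ennreal M'"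
    by (rule garcia_bound_above[OF f M0 car]) blast
  obtain \<sigma> :: "nat \<Rightarrow> real" where \<sigma>: "\<And>j. \<sigma> j > 0" and \<sigma>0: "\<sigma> \<longlonglongrightarrow> 0"
    and ae: "AE y in Rn n. (\<lambda>j. U n f (y(n := \<sigma> j))) \<longlonglongrightarrow> f y"
    by (rule poisson_approx_AE[OF f]) blast
  have fm: "f \<in> borel_measurable (Rn n)" using f by auto
  have "(\<integral>\<^sup>+y. ennreal ((f y - U n f (x(n := 2 powi k)))\<^sup>2 * pk n (sh n (x(n := 2 powi k)) y)) \<partial>Rn n) \<le> ennreal M'"
    if x: "x \<in> space (Rn n)" for x k
  proof (rule nn_integral_liminf_le[where G="\<lambda>j y. ennreal ((U n f (y(n := \<sigma> j)) - U n f (x(n := 2 powi k)))\<^sup>2 * pk n (sh n (x(n := 2 powi k)) y))"])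
    show "(\<lambda>y. ennreal ((U n f (y(n := \<sigma> j)) - U n f (x(n := 2 powi k)))\<^sup>2 * pk n (sh n (x(n := 2 powi k)) y))) \<in> borel_measurable (Rn n)" for j
      by (intro measurable_compose[OF _ measurable_ennreal] borel_measurable_times borel_measurable_power borel_measurable_diff U_measurable fm
          borel_measurable_const measurable_pk_sh)
    show "AE y in Rn n. (\<lambda>j. ennreal ((U n f (y(n := \<sigma> j)) - U n f (x(n := 2 powi k)))\<^sup>2 * pk n (sh n (x(n := 2 powi k)) y)))
      \<longlonglongrightarrow> ennreal ((f y - U n f (x(n := 2 powi k)))\<^sup>2 * pk n (sh n (x(n := 2 powi k)) y))"
      using ae
    proof eventually_elim
      case (elim y)
      then show ?case by (intro tendsto_ennrealI tendsto_mult tendsto_power tendsto_diff tendsto_const)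
    qed
    show "eventually (\<lambda>j. (\<integral>\<^sup>+y. ennreal ((U n f (y(n := \<sigma> j)) - U n f (x(n := 2 powi k)))\<^sup>2 * pk n (sh n (x(n := 2 powi k)) y)) \<partial>Rn n) \<le> ennreal M') sequentially"
    proof -
      have "eventually (\<lambda>j. \<sigma> j < 2 powi k) sequentially" by (rule order_tendstoD(2)[OF \<sigma>0]) simp
      then show ?thesis by eventually_elim (rule b[OF x \<sigma>])
    qed
  qed
  then show ?thesis using that M' by blast
qed

lemma U1_diff_const:
  assumes f: "integrable (Rn n) f" and g: "integrable (Rn n) g" and i: "i \<le> n" and X: "X n > 0"
  shows "integrable (Rn n) (\<lambda>z. pk1 n i (sh n X z) * (f z - c - g z))"
    and "U1 n f i X = U1 n g i X + (\<integral>z. pk1 n i (sh n X z) * (f z - c - g z) \<partial>Rn n)"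
proof -
  note a = integrable_pk1_mult[of n f X i, OF f X i] integrable_pk1_mult[of n g X i, OF g X i] pk1_integrable[of i n X, OF i X]
  have e: "pk1 n i (sh n X z) * (f z - c - g z) = pk1 n i (sh n X z) * f z - c * pk1 n i (sh n X z) - pk1 n i (sh n X z) * g z" for z
    by (simp add: algebra_simps)
  show "integrable (Rn n) (\<lambda>z. pk1 n i (sh n X z) * (f z - c - g z))"
    unfolding e by (intro Bochner_Integration.integrable_diff integrable_mult_right a)
  show "U1 n f i X = U1 n g i X + (\<integral>z. pk1 n i (sh n X z) * (f z - c - g z) \<partial>Rn n)"
    unfolding e U1_def using a integral_pk1[of i n X, OF i X] by simp
qed

text \<open>For each cube, \<open>\<psi> - c\<close> is split into \<open>g\<close>, its part within
  \<open>2 * R\<close> of \<open>x\<close> in every coordinate, and the rest. The energy of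
  \<open>g\<close> over the whole half space is at most its squared norm, which the hypothesis
  bounds because the kernel is at least of order \<open>1 / vk k\<close> there. The rest has
  gradient of order \<open>1 / R\<close> over the cube. The constant \<open>c\<close> may be any
  number and may change with the cube, which leaves room for truncation.\<close>

lemma (in dyadic) carleson_of_garcia:
  assumes \<psi>: "integrable (Rn n) \<psi>" and M': "M' \<ge> 0"
    and gar: "\<And>x k. x \<in> space (Rn n) \<Longrightarrow>
      \<exists>c. (\<integral>\<^sup>+z. ennreal ((\<psi> z - c)\<^sup>2 * pk n (sh n (x(n := 2 powi k)) z)) \<partial>Rn n) \<le> ennreal M'"
  shows "carleson (\<lambda>p. ennreal (snd p * gsq n \<psi> p))
    (2 * ((4 * real n + 1) powr pm n / pc n * M') + 2 * real (Suc n) * (pC n * (2 * real n + 3) powr pm n * (1 + M'))\<^sup>2)"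
  unfolding carleson_def
proof (intro ballI allI)
  fix x k assume x: "x \<in> space (Rn n)"
  define R where "R = (2::real) powi k"
  have R: "R > 0" by (simp add: R_def)
  obtain c where c: "(\<integral>\<^sup>+z. ennreal ((\<psi> z - c)\<^sup>2 * pk n (sh n (x(n := 2 powi k)) z)) \<partial>Rn n) \<le> ennreal M'"
    using gar[OF x] by blast
  define X0 where "X0 = x(n := R)"
  have X0: "X0 n > 0" using R by (simp add: X0_def)
  define w where "w z = pk n (sh n X0 z)" for z
  have w0: "w z \<ge> 0" for z unfolding w_def using X0 by (intro pk_nonneg) simp
  have wi: "integrable (Rn n) w" "(\<integral>z. w z \<partial>Rn n) = 1"
    using integrable_pk[of X0, OF X0] integral_pk[of X0, OF X0] by (simp_all add: w_def[abs_def])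
  have \<psi>m: "\<psi> \<in> borel_measurable (Rn n)" and wm: "w \<in> borel_measurable (Rn n)" using \<psi> wi by auto
  have q: "integrable (Rn n) (\<lambda>z. (\<psi> z - c)\<^sup>2 * w z)" "(\<integral>z. (\<psi> z - c)\<^sup>2 * w z \<partial>Rn n) \<le> M'"
  proof -
    have "(\<integral>\<^sup>+z. ennreal ((\<psi> z - c)\<^sup>2 * w z) \<partial>Rn n) \<le> ennreal M'" using c by (simp only: w_def X0_def R_def)
    from integral_le_nn_integral_bound[OF _ _ this M']
    show "integrable (Rn n) (\<lambda>z. (\<psi> z - c)\<^sup>2 * w z)" "(\<integral>z. (\<psi> z - c)\<^sup>2 * w z \<partial>Rn n) \<le> M'"
      using \<psi>m wm w0 by auto
  qed
  have q1: "integrable (Rn n) (\<lambda>z. (1 + (\<psi> z - c)\<^sup>2) * w z)" "(\<integral>z. (1 + (\<psi> z - c)\<^sup>2) * w z \<partial>Rn n) \<le> 1 + M'"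
    using q wi by (simp_all add: distrib_right)
  \<comment> \<open>\<open>B * vk k\<close> bounds the reciprocal of the kernel on the near set
    \<open>S\<close>; off \<open>S\<close>, the kernel gradient seen from points above the cube is
    at most \<open>D / R\<close> times the kernel.\<close>
  define B where "B = (4 * real n + 1) powr pm n / pc n"
  define D where "D = pC n * (2 * real n + 3) powr pm n"
  have B: "B \<ge> 0" using pc_pos[of n] by (simp add: B_def)
  have D: "D \<ge> 0" using pC_ge_1[of n] by (simp add: D_def)
  define S where "S = {z \<in> space (Rn n). \<forall>i\<in>{..<n}. \<bar>z i - x i\<bar> \<le> 2 * R}"
  have S: "S \<in> sets (Rn n)"
    unfolding S_def
    by (intro sets.sets_Collect_finite_All borel_measurable_le borel_measurable_abs borel_measurable_diff borel_measurable_const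
        measurable_Rn_component[OF measurable_ident]) auto
  have ssqX0: "ssq n (sh n X0 z) = R\<^sup>2 + (\<Sum>i<n. (x i - z i)\<^sup>2)" for z
    by (simp add: ssq_split X0_def sh_def)
  have inS: "1 \<le> B * vk k * w z" if z: "z \<in> S" for z
  proof -
    have "(\<Sum>i<n. (x i - z i)\<^sup>2) \<le> (\<Sum>i<n. (2 * R)\<^sup>2)"
    proof (rule sum_mono)
      fix i assume "i \<in> {..<n}"
      then have "\<bar>x i - z i\<bar> \<le> \<bar>2 * R\<bar>" using z R by (simp add: S_def abs_minus_commute)
      then show "(x i - z i)\<^sup>2 \<le> (2 * R)\<^sup>2" by (simp only: abs_le_square_iff)
    qed
    then have le: "ssq n (sh n X0 z) \<le> (4 * real n + 1) * R\<^sup>2" unfolding ssqX0 by (simp add: algebra_simps power_mult_distrib)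
    have pos: "ssq n (sh n X0 z) > 0" using X0 by (intro ssq_pos) auto
    have RR: "R ^ n * (R * (R\<^sup>2) powr (- pm n)) = 1"
    proof -
      have r2: "R\<^sup>2 = R powr 2" and e2: "2 * - pm n = - (real n + 1)" using R by (simp_all add: pm_def field_simps)
      have "(R\<^sup>2) powr (- pm n) = R powr (- (real n + 1))" unfolding r2 powr_powr e2 ..
      also have "\<dots> = 1 / (R ^ n * R)"
        unfolding powr_minus_divide powr_add using R by (simp add: powr_realpow)
      finally show ?thesis using R by simp
    qed
    have "1 = B * vk k * (pc n * R * ((4 * real n + 1) * R\<^sup>2) powr (- pm n))"
    proof -
      have a: "((4 * real n + 1) * R\<^sup>2) powr (- pm n) = (4 * real n + 1) powr (- pm n) * (R\<^sup>2) powr (- pm n)"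
        by (rule powr_mult)
      have b: "(4 * real n + 1) powr pm n * (4 * real n + 1) powr (- pm n) = 1"
        by (simp only: powr_add[symmetric]) simp
      have "B * vk k * (pc n * R * ((4 * real n + 1) powr (- pm n) * (R\<^sup>2) powr (- pm n)))
        = ((4 * real n + 1) powr pm n * (4 * real n + 1) powr (- pm n)) * (R ^ n * (R * (R\<^sup>2) powr (- pm n)))"
        using pc_pos[of n] by (simp add: B_def vk_def R_def)
      then show ?thesis unfolding a b RR by simp
    qed
    also have "\<dots> \<le> B * vk k * (pc n * R * ssq n (sh n X0 z) powr (- pm n))"
      using le pos B vk_pos[of k] pc_pos[of n] pm_pos[of n] R by (intro mult_left_mono powr_mono2') auto
    finally show ?thesis by (simp add: w_def pk_def X0_def)
  qed
  define g where "g z = indicator S z * (\<psi> z - c)" for z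
  have gm: "g \<in> borel_measurable (Rn n)"
    unfolding g_def[abs_def] using S \<psi>m by (intro borel_measurable_times borel_measurable_indicator borel_measurable_diff) auto
  \<comment> \<open>It takes the place of the Cauchy-Schwarz inequality: first moments are at most 1
    plus second moments, which is the origin of \<open>1 + M'\<close>.\<close>
  have sq: "\<bar>a\<bar> \<le> 1 + a\<^sup>2" for a :: real
  proof -
    have "0 \<le> (\<bar>a\<bar> - 1)\<^sup>2" by simp
    then show ?thesis by (simp add: power2_diff)
  qed
  have V: "vk k \<ge> 0" using vk_pos[of k] by simp
  have g: "integrable (Rn n) g"
  proof (rule Bochner_Integration.integrable_bound)
    show "integrable (Rn n) (\<lambda>z. B * vk k * ((1 + (\<psi> z - c)\<^sup>2) * w z))" using q1(1) by simp
    show "AE z in Rn n. norm (g z) \<le> norm (B * vk k * ((1 + (\<psi> z - c)\<^sup>2) * w z))"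
    proof (rule AE_I2)
      fix z
      have p: "0 \<le> B * vk k * ((1 + (\<psi> z - c)\<^sup>2) * w z)" using B V w0[of z] by simp
      have "\<bar>g z\<bar> \<le> (1 + (\<psi> z - c)\<^sup>2) * (B * vk k * w z)"
      proof (cases "z \<in> S")
        case True
        have "\<bar>\<psi> z - c\<bar> * 1 \<le> (1 + (\<psi> z - c)\<^sup>2) * (B * vk k * w z)"
          by (rule mult_mono[OF sq inS[OF True]]) auto
        then show ?thesis using True by (simp add: g_def)
      qed (use p in \<open>simp add: g_def mult_ac\<close>)
      then show "norm (g z) \<le> norm (B * vk k * ((1 + (\<psi> z - c)\<^sup>2) * w z))" using p by (simp add: mult_ac)
    qed
  qed (rule gm)
  have gg: "(g z)\<^sup>2 \<le> B * vk k * ((\<psi> z - c)\<^sup>2 * w z)" for z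
  proof (cases "z \<in> S")
    case True
    have "(\<psi> z - c)\<^sup>2 * 1 \<le> (\<psi> z - c)\<^sup>2 * (B * vk k * w z)"
      by (rule mult_left_mono[OF inS[OF True]]) auto
    then show ?thesis using True by (simp add: g_def mult_ac)
  qed (use B V w0[of z] in \<open>simp add: g_def\<close>)
  have g2: "integrable (Rn n) (\<lambda>z. (g z)\<^sup>2)"
  proof (rule Bochner_Integration.integrable_bound)
    show "integrable (Rn n) (\<lambda>z. B * vk k * ((\<psi> z - c)\<^sup>2 * w z))" using q(1) by simp
    show "AE z in Rn n. norm ((g z)\<^sup>2) \<le> norm (B * vk k * ((\<psi> z - c)\<^sup>2 * w z))"
    proof (rule AE_I2)
      fix z show "norm ((g z)\<^sup>2) \<le> norm (B * vk k * ((\<psi> z - c)\<^sup>2 * w z))" using gg[of z] by simp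
    qed
  qed (intro borel_measurable_power gm)
  have gQ: "(\<integral>z. (g z)\<^sup>2 \<partial>Rn n) \<le> B * vk k * M'"
  proof -
    have "(\<integral>z. (g z)\<^sup>2 \<partial>Rn n) \<le> (\<integral>z. B * vk k * ((\<psi> z - c)\<^sup>2 * w z) \<partial>Rn n)"
      using q(1) by (intro integral_mono g2 gg integrable_mult_right)
    also have "\<dots> \<le> B * vk k * M'" using q(2) B V by (simp add: mult_left_mono)
    finally show ?thesis .
  qed
  define e where "e = 2 * real (Suc n) * (D * (1 + M') / R)\<^sup>2"
  have e: "e \<ge> 0" by (simp add: e_def)
  have far: "\<bar>U1 n \<psi> i (y(n := t)) - U1 n g i (y(n := t))\<bar> \<le> D * (1 + M') / R"
    if y: "y \<in> cubk k x" and t: "0 < t" "t \<le> R" and i: "i \<le> n" for y t i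
  proof -
    let ?X = "y(n := t)"
    have X: "?X n > 0" using t by simp
    have pw: "\<bar>pk1 n i (sh n ?X z) * (\<psi> z - c - g z)\<bar> \<le> D / R * ((1 + (\<psi> z - c)\<^sup>2) * w z)" if zs: "z \<in> space (Rn n)" for z
    proof (cases "z \<in> S")
      case True
      then show ?thesis using D R w0[of z] by (simp add: g_def)
    next
      case False
      then obtain j where j: "j < n" "\<bar>z j - x j\<bar> > 2 * R" using zs by (auto simp: S_def not_le)
      have yx: "\<bar>y i - x i\<bar> \<le> R" if "i < n" for i using cubk_dist[OF x y that] by (simp add: R_def)
      have p: "ssq n (sh n ?X z) > 0" using X by (intro ssq_pos) auto
      have p0: "ssq n (sh n X0 z) > 0" using X0 by (intro ssq_pos) auto
      have eX: "ssq n (sh n ?X z) = t\<^sup>2 + (\<Sum>i<n. (y i - z i)\<^sup>2)" by (simp add: ssq_split sh_def)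
      \<comment> \<open>The coordinate \<open>j\<close> of \<open>z\<close> is more than
        \<open>2 * R\<close> away from that of \<open>x\<close>, while \<open>y\<close> is within
        \<open>R\<close>. This horizontal gap makes up for the height \<open>t\<close>, which may be
        arbitrarily small.\<close>
      have "R \<le> \<bar>y j - z j\<bar>" using j yx[of j] by linarith
      then have "R\<^sup>2 \<le> (y j - z j)\<^sup>2" using R by (metis abs_of_pos abs_le_square_iff)
      also have "\<dots> \<le> (\<Sum>i<n. (y i - z i)\<^sup>2)" using j by (intro member_le_sum) auto
      finally have RS: "R\<^sup>2 \<le> (\<Sum>i<n. (y i - z i)\<^sup>2)" .
      have "(\<Sum>i<n. (x i - z i)\<^sup>2) \<le> (\<Sum>i<n. 2 * (y i - z i)\<^sup>2 + 2 * R\<^sup>2)"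
      proof (rule sum_mono)
        fix i assume "i \<in> {..<n}"
        then have a: "(y i - x i)\<^sup>2 \<le> R\<^sup>2" using yx[of i] R by (simp add: abs_le_square_iff[symmetric])
        have "0 \<le> ((y i - z i) + (y i - x i))\<^sup>2" by simp
        then have "(x i - z i)\<^sup>2 \<le> 2 * (y i - z i)\<^sup>2 + 2 * (y i - x i)\<^sup>2" by (simp add: power2_eq_square algebra_simps)
        with a show "(x i - z i)\<^sup>2 \<le> 2 * (y i - z i)\<^sup>2 + 2 * R\<^sup>2" by linarith
      qed
      also have "\<dots> = 2 * (\<Sum>i<n. (y i - z i)\<^sup>2) + 2 * real n * R\<^sup>2" by (simp add: sum.distrib sum_distrib_left)
      finally have s1: "ssq n (sh n X0 z) \<le> (2 * real n + 1) * R\<^sup>2 + 2 * (\<Sum>i<n. (y i - z i)\<^sup>2)"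
        unfolding ssqX0 by (simp add: algebra_simps)
      have s2: "(2 * real n + 1) * R\<^sup>2 \<le> (2 * real n + 1) * (\<Sum>i<n. (y i - z i)\<^sup>2)" by (rule mult_left_mono[OF RS]) simp
      have s3: "(2 * real n + 3) * (\<Sum>i<n. (y i - z i)\<^sup>2) \<le> (2 * real n + 3) * ssq n (sh n ?X z)"
        unfolding eX by (intro mult_left_mono) auto
      have alg: "(2 * real n + 1) * s + 2 * s = (2 * real n + 3) * s" for s by (simp add: algebra_simps)
      have ss: "ssq n (sh n X0 z) \<le> (2 * real n + 3) * ssq n (sh n ?X z)"
        using s1 s2 s3 alg[of "\<Sum>i<n. (y i - z i)\<^sup>2"] by linarith
      have "ssq n (sh n ?X z) powr (- pm n) \<le> (ssq n (sh n X0 z) / (2 * real n + 3)) powr (- pm n)"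
        using ss p0 pm_pos[of n] by (intro powr_mono2') (auto simp: divide_le_eq mult.commute)
      also have "\<dots> = (2 * real n + 3) powr pm n * ssq n (sh n X0 z) powr (- pm n)"
        by (simp only: powr_divide powr_minus_divide) simp
      finally have "pc n * pC n * ssq n (sh n ?X z) powr (- pm n) \<le> pc n * pC n * ((2 * real n + 3) powr pm n * ssq n (sh n X0 z) powr (- pm n))"
        using pc_pos[of n] pC_ge_1[of n] by (intro mult_left_mono) auto
      also have "\<dots> = D / R * w z" using R by (simp add: D_def w_def pk_def X0_def)
      finally have a: "\<bar>pk1 n i (sh n ?X z)\<bar> \<le> D / R * w z" using abs_pk1_le[OF i p] by linarith
      have b: "\<bar>\<psi> z - c - g z\<bar> \<le> 1 + (\<psi> z - c)\<^sup>2" using False sq[of "\<psi> z - c"] by (simp add: g_def)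
      have "\<bar>pk1 n i (sh n ?X z)\<bar> * \<bar>\<psi> z - c - g z\<bar> \<le> (D / R * w z) * (1 + (\<psi> z - c)\<^sup>2)"
        using a b D R w0[of z] by (intro mult_mono) auto
      then show ?thesis by (simp only: abs_mult mult_ac)
    qed
    have "U1 n \<psi> i ?X - U1 n g i ?X = (\<integral>z. pk1 n i (sh n ?X z) * (\<psi> z - c - g z) \<partial>Rn n)"
      using U1_diff_const(2)[OF \<psi> g i, of ?X c] X by simp
    also have "\<bar>\<dots>\<bar> \<le> (\<integral>z. D / R * ((1 + (\<psi> z - c)\<^sup>2) * w z) \<partial>Rn n)"
      by (rule abs_integral_le[OF integrable_mult_right[OF q1(1)] pw])
    also have "\<dots> \<le> D / R * (1 + M')"
      unfolding integral_mult_right_zero using q1(2) D R by (intro mult_left_mono) auto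
    finally show ?thesis by simp
  qed
  have gsqle: "gsq n \<psi> (y, t) \<le> 2 * gsq n g (y, t) + e" if y: "y \<in> cubk k x" and t: "0 < t" "t \<le> R" for y t
  proof -
    have "gsq n \<psi> (y, t) \<le> (\<Sum>i\<le>n. 2 * (U1 n g i (y(n := t)))\<^sup>2 + 2 * (D * (1 + M') / R)\<^sup>2)"
      unfolding gsq_def fst_conv snd_conv
    proof (rule sum_mono)
      fix i assume i: "i \<in> {..n}"
      have alg: "a\<^sup>2 \<le> 2 * b\<^sup>2 + 2 * d\<^sup>2" if "\<bar>a - b\<bar> \<le> d" for a b d :: real
      proof -
        have "(a - b)\<^sup>2 \<le> d\<^sup>2" using that by (metis abs_ge_zero abs_of_nonneg abs_le_square_iff order.trans)
        moreover have "0 \<le> (a - 2 * b)\<^sup>2" by simp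
        moreover have "a\<^sup>2 = 2 * b\<^sup>2 + 2 * (a - b)\<^sup>2 - (a - 2 * b)\<^sup>2" by (simp add: power2_eq_square algebra_simps)
        ultimately show ?thesis by linarith
      qed
      show "(U1 n \<psi> i (y(n := t)))\<^sup>2 \<le> 2 * (U1 n g i (y(n := t)))\<^sup>2 + 2 * (D * (1 + M') / R)\<^sup>2"
        by (rule alg[OF far[OF y t]]) (use i in simp)
    qed
    also have "\<dots> = 2 * gsq n g (y, t) + e" by (simp add: gsq_def e_def sum.distrib sum_distrib_left)
    finally show ?thesis .
  qed
  define h where "h p = ennreal (indicator {0<..} (snd p) * (snd p * gsq n g p))" for p
  have hm: "h \<in> borel_measurable (Rnt n)"
    unfolding h_def[abs_def] using gsq_measurable[OF gm]
    by (intro measurable_compose[OF _ measurable_ennreal] borel_measurable_times measurable_indicator_snd) auto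
  have hy: "(\<lambda>t. h (y, t)) \<in> borel_measurable lborel" if "y \<in> space (Rn n)" for y
    by (rule measurable_compose[OF measurable_Pair1'[OF that] hm])
  have line: "line_int {0<..R} (\<lambda>p. ennreal (snd p * gsq n \<psi> p)) y \<le> 2 * (\<integral>\<^sup>+t. h (y, t) \<partial>lborel) + ennreal (R * e * R)"
    if y: "y \<in> cubk k x" "y \<in> space (Rn n)" for y
  proof -
    have "line_int {0<..R} (\<lambda>p. ennreal (snd p * gsq n \<psi> p)) y \<le> (\<integral>\<^sup>+t. 2 * h (y, t) + ennreal (R * e) * indicator {0<..R} t \<partial>lborel)"
      unfolding line_int_def
    proof (rule nn_integral_mono)
      fix t
      show "indicator {0<..R} t * ennreal (snd (y, t) * gsq n \<psi> (y, t)) \<le> 2 * h (y, t) + ennreal (R * e) * indicator {0<..R} t"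
      proof (cases "t \<in> {0<..R}")
        case True
        then have t: "0 < t" "t \<le> R" by auto
        have "t * gsq n \<psi> (y, t) \<le> t * (2 * gsq n g (y, t)) + R * e"
          using mult_left_mono[OF gsqle[OF y(1) t], of t] mult_right_mono[OF t(2) e] t by (simp add: distrib_left)
        then have "ennreal (t * gsq n \<psi> (y, t)) \<le> ennreal (2 * (t * gsq n g (y, t)) + R * e)" by (intro ennreal_leI) simp
        also have "\<dots> = ennreal (2 * (t * gsq n g (y, t))) + ennreal (R * e)"
          using t R e gsq_nonneg[of n g "(y, t)"] by (intro ennreal_plus) auto
        also have "ennreal (2 * (t * gsq n g (y, t))) = 2 * h (y, t)" using t by (simp add: h_def ennreal_mult')
        finally show ?thesis using True by simp
      qed simp
    qed
    also have "\<dots> = 2 * (\<integral>\<^sup>+t. h (y, t) \<partial>lborel) + ennreal (R * e) * ennreal R"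
      using hy[OF y(2)] R by (subst nn_integral_add) (auto simp: nn_integral_cmult nn_integral_cmult_indicator)
    also have "ennreal (R * e) * ennreal R = ennreal (R * e * R)" using R e by (simp add: ennreal_mult[symmetric])
    finally show ?thesis .
  qed
  have mind: "(\<lambda>y. ind k x y) \<in> borel_measurable (Rn n)" using x by (intro measurable_ind) auto
  have mh: "(\<lambda>y. \<integral>\<^sup>+t. h (y, t) \<partial>lborel) \<in> borel_measurable (Rn n)"
    by (rule lborel.borel_measurable_nn_integral_fst[OF hm])
  have "(\<integral>\<^sup>+y. ind k x y * line_int {0<..R} (\<lambda>p. ennreal (snd p * gsq n \<psi> p)) y \<partial>Rn n)
    \<le> (\<integral>\<^sup>+y. 2 * (\<integral>\<^sup>+t. h (y, t) \<partial>lborel) + ennreal (R * e * R) * ind k x y \<partial>Rn n)"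
  proof (rule nn_integral_mono)
    fix y assume y: "y \<in> space (Rn n)"
    show "ind k x y * line_int {0<..R} (\<lambda>p. ennreal (snd p * gsq n \<psi> p)) y \<le> 2 * (\<integral>\<^sup>+t. h (y, t) \<partial>lborel) + ennreal (R * e * R) * ind k x y"
      using line[OF _ y] same_iff[OF x, of y k] by (cases "(x, y) \<in> same k") auto
  qed
  also have "\<dots> = 2 * (\<integral>\<^sup>+y. (\<integral>\<^sup>+t. h (y, t) \<partial>lborel) \<partial>Rn n) + ennreal (R * e * R) * ennreal (vk k)"
    using mind mh nn_integral_ind[OF x, of k] by (subst nn_integral_add) (auto simp: nn_integral_cmult)
  also have "(\<integral>\<^sup>+y. (\<integral>\<^sup>+t. h (y, t) \<partial>lborel) \<partial>Rn n) = (\<integral>\<^sup>+p. h p \<partial>(Rnt n))"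
    by (rule lborel.nn_integral_fst[OF hm])
  also have "2 * (\<integral>\<^sup>+p. h p \<partial>(Rnt n)) + ennreal (R * e * R) * ennreal (vk k)
     \<le> 2 * ennreal (B * vk k * M') + ennreal (R * e * R) * ennreal (vk k)"
    unfolding h_def using half_space_energy_le[OF n g g2] gQ
    by (intro add_right_mono mult_left_mono) (auto intro: order.trans ennreal_leI)
  also have "\<dots> = ennreal ((2 * (B * M') + R * e * R) * vk k)"
  proof -
    have "2 * ennreal (B * vk k * M') = ennreal (2 * (B * vk k * M'))" using B V M' by (simp add: ennreal_mult')
    moreover have "ennreal (R * e * R) * ennreal (vk k) = ennreal (R * e * R * vk k)" using R e V by (simp add: ennreal_mult[symmetric])
    moreover have "(2 * (B * M') + R * e * R) * vk k = 2 * (B * vk k * M') + R * e * R * vk k" by (simp add: algebra_simps)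
    ultimately show ?thesis using B V M' R e by (simp add: ennreal_plus[symmetric] del: ennreal_plus)
  qed
  \<comment> \<open>Scale invariance: a squared gradient of order one over the square of
    \<open>R\<close>, integrated with weight \<open>t\<close> over heights up to \<open>R\<close>,
    contributes a constant.\<close>
  also have "R * e * R = 2 * real (Suc n) * (D * (1 + M'))\<^sup>2" using R by (simp add: e_def power2_eq_square)
  finally show "(\<integral>\<^sup>+y. ind k x y * line_int {0<..2 powi k} (\<lambda>p. ennreal (snd p * gsq n \<psi> p)) y \<partial>Rn n)
    \<le> ennreal ((2 * ((4 * real n + 1) powr pm n / pc n * M') + 2 * real (Suc n) * (pC n * (2 * real n + 3) powr pm n * (1 + M'))\<^sup>2) * vk k)"
    by (simp only: R_def B_def D_def)
qed

section \<open>Truncation\<close>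

definition trunc :: "real \<Rightarrow> real \<Rightarrow> real" where
  "trunc K a = max (- K) (min K a)"

lemma trunc_lipschitz: "\<bar>trunc K a - trunc K b\<bar> \<le> \<bar>a - b\<bar>"
  by (auto simp: trunc_def max_def min_def)

lemma abs_trunc_le: "K \<ge> 0 \<Longrightarrow> \<bar>trunc K a\<bar> \<le> K" "K \<ge> 0 \<Longrightarrow> \<bar>trunc K a\<bar> \<le> \<bar>a\<bar>"
  by (auto simp: trunc_def max_def min_def)

lemma trunc_eq: "\<bar>a\<bar> \<le> K \<Longrightarrow> trunc K a = a"
  by (auto simp: trunc_def max_def min_def)

lemma integrable_trunc:
  assumes f: "integrable M f" and K: "K \<ge> 0"
  shows "integrable M (\<lambda>z. trunc K (f z))"
proof (rule Bochner_Integration.integrable_bound[OF f])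
  show "(\<lambda>z. trunc K (f z)) \<in> borel_measurable M"
    unfolding trunc_def using f by (intro borel_measurable_max borel_measurable_min borel_measurable_const) auto
  show "AE z in M. norm (trunc K (f z)) \<le> norm (f z)" using abs_trunc_le(2)[OF K] by (intro AE_I2) simp
qed

text \<open>Truncation does not increase distances, so with the truncated constant in place of
  \<open>c\<close> the Garcia integral does not grow. The resulting Carleson constant is the same
  for all levels \<open>K\<close>.\<close>

lemma (in dyadic) carleson_trunc:
  assumes f: "integrable (Rn n) f" and M0: "M0 \<ge> 0" and car: "carleson_grad f M0"
  obtains M1 where "M1 \<ge> 0" "\<And>K. K \<ge> 0 \<Longrightarrow> carleson_grad (\<lambda>z. trunc K (f z)) M1"
proof -
  obtain M' where M': "M' \<ge> 0"
    and b: "\<And>x k. x \<in> space (Rn n) \<Longrightarrow>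
      (\<integral>\<^sup>+y. ennreal ((f y - U n f (x(n := 2 powi k)))\<^sup>2 * pk n (sh n (x(n := 2 powi k)) y)) \<partial>Rn n) \<le> ennreal M'"
    by (rule garcia_bound[OF f M0 car]) blast
  let ?M1 = "2 * ((4 * real n + 1) powr pm n / pc n * M') + 2 * real (Suc n) * (pC n * (2 * real n + 3) powr pm n * (1 + M'))\<^sup>2"
  have "?M1 \<ge> 0" using M' pc_pos[of n] by simp
  moreover have "carleson_grad (\<lambda>z. trunc K (f z)) ?M1" if K: "K \<ge> 0" for K
  proof (rule carleson_of_garcia[OF integrable_trunc[OF f K] M'])
    fix x k assume x: "x \<in> space (Rn n)"
    let ?c = "U n f (x(n := 2 powi k))"
    have "(\<integral>\<^sup>+z. ennreal ((trunc K (f z) - trunc K ?c)\<^sup>2 * pk n (sh n (x(n := 2 powi k)) z)) \<partial>Rn n)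
      \<le> (\<integral>\<^sup>+z. ennreal ((f z - ?c)\<^sup>2 * pk n (sh n (x(n := 2 powi k)) z)) \<partial>Rn n)"
      by (intro nn_integral_mono ennreal_leI mult_right_mono pk_nonneg)
        (simp_all only: abs_le_square_iff[symmetric] trunc_lipschitz, simp)
    also have "\<dots> \<le> ennreal M'" by (rule b[OF x])
    finally show "\<exists>c. (\<integral>\<^sup>+z. ennreal ((trunc K (f z) - c)\<^sup>2 * pk n (sh n (x(n := 2 powi k)) z)) \<partial>Rn n) \<le> ennreal M'" by blast
  qed
  ultimately show ?thesis using that by blast
qed

section \<open>The pairing\<close>

lemma abs_dotg_le: "\<bar>dotg n (U1 n \<phi>) (U1 n f) ((fst p)(n := snd p))\<bar> \<le> sqrt (gsq n \<phi> p * gsq n f p)"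
proof -
  let ?X = "(fst p)(n := snd p)"
  have "(dotg n (U1 n \<phi>) (U1 n f) ?X)\<^sup>2 \<le> gsq n \<phi> p * gsq n f p"
    unfolding dotg_def gsq_def by (rule Cauchy_Schwarz_ineq_sum)
  then have "sqrt ((dotg n (U1 n \<phi>) (U1 n f) ?X)\<^sup>2) \<le> sqrt (gsq n \<phi> p * gsq n f p)" by (rule real_sqrt_le_mono)
  then show ?thesis by simp
qed

lemma dotg_measurable:
  assumes "integrable (Rn n) \<phi>" "integrable (Rn n) f"
  shows "(\<lambda>p. dotg n (U1 n \<phi>) (U1 n f) ((fst p)(n := snd p))) \<in> borel_measurable (Rnt n)"
  unfolding dotg_def using assms by (intro borel_measurable_sum borel_measurable_times U1_measurable) auto

text \<open>The right side of Green's formula, taken as the definition of the functional: it makes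
  sense on the whole Hardy space, also where the product of \<phi> and \<open>f\<close> is not
  integrable.\<close>

definition pairing :: "nat \<Rightarrow> (point \<Rightarrow> real) \<Rightarrow> (point \<Rightarrow> real) \<Rightarrow> real" where
  "pairing n \<phi> f = 2 * (\<integral>p. hdot n (U1 n \<phi>) (U1 n f) p \<partial>(Rnt n))"

section \<open>Translation of the two norms into dyadic averages\<close>

context dyadic
begin

lemma nn_integral_ind_line_int:
  assumes x: "x \<in> space (Rn n)" and G: "G \<in> borel_measurable (Rnt n)" and S: "S \<in> sets borel"
  shows "(\<integral>\<^sup>+y. ind k x y * line_int S G y \<partial>Rn n) = (\<integral>\<^sup>+p. ind k x (fst p) * (indicator S (snd p) * G p) \<partial>(Rnt n))"
    and "(\<lambda>p. ind k x (fst p) * (indicator S (snd p) * G p)) \<in> borel_measurable (Rnt n)"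
proof -
  have mS: "(\<lambda>p. indicator S (snd p) * G p) \<in> borel_measurable (Rnt n)"
    using G S by (intro borel_measurable_times_ennreal measurable_compose[OF measurable_snd]) auto
  have "(\<lambda>p. ind k x (fst p)) \<in> borel_measurable (Rnt n)"
    using x by (intro measurable_ind measurable_fst) auto
  then show m: "(\<lambda>p. ind k x (fst p) * (indicator S (snd p) * G p)) \<in> borel_measurable (Rnt n)"
    by (intro borel_measurable_times_ennreal mS)
  have "(\<integral>\<^sup>+y. ind k x y * line_int S G y \<partial>Rn n) = (\<integral>\<^sup>+y. (\<integral>\<^sup>+t. ind k x y * (indicator S t * G (y, t)) \<partial>lborel) \<partial>Rn n)"
  proof (rule nn_integral_cong)
    fix y assume y: "y \<in> space (Rn n)"
    have "(\<lambda>t. indicator S t * G (y, t)) \<in> borel_measurable lborel"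
      using measurable_compose[OF measurable_Pair1'[OF y] mS] by simp
    then show "ind k x y * line_int S G y = (\<integral>\<^sup>+t. ind k x y * (indicator S t * G (y, t)) \<partial>lborel)"
      unfolding line_int_def by (rule nn_integral_cmult[symmetric])
  qed
  also have "\<dots> = (\<integral>\<^sup>+p. ind k x (fst p) * (indicator S (snd p) * G p) \<partial>(Rnt n))"
    using lborel.nn_integral_fst[OF m] by simp
  finally show "(\<integral>\<^sup>+y. ind k x y * line_int S G y \<partial>Rn n) = (\<integral>\<^sup>+p. ind k x (fst p) * (indicator S (snd p) * G p) \<partial>(Rnt n))" .
qed

lemma measurable_height_gsq:
  "integrable (Rn n) f \<Longrightarrow> (\<lambda>p. ennreal (snd p * gsq n f p)) \<in> borel_measurable (Rnt n)"
  by (intro measurable_compose[OF _ measurable_ennreal] borel_measurable_times gsq_measurable) auto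

lemma carleson_of_bmo_bound:
  assumes \<phi>: "integrable (Rn n) \<phi>" and b: "bmo_bound n D \<phi> C0"
  shows "carleson (\<lambda>p. ennreal (snd p * gsq n \<phi> p)) (C0\<^sup>2)"
  unfolding carleson_def
proof (intro ballI allI)
  fix x k assume x: "x \<in> space (Rn n)"
  let ?G = "\<lambda>p. ennreal (snd p * gsq n \<phi> p)"
  have "(\<integral>\<^sup>+y. ind k x y * line_int {0<..2 powi k} ?G y \<partial>Rn n) = (\<integral>\<^sup>+p. ind k x (fst p) * (indicator {0<..2 powi k} (snd p) * ?G p) \<partial>(Rnt n))"
    by (rule nn_integral_ind_line_int(1)[OF x measurable_height_gsq[OF \<phi>]]) simp
  also have "\<dots> \<le> (\<integral>\<^sup>+p\<in>carleson_box n (cubk k x). ennreal (grad_sq n \<phi> (fst p) (snd p) * snd p) \<partial>(Rnt n))"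
  proof (rule nn_integral_mono)
    fix p
    show "ind k x (fst p) * (indicator {0<..2 powi k} (snd p) * ?G p) \<le> ennreal (grad_sq n \<phi> (fst p) (snd p) * snd p) * indicator (carleson_box n (cubk k x)) p"
    proof (cases "fst p \<in> cubk k x \<and> snd p \<in> {0<..2 powi k}")
      case True
      then have "p \<in> carleson_box n (cubk k x)" by (cases p) (auto simp: carleson_box_def cubk(2)[OF x])
      moreover have "grad_sq n \<phi> (fst p) (snd p) * snd p = snd p * gsq n \<phi> p"
        using grad_sq_eq_gsq[OF n \<phi>, of "snd p" "fst p"] True by simp
      ultimately show ?thesis using True by (simp add: indicator_def mult.commute)
    next
      case False
      then show ?thesis using same_iff[OF x, of "fst p" k] by (auto simp: indicator_def)
    qed
  qed
  also have "\<dots> \<le> ennreal (C0\<^sup>2 * vol n (cubk k x))" using b cubk(1)[OF x] by (simp add: bmo_bound_def)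
  also have "\<dots> = ennreal (C0\<^sup>2 * vk k)" by (simp add: vol_cubk[OF x])
  finally show "(\<integral>\<^sup>+y. ind k x y * line_int {0<..2 powi k} ?G y \<partial>Rn n) \<le> ennreal (C0\<^sup>2 * vk k)" .
qed

lemma carleson_mono: "carleson G M \<Longrightarrow> M \<le> M' \<Longrightarrow> carleson G M'"
  unfolding carleson_def using vk_pos by (meson ennreal_leI less_imp_le mult_right_mono order.trans)

text \<open>Offspring are specified by volume, which for cubes of the lattice forces the side
  \<open>2 powi (k - 1)\<close>. A point of greater height lies in none of their Carleson
  boxes.\<close>

lemma strip_subset_top_half:
  assumes x: "x \<in> space (Rn n)" and p: "fst p \<in> cubk k x" "snd p \<in> strip k"
  shows "p \<in> dyadic_cone n D x"
proof -
  have t: "2 powi (k - 1) < snd p" "snd p \<le> 2 powi k" using p by (auto simp: strip_def)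
  have t0: "snd p > 0" using t(1) by (smt (verit) zero_less_power_int)
  have "p \<in> carleson_box n (cubk k x)"
    using p t t0 by (cases p) (auto simp: carleson_box_def cubk(2)[OF x])
  moreover have "p \<notin> carleson_box n J" if J: "J \<in> offspring n D (cubk k x)" for J
  proof
    assume pJ: "p \<in> carleson_box n J"
    have JD: "J \<in> D" "vol n J = vk k / 2 ^ n" using J by (auto simp: offspring_def vol_cubk[OF x])
    obtain a j where j: "J = cube n a (2 powi j)" "side n J = 2 powi j" by (rule D_cube[OF JD(1)])
    have v1: "vol n J = (2 powi j) ^ n" unfolding j by (rule vol_cube) simp
    have v2: "vk k / 2 ^ n = (2 powi (k - 1)) ^ n"
      by (simp add: vk_def power_int_diff power_divide)
    have "(2 powi j :: real) ^ n = (2 powi (k - 1)) ^ n" using JD(2) unfolding v1 v2 .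
    then have "(2 powi j :: real) = 2 powi (k - 1)" using n by (subst (asm) power_eq_iff_eq_base) auto
    then have "snd p \<le> 2 powi (k - 1)" using pJ j(2) by (auto simp: carleson_box_def)
    then show False using t by simp
  qed
  ultimately have "p \<in> top_half n D (cubk k x)" by (auto simp: top_half_def)
  then show ?thesis unfolding dyadic_cone_def using cubk(1,3)[OF x, of k] by blast
qed

text \<open>On \<open>strip k\<close> the height is at most \<open>2 powi k\<close>, hence
  \<open>1 / vk k\<close> is at most the height to the power \<open>-n\<close>. The inequality
  points in the favourable direction, so the comparison with the square function of the Hardy norm
  holds with constant 1 in every dimension.\<close>

lemma tent_total_le_cone:
  assumes x: "x \<in> space (Rn n)" and f: "integrable (Rn n) f"
  shows "tent_total (\<lambda>p. ennreal (snd p * gsq n f p)) x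
    \<le> (\<integral>\<^sup>+p\<in>dyadic_cone n D x. ennreal (grad_sq n f (fst p) (snd p) * snd p powi (1 - int n)) \<partial>(Rnt n))"
  unfolding tent_total_def
proof (rule SUP_least)
  fix K :: nat
  let ?G = "\<lambda>p. ennreal (snd p * gsq n f p)"
  define F where "F k p = ennreal (1 / vk k) * (ind k x (fst p) * (indicator (strip k) (snd p) * ?G p))" for k p
  define R where "R p = ennreal (grad_sq n f (fst p) (snd p) * snd p powi (1 - int n)) * indicator (dyadic_cone n D x) p" for p
  have sb: "strip k \<in> sets borel" for k by (simp add: strip_def)
  have mF: "F k \<in> borel_measurable (Rnt n)" for k
    unfolding F_def[abs_def]
    by (intro borel_measurable_times_ennreal nn_integral_ind_line_int(2)[OF x measurable_height_gsq[OF f] sb] borel_measurable_const)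
  have "tent_avg k ?G x = (\<integral>\<^sup>+p. F k p \<partial>(Rnt n))" for k
    unfolding tent_avg_def F_def nn_integral_ind_line_int(1)[OF x measurable_height_gsq[OF f] sb]
    by (rule nn_integral_cmult[symmetric]) (rule nn_integral_ind_line_int(2)[OF x measurable_height_gsq[OF f] sb])
  then have "(\<Sum>k\<in>{- int K..int K}. tent_avg k ?G x) = (\<integral>\<^sup>+p. (\<Sum>k\<in>{- int K..int K}. F k p) \<partial>(Rnt n))"
    using mF by (simp add: nn_integral_sum)
  also have "\<dots> \<le> (\<integral>\<^sup>+p. R p \<partial>(Rnt n))"
  proof (rule nn_integral_mono)
    fix p
    have FR: "F k p \<le> R p" for k
    proof (cases "fst p \<in> cubk k x \<and> snd p \<in> strip k")
      case True
      have t: "snd p \<le> 2 powi k" and t0: "snd p > 0"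
        using True strip_pos[of "snd p" k] by (auto simp: strip_def)
      have "snd p ^ n \<le> vk k" unfolding vk_def using t t0 by (intro power_mono) auto
      then have "1 / vk k \<le> 1 / snd p ^ n" using t0 by (intro divide_left_mono) (auto simp: vk_pos)
      then have "1 / vk k * (snd p * gsq n f p) \<le> 1 / snd p ^ n * (snd p * gsq n f p)"
        using t0 gsq_nonneg[of n f p] by (intro mult_right_mono) auto
      also have "\<dots> = grad_sq n f (fst p) (snd p) * snd p powi (1 - int n)"
        using grad_sq_eq_gsq[OF n f t0, of "fst p"] t0 by (simp add: power_int_diff)
      finally have "ennreal (1 / vk k) * ?G p \<le> ennreal (grad_sq n f (fst p) (snd p) * snd p powi (1 - int n))"
        using vk_pos[of k] by (subst ennreal_mult'[symmetric]) (auto intro: ennreal_leI)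
      then show ?thesis using True strip_subset_top_half[OF x, of p k] same_iff[OF x, of "fst p" k]
        by (simp add: F_def R_def)
    next
      case False
      then have "F k p = 0" using same_iff[OF x, of "fst p" k] by (auto simp: F_def)
      then show ?thesis by simp
    qed
    \<comment> \<open>A height belongs to at most one strip, so at most one summand differs from
      zero.\<close>
    show "(\<Sum>k\<in>{- int K..int K}. F k p) \<le> R p"
    proof (cases "\<exists>k. snd p \<in> strip k")
      case True
      then obtain k0 where k0: "snd p \<in> strip k0" by blast
      have "F k p = (if k = k0 then F k0 p else 0)" for k
      proof (cases "k = k0")
        case False
        then have "snd p \<notin> strip k" using strip_disjoint[OF k0, of k] by blast
        then show ?thesis using False by (simp add: F_def)
      qed simp
      then have "(\<Sum>k\<in>{- int K..int K}. F k p) = (\<Sum>k\<in>{- int K..int K}. if k = k0 then F k0 p else 0)" by metis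
      also have "\<dots> \<le> F k0 p" by (simp only: sum.delta' sum.delta finite_atLeastAtMost_int split: if_splits) simp
      also have "\<dots> \<le> R p" by (rule FR)
      finally show ?thesis .
    next
      case False
      then have "F k p = 0" for k by (simp add: F_def)
      then show ?thesis by simp
    qed
  qed
  finally show "(\<Sum>k\<in>{- int K..int K}. tent_avg k ?G x)
    \<le> (\<integral>\<^sup>+p\<in>dyadic_cone n D x. ennreal (grad_sq n f (fst p) (snd p) * snd p powi (1 - int n)) \<partial>(Rnt n))"
    by (simp only: R_def)
qed

text \<open>The norm of the square function formed from averages over top halves: the duality
  estimate yields it, and the Hardy norm dominates it.\<close>

definition tent_norm :: "(point \<Rightarrow> real) \<Rightarrow> ennreal" where
  "tent_norm f = (\<integral>\<^sup>+x. ennsqrt (tent_total (\<lambda>p. ennreal (snd p * gsq n f p)) x) \<partial>Rn n)"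

lemma tent_norm_le: "integrable (Rn n) f \<Longrightarrow> tent_norm f \<le> hardy_ennnorm n D f"
  unfolding tent_norm_def hardy_ennnorm_def by (intro nn_integral_mono ennsqrt_mono tent_total_le_cone)

text \<open>A set \<open>S\<close> of heights is carried along for two uses: the whole line gives
  the bound of the pairing, and the complement of a strip gives the bound of its tail.\<close>

lemma nn_integral_pairing_le:
  assumes \<phi>: "integrable (Rn n) \<phi>" and f: "integrable (Rn n) f" and C: "C > 0"
    and car: "carleson (\<lambda>p. ennreal (snd p * gsq n \<phi> p)) (C\<^sup>2)" and S: "S \<in> sets borel"
  shows "(\<integral>\<^sup>+p. ennreal \<bar>indicator {0<..} (snd p) * (indicator S (snd p) * (snd p * dotg n (U1 n \<phi>) (U1 n f) ((fst p)(n := snd p))))\<bar> \<partial>(Rnt n))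
    \<le> ennreal (3 / 2 * C) * (\<integral>\<^sup>+x. ennsqrt (tent_total (\<lambda>p. ennreal (snd p * (gsq n f p * indicator S (snd p)))) x) \<partial>Rn n)"
proof -
  have m: "gsq n \<phi> \<in> borel_measurable (Rnt n)" "(\<lambda>p. gsq n f p * indicator S (snd p)) \<in> borel_measurable (Rnt n)"
    using \<phi> f S by (auto intro!: gsq_measurable borel_measurable_times measurable_indicator_snd)
  have "(\<integral>\<^sup>+p. ennreal \<bar>indicator {0<..} (snd p) * (indicator S (snd p) * (snd p * dotg n (U1 n \<phi>) (U1 n f) ((fst p)(n := snd p))))\<bar> \<partial>(Rnt n))
    \<le> (\<integral>\<^sup>+p. indicator {0<..} (snd p) * ennreal (snd p * sqrt (gsq n \<phi> p * (gsq n f p * indicator S (snd p)))) \<partial>(Rnt n))"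
  proof (rule nn_integral_mono)
    fix p :: "point \<times> real"
    show "ennreal \<bar>indicator {0<..} (snd p) * (indicator S (snd p) * (snd p * dotg n (U1 n \<phi>) (U1 n f) ((fst p)(n := snd p))))\<bar>
      \<le> indicator {0<..} (snd p) * ennreal (snd p * sqrt (gsq n \<phi> p * (gsq n f p * indicator S (snd p))))"
    proof (cases "snd p > 0 \<and> snd p \<in> S")
      case True
      have "\<bar>snd p * dotg n (U1 n \<phi>) (U1 n f) ((fst p)(n := snd p))\<bar> \<le> snd p * sqrt (gsq n \<phi> p * gsq n f p)"
        unfolding abs_mult using True by (intro mult_mono abs_dotg_le) auto
      then show ?thesis using True by (simp only: indicator_simps greaterThan_iff mult_1 mult_1_right) (rule ennreal_leI)
    qed (auto simp: indicator_def)
  qed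
  also have "\<dots> \<le> ennreal (3 / 2 * C) * (\<integral>\<^sup>+x. ennsqrt (tent_total (\<lambda>p. ennreal (snd p * (gsq n f p * indicator S (snd p)))) x) \<partial>Rn n)"
    by (rule carleson_duality[OF m _ _ C car]) (simp_all add: gsq_nonneg)
  finally show ?thesis .
qed

text \<open>The constant 3 is the 2 of Green's formula times the 3/2 of the duality.\<close>

lemma pairing_bound:
  assumes \<phi>: "integrable (Rn n) \<phi>" and f: "integrable (Rn n) f" and C: "C > 0"
    and car: "carleson (\<lambda>p. ennreal (snd p * gsq n \<phi> p)) (C\<^sup>2)" and fin: "tent_norm f < \<infinity>"
  shows "integrable (Rnt n) (\<lambda>p. hdot n (U1 n \<phi>) (U1 n f) p)"
    and "\<bar>pairing n \<phi> f\<bar> \<le> 3 * C * enn2real (tent_norm f)"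
proof -
  let ?F = "\<lambda>p. hdot n (U1 n \<phi>) (U1 n f) p"
  have b: "(\<integral>\<^sup>+p. ennreal \<bar>?F p\<bar> \<partial>(Rnt n)) \<le> ennreal (3 / 2 * C) * tent_norm f"
    using nn_integral_pairing_le[OF \<phi> f C car, of UNIV] by (simp only: indicator_UNIV mult_1 mult_1_right tent_norm_def) simp
  have m: "?F \<in> borel_measurable (Rnt n)"
    by (intro borel_measurable_times measurable_indicator_snd dotg_measurable \<phi> f) auto
  have fin': "ennreal (3 / 2 * C) * tent_norm f < \<infinity>" using fin by (simp add: ennreal_mult_less_top)
  show i: "integrable (Rnt n) ?F"
    by (rule integrableI_bounded[OF m]) (unfold real_norm_def, rule order.strict_trans1[OF b fin'])
  have e: "ennreal (3 / 2 * C) * tent_norm f = ennreal (3 / 2 * C * enn2real (tent_norm f))"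
  proof -
    have tn: "ennreal (enn2real (tent_norm f)) = tent_norm f" using fin by (simp add: less_top)
    have "ennreal (3 / 2 * C * enn2real (tent_norm f)) = ennreal (3 / 2 * C) * ennreal (enn2real (tent_norm f))"
      using C by (intro ennreal_mult) auto
    then show ?thesis unfolding tn by (rule sym)
  qed
  have "\<bar>\<integral>p. ?F p \<partial>(Rnt n)\<bar> \<le> (\<integral>p. \<bar>?F p\<bar> \<partial>(Rnt n))" by (rule integral_abs_bound)
  also have "\<dots> \<le> 3 / 2 * C * enn2real (tent_norm f)"
    using C by (intro integral_le_of_nn_integral_le integrable_abs i b[unfolded e]) auto
  finally show "\<bar>pairing n \<phi> f\<bar> \<le> 3 * C * enn2real (tent_norm f)" by (simp add: pairing_def)
qed

text \<open>Outside the strips of index at most N, the tent total is a tail of the series of tent averages.\<close>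

lemma tent_tail_tendsto_0:
  assumes f: "integrable (Rn n) f" and fin: "tent_norm f < \<infinity>"
  shows "(\<lambda>N. \<integral>\<^sup>+x. ennsqrt (tent_total (\<lambda>p. ennreal (snd p * (gsq n f p * indicator (- {2 powi (- int N - 1)<..2 powi int N}) (snd p)))) x) \<partial>Rn n) \<longlonglongrightarrow> 0"
proof -
  let ?E = "\<lambda>N. - {2 powi (- int N - 1)<..2 powi int N} :: real set"
  define G where "G p = ennreal (snd p * gsq n f p)" for p
  define GN where "GN N p = ennreal (snd p * (gsq n f p * indicator (?E N) (snd p)))" for N p
  have mG: "G \<in> borel_measurable (Rnt n)" unfolding G_def[abs_def] by (rule measurable_height_gsq[OF f])
  have mGN: "GN N \<in> borel_measurable (Rnt n)" for N
    unfolding GN_def[abs_def] using f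
    by (intro measurable_compose[OF _ measurable_ennreal] borel_measurable_times gsq_measurable measurable_indicator_snd) auto
  have GNG: "GN N p \<le> G p" for N p by (auto simp: GN_def G_def indicator_def)
  have GT: "tent_total (GN N) x \<le> tent_total G x" for N x
    unfolding tent_total_def by (rule SUP_mono') (intro sum_mono tent_avg_mono GNG)
  \<comment> \<open>Cutting out the heights from \<open>2 powi (- int N - 1)\<close> to
    \<open>2 powi int N\<close> removes the strips of index \<open>- int N\<close> to
    \<open>int N\<close>; the lower end is the bottom of the lowest strip.\<close>
  have z: "tent_avg k (GN N) x = 0" if k: "k \<in> {- int N..int N}" for k N x
  proof -
    have "indicator (strip k) t * GN N (y, t) = 0" for y t
    proof (cases "t \<in> strip k")
      case True
      have "(2::real) powi (- int N - 1) \<le> 2 powi (k - 1)" by (rule power_int_increasing) (use k in auto)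
      moreover have "(2::real) powi k \<le> 2 powi int N" by (rule power_int_increasing) (use k in auto)
      moreover have "2 powi (k - 1) < t" "t \<le> 2 powi k" using True by (simp_all only: strip_def greaterThanAtMost_iff)
      ultimately have "t \<notin> ?E N" by (simp only: Compl_iff greaterThanAtMost_iff not_not) linarith
      then show ?thesis by (simp add: GN_def)
    qed simp
    then show ?thesis unfolding tent_avg_def line_int_def by (simp only: nn_integral_const mult_zero_left mult_zero_right)
  qed
  define s where "s N x = (\<Sum>k\<in>{- int N..int N}. tent_avg k G x)" for N x
  have le_total: "s N x \<le> tent_total G x" for N x unfolding s_def tent_total_def by (rule SUP_upper) simp
  \<comment> \<open>What is left after the cut is at most the remainder of the series. The
    inequality is stated additively, so that it holds also where the total is infinite; the
    subtraction is made at points where it is finite.\<close>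
  have tail: "tent_total (GN N) x + s N x \<le> tent_total G x" for N x
    unfolding tent_total_def[of "GN N"]
  proof (subst ennreal_SUP_add_left[symmetric], simp, rule SUP_least)
    fix K
    define L where "L = max K N"
    have "(\<Sum>k\<in>{- int K..int K}. tent_avg k (GN N) x) \<le> (\<Sum>k\<in>{- int L..int L}. tent_avg k (GN N) x)"
      by (intro sum_mono2) (auto simp: L_def)
    also have "\<dots> = (\<Sum>k\<in>{- int L..int L} - {- int N..int N}. tent_avg k (GN N) x)"
      using z[of _ N x] by (intro sum.mono_neutral_right) auto
    also have "\<dots> \<le> (\<Sum>k\<in>{- int L..int L} - {- int N..int N}. tent_avg k G x)"
      by (intro sum_mono tent_avg_mono GNG)
    finally have "(\<Sum>k\<in>{- int K..int K}. tent_avg k (GN N) x) + s N x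
      \<le> (\<Sum>k\<in>{- int L..int L} - {- int N..int N}. tent_avg k G x) + s N x" by (rule add_right_mono)
    also have "\<dots> = s L x"
      unfolding s_def by (rule sum.subset_diff[symmetric]) (auto simp: L_def)
    also have "\<dots> \<le> tent_total G x" by (rule le_total)
    finally show "(\<Sum>k\<in>{- int K..int K}. tent_avg k (GN N) x) + s N x \<le> tent_total G x" .
  qed
  have lim: "(\<lambda>N. ennsqrt (tent_total (GN N) x)) \<longlonglongrightarrow> 0" if fx: "tent_total G x < \<infinity>" for x
  proof -
    have inc: "incseq (\<lambda>N. s N x)" unfolding s_def by (intro incseq_SucI sum_mono2) auto
    have s1: "(\<lambda>N. s N x) \<longlonglongrightarrow> tent_total G x"
      using LIMSEQ_SUP[OF inc] by (simp add: tent_total_def s_def)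
    have "(\<lambda>N. tent_total G x - s N x) \<longlonglongrightarrow> tent_total G x - tent_total G x"
      using fx by (intro tendsto_diff_ennreal s1 tendsto_const) auto
    then have d: "(\<lambda>N. tent_total G x - s N x) \<longlonglongrightarrow> 0" using fx by simp
    have tle: "tent_total (GN N) x \<le> tent_total G x - s N x" for N
    proof -
      have "tent_total (GN N) x = tent_total (GN N) x + s N x - s N x"
        using le_total[of N x] fx by (intro ennreal_add_diff_cancel_right[symmetric]) (auto simp: top_unique)
      also have "\<dots> \<le> tent_total G x - s N x" by (rule ennreal_minus_mono[OF tail order_refl])
      finally show ?thesis .
    qed
    have "(\<lambda>N. tent_total (GN N) x) \<longlonglongrightarrow> ennreal 0"
      by (rule tendsto_sandwich[OF _ _ tendsto_const d[folded ennreal_0]]) (auto simp: tle)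
    then have "(\<lambda>N. ennreal (sqrt (enn2real (tent_total (GN N) x)))) \<longlonglongrightarrow> ennreal (sqrt 0)"
      by (intro tendsto_ennrealI tendsto_real_sqrt tendsto_enn2real) auto
    moreover have "ennsqrt (tent_total (GN N) x) = ennreal (sqrt (enn2real (tent_total (GN N) x)))" for N
    proof -
      have "tent_total (GN N) x < \<infinity>" using GT[of N x] fx by (rule order.strict_trans1)
      then show ?thesis by (simp add: ennsqrt_def)
    qed
    ultimately show ?thesis by simp
  qed
  have mt: "(\<lambda>x. ennsqrt (tent_total H x)) \<in> borel_measurable (Rn n)" if "H \<in> borel_measurable (Rnt n)" for H
    by (rule measurable_compose[OF measurable_tent_total[OF that] ennsqrt_measurable])
  have fin': "(\<integral>\<^sup>+x. ennsqrt (tent_total G x) \<partial>Rn n) < \<infinity>" using fin by (simp add: tent_norm_def G_def[abs_def])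
  have ae: "AE x in Rn n. ennsqrt (tent_total G x) \<noteq> \<infinity>" by (rule nn_integral_PInf_AE[OF mt[OF mG]]) (use fin' in auto)
  have "(\<lambda>N. \<integral>\<^sup>+x. ennsqrt (tent_total (GN N) x) \<partial>Rn n) \<longlonglongrightarrow> (\<integral>\<^sup>+x. 0 \<partial>Rn n)"
  proof (rule nn_integral_dominated_convergence[where w="\<lambda>x. ennsqrt (tent_total G x)"])
    show "AE x in Rn n. (\<lambda>N. ennsqrt (tent_total (GN N) x)) \<longlonglongrightarrow> 0"
      using ae by eventually_elim (rule lim, rule ennsqrt_less_top, simp add: less_top)
    show "AE x in Rn n. ennsqrt (tent_total (GN N) x) \<le> ennsqrt (tent_total G x)" for N
      by (intro AE_I2 ennsqrt_mono GT)
  qed (use mt mG mGN fin' in auto)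
  then show ?thesis by (simp add: GN_def[abs_def])
qed

end

section \<open>Agreement of the Green pairing with the integral\<close>

lemma abs_U_le:
  assumes \<psi>: "integrable (Rn n) \<psi>" and K: "\<And>z. \<bar>\<psi> z\<bar> \<le> K" and X: "X n > 0"
  shows "\<bar>U n \<psi> X\<bar> \<le> K"
proof -
  have "\<bar>U n \<psi> X\<bar> \<le> (\<integral>z. K * pk n (sh n X z) \<partial>Rn n)"
    unfolding U_def
  proof (rule abs_integral_le)
    show "integrable (Rn n) (\<lambda>z. K * pk n (sh n X z))" using integrable_pk[of X, OF X] by simp
    fix z
    have "pk n (sh n X z) \<ge> 0" using X by (intro pk_nonneg) simp
    then show "\<bar>pk n (sh n X z) * \<psi> z\<bar> \<le> K * pk n (sh n X z)"
      using mult_left_mono[OF K[of z], of "pk n (sh n X z)"] by (simp add: abs_mult mult.commute)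
  qed
  then show ?thesis using integral_pk[of X, OF X] by simp
qed

text \<open>In the slice integrals, the extensions of \<open>f\<close> converge in the mean while
  those of \<psi> are bounded by \<open>K\<close>; then the extensions of \<psi> converge almost
  everywhere with majorant \<open>K * \<bar>f y\<bar>\<close>. Boundedness of \<psi> is used in both
  limits.\<close>

lemma pairing_eq_integral_bounded:
  assumes n: "n \<ge> 1" and \<psi>: "integrable (Rn n) \<psi>" and K: "\<And>z. \<bar>\<psi> z\<bar> \<le> K" and f: "integrable (Rn n) f"
    and int: "integrable (Rnt n) (\<lambda>p. hdot n (U1 n \<psi>) (U1 n f) p)"
  shows "pairing n \<psi> f = (\<integral>z. \<psi> z * f z \<partial>Rn n)"
proof -
  obtain \<sigma> :: "nat \<Rightarrow> real" where \<sigma>: "\<And>j. \<sigma> j > 0" and \<sigma>0: "\<sigma> \<longlonglongrightarrow> 0"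
    and ae: "AE y in Rn n. (\<lambda>j. U n \<psi> (y(n := \<sigma> j))) \<longlonglongrightarrow> \<psi> y"
    by (rule poisson_approx_AE[OF \<psi>]) blast
  interpret u: nice_harmonic n "U n \<psi>" "U1 n \<psi>" "U2 n \<psi>" "\<lambda>X. pC n * U n (\<lambda>z. \<bar>\<psi> z\<bar>) X" "pC n * (1 + pc n) * (\<integral>z. \<bar>\<psi> z\<bar> \<partial>Rn n)"
    by (rule nice_harmonic_U[OF n \<psi>])
  have lim1: "(\<lambda>j. \<integral>y. U n \<psi> (y(n := \<sigma> j)) * U n f (y(n := \<sigma> j)) \<partial>Rn n) \<longlonglongrightarrow> pairing n \<psi> f"
    unfolding pairing_def by (rule u.integral_mult_limit[OF nice_harmonic_U[OF n f] int \<sigma> \<sigma>0])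
  have bU: "\<bar>U n \<psi> (y(n := \<sigma> j))\<bar> \<le> K" for y j by (rule abs_U_le[OF \<psi> K]) (simp add: \<sigma>)
  have mU: "(\<lambda>y. U n \<psi> (y(n := \<sigma> j))) \<in> borel_measurable (Rn n)" for j using \<psi> by (intro U_measurable) auto
  have id: "integrable (Rn n) (\<lambda>y. U n f (y(n := \<sigma> j)) - f y)" for j
    by (intro Bochner_Integration.integrable_diff U_integrable f \<sigma>)
  have i1: "integrable (Rn n) (\<lambda>y. U n \<psi> (y(n := \<sigma> j)) * (U n f (y(n := \<sigma> j)) - f y))" for j
    by (rule integrable_bounded_mult[OF id mU bU])
  have i2: "integrable (Rn n) (\<lambda>y. U n \<psi> (y(n := \<sigma> j)) * f y)" for j
    by (rule integrable_bounded_mult[OF f mU bU])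
  have split: "(\<integral>y. U n \<psi> (y(n := \<sigma> j)) * U n f (y(n := \<sigma> j)) \<partial>Rn n)
     = (\<integral>y. U n \<psi> (y(n := \<sigma> j)) * (U n f (y(n := \<sigma> j)) - f y) \<partial>Rn n) + (\<integral>y. U n \<psi> (y(n := \<sigma> j)) * f y \<partial>Rn n)" for j
    unfolding Bochner_Integration.integral_add[OF i1 i2, symmetric] by (simp only: right_diff_distrib diff_add_cancel)
  have z1: "(\<lambda>j. \<integral>y. U n \<psi> (y(n := \<sigma> j)) * (U n f (y(n := \<sigma> j)) - f y) \<partial>Rn n) \<longlonglongrightarrow> 0"
  proof (rule Lim_null_comparison)
    have "(\<lambda>j. \<integral>y. \<bar>U n f (y(n := \<sigma> j)) - f y\<bar> \<partial>Rn n) \<longlonglongrightarrow> 0"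
      using l1_approx_integrable[OF \<sigma> \<sigma>0 f] by (simp add: l1_approx_def)
    from tendsto_mult_right_zero[OF this, of K]
    show "(\<lambda>j. K * (\<integral>y. \<bar>U n f (y(n := \<sigma> j)) - f y\<bar> \<partial>Rn n)) \<longlonglongrightarrow> 0" .
    show "eventually (\<lambda>j. norm (\<integral>y. U n \<psi> (y(n := \<sigma> j)) * (U n f (y(n := \<sigma> j)) - f y) \<partial>Rn n) \<le> K * (\<integral>y. \<bar>U n f (y(n := \<sigma> j)) - f y\<bar> \<partial>Rn n)) sequentially"
    proof (rule always_eventually, rule allI)
      fix j
      have "\<bar>\<integral>y. U n \<psi> (y(n := \<sigma> j)) * (U n f (y(n := \<sigma> j)) - f y) \<partial>Rn n\<bar> \<le> (\<integral>y. K * \<bar>U n f (y(n := \<sigma> j)) - f y\<bar> \<partial>Rn n)"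
      proof (rule abs_integral_le)
        show "integrable (Rn n) (\<lambda>y. K * \<bar>U n f (y(n := \<sigma> j)) - f y\<bar>)" by (intro integrable_mult_right integrable_abs id)
        fix y
        show "\<bar>U n \<psi> (y(n := \<sigma> j)) * (U n f (y(n := \<sigma> j)) - f y)\<bar> \<le> K * \<bar>U n f (y(n := \<sigma> j)) - f y\<bar>"
          unfolding abs_mult by (rule mult_right_mono[OF bU]) simp
      qed
      then show "norm (\<integral>y. U n \<psi> (y(n := \<sigma> j)) * (U n f (y(n := \<sigma> j)) - f y) \<partial>Rn n) \<le> K * (\<integral>y. \<bar>U n f (y(n := \<sigma> j)) - f y\<bar> \<partial>Rn n)"
        by (simp only: real_norm_def integral_mult_right_zero)
    qed
  qed
  have z2: "(\<lambda>j. \<integral>y. U n \<psi> (y(n := \<sigma> j)) * f y \<partial>Rn n) \<longlonglongrightarrow> (\<integral>y. \<psi> y * f y \<partial>Rn n)"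
  proof (rule integral_dominated_convergence[where w="\<lambda>y. K * \<bar>f y\<bar>"])
    show "AE y in Rn n. (\<lambda>j. U n \<psi> (y(n := \<sigma> j)) * f y) \<longlonglongrightarrow> \<psi> y * f y"
      using ae
    proof eventually_elim
      case (elim y)
      then show ?case by (intro tendsto_mult tendsto_const)
    qed
    show "AE y in Rn n. norm (U n \<psi> (y(n := \<sigma> j)) * f y) \<le> K * \<bar>f y\<bar>" for j
    proof (rule AE_I2)
      fix y show "norm (U n \<psi> (y(n := \<sigma> j)) * f y) \<le> K * \<bar>f y\<bar>"
        unfolding real_norm_def abs_mult by (rule mult_right_mono[OF bU]) simp
    qed
    show "(\<lambda>y. \<psi> y * f y) \<in> borel_measurable (Rn n)" using \<psi> f by auto
    show "(\<lambda>y. U n \<psi> (y(n := \<sigma> j)) * f y) \<in> borel_measurable (Rn n)" for j using i2 by auto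
    show "integrable (Rn n) (\<lambda>y. K * \<bar>f y\<bar>)" using f by simp
  qed
  have "(\<lambda>j. \<integral>y. U n \<psi> (y(n := \<sigma> j)) * U n f (y(n := \<sigma> j)) \<partial>Rn n) \<longlonglongrightarrow> 0 + (\<integral>y. \<psi> y * f y \<partial>Rn n)"
    unfolding split by (rule tendsto_add[OF z1 z2])
  then show ?thesis using LIMSEQ_unique[OF lim1] by simp
qed

lemma trunc_tendsto: "(\<lambda>j. trunc (real j) a) \<longlonglongrightarrow> a"
proof (rule tendsto_eventually)
  have "eventually (\<lambda>j. \<bar>a\<bar> \<le> real j) sequentially"
    using filterlim_real_sequentially by (simp add: filterlim_at_top)
  then show "eventually (\<lambda>j. trunc (real j) a = a) sequentially" by eventually_elim (rule trunc_eq)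
qed

lemma U1_trunc_tendsto:
  assumes \<phi>: "integrable (Rn n) \<phi>" and X: "X n > 0" and i: "i \<le> n"
  shows "(\<lambda>j. U1 n (\<lambda>z. trunc (real j) (\<phi> z)) i X) \<longlonglongrightarrow> U1 n \<phi> i X"
  unfolding U1_def
proof (rule integral_dominated_convergence[where w="\<lambda>z. \<bar>pk1 n i (sh n X z) * \<phi> z\<bar>"])
  note I = integrable_pk1_mult[of n _ X i, OF _ X i]
  show "integrable (Rn n) (\<lambda>z. \<bar>pk1 n i (sh n X z) * \<phi> z\<bar>)" by (intro integrable_abs I \<phi>)
  show "(\<lambda>z. pk1 n i (sh n X z) * \<phi> z) \<in> borel_measurable (Rn n)" using I[OF \<phi>] by auto
  show "(\<lambda>z. pk1 n i (sh n X z) * trunc (real j) (\<phi> z)) \<in> borel_measurable (Rn n)" for j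
    by (rule borel_measurable_integrable[OF I[OF integrable_trunc[OF \<phi>]]]) simp
  show "AE z in Rn n. (\<lambda>j. pk1 n i (sh n X z) * trunc (real j) (\<phi> z)) \<longlonglongrightarrow> pk1 n i (sh n X z) * \<phi> z"
    by (intro AE_I2 tendsto_mult tendsto_const trunc_tendsto)
  show "AE z in Rn n. norm (pk1 n i (sh n X z) * trunc (real j) (\<phi> z)) \<le> \<bar>pk1 n i (sh n X z) * \<phi> z\<bar>" for j
    unfolding real_norm_def abs_mult by (intro AE_I2 mult_left_mono abs_trunc_le) auto
qed

text \<open>On heights between \<open>a > 0\<close> and \<open>b\<close> dominated convergence
  applies: the truncations are at most \<phi> in absolute value, so their gradients obey a bound at
  height \<open>a\<close> that does not depend on the level, and the gradient of \<open>f\<close>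
  has a majorant with uniformly bounded slice integrals.\<close>

lemma pairing_strip_limit:
  fixes f \<phi> :: "point \<Rightarrow> real" and a b :: real
  assumes n: "n \<ge> 1" and \<phi>: "integrable (Rn n) \<phi>" and f: "integrable (Rn n) f" and a: "a > 0"
  shows "(\<lambda>j. \<integral>p. indicator {a<..b} (snd p) * (hdot n (U1 n (\<lambda>z. trunc (real j) (\<phi> z))) (U1 n f) p) \<partial>(Rnt n))
    \<longlonglongrightarrow> (\<integral>p. indicator {a<..b} (snd p) * (hdot n (U1 n \<phi>) (U1 n f) p) \<partial>(Rnt n))"
proof -
  interpret f: nice_harmonic n "U n f" "U1 n f" "U2 n f" "\<lambda>X. pC n * U n (\<lambda>z. \<bar>f z\<bar>) X" "pC n * (1 + pc n) * (\<integral>z. \<bar>f z\<bar> \<partial>Rn n)"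
    by (rule nice_harmonic_U[OF n f])
  define al where "al X = pC n * U n (\<lambda>z. \<bar>f z\<bar>) X" for X
  have al0: "al X \<ge> 0" if "X n > 0" for X unfolding al_def by (rule f.a_nonneg) (rule that)
  define \<psi> where "\<psi> j z = trunc (real j) (\<phi> z)" for j z
  have \<psi>: "integrable (Rn n) (\<psi> j)" for j unfolding \<psi>_def by (rule integrable_trunc[OF \<phi>]) simp
  define B where "B = pC n * pc n * (\<integral>z. \<bar>\<phi> z\<bar> \<partial>Rn n)"
  have pp: "pC n * pc n \<ge> 0" using pC_ge_1[of n] pc_pos[of n] by simp
  have B: "B \<ge> 0" using pp unfolding B_def by (rule mult_nonneg_nonneg) simp
  define c where "c = real (Suc n) * B / a ^ Suc n"
  have c: "c \<ge> 0" using B a by (simp add: c_def)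
  have U\<psi>: "\<bar>U1 n (\<psi> j) i X\<bar> \<le> B / X n ^ Suc n" if X: "X n > 0" and i: "i \<le> n" for j i X
  proof -
    have "(\<integral>z. \<bar>\<psi> j z\<bar> \<partial>Rn n) \<le> (\<integral>z. \<bar>\<phi> z\<bar> \<partial>Rn n)"
      by (intro integral_mono integrable_abs \<phi> \<psi>) (simp only: \<psi>_def abs_trunc_le of_nat_0_le_iff)
    then have "pC n * pc n * (\<integral>z. \<bar>\<psi> j z\<bar> \<partial>Rn n) \<le> B" unfolding B_def using pp by (rule mult_left_mono)
    then have b: "pC n * pc n * (\<integral>z. \<bar>\<psi> j z\<bar> \<partial>Rn n) / X n ^ Suc n \<le> B / X n ^ Suc n" using X by (intro divide_right_mono) auto
    have "\<bar>U1 n (\<psi> j) i X\<bar> \<le> pC n * U n (\<lambda>z. \<bar>\<psi> j z\<bar>) X / X n" by (rule U_abs_bounds(2)[OF \<psi>, of X i, OF X i])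
    also have "\<dots> \<le> pC n * (pc n * (\<integral>z. \<bar>\<psi> j z\<bar> \<partial>Rn n) / X n ^ n) / X n"
      using X pC_ge_1[of n] by (intro divide_right_mono mult_left_mono U_abs_bounds(4)[OF \<psi>, of X, OF X]) auto
    also have "\<dots> = pC n * pc n * (\<integral>z. \<bar>\<psi> j z\<bar> \<partial>Rn n) / X n ^ Suc n" by (simp add: mult_ac)
    finally show ?thesis using b by linarith
  qed
  define w where "w r = c * indicator {a<..b} r" for r
  have w0: "w r \<ge> 0" for r using c by (simp add: w_def)
  have wm: "w \<in> borel_measurable lborel" unfolding w_def[abs_def] by measurable
  have ma: "(\<lambda>p. w (snd p) * al ((fst p)(n := snd p))) \<in> borel_measurable (Rnt n)"
    unfolding al_def by (intro borel_measurable_times f.measa measurable_compose[OF measurable_snd wm])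
  have dom: "integrable (Rnt n) (\<lambda>p. indicator {0<..} (snd p) * (w (snd p) * al ((fst p)(n := snd p))))"
  proof (rule f.integrable_half_space_weight[OF ma _ _ wm])
    fix y :: "nat \<Rightarrow> real" and r :: real assume r: "r > 0"
    have "al (y(n := r)) \<ge> 0" using r by (intro al0) simp
    then have "\<bar>w r * al (y(n := r))\<bar> = w r * al (y(n := r))" using w0[of r] by (simp add: abs_mult)
    then show "\<bar>w (snd (y, r)) * al ((fst (y, r))(n := snd (y, r)))\<bar> \<le> w r * (pC n * U n (\<lambda>z. \<bar>f z\<bar>) (y(n := r)))"
      by (simp only: fst_conv snd_conv al_def order_refl)
    show "w r \<ge> 0" by (rule w0)
  next
    have "(\<integral>\<^sup>+r. ennreal (indicator {0<..} r * w r) \<partial>lborel) \<le> (\<integral>\<^sup>+r. ennreal c * indicator {a<..b} r \<partial>lborel)"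
      using c by (intro nn_integral_mono) (auto simp: w_def indicator_def)
    also have "\<dots> < \<infinity>" by (cases "a \<le> b") (simp_all add: nn_integral_cmult_indicator ennreal_mult_less_top)
    finally show "(\<integral>\<^sup>+r. ennreal (indicator {0<..} r * w r) \<partial>lborel) < \<infinity>" .
  qed
  let ?F = "\<lambda>\<eta> p. indicator {a<..b} (snd p) * (hdot n (U1 n \<eta>) (U1 n f) p) :: real"
  have mF: "?F \<eta> \<in> borel_measurable (Rnt n)" if "integrable (Rn n) \<eta>" for \<eta>
    by (intro borel_measurable_times measurable_indicator_snd dotg_measurable that f) auto
  have "(\<lambda>j. \<integral>p. ?F (\<psi> j) p \<partial>(Rnt n)) \<longlonglongrightarrow> (\<integral>p. ?F \<phi> p \<partial>(Rnt n))"
  proof (rule integral_dominated_convergence[OF mF[OF \<phi>] mF[OF \<psi>] dom])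
    show "AE p in Rnt n. (\<lambda>j. ?F (\<psi> j) p) \<longlonglongrightarrow> ?F \<phi> p"
    proof (rule AE_I2)
      fix p :: "point \<times> real"
      show "(\<lambda>j. ?F (\<psi> j) p) \<longlonglongrightarrow> ?F \<phi> p"
      proof (cases "snd p > 0")
        case True
        then have X: "((fst p)(n := snd p)) n > 0" by simp
        show ?thesis unfolding dotg_def \<psi>_def[abs_def]
          using X by (intro tendsto_mult tendsto_const tendsto_sum U1_trunc_tendsto \<phi>) auto
      qed simp
    qed
    show "AE p in Rnt n. norm (?F (\<psi> j) p) \<le> indicator {0<..} (snd p) * (w (snd p) * al ((fst p)(n := snd p)))" for j
    proof (rule AE_I2)
      fix p :: "point \<times> real"
      show "norm (?F (\<psi> j) p) \<le> indicator {0<..} (snd p) * (w (snd p) * al ((fst p)(n := snd p)))"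
      proof (cases "snd p \<in> {a<..b}")
        case True
        define t where "t = snd p"
        define X where "X = (fst p)(n := t)"
        have t: "t > a" "t \<le> b" "t > 0" using True a by (auto simp: t_def)
        have Xn: "X n = t" by (simp add: X_def)
        have X: "X n > 0" using t Xn by simp
        have "\<bar>dotg n (U1 n (\<psi> j)) (U1 n f) X\<bar> \<le> (\<Sum>i\<le>n. B / t ^ Suc n * (al X / t))"
          unfolding dotg_def
        proof (rule order.trans[OF sum_abs], rule sum_mono)
          fix i assume i: "i \<in> {..n}"
          have "\<bar>U1 n f i X\<bar> \<le> al X / t" using f.bound1[of i X] i X by (simp add: al_def Xn)
          moreover have "\<bar>U1 n (\<psi> j) i X\<bar> \<le> B / t ^ Suc n" using U\<psi>[of X i j] X i by (simp only: Xn atMost_iff)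
          ultimately show "\<bar>U1 n (\<psi> j) i X * U1 n f i X\<bar> \<le> B / t ^ Suc n * (al X / t)"
            unfolding abs_mult using B t by (intro mult_mono) auto
        qed
        then have "t * \<bar>dotg n (U1 n (\<psi> j)) (U1 n f) X\<bar> \<le> t * (\<Sum>i\<le>n. B / t ^ Suc n * (al X / t))"
          using t by (intro mult_left_mono) auto
        also have "\<dots> = real (Suc n) * B / t ^ Suc n * al X" using t by (simp del: power_Suc)
        also have "\<dots> \<le> c * al X"
          unfolding c_def using t a B al0[of X, OF X] by (intro mult_right_mono divide_left_mono power_mono mult_pos_pos zero_less_power) auto
        finally have "\<bar>t * dotg n (U1 n (\<psi> j)) (U1 n f) X\<bar> \<le> c * al X" using t by (simp add: abs_mult)
        then show ?thesis using True t by (simp add: w_def t_def X_def)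
      qed (simp add: w_def)
    qed
  qed
  then show ?thesis by (simp only: \<psi>_def[abs_def])
qed

lemma U1_lincomb:
  assumes "integrable (Rn n) f" "integrable (Rn n) g" "X n > 0" "i \<le> n"
  shows "U1 n (\<lambda>y. a * f y + b * g y) i X = a * U1 n f i X + b * U1 n g i X"
proof -
  note I = integrable_pk1_mult[of n f X i] integrable_pk1_mult[of n g X i]
  have e: "pk1 n i (sh n X z) * (a * f z + b * g z) = a * (pk1 n i (sh n X z) * f z) + b * (pk1 n i (sh n X z) * g z)" for z
    by (simp add: algebra_simps)
  show ?thesis unfolding U1_def e using I assms by simp
qed

lemma pairing_lincomb:
  fixes \<phi> f g :: "point \<Rightarrow> real"
  assumes f: "integrable (Rn n) f" and g: "integrable (Rn n) g"
    and F: "integrable (Rnt n) (\<lambda>p. hdot n (U1 n \<phi>) (U1 n f) p)"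
    and G: "integrable (Rnt n) (\<lambda>p. hdot n (U1 n \<phi>) (U1 n g) p)"
  shows "pairing n \<phi> (\<lambda>y. a * f y + b * g y) = a * pairing n \<phi> f + b * pairing n \<phi> g"
proof -
  let ?F = "\<lambda>h p. hdot n (U1 n \<phi>) (U1 n h) p :: real"
  have e: "?F (\<lambda>y. a * f y + b * g y) p = a * ?F f p + b * ?F g p" for p :: "point \<times> real"
  proof (cases "snd p > 0")
    case True
    let ?X = "(fst p)(n := snd p)"
    have "dotg n (U1 n \<phi>) (U1 n (\<lambda>y. a * f y + b * g y)) ?X = (\<Sum>i\<le>n. a * (U1 n \<phi> i ?X * U1 n f i ?X) + b * (U1 n \<phi> i ?X * U1 n g i ?X))"
      unfolding dotg_def
    proof (rule sum.cong[OF refl])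
      fix i assume i: "i \<in> {..n}"
      have l: "U1 n (\<lambda>y. a * f y + b * g y) i ?X = a * U1 n f i ?X + b * U1 n g i ?X"
        by (rule U1_lincomb[OF f g]) (use True i in auto)
      have alg: "z * (a * x + b * y) = a * (z * x) + b * (z * y)" for x y z :: real by (simp add: algebra_simps)
      show "U1 n \<phi> i ?X * U1 n (\<lambda>y. a * f y + b * g y) i ?X = a * (U1 n \<phi> i ?X * U1 n f i ?X) + b * (U1 n \<phi> i ?X * U1 n g i ?X)"
        unfolding l by (rule alg)
    qed
    also have "\<dots> = a * dotg n (U1 n \<phi>) (U1 n f) ?X + b * dotg n (U1 n \<phi>) (U1 n g) ?X"
      unfolding dotg_def sum.distrib sum_distrib_left ..
    finally have d: "dotg n (U1 n \<phi>) (U1 n (\<lambda>y. a * f y + b * g y)) ?X = a * dotg n (U1 n \<phi>) (U1 n f) ?X + b * dotg n (U1 n \<phi>) (U1 n g) ?X" .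
    have alg: "q * (t * (a * x + b * y)) = a * (q * (t * x)) + b * (q * (t * y))" for q t x y :: real by (simp add: algebra_simps)
    show ?thesis unfolding d by (rule alg)
  qed simp
  have "pairing n \<phi> (\<lambda>y. a * f y + b * g y) = 2 * (\<integral>p. a * ?F f p + b * ?F g p \<partial>(Rnt n))"
    unfolding pairing_def e ..
  also have "(\<integral>p. a * ?F f p + b * ?F g p \<partial>(Rnt n)) = (\<integral>p. a * ?F f p \<partial>(Rnt n)) + (\<integral>p. b * ?F g p \<partial>(Rnt n))"
    by (intro Bochner_Integration.integral_add integrable_mult_right F G)
  finally show ?thesis by (simp only: pairing_def integral_mult_right_zero) (simp add: algebra_simps)
qed

context dyadic
begin

text \<open>The duality estimate for the heights outside \<open>S\<close>. The function \<phi>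
  enters the error through its Carleson constant alone, so the error is uniform over the
  truncations.\<close>

lemma pairing_split:
  assumes \<phi>: "integrable (Rn n) \<phi>" and f: "integrable (Rn n) f" and C: "C > 0"
    and car: "carleson (\<lambda>p. ennreal (snd p * gsq n \<phi> p)) (C\<^sup>2)" and fin: "tent_norm f < \<infinity>"
    and S: "S \<in> sets borel"
    and T: "(\<integral>\<^sup>+x. ennsqrt (tent_total (\<lambda>p. ennreal (snd p * (gsq n f p * indicator (- S) (snd p)))) x) \<partial>Rn n) \<le> ennreal e" and e: "e \<ge> 0"
  shows "\<bar>pairing n \<phi> f - 2 * (\<integral>p. indicator S (snd p) * (hdot n (U1 n \<phi>) (U1 n f) p) \<partial>(Rnt n))\<bar>
    \<le> 3 * C * e"
proof -
  let ?F = "\<lambda>p. hdot n (U1 n \<phi>) (U1 n f) p :: real"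
  have i: "integrable (Rnt n) ?F" by (rule pairing_bound(1)[OF \<phi> f C car fin])
  have iS: "integrable (Rnt n) (\<lambda>p. indicator A (snd p) * ?F p)" if A: "A \<in> sets borel" for A
    by (rule integrable_bounded_mult[OF i measurable_indicator_snd[OF A], where B=1]) (simp add: indicator_def)
  have S': "- S \<in> sets borel" using S by (simp add: Compl_in_sets_lebesgue borel_comp)
  have "(\<integral>p. ?F p \<partial>(Rnt n)) = (\<integral>p. indicator S (snd p) * ?F p + indicator (- S) (snd p) * ?F p \<partial>(Rnt n))"
    by (rule Bochner_Integration.integral_cong[OF refl]) (simp add: indicator_def)
  also have "\<dots> = (\<integral>p. indicator S (snd p) * ?F p \<partial>(Rnt n)) + (\<integral>p. indicator (- S) (snd p) * ?F p \<partial>(Rnt n))"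
    by (rule Bochner_Integration.integral_add[OF iS[OF S] iS[OF S']])
  finally have split: "(\<integral>p. ?F p \<partial>(Rnt n)) = (\<integral>p. indicator S (snd p) * ?F p \<partial>(Rnt n)) + (\<integral>p. indicator (- S) (snd p) * ?F p \<partial>(Rnt n))" .
  have "(\<integral>\<^sup>+p. ennreal \<bar>indicator {0<..} (snd p) * (indicator (- S) (snd p) * (snd p * dotg n (U1 n \<phi>) (U1 n f) ((fst p)(n := snd p))))\<bar> \<partial>(Rnt n))
     \<le> ennreal (3 / 2 * C) * ennreal e"
    by (rule order.trans[OF nn_integral_pairing_le[OF \<phi> f C car S'] mult_left_mono[OF T]]) simp
  also have "\<dots> = ennreal (3 / 2 * C * e)" using C e by (intro ennreal_mult[symmetric]) auto
  finally have b: "(\<integral>\<^sup>+p. ennreal \<bar>indicator (- S) (snd p) * ?F p\<bar> \<partial>(Rnt n)) \<le> ennreal (3 / 2 * C * e)"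
    by (simp only: mult.left_commute)
  have "\<bar>\<integral>p. indicator (- S) (snd p) * ?F p \<partial>(Rnt n)\<bar> \<le> (\<integral>p. \<bar>indicator (- S) (snd p) * ?F p\<bar> \<partial>(Rnt n))"
    by (rule integral_abs_bound)
  also have "\<dots> \<le> 3 / 2 * C * e"
    by (rule integral_le_of_nn_integral_le[OF integrable_abs[OF iS[OF S']] b]) (use C e in simp)
  finally show ?thesis unfolding pairing_def split by (simp add: abs_mult)
qed

text \<open>The pairings of the truncations are integrals and converge to \<open>L\<close> with
  majorant \<open>\<bar>\<phi> y * f y\<bar>\<close>. To see that the limit is the pairing of
  \<phi>, both are compared with the part over a strip, where the limit in the level is known; the
  tails are at most \<open>3 * C1 * e\<close> for the truncations and \<open>3 * C * e\<close> for
  \<phi>.\<close>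

lemma pairing_eq_integral:
  assumes \<phi>: "integrable (Rn n) \<phi>" and f: "integrable (Rn n) f" and C: "C > 0"
    and car: "carleson (\<lambda>p. ennreal (snd p * gsq n \<phi> p)) (C\<^sup>2)" and fin: "tent_norm f < \<infinity>"
    and \<phi>f: "integrable (Rn n) (\<lambda>y. \<phi> y * f y)"
  shows "pairing n \<phi> f = (\<integral>y. \<phi> y * f y \<partial>Rn n)"
proof -
  obtain M1 where M1: "M1 \<ge> 0" and car1: "\<And>K. K \<ge> 0 \<Longrightarrow> carleson_grad (\<lambda>z. trunc K (\<phi> z)) M1"
    by (rule carleson_trunc[OF \<phi> zero_le_power2 car]) blast
  \<comment> \<open>The square root of the common Carleson constant of the truncations; the added 1
    makes it positive, as the duality demands.\<close>
  define C1 where "C1 = sqrt M1 + 1"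
  have C1: "C1 > 0" using M1 by (simp add: C1_def add_nonneg_pos)
  have C12: "M1 \<le> C1\<^sup>2" using M1 by (simp add: C1_def power2_sum)
  define \<psi> where "\<psi> j z = trunc (real j) (\<phi> z)" for j z
  have \<psi>: "integrable (Rn n) (\<psi> j)" for j unfolding \<psi>_def by (rule integrable_trunc[OF \<phi>]) simp
  have car\<psi>: "carleson_grad (\<psi> j) (C1\<^sup>2)" for j
    unfolding \<psi>_def[abs_def] by (rule carleson_mono[OF car1 C12]) simp
  have pe: "pairing n (\<psi> j) f = (\<integral>y. \<psi> j y * f y \<partial>Rn n)" for j
  proof (rule pairing_eq_integral_bounded[OF n \<psi> _ f pairing_bound(1)[OF \<psi> f C1 car\<psi> fin]])
    show "\<bar>\<psi> j z\<bar> \<le> real j" for z unfolding \<psi>_def by (rule abs_trunc_le) simp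
  qed
  define L where "L = (\<integral>y. \<phi> y * f y \<partial>Rn n)"
  have lim: "(\<lambda>j. pairing n (\<psi> j) f) \<longlonglongrightarrow> L"
    unfolding pe L_def
  proof (rule integral_dominated_convergence[where w="\<lambda>y. \<bar>\<phi> y * f y\<bar>"])
    show "(\<lambda>y. \<phi> y * f y) \<in> borel_measurable (Rn n)" "integrable (Rn n) (\<lambda>y. \<bar>\<phi> y * f y\<bar>)" using \<phi>f by auto
    show "(\<lambda>y. \<psi> j y * f y) \<in> borel_measurable (Rn n)" for j using \<psi>[of j] f by auto
    show "AE y in Rn n. (\<lambda>j. \<psi> j y * f y) \<longlonglongrightarrow> \<phi> y * f y"
      unfolding \<psi>_def by (intro AE_I2 tendsto_mult tendsto_const trunc_tendsto)
    show "AE y in Rn n. norm (\<psi> j y * f y) \<le> \<bar>\<phi> y * f y\<bar>" for j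
      unfolding real_norm_def abs_mult \<psi>_def by (intro AE_I2 mult_right_mono abs_trunc_le) auto
  qed
  define T where "T N = (\<integral>\<^sup>+x. ennsqrt (tent_total (\<lambda>p. ennreal (snd p * (gsq n f p * indicator (- {2 powi (- int N - 1)<..2 powi int N}) (snd p)))) x) \<partial>Rn n)" for N
  have T0: "T \<longlonglongrightarrow> 0" unfolding T_def by (rule tent_tail_tendsto_0[OF f fin])
  have "\<bar>L - pairing n \<phi> f\<bar> \<le> 3 * (C1 + C) * e" if e: "e > 0" for e
  proof -
    have "eventually (\<lambda>N. T N < ennreal e) sequentially" by (rule order_tendstoD(2)[OF T0]) (use e in simp)
    then obtain N where N: "T N < ennreal e" by (auto simp: eventually_sequentially)
    define S where "S = {2 powi (- int N - 1)<..(2::real) powi int N}"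
    have S: "S \<in> sets borel" by (simp add: S_def)
    have TS: "(\<integral>\<^sup>+x. ennsqrt (tent_total (\<lambda>p. ennreal (snd p * (gsq n f p * indicator (- S) (snd p)))) x) \<partial>Rn n) \<le> ennreal e"
      using N unfolding T_def S_def by (rule less_imp_le)
    let ?I = "\<lambda>\<eta>. \<integral>p. indicator S (snd p) * (hdot n (U1 n \<eta>) (U1 n f) p) \<partial>(Rnt n)"
    have e0: "e \<ge> 0" using e by simp
    have l1: "(\<lambda>j. ?I (\<psi> j)) \<longlonglongrightarrow> ?I \<phi>"
      unfolding \<psi>_def[abs_def] S_def by (rule pairing_strip_limit[OF n \<phi> f]) simp
    have l2: "(\<lambda>j. \<bar>pairing n (\<psi> j) f - 2 * ?I (\<psi> j)\<bar>) \<longlonglongrightarrow> \<bar>L - 2 * ?I \<phi>\<bar>"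
      by (intro tendsto_rabs tendsto_diff tendsto_mult tendsto_const lim l1)
    have "\<bar>L - 2 * ?I \<phi>\<bar> \<le> 3 * C1 * e"
      by (rule LIMSEQ_le_const2[OF l2]) (use pairing_split[OF \<psi> f C1 car\<psi> fin S TS e0] in blast)
    moreover have "\<bar>pairing n \<phi> f - 2 * ?I \<phi>\<bar> \<le> 3 * C * e" by (rule pairing_split[OF \<phi> f C car fin S TS e0])
    moreover have "3 * (C1 + C) * e = 3 * C1 * e + 3 * C * e" by (simp add: algebra_simps)
    ultimately show ?thesis by linarith
  qed
  then have "\<bar>L - pairing n \<phi> f\<bar> \<le> 0 + e" if "e > 0" for e
  proof -
    have p: "3 * (C1 + C) > 0" using C C1 by simp
    have "\<bar>L - pairing n \<phi> f\<bar> \<le> 3 * (C1 + C) * (e / (3 * (C1 + C)))"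
      by (rule \<open>\<And>e. e > 0 \<Longrightarrow> \<bar>L - pairing n \<phi> f\<bar> \<le> 3 * (C1 + C) * e\<close>) (use that p in simp)
    also have "\<dots> = e" using p by (simp del: distrib_left_numeral)
    finally show ?thesis by simp
  qed
  then have "\<bar>L - pairing n \<phi> f\<bar> \<le> 0" by (rule field_le_epsilon)
  then show ?thesis by (simp add: L_def)
qed

section \<open>The functional on the Hardy space\<close>

lemma hardy_spaceD:
  assumes "f \<in> hardy_space n D"
  shows "integrable (Rn n) f" "tent_norm f < \<infinity>" "enn2real (tent_norm f) \<le> hardy_norm n D f"
proof -
  show f: "integrable (Rn n) f" using assms by (simp add: hardy_space_def)
  have h: "hardy_ennnorm n D f < \<infinity>" using assms by (simp add: hardy_space_def)
  show "tent_norm f < \<infinity>" using tent_norm_le[OF f] h by (rule order.strict_trans1)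
  show "enn2real (tent_norm f) \<le> hardy_norm n D f"
    unfolding hardy_norm_def using h by (intro enn2real_mono tent_norm_le f) simp
qed

lemma bmo_norm_nonneg:
  assumes "\<phi> \<in> bmo_space n D" shows "bmo_norm n D \<phi> \<ge> 0"
  unfolding bmo_norm_def using assms by (intro cInf_greatest) (auto simp: bmo_space_def bmo_bound_def)

lemma bmo_carleson:
  assumes \<phi>: "integrable (Rn n) \<phi>" and b: "bmo_bound n D \<phi> C0" and e: "e \<ge> 0"
  shows "carleson (\<lambda>p. ennreal (snd p * gsq n \<phi> p)) ((C0 + e)\<^sup>2)"
  using b e by (intro carleson_mono[OF carleson_of_bmo_bound[OF \<phi> b]] power_mono) (auto simp: bmo_bound_def)

text \<open>The duality asks for a positive constant, hence \<open>C0 + e\<close>. The infimum in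
  the norm is not assumed to be attained: after division by the Hardy norm the quotient is a lower
  bound of all admissible constants. If the Hardy norm is zero, a single admissible constant already
  makes the pairing vanish.\<close>

lemma pairing_le_norms:
  assumes \<phi>: "\<phi> \<in> bmo_space n D" and f: "f \<in> hardy_space n D"
  shows "\<bar>pairing n \<phi> f\<bar> \<le> 3 * bmo_norm n D \<phi> * hardy_norm n D f"
proof -
  have \<phi>i: "integrable (Rn n) \<phi>" and ne: "{C0. bmo_bound n D \<phi> C0} \<noteq> {}" using \<phi> by (auto simp: bmo_space_def)
  define h where "h = hardy_norm n D f"
  have h: "h \<ge> 0" by (simp add: h_def hardy_norm_def)
  have b: "\<bar>pairing n \<phi> f\<bar> \<le> 3 * (C0 + e) * h" if C0: "bmo_bound n D \<phi> C0" and e: "e > 0" for C0 e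
  proof -
    have p: "C0 + e > 0" using C0 e by (simp add: bmo_bound_def)
    have "\<bar>pairing n \<phi> f\<bar> \<le> 3 * (C0 + e) * enn2real (tent_norm f)"
      by (rule pairing_bound(2)[OF \<phi>i hardy_spaceD(1)[OF f] p bmo_carleson[OF \<phi>i C0] hardy_spaceD(2)[OF f]]) (use e in simp)
    also have "\<dots> \<le> 3 * (C0 + e) * h" unfolding h_def using p by (intro mult_left_mono hardy_spaceD(3)[OF f]) auto
    finally show ?thesis .
  qed
  show ?thesis
  proof (cases "h = 0")
    case True
    obtain C0 where "bmo_bound n D \<phi> C0" using ne by blast
    from b[OF this, of 1] True show ?thesis by (simp add: h_def)
  next
    case False
    then have hp: "h > 0" using h by simp
    have "\<bar>pairing n \<phi> f\<bar> / (3 * h) \<le> bmo_norm n D \<phi>"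
      unfolding bmo_norm_def
    proof (rule cInf_greatest[OF ne])
      fix C0 assume C0: "C0 \<in> {C0. bmo_bound n D \<phi> C0}"
      show "\<bar>pairing n \<phi> f\<bar> / (3 * h) \<le> C0"
      proof (rule field_le_epsilon)
        fix e :: real assume e: "e > 0"
        show "\<bar>pairing n \<phi> f\<bar> / (3 * h) \<le> C0 + e" using b[of C0 e] C0 e hp by (simp add: divide_le_eq mult_ac)
      qed
    qed
    then show ?thesis using hp by (simp add: divide_le_eq mult_ac h_def)
  qed
qed

lemma represents_pairing:
  assumes \<phi>: "\<phi> \<in> bmo_space n D"
  shows "represents n D \<phi> (pairing n \<phi>)"
proof -
  have \<phi>i: "integrable (Rn n) \<phi>" using \<phi> by (simp add: bmo_space_def)
  obtain C0 where C0: "bmo_bound n D \<phi> C0" using \<phi> by (auto simp: bmo_space_def)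
  have p: "C0 + 1 > 0" using C0 by (simp add: bmo_bound_def)
  have car: "carleson (\<lambda>p. ennreal (snd p * gsq n \<phi> p)) ((C0 + 1)\<^sup>2)" by (rule bmo_carleson[OF \<phi>i C0]) simp
  show ?thesis
    unfolding represents_def hardy_dual_def
  proof (intro conjI CollectI ballI allI impI)
    fix f g a b assume f: "f \<in> hardy_space n D" and g: "g \<in> hardy_space n D"
    show "pairing n \<phi> (\<lambda>y. a * f y + b * g y) = a * pairing n \<phi> f + b * pairing n \<phi> g"
      by (rule pairing_lincomb[OF hardy_spaceD(1)[OF f] hardy_spaceD(1)[OF g]
          pairing_bound(1)[OF \<phi>i hardy_spaceD(1)[OF f] p car hardy_spaceD(2)[OF f]]
          pairing_bound(1)[OF \<phi>i hardy_spaceD(1)[OF g] p car hardy_spaceD(2)[OF g]]])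
  next
    show "\<exists>K. \<forall>f\<in>hardy_space n D. \<bar>pairing n \<phi> f\<bar> \<le> K * hardy_norm n D f"
      using pairing_le_norms[OF \<phi>] by blast
  next
    fix f assume f: "f \<in> hardy_space n D" and i: "integrable (Rn n) (\<lambda>y. \<phi> y * f y)"
    show "pairing n \<phi> f = (\<integral>y. \<phi> y * f y \<partial>Rn n)"
      by (rule pairing_eq_integral[OF \<phi>i hardy_spaceD(1)[OF f] p car hardy_spaceD(2)[OF f] i])
  qed
qed

end

theorem theorem4p2:
  "\<exists>C::real. \<forall>n\<ge>1. \<forall>D. dyadic_lattice n D \<longrightarrow>
     (\<forall>\<phi>\<in>bmo_space n D.
        (\<exists>\<Lambda>. represents n D \<phi> \<Lambda> \<and>
             (\<forall>f\<in>hardy_space n D. \<bar>\<Lambda> f\<bar> \<le> C * bmo_norm n D \<phi> * hardy_norm n D f)) \<and>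
        (\<forall>f\<in>hardy_space n D.
           \<bar>\<integral>y. \<phi> y * f y \<partial>Rn n\<bar> \<le> C * bmo_norm n D \<phi> * hardy_norm n D f))"
proof (intro exI[of _ 3] allI impI ballI)
  fix n :: nat and D \<phi> assume n: "n \<ge> 1" and D: "dyadic_lattice n D" and \<phi>: "\<phi> \<in> bmo_space n D"
  interpret dyadic n D by (rule dyadic.intro[OF n D])
  have r: "represents n D \<phi> (pairing n \<phi>)" by (rule represents_pairing[OF \<phi>])
  have b: "\<bar>\<integral>y. \<phi> y * f y \<partial>Rn n\<bar> \<le> 3 * bmo_norm n D \<phi> * hardy_norm n D f" if f: "f \<in> hardy_space n D" for f
  proof (cases "integrable (Rn n) (\<lambda>y. \<phi> y * f y)")
    case True
    then have "pairing n \<phi> f = (\<integral>y. \<phi> y * f y \<partial>Rn n)" using r f by (simp add: represents_def)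
    then show ?thesis using pairing_le_norms[OF \<phi> f] by simp
  next
    \<comment> \<open>The Bochner integral of a function that is not integrable is 0, so the
      inequality only says that the right side is nonnegative. For such pairs the content of the
      theorem lies in the functional.\<close>
    case False
    have "0 \<le> 3 * bmo_norm n D \<phi> * hardy_norm n D f" using bmo_norm_nonneg[OF \<phi>] by (simp add: hardy_norm_def)
    then show ?thesis using False by (simp add: not_integrable_integral_eq)
  qed
  show "(\<exists>\<Lambda>. represents n D \<phi> \<Lambda> \<and> (\<forall>f\<in>hardy_space n D. \<bar>\<Lambda> f\<bar> \<le> 3 * bmo_norm n D \<phi> * hardy_norm n D f)) \<and>
    (\<forall>f\<in>hardy_space n D. \<bar>\<integral>y. \<phi> y * f y \<partial>Rn n\<bar> \<le> 3 * bmo_norm n D \<phi> * hardy_norm n D f)"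
    using r pairing_le_norms[OF \<phi>] b by blast
qed

end
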